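(* Let $\pi:(M,g,J)\to(N,g_N)$ be a proper bi-slant submersion from a Kähler manifold onto a Riemannian manifold. Assume that each of the subbundles $F\mathcal D^{\theta_1}$ and $F\mathcal D^{\theta_2}$ of $(\ker\pi_* )^\perp$ is locally spanned by basic vector fields. Then the vertical distribution $\ker\pi_*$ is locally a product $M_{\mathcal D^{\theta_1}}\times M_{\mathcal D^{\theta_2}}$ (i.e. every fibre of $\pi$ is locally a Riemannian product of integral manifolds $M_{\mathcal D^{\theta_1}}$ and $M_{\mathcal D^{\theta_2}}$ of the distributions $\mathcal D^{\theta_1}$ and $\mathcal D^{\theta_2}$) if and only if $$g\big(\mathcal T_{PU}FY-\mathcal T_U FPY+\mathcal A_{FU}FY,\;X\big)=0\quad\text{and}\quad g\big(\mathcal T_{PX}FV-\mathcal T_X FPV+\mathcal A_{FX}FV,\;U\big)=0$$ for all $X,Y\in\mathcal D^{\theta_1}$ and $U,V\in\mathcal D^{\theta_2}$.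
   Context: All objects are smooth. A Riemannian submersion $\pi:(M,g)\to(N,g_N)$, $\dim M>\dim N$, is a surjective map of maximal rank such that $\pi_*$ restricted to $(\ker\pi_* )^\perp$ is a linear isometry. Vector fields in $\ker\pi_*$ are vertical, those in $(\ker\pi_* )^\perp$ horizontal; $\mathcal V,\mathcal H$ are the orthogonal projections onto $\ker\pi_*$ and $(\ker\pi_* )^\perp$. Fibres carry the induced metric. A horizontal vector field is basic if it is $\pi$-related to a vector field on $N$. $\nabla$ is the Levi-Civita connection of $g$. O'Neill's tensors are $\mathcal T_E G=\mathcal V\nabla_{\mathcal V E}\mathcal H G+\mathcal H\nabla_{\mathcal V E}\mathcal V G$ and $\mathcal A_E G=\mathcal V\nabla_{\mathcal H E}\mathcal H G+\mathcal H\nabla_{\mathcal H E}\mathcal V G$. Kähler means $J^2=-I$, $g(JX,JY)=g(X,Y)$, $\nabla J=0$. For vertical $V$ write $JV=PV+FV$ with $PV$ vertical and $FV$ horizontal. A distribution $\mathcal D$ is slant with slant angle $\theta$ if for every point $p$ and every nonzero $X\in\mathcal D_p$ the angle between $JX$ and $\mathcal D_p$ equals the constant $\theta$. $\pi$ is a bi-slant submersion if $\ker\pi_*=\mathcal D^{\theta_1}\oplus\mathcal D^{\theta_2}$ (orthogonal direct sum), where $\mathcal D^{\theta_i}$ is slant with slant angle $\theta_i$ and $P\mathcal D^{\theta_i}\subset\mathcal D^{\theta_i}$, $i=1,2$. It is proper if neither slant angle is $0$ or $\pi/2$, i.e. $\theta_1,\theta_2\in(0,\pi/2)$. *)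

theory Defs
  imports "HOL-Analysis.Analysis"
begin

text \<open>
  Continuous differentiability is only meant to be used on open sets.
\<close>

primrec Ck_on :: "nat \<Rightarrow> ('a::euclidean_space \<Rightarrow> 'b::real_normed_vector) \<Rightarrow> 'a set \<Rightarrow> bool" where
  "Ck_on 0 f U \<longleftrightarrow> continuous_on U f"
| "Ck_on (Suc k) f U \<longleftrightarrow>
     (\<forall>x\<in>U. f differentiable (at x)) \<and> (\<forall>v. Ck_on k (\<lambda>x. frechet_derivative f (at x) v) U)"

definition smooth_on :: "'a set \<Rightarrow> ('a::euclidean_space \<Rightarrow> 'b::real_normed_vector) \<Rightarrow> bool" where
  "smooth_on U f \<longleftrightarrow> (\<forall>k. Ck_on k f U)"

type_synonym ('m, 'e) chart = "'m set \<times> ('m \<Rightarrow> 'e)"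

abbreviation cdom :: "('m, 'e) chart \<Rightarrow> 'm set" where "cdom \<equiv> fst"
abbreviation cmap :: "('m, 'e) chart \<Rightarrow> 'm \<Rightarrow> 'e" where "cmap \<equiv> snd"
abbreviation cinv :: "('m, 'e) chart \<Rightarrow> 'e \<Rightarrow> 'm" where "cinv c \<equiv> inv_into (cdom c) (cmap c)"

text \<open>
  A manifold is a topological space (a whole type) with an atlas modelled on a Euclidean space.
  The atlas need not be maximal; a pair \<open>c\<close> is a chart of the smooth structure generated by
  the atlas \<open>A\<close> iff \<open>smooth_atlas (insert c A)\<close> holds.
\<close>

definition smooth_atlas :: "('m::topological_space, 'e::euclidean_space) chart set \<Rightarrow> bool" where
  "smooth_atlas A \<longleftrightarrow>
     (\<forall>c\<in>A. open (cdom c) \<and> open (cmap c ` cdom c) \<and>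
        homeomorphism (cdom c) (cmap c ` cdom c) (cmap c) (cinv c)) \<and>
     (\<Union>c\<in>A. cdom c) = UNIV \<and>
     (\<forall>c\<in>A. \<forall>d\<in>A. smooth_on (cmap c ` (cdom c \<inter> cdom d)) (cmap d \<circ> cinv c))"

definition model_atlas :: "('e::euclidean_space, 'e) chart set" where
  "model_atlas = {(UNIV, id)}"

definition prod_atlas ::
  "('m, 'e) chart set \<Rightarrow> ('n, 'f) chart set \<Rightarrow> ('m \<times> 'n, 'e \<times> 'f) chart set" where
  "prod_atlas A B = {(cdom c \<times> cdom d, map_prod (cmap c) (cmap d)) | c d. c \<in> A \<and> d \<in> B}"

text \<open>
  The tangent space at \<open>p\<close> is the model space \<open>'e\<close>: a vector stands for the tangent vector
  having these components in the chart \<open>chart_at A p\<close>, an arbitrary but fixed chart around \<open>p\<close>.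
  The function \<open>to_chart A c p\<close> converts to components in any other chart \<open>c\<close> around \<open>p\<close>.
  Since \<open>chart_at A p\<close> may jump with \<open>p\<close>, smoothness of fields is only tested after this conversion.
\<close>

definition chart_at :: "('m, 'e) chart set \<Rightarrow> 'm \<Rightarrow> ('m, 'e) chart" where
  "chart_at A p = (SOME c. c \<in> A \<and> p \<in> cdom c)"

definition to_chart ::
  "('m, 'e::euclidean_space) chart set \<Rightarrow> ('m, 'e) chart \<Rightarrow> 'm \<Rightarrow> 'e \<Rightarrow> 'e" where
  "to_chart A c p = frechet_derivative (cmap c \<circ> cinv (chart_at A p)) (at (cmap (chart_at A p) p))"

definition smooth_map_on ::
  "('m::topological_space, 'e::euclidean_space) chart set \<Rightarrow>
   ('n::topological_space, 'f::euclidean_space) chart set \<Rightarrow> 'm set \<Rightarrow> ('m \<Rightarrow> 'n) \<Rightarrow> bool" where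
  "smooth_map_on A B W f \<longleftrightarrow> continuous_on W f \<and>
     (\<forall>c\<in>A. \<forall>d\<in>B. smooth_on (cmap c ` (cdom c \<inter> W \<inter> f -` cdom d)) (cmap d \<circ> f \<circ> cinv c))"

definition differential ::
  "('m, 'e::euclidean_space) chart set \<Rightarrow> ('n, 'f::euclidean_space) chart set \<Rightarrow>
   ('m \<Rightarrow> 'n) \<Rightarrow> 'm \<Rightarrow> 'e \<Rightarrow> 'f" where
  "differential A B f p =
     frechet_derivative (cmap (chart_at B (f p)) \<circ> f \<circ> cinv (chart_at A p)) (at (cmap (chart_at A p) p))"

text \<open>
  The map \<open>F\<close> is a smooth extension, to a neighbourhood of \<open>x\<close>, of \<open>f\<close> restricted to the
  (not necessarily open) set \<open>S\<close>.
\<close>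

definition smooth_extension_at ::
  "('m::topological_space, 'e::euclidean_space) chart set \<Rightarrow>
   ('n::topological_space, 'f::euclidean_space) chart set \<Rightarrow>
   'm set \<Rightarrow> ('m \<Rightarrow> 'n) \<Rightarrow> 'm \<Rightarrow> ('m \<Rightarrow> 'n) \<Rightarrow> bool" where
  "smooth_extension_at A B S f x F \<longleftrightarrow>
     (\<exists>W. open W \<and> x \<in> W \<and> smooth_map_on A B W F \<and> (\<forall>z\<in>W \<inter> S. F z = f z))"

definition field_rep ::
  "('m, 'e::euclidean_space) chart set \<Rightarrow> ('m, 'e) chart \<Rightarrow> ('m \<Rightarrow> 'e) \<Rightarrow> 'e \<Rightarrow> 'e" where
  "field_rep A c X = (\<lambda>x. to_chart A c (cinv c x) (X (cinv c x)))"

definition vector_field_on ::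
  "('m, 'e::euclidean_space) chart set \<Rightarrow> 'm set \<Rightarrow> ('m \<Rightarrow> 'e) \<Rightarrow> bool" where
  "vector_field_on A W X \<longleftrightarrow> (\<forall>c\<in>A. smooth_on (cmap c ` (cdom c \<inter> W)) (field_rep A c X))"

definition section_on ::
  "('m, 'e::euclidean_space) chart set \<Rightarrow> ('m \<Rightarrow> 'e set) \<Rightarrow> 'm set \<Rightarrow> ('m \<Rightarrow> 'e) \<Rightarrow> bool" where
  "section_on A D W X \<longleftrightarrow> vector_field_on A W X \<and> (\<forall>p\<in>W. X p \<in> D p)"

definition lie_bracket ::
  "('m, 'e::euclidean_space) chart set \<Rightarrow> ('m \<Rightarrow> 'e) \<Rightarrow> ('m \<Rightarrow> 'e) \<Rightarrow> 'm \<Rightarrow> 'e" where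
  "lie_bracket A X Y p =
     (let c = chart_at A p; x = cmap c p; X' = field_rep A c X; Y' = field_rep A c Y
      in frechet_derivative Y' (at x) (X' x) - frechet_derivative X' (at x) (Y' x))"

definition smooth_distribution ::
  "('m::topological_space, 'e::euclidean_space) chart set \<Rightarrow> ('m \<Rightarrow> 'e set) \<Rightarrow> bool" where
  "smooth_distribution A D \<longleftrightarrow>
     (\<forall>p. subspace (D p)) \<and>
     (\<forall>p. \<exists>W S. open W \<and> p \<in> W \<and> finite S \<and> (\<forall>X\<in>S. vector_field_on A W X) \<and>
        (\<forall>q\<in>W. inj_on (\<lambda>X. X q) S \<and> independent ((\<lambda>X. X q) ` S) \<and> span ((\<lambda>X. X q) ` S) = D q))"

text \<open>
  \<open>L\<close> is an embedded submanifold (slice charts exist around each of its points) and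
  its tangent space at each point is the value of \<open>D\<close>.
\<close>

definition integral_manifold ::
  "('m::topological_space, 'e::euclidean_space) chart set \<Rightarrow> ('m \<Rightarrow> 'e set) \<Rightarrow> 'm set \<Rightarrow> bool" where
  "integral_manifold A D L \<longleftrightarrow>
     (\<forall>p\<in>L. \<exists>c S. p \<in> cdom c \<and> smooth_atlas (insert c A) \<and> subspace S \<and>
        cmap c ` (cdom c \<inter> L) = cmap c ` cdom c \<inter> S \<and>
        (\<forall>q\<in>cdom c \<inter> L. to_chart A c q ` D q = S))"

definition riemannian_metric ::
  "('m::topological_space, 'e::euclidean_space) chart set \<Rightarrow> ('m \<Rightarrow> 'e \<Rightarrow> 'e \<Rightarrow> real) \<Rightarrow> bool" where
  "riemannian_metric A g \<longleftrightarrow>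
     (\<forall>p. bilinear (g p) \<and> (\<forall>u v. g p u v = g p v u) \<and> (\<forall>u. u \<noteq> 0 \<longrightarrow> 0 < g p u u)) \<and>
     (\<forall>W X Y. open W \<and> vector_field_on A W X \<and> vector_field_on A W Y \<longrightarrow>
        smooth_map_on A model_atlas W (\<lambda>p. g p (X p) (Y p)))"

text \<open>
  A connection is given as an operator on vector fields defined on arbitrary open sets \<open>W\<close>.
  The axioms make the values on \<open>W\<close> depend on the values on \<open>W\<close> only: apply the
  linearity rules to the function that is 0 on \<open>W\<close> and 1 elsewhere.
\<close>

definition affine_connection ::
  "('m::topological_space, 'e::euclidean_space) chart set \<Rightarrow>
   (('m \<Rightarrow> 'e) \<Rightarrow> ('m \<Rightarrow> 'e) \<Rightarrow> 'm \<Rightarrow> 'e) \<Rightarrow> bool" where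
  "affine_connection A nabla \<longleftrightarrow>
     (\<forall>W X Y. open W \<and> vector_field_on A W X \<and> vector_field_on A W Y \<longrightarrow>
        vector_field_on A W (nabla X Y) \<and>
        (\<forall>Z p. vector_field_on A W Z \<and> p \<in> W \<longrightarrow>
           nabla (\<lambda>q. X q + Y q) Z p = nabla X Z p + nabla Y Z p \<and>
           nabla Z (\<lambda>q. X q + Y q) p = nabla Z X p + nabla Z Y p) \<and>
        (\<forall>f p. smooth_map_on A (model_atlas :: (real, real) chart set) W f \<and> p \<in> W \<longrightarrow>
           nabla (\<lambda>q. f q *\<^sub>R X q) Y p = f p *\<^sub>R nabla X Y p \<and>
           nabla X (\<lambda>q. f q *\<^sub>R Y q) p =
             differential A model_atlas f p (X p) *\<^sub>R Y p + f p *\<^sub>R nabla X Y p))"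

definition levi_civita ::
  "('m::topological_space, 'e::euclidean_space) chart set \<Rightarrow> ('m \<Rightarrow> 'e \<Rightarrow> 'e \<Rightarrow> real) \<Rightarrow>
   (('m \<Rightarrow> 'e) \<Rightarrow> ('m \<Rightarrow> 'e) \<Rightarrow> 'm \<Rightarrow> 'e) \<Rightarrow> bool" where
  "levi_civita A g nabla \<longleftrightarrow> affine_connection A nabla \<and>
     (\<forall>W X Y. open W \<and> vector_field_on A W X \<and> vector_field_on A W Y \<longrightarrow>
        (\<forall>p\<in>W. nabla X Y p - nabla Y X p = lie_bracket A X Y p) \<and>
        (\<forall>Z p. vector_field_on A W Z \<and> p \<in> W \<longrightarrow>
           differential A model_atlas (\<lambda>q. g q (X q) (Y q)) p (Z p) =
             g p (nabla Z X p) (Y p) + g p (X p) (nabla Z Y p)))"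

definition kaehler ::
  "('m::topological_space, 'e::euclidean_space) chart set \<Rightarrow> ('m \<Rightarrow> 'e \<Rightarrow> 'e \<Rightarrow> real) \<Rightarrow>
   (('m \<Rightarrow> 'e) \<Rightarrow> ('m \<Rightarrow> 'e) \<Rightarrow> 'm \<Rightarrow> 'e) \<Rightarrow> ('m \<Rightarrow> 'e \<Rightarrow> 'e) \<Rightarrow> bool" where
  "kaehler A g nabla J \<longleftrightarrow>
     (\<forall>p. linear (J p) \<and> (\<forall>u. J p (J p u) = - u) \<and> (\<forall>u v. g p (J p u) (J p v) = g p u v)) \<and>
     (\<forall>W X. open W \<and> vector_field_on A W X \<longrightarrow> vector_field_on A W (\<lambda>q. J q (X q))) \<and>
     (\<forall>W X Y p. open W \<and> vector_field_on A W X \<and> vector_field_on A W Y \<and> p \<in> W \<longrightarrow>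
        nabla X (\<lambda>q. J q (Y q)) p = J p (nabla X Y p))"

definition orth_proj :: "('e \<Rightarrow> 'e \<Rightarrow> real) \<Rightarrow> 'e::euclidean_space set \<Rightarrow> 'e \<Rightarrow> 'e" where
  "orth_proj h D u = (THE v. v \<in> D \<and> (\<forall>w\<in>D. h (u - v) w = 0))"

definition inner_angle :: "('e \<Rightarrow> 'e \<Rightarrow> real) \<Rightarrow> 'e::euclidean_space \<Rightarrow> 'e \<Rightarrow> real" where
  "inner_angle h u v = arccos (h u v / (sqrt (h u u) * sqrt (h v v)))"

text \<open>
  If the projection vanishes, the quotient in \<open>inner_angle\<close> is 0, so the angle is \<open>pi / 2\<close>,
  as it should be.
\<close>

definition angle_to_subspace :: "('e \<Rightarrow> 'e \<Rightarrow> real) \<Rightarrow> 'e::euclidean_space \<Rightarrow> 'e set \<Rightarrow> real" where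
  "angle_to_subspace h u D = inner_angle h u (orth_proj h D u)"

definition vertical ::
  "('m, 'e::euclidean_space) chart set \<Rightarrow> ('n, 'f::euclidean_space) chart set \<Rightarrow>
   ('m \<Rightarrow> 'n) \<Rightarrow> 'm \<Rightarrow> 'e set" where
  "vertical A B \<pi> p = {v. differential A B \<pi> p v = 0}"

definition horizontal ::
  "('m, 'e::euclidean_space) chart set \<Rightarrow> ('n, 'f::euclidean_space) chart set \<Rightarrow>
   ('m \<Rightarrow> 'n) \<Rightarrow> ('m \<Rightarrow> 'e \<Rightarrow> 'e \<Rightarrow> real) \<Rightarrow> 'm \<Rightarrow> 'e set" where
  "horizontal A B \<pi> g p = {h. \<forall>v\<in>vertical A B \<pi> p. g p h v = 0}"

definition riemannian_submersion ::
  "('m::topological_space, 'e::euclidean_space) chart set \<Rightarrow> ('m \<Rightarrow> 'e \<Rightarrow> 'e \<Rightarrow> real) \<Rightarrow>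
   ('n::topological_space, 'f::euclidean_space) chart set \<Rightarrow> ('n \<Rightarrow> 'f \<Rightarrow> 'f \<Rightarrow> real) \<Rightarrow>
   ('m \<Rightarrow> 'n) \<Rightarrow> bool" where
  "riemannian_submersion A g B g\<^sub>N \<pi> \<longleftrightarrow>
     DIM('f) < DIM('e) \<and> smooth_map_on A B UNIV \<pi> \<and> surj \<pi> \<and>
     (\<forall>p. surj (differential A B \<pi> p)) \<and>
     (\<forall>p. \<forall>u\<in>horizontal A B \<pi> g p. \<forall>v\<in>horizontal A B \<pi> g p.
        g\<^sub>N (\<pi> p) (differential A B \<pi> p u) (differential A B \<pi> p v) = g p u v)"

definition basic_on ::
  "('m::topological_space, 'e::euclidean_space) chart set \<Rightarrow> ('m \<Rightarrow> 'e \<Rightarrow> 'e \<Rightarrow> real) \<Rightarrow>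
   ('n::topological_space, 'f::euclidean_space) chart set \<Rightarrow> ('m \<Rightarrow> 'n) \<Rightarrow>
   'm set \<Rightarrow> ('m \<Rightarrow> 'e) \<Rightarrow> bool" where
  "basic_on A g B \<pi> W X \<longleftrightarrow> section_on A (horizontal A B \<pi> g) W X \<and>
     (\<exists>V Y. open V \<and> \<pi> ` W \<subseteq> V \<and> vector_field_on B V Y \<and>
        (\<forall>p\<in>W. differential A B \<pi> p (X p) = Y (\<pi> p)))"

definition locally_spanned_by_basic ::
  "('m::topological_space, 'e::euclidean_space) chart set \<Rightarrow> ('m \<Rightarrow> 'e \<Rightarrow> 'e \<Rightarrow> real) \<Rightarrow>
   ('n::topological_space, 'f::euclidean_space) chart set \<Rightarrow> ('m \<Rightarrow> 'n) \<Rightarrow>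
   ('m \<Rightarrow> 'e set) \<Rightarrow> bool" where
  "locally_spanned_by_basic A g B \<pi> D \<longleftrightarrow>
     (\<forall>p. \<exists>W S. open W \<and> p \<in> W \<and> finite S \<and> (\<forall>X\<in>S. basic_on A g B \<pi> W X) \<and>
        (\<forall>q\<in>W. span ((\<lambda>X. X q) ` S) = D q))"

definition ver ::
  "('m, 'e::euclidean_space) chart set \<Rightarrow> ('m \<Rightarrow> 'e \<Rightarrow> 'e \<Rightarrow> real) \<Rightarrow>
   ('n, 'f::euclidean_space) chart set \<Rightarrow> ('m \<Rightarrow> 'n) \<Rightarrow> 'm \<Rightarrow> 'e \<Rightarrow> 'e" where
  "ver A g B \<pi> p = orth_proj (g p) (vertical A B \<pi> p)"

definition hor ::
  "('m, 'e::euclidean_space) chart set \<Rightarrow> ('m \<Rightarrow> 'e \<Rightarrow> 'e \<Rightarrow> real) \<Rightarrow>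
   ('n, 'f::euclidean_space) chart set \<Rightarrow> ('m \<Rightarrow> 'n) \<Rightarrow> 'm \<Rightarrow> 'e \<Rightarrow> 'e" where
  "hor A g B \<pi> p = orth_proj (g p) (horizontal A B \<pi> g p)"

definition oneill_T ::
  "('m, 'e::euclidean_space) chart set \<Rightarrow> ('m \<Rightarrow> 'e \<Rightarrow> 'e \<Rightarrow> real) \<Rightarrow>
   ('n, 'f::euclidean_space) chart set \<Rightarrow> ('m \<Rightarrow> 'n) \<Rightarrow>
   (('m \<Rightarrow> 'e) \<Rightarrow> ('m \<Rightarrow> 'e) \<Rightarrow> 'm \<Rightarrow> 'e) \<Rightarrow> ('m \<Rightarrow> 'e) \<Rightarrow> ('m \<Rightarrow> 'e) \<Rightarrow> 'm \<Rightarrow> 'e" where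
  "oneill_T A g B \<pi> nabla E G p =
     (let \<V> = ver A g B \<pi>; \<H> = hor A g B \<pi> in
      \<V> p (nabla (\<lambda>q. \<V> q (E q)) (\<lambda>q. \<H> q (G q)) p) +
      \<H> p (nabla (\<lambda>q. \<V> q (E q)) (\<lambda>q. \<V> q (G q)) p))"

definition oneill_A ::
  "('m, 'e::euclidean_space) chart set \<Rightarrow> ('m \<Rightarrow> 'e \<Rightarrow> 'e \<Rightarrow> real) \<Rightarrow>
   ('n, 'f::euclidean_space) chart set \<Rightarrow> ('m \<Rightarrow> 'n) \<Rightarrow>
   (('m \<Rightarrow> 'e) \<Rightarrow> ('m \<Rightarrow> 'e) \<Rightarrow> 'm \<Rightarrow> 'e) \<Rightarrow> ('m \<Rightarrow> 'e) \<Rightarrow> ('m \<Rightarrow> 'e) \<Rightarrow> 'm \<Rightarrow> 'e" where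
  "oneill_A A g B \<pi> nabla E G p =
     (let \<V> = ver A g B \<pi>; \<H> = hor A g B \<pi> in
      \<V> p (nabla (\<lambda>q. \<H> q (E q)) (\<lambda>q. \<H> q (G q)) p) +
      \<H> p (nabla (\<lambda>q. \<H> q (E q)) (\<lambda>q. \<V> q (G q)) p))"

definition J_ver ::
  "('m, 'e::euclidean_space) chart set \<Rightarrow> ('m \<Rightarrow> 'e \<Rightarrow> 'e \<Rightarrow> real) \<Rightarrow>
   ('n, 'f::euclidean_space) chart set \<Rightarrow> ('m \<Rightarrow> 'n) \<Rightarrow> ('m \<Rightarrow> 'e \<Rightarrow> 'e) \<Rightarrow> 'm \<Rightarrow> 'e \<Rightarrow> 'e" where
  "J_ver A g B \<pi> J p v = ver A g B \<pi> p (J p v)"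

definition J_hor ::
  "('m, 'e::euclidean_space) chart set \<Rightarrow> ('m \<Rightarrow> 'e \<Rightarrow> 'e \<Rightarrow> real) \<Rightarrow>
   ('n, 'f::euclidean_space) chart set \<Rightarrow> ('m \<Rightarrow> 'n) \<Rightarrow> ('m \<Rightarrow> 'e \<Rightarrow> 'e) \<Rightarrow> 'm \<Rightarrow> 'e \<Rightarrow> 'e" where
  "J_hor A g B \<pi> J p v = hor A g B \<pi> p (J p v)"

definition slant ::
  "('m \<Rightarrow> 'e \<Rightarrow> 'e \<Rightarrow> real) \<Rightarrow> ('m \<Rightarrow> 'e \<Rightarrow> 'e) \<Rightarrow> ('m \<Rightarrow> 'e::euclidean_space set) \<Rightarrow> real \<Rightarrow> bool" where
  "slant g J D \<theta> \<longleftrightarrow> (\<forall>p. \<forall>X\<in>D p. X \<noteq> 0 \<longrightarrow> angle_to_subspace (g p) (J p X) (D p) = \<theta>)"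

definition bi_slant_submersion ::
  "('m::topological_space, 'e::euclidean_space) chart set \<Rightarrow> ('m \<Rightarrow> 'e \<Rightarrow> 'e \<Rightarrow> real) \<Rightarrow>
   ('m \<Rightarrow> 'e \<Rightarrow> 'e) \<Rightarrow>
   ('n::topological_space, 'f::euclidean_space) chart set \<Rightarrow> ('n \<Rightarrow> 'f \<Rightarrow> 'f \<Rightarrow> real) \<Rightarrow>
   ('m \<Rightarrow> 'n) \<Rightarrow> ('m \<Rightarrow> 'e set) \<Rightarrow> real \<Rightarrow> ('m \<Rightarrow> 'e set) \<Rightarrow> real \<Rightarrow> bool" where
  "bi_slant_submersion A g J B g\<^sub>N \<pi> D\<^sub>1 \<theta>\<^sub>1 D\<^sub>2 \<theta>\<^sub>2 \<longleftrightarrow>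
     riemannian_submersion A g B g\<^sub>N \<pi> \<and>
     smooth_distribution A D\<^sub>1 \<and> smooth_distribution A D\<^sub>2 \<and>
     (\<forall>p. vertical A B \<pi> p = {u + v | u v. u \<in> D\<^sub>1 p \<and> v \<in> D\<^sub>2 p} \<and>
        (\<forall>u\<in>D\<^sub>1 p. \<forall>v\<in>D\<^sub>2 p. g p u v = 0)) \<and>
     slant g J D\<^sub>1 \<theta>\<^sub>1 \<and> slant g J D\<^sub>2 \<theta>\<^sub>2 \<and>
     (\<forall>p. J_ver A g B \<pi> J p ` D\<^sub>1 p \<subseteq> D\<^sub>1 p \<and> J_ver A g B \<pi> J p ` D\<^sub>2 p \<subseteq> D\<^sub>2 p)"

definition proper_bi_slant_submersion ::
  "('m::topological_space, 'e::euclidean_space) chart set \<Rightarrow> ('m \<Rightarrow> 'e \<Rightarrow> 'e \<Rightarrow> real) \<Rightarrow>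
   ('m \<Rightarrow> 'e \<Rightarrow> 'e) \<Rightarrow>
   ('n::topological_space, 'f::euclidean_space) chart set \<Rightarrow> ('n \<Rightarrow> 'f \<Rightarrow> 'f \<Rightarrow> real) \<Rightarrow>
   ('m \<Rightarrow> 'n) \<Rightarrow> ('m \<Rightarrow> 'e set) \<Rightarrow> real \<Rightarrow> ('m \<Rightarrow> 'e set) \<Rightarrow> real \<Rightarrow> bool" where
  "proper_bi_slant_submersion A g J B g\<^sub>N \<pi> D\<^sub>1 \<theta>\<^sub>1 D\<^sub>2 \<theta>\<^sub>2 \<longleftrightarrow>
     bi_slant_submersion A g J B g\<^sub>N \<pi> D\<^sub>1 \<theta>\<^sub>1 D\<^sub>2 \<theta>\<^sub>2 \<and>
     0 < \<theta>\<^sub>1 \<and> \<theta>\<^sub>1 < pi / 2 \<and> 0 < \<theta>\<^sub>2 \<and> \<theta>\<^sub>2 < pi / 2"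

text \<open>
  Near \<open>p\<close> the subset \<open>N\<close> (below: a fibre) of the manifold is the Riemannian product of integral
  manifolds \<open>L\<^sub>1\<close>, \<open>L\<^sub>2\<close> of \<open>D\<^sub>1\<close>, \<open>D\<^sub>2\<close> through \<open>p\<close>: a diffeomorphism \<open>\<Phi>\<close> from
  \<open>L\<^sub>1 \<times> L\<^sub>2\<close> onto a neighbourhood \<open>W\<close> of \<open>p\<close> in \<open>N\<close> pulls the induced metric back to the product
  metric, and it maps the tangent spaces of the two factors to \<open>D\<^sub>1\<close> and \<open>D\<^sub>2\<close>.
  As \<open>\<Phi>\<close> lives on the submanifold \<open>L\<^sub>1 \<times> L\<^sub>2\<close> of the product manifold, its differential is computed
  from a local smooth extension \<open>F\<close>; on vectors tangent to \<open>L\<^sub>1\<close> and \<open>L\<^sub>2\<close> the choice of \<open>F\<close> is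
  irrelevant. The image of \<open>(u, v)\<close> under the differential is \<open>a u + b v\<close> with the partial
  differentials \<open>a\<close>, \<open>b\<close>.
\<close>

definition local_riemannian_product_at ::
  "('m::topological_space, 'e::euclidean_space) chart set \<Rightarrow> ('m \<Rightarrow> 'e \<Rightarrow> 'e \<Rightarrow> real) \<Rightarrow>
   ('m \<Rightarrow> 'e set) \<Rightarrow> ('m \<Rightarrow> 'e set) \<Rightarrow> 'm set \<Rightarrow> 'm \<Rightarrow> bool" where
  "local_riemannian_product_at A g D\<^sub>1 D\<^sub>2 N p \<longleftrightarrow>
     (\<exists>W L\<^sub>1 L\<^sub>2 \<Phi>.
        openin (top_of_set N) W \<and>
        integral_manifold A D\<^sub>1 L\<^sub>1 \<and> integral_manifold A D\<^sub>2 L\<^sub>2 \<and> p \<in> L\<^sub>1 \<and> p \<in> L\<^sub>2 \<and>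
        bij_betw \<Phi> (L\<^sub>1 \<times> L\<^sub>2) W \<and>
        (\<forall>x\<in>L\<^sub>1. \<Phi> (x, p) = x) \<and> (\<forall>y\<in>L\<^sub>2. \<Phi> (p, y) = y) \<and>
        (\<forall>w\<in>W. \<exists>G. smooth_extension_at A (prod_atlas A A) W (inv_into (L\<^sub>1 \<times> L\<^sub>2) \<Phi>) w G) \<and>
        (\<forall>x\<in>L\<^sub>1. \<forall>y\<in>L\<^sub>2. \<exists>F. smooth_extension_at (prod_atlas A A) A (L\<^sub>1 \<times> L\<^sub>2) \<Phi> (x, y) F \<and>
           (let a = differential A A (\<lambda>x'. F (x', y)) x;
                b = differential A A (\<lambda>y'. F (x, y')) y;
                q = \<Phi> (x, y)
            in a ` D\<^sub>1 x = D\<^sub>1 q \<and> b ` D\<^sub>2 y = D\<^sub>2 q \<and>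
               (\<forall>u\<in>D\<^sub>1 x. \<forall>u'\<in>D\<^sub>1 x. \<forall>v\<in>D\<^sub>2 y. \<forall>v'\<in>D\<^sub>2 y.
                  g q (a u + b v) (a u' + b v') = g x u u' + g y v v'))))"

definition fibres_locally_riemannian_product ::
  "('m::topological_space, 'e::euclidean_space) chart set \<Rightarrow> ('m \<Rightarrow> 'e \<Rightarrow> 'e \<Rightarrow> real) \<Rightarrow>
   ('m \<Rightarrow> 'n) \<Rightarrow> ('m \<Rightarrow> 'e set) \<Rightarrow> ('m \<Rightarrow> 'e set) \<Rightarrow> bool" where
  "fibres_locally_riemannian_product A g \<pi> D\<^sub>1 D\<^sub>2 \<longleftrightarrow>
     (\<forall>y. \<forall>p\<in>\<pi> -` {y}. local_riemannian_product_at A g D\<^sub>1 D\<^sub>2 (\<pi> -` {y}) p)"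

end

theory Submission
  imports Defs
begin

text \<open>
  With the Kaehler identity \<open>\<nabla>J = 0\<close>, the slant condition \<open>P\<^sup>2 = - cos\<^sup>2 \<theta>\<^sub>1\<close> on \<open>D\<^sub>1\<close> and the
  hypothesis on basic fields (which turns \<open>g(\<nabla>\<^sub>X FY, FU)\<close> into \<open>g(\<A>\<^bsub>FU\<^esub> FY, X)\<close>), the first expression
  equals \<open>sin\<^sup>2 \<theta>\<^sub>1 g(\<nabla>\<^sub>X Y, U)\<close>; the second is symmetric. As \<open>sin \<theta>\<^sub>i \<noteq> 0\<close>, the two equations say that
  each of \<open>D\<^sub>1\<close> and \<open>D\<^sub>2\<close> is totally geodesic in the fibres. By Koszul's formula, in a product
  parametrization \<open>H\<close> of a fibre with orthogonal factors, \<open>2 g(\<nabla>\<^sub>X Y, U)\<close> is minus the derivative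
  of \<open>g(dH u, dH v)\<close> in the direction of the other factor, so the condition says that the induced metric
  on each factor does not depend on the other one. For the converse a product parametrization is needed:
  both distributions are involutive, and first integrals of \<open>D\<^sub>1\<close> and \<open>D\<^sub>2\<close> given by the Frobenius theorem,
  together with \<open>\<pi>\<close>, form a chart in which \<open>D\<^sub>1\<close>, \<open>D\<^sub>2\<close> and the fibres are coordinate planes.
\<close>

subsection \<open>Continuously differentiable maps on open sets\<close>

text \<open>Tangent vectors are component vectors in a chart that may jump from point to point, so
  nothing can be differentiated before it is moved to one fixed chart with \<open>to_chart\<close>.
  A product parametrization is only known to extend smoothly near each point of
  \<open>L\<^sub>1 \<times> L\<^sub>2\<close>, by an extension that changes with the point;
  derivatives are therefore compared only along slices tangent to the two factors. One formula,
  \<open>metric_variation\<close>, serves both directions: with the given parametrization of a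
  fibre, and with the identity map of an adapted chart. Frobenius' theorem requires flows that
  depend smoothly on the initial value. They are obtained as fixed points in a Banach space of
  paths, where the derivative solves a linear fixed point equation and its formula raises the
  regularity by induction. Basic fields enter through one fact: their bracket with a vertical field
  is vertical. The two halves of the statement are mirror images, and the locale
  \<open>bislant\<close> is closed under exchanging the distributions.\<close>

lemma frechet_derivative_eq:
  "(f has_derivative f') (at x) \<Longrightarrow> frechet_derivative f (at x) = f'"
  using frechet_derivative_at by metis

lemma has_frechet_derivative:
  "f differentiable (at x) \<Longrightarrow> (f has_derivative frechet_derivative f (at x)) (at x)"
  using frechet_derivative_works by blast

lemma frechet_derivative_linear:
  "f differentiable (at x) \<Longrightarrow> bounded_linear (frechet_derivative f (at x))"
  using has_frechet_derivative has_derivative_bounded_linear by blast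

lemma frechet_derivative_cong:
  assumes "open U" "x \<in> U" "\<And>y. y \<in> U \<Longrightarrow> f y = g y"
  shows "frechet_derivative f (at x) = frechet_derivative g (at x)"
proof -
  have "(f has_derivative f') (at x) \<longleftrightarrow> (g has_derivative f') (at x)" for f'
    using has_derivative_transform_within_open[OF _ assms(1,2)] assms(3) by metis
  then show ?thesis unfolding frechet_derivative_def by simp
qed

lemma Ck_on_mono: "Ck_on k f U \<Longrightarrow> V \<subseteq> U \<Longrightarrow> Ck_on k f V"
proof (induction k arbitrary: f)
  case 0 then show ?case by (auto intro: continuous_on_subset)
next
  case (Suc k) then show ?case by (auto simp: subset_eq)
qed

lemma Ck_on_cong:
  assumes "open U" "\<And>x. x \<in> U \<Longrightarrow> f x = g x" "Ck_on k f U"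
  shows "Ck_on k g U"
  using assms(2,3)
proof (induction k arbitrary: f g)
  case 0 then show ?case using continuous_on_cong by (metis Ck_on.simps(1))
next
  case (Suc k)
  have d: "g differentiable (at x)" if "x \<in> U" for x
  proof -
    have "(f has_derivative frechet_derivative f (at x)) (at x)"
      using Suc.prems(2) that has_frechet_derivative by auto
    then have "(g has_derivative frechet_derivative f (at x)) (at x)"
      using has_derivative_transform_within_open[OF _ assms(1) that] Suc.prems(1) by blast
    then show ?thesis by (auto simp: differentiable_def)
  qed
  have "Ck_on k (\<lambda>x. frechet_derivative g (at x) v) U" for v
  proof (rule Suc.IH[of "\<lambda>x. frechet_derivative f (at x) v"])
    show "Ck_on k (\<lambda>x. frechet_derivative f (at x) v) U" using Suc.prems(2) by simp
    show "frechet_derivative f (at x) v = frechet_derivative g (at x) v" if "x \<in> U" for x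
      using frechet_derivative_cong[OF assms(1) that Suc.prems(1)] by simp
  qed
  then show ?case using d by simp
qed

text \<open>The derivative may be given by any formula \<open>f'\<close> that is right on
  \<open>U\<close>. The order k is raised by one whenever this formula is built from maps of order
  k, which is the pattern of most inductions on k below.\<close>

lemma Ck_on_SucI:
  assumes "open U" "\<And>x. x \<in> U \<Longrightarrow> (f has_derivative f' x) (at x)"
    "\<And>v. Ck_on k (\<lambda>x. f' x v) U"
  shows "Ck_on (Suc k) f U"
proof -
  have "Ck_on k (\<lambda>x. frechet_derivative f (at x) v) U" for v
    by (rule Ck_on_cong[OF assms(1) _ assms(3)[of v]]) (simp add: frechet_derivative_eq[OF assms(2)])
  then show ?thesis using assms(2) by (auto simp: differentiable_def)
qed

lemma Ck_on_continuous: "Ck_on k f U \<Longrightarrow> continuous_on U f"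
  by (cases k) (auto intro!: continuous_at_imp_continuous_on differentiable_imp_continuous_within)

lemma Ck_on_SucD: "Ck_on (Suc k) f U \<Longrightarrow> Ck_on k f U"
proof (induction k arbitrary: f)
  case 0 then show ?case using Ck_on_continuous by fastforce
next
  case (Suc k) then show ?case by (metis Ck_on.simps(2))
qed

lemma Ck_on_local:
  assumes "\<And>x. x \<in> U \<Longrightarrow> \<exists>V. open V \<and> x \<in> V \<and> Ck_on k f V"
  shows "Ck_on k f U"
  using assms
proof (induction k arbitrary: f)
  case 0
  show ?case
  proof (simp, rule continuous_at_imp_continuous_on, rule ballI)
    fix x assume "x \<in> U"
    then obtain V where "open V" "x \<in> V" "continuous_on V f" using 0 by force
    then show "isCont f x" using continuous_on_eq_continuous_at by blast
  qed
next
  case (Suc k)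
  have "f differentiable (at x)" if "x \<in> U" for x using Suc.prems[OF that] by auto
  moreover have "Ck_on k (\<lambda>x. frechet_derivative f (at x) v) U" for v
    by (rule Suc.IH) (metis Ck_on.simps(2) Suc.prems)
  ultimately show ?case by simp
qed

lemma Ck_on_const [simp]: "Ck_on k (\<lambda>x. c) U"
proof (induction k arbitrary: c)
  case (Suc k) then show ?case by simp
qed simp

lemma Ck_on_linear:
  assumes "open U" "bounded_linear L" "Ck_on k f U"
  shows "Ck_on k (\<lambda>x. L (f x)) U"
  using assms(3)
proof (induction k arbitrary: f)
  case 0 then show ?case
    using continuous_on_compose2[OF linear_continuous_on[OF assms(2)]] by (auto intro: subset_UNIV)
next
  case (Suc k)
  show ?case
  proof (rule Ck_on_SucI[OF assms(1)])
    show "((\<lambda>x. L (f x)) has_derivative (\<lambda>v. L (frechet_derivative f (at x) v))) (at x)" if "x \<in> U" for x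
      using bounded_linear.has_derivative[OF assms(2) has_frechet_derivative] Suc.prems that by auto
    show "Ck_on k (\<lambda>x. L (frechet_derivative f (at x) v)) U" for v
      by (rule Suc.IH) (use Suc.prems in simp)
  qed
qed

lemma Ck_on_ident: "open U \<Longrightarrow> Ck_on k (\<lambda>x. x) U"
proof (cases k)
  case (Suc n)
  assume "open U"
  then show ?thesis unfolding Suc by (intro Ck_on_SucI[where f' = "\<lambda>_ v. v"]) auto
qed simp

lemma Ck_on_add:
  assumes "open U" "Ck_on k f U" "Ck_on k g U"
  shows "Ck_on k (\<lambda>x. f x + g x) U"
  using assms(2,3)
proof (induction k arbitrary: f g)
  case 0 then show ?case by (auto intro: continuous_intros)
next
  case (Suc k)
  show ?case
  proof (rule Ck_on_SucI[OF assms(1)])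
    show "((\<lambda>x. f x + g x) has_derivative (\<lambda>v. frechet_derivative f (at x) v + frechet_derivative g (at x) v)) (at x)"
      if "x \<in> U" for x
      by (intro has_derivative_add has_frechet_derivative) (use Suc.prems that in auto)
    show "Ck_on k (\<lambda>x. frechet_derivative f (at x) v + frechet_derivative g (at x) v) U" for v
      by (rule Suc.IH) (use Suc.prems in auto)
  qed
qed

lemma Ck_on_sum:
  assumes "open U" "\<And>i. i \<in> I \<Longrightarrow> Ck_on k (f i) U"
  shows "Ck_on k (\<lambda>x. \<Sum>i\<in>I. f i x) U"
proof (cases "finite I")
  case True
  then show ?thesis using assms(2)
    by (induction I rule: finite_induct) (auto intro!: Ck_on_add assms(1))
qed simp

lemma Ck_on_bilinear:
  assumes "open U" "bounded_bilinear B" "Ck_on k f U" "Ck_on k g U"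
  shows "Ck_on k (\<lambda>x. B (f x) (g x)) U"
  using assms(3,4)
proof (induction k arbitrary: f g)
  case 0 then show ?case using bounded_bilinear.continuous_on[OF assms(2)] by auto
next
  case (Suc k)
  show ?case
  proof (rule Ck_on_SucI[OF assms(1)])
    show "((\<lambda>x. B (f x) (g x)) has_derivative
        (\<lambda>v. B (f x) (frechet_derivative g (at x) v) + B (frechet_derivative f (at x) v) (g x))) (at x)"
      if "x \<in> U" for x
      by (intro bounded_bilinear.FDERIV[OF assms(2)] has_frechet_derivative) (use Suc.prems that in auto)
    have "Ck_on k (\<lambda>x. B (f x) (frechet_derivative g (at x) v)) U"
         "Ck_on k (\<lambda>x. B (frechet_derivative f (at x) v) (g x)) U" for v
      using Suc.IH Suc.prems Ck_on_SucD by (metis Ck_on.simps(2))+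
    then show "Ck_on k (\<lambda>x. B (f x) (frechet_derivative g (at x) v) + B (frechet_derivative f (at x) v) (g x)) U" for v
      by (intro Ck_on_add assms(1))
  qed
qed

lemma linear_sum_Basis:
  fixes v :: "'a::euclidean_space"
  assumes "linear L" shows "L v = (\<Sum>b\<in>Basis. (v \<bullet> b) *\<^sub>R L b)"
proof -
  have "L v = L (\<Sum>b\<in>Basis. (v \<bullet> b) *\<^sub>R b)" by (simp add: euclidean_representation)
  then show ?thesis using assms by (simp add: linear_sum linear_scale)
qed

text \<open>A family of linear maps is controlled through its values on the basis: expanding
  \<open>v x\<close> in \<open>Basis\<close> leaves a finite sum of products. No topology on the
  space of operators is involved.\<close>

lemma Ck_on_apply_linear:
  fixes v :: "'a::euclidean_space \<Rightarrow> 'b::euclidean_space" and L :: "'a \<Rightarrow> 'b \<Rightarrow> 'c::real_normed_vector"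
  assumes "open U" "\<And>x. x \<in> U \<Longrightarrow> linear (L x)" "\<And>b. b \<in> Basis \<Longrightarrow> Ck_on k (\<lambda>x. L x b) U" "Ck_on k v U"
  shows "Ck_on k (\<lambda>x. L x (v x)) U"
proof (rule Ck_on_cong[OF assms(1)])
  show "(\<Sum>b\<in>Basis. (v x \<bullet> b) *\<^sub>R L x b) = L x (v x)" if "x \<in> U" for x
    by (rule linear_sum_Basis[OF assms(2)[OF that], symmetric])
  show "Ck_on k (\<lambda>x. \<Sum>b\<in>Basis. (v x \<bullet> b) *\<^sub>R L x b) U"
    by (intro Ck_on_sum assms(1) Ck_on_bilinear[OF _ bounded_bilinear_scaleR] assms(3)
        Ck_on_linear[OF _ bounded_linear_inner_left] assms(4))
qed

text \<open>The chain rule expresses the derivative as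
  \<open>frechet_derivative g (at (f x))\<close> applied to a vector depending on \<open>x\<close>.
  Its values on basis vectors are directional derivatives of \<open>g\<close> composed with the same
  \<open>f\<close>, so the induction on k runs over all \<open>g\<close> while \<open>f\<close>
  stays fixed.\<close>

lemma Ck_on_compose:
  fixes f :: "'a::euclidean_space \<Rightarrow> 'b::euclidean_space"
  assumes "open U" "open V" "f ` U \<subseteq> V" "Ck_on k g V" "Ck_on k f U"
  shows "Ck_on k (\<lambda>x. g (f x)) U"
  using assms(4,5)
proof (induction k arbitrary: g)
  case 0 then show ?case using continuous_on_compose2 assms(3) by auto
next
  case (Suc k)
  show ?case
  proof (rule Ck_on_SucI[OF assms(1)])
    show "((\<lambda>x. g (f x)) has_derivative (\<lambda>v. frechet_derivative g (at (f x)) (frechet_derivative f (at x) v))) (at x)"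
      if "x \<in> U" for x
      by (rule has_derivative_compose[OF has_frechet_derivative has_frechet_derivative])
        (use Suc.prems that assms(3) in auto)
    show "Ck_on k (\<lambda>x. frechet_derivative g (at (f x)) (frechet_derivative f (at x) v)) U" for v
    proof (rule Ck_on_apply_linear[OF assms(1)])
      show "linear (frechet_derivative g (at (f x)))" if "x \<in> U" for x
        by (intro bounded_linear.linear frechet_derivative_linear) (use Suc.prems that assms(3) in auto)
      show "Ck_on k (\<lambda>x. frechet_derivative g (at (f x)) b) U" for b
        by (rule Suc.IH) (use Suc.prems Ck_on_SucD in auto)
      show "Ck_on k (\<lambda>x. frechet_derivative f (at x) v) U" using Suc.prems by simp
    qed
  qed
qed

lemma Ck_on_Pair:
  assumes "open U" "Ck_on k f U" "Ck_on k g U"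
  shows "Ck_on k (\<lambda>x. (f x, g x)) U"
proof -
  have "Ck_on k (\<lambda>x. (f x, 0) + (0, g x)) U"
    by (intro Ck_on_add assms Ck_on_linear[of U "\<lambda>x. (x, 0)"] Ck_on_linear[of U "\<lambda>x. (0, x)"]
        bounded_linear_Pair bounded_linear_ident bounded_linear_zero)
  then show ?thesis by simp
qed

section \<open>Inverses of functions and of operators\<close>

lemma Ck_on_inverse:
  fixes f :: "'a::euclidean_space \<Rightarrow> real"
  assumes "open U" "\<And>x. x \<in> U \<Longrightarrow> f x \<noteq> 0" "Ck_on k f U"
  shows "Ck_on k (\<lambda>x. inverse (f x)) U"
  using assms(3)
proof (induction k)
  case 0 then show ?case using assms(2) by (auto intro!: continuous_intros)
next
  case (Suc k)
  have ih: "Ck_on k (\<lambda>x. inverse (f x)) U" using Suc Ck_on_SucD by blast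
  show ?case
  proof (rule Ck_on_SucI[OF assms(1)])
    show "((\<lambda>x. inverse (f x)) has_derivative (\<lambda>v. - (inverse (f x) * frechet_derivative f (at x) v * inverse (f x)))) (at x)"
      if "x \<in> U" for x
      using Deriv.has_derivative_inverse[where f = f and x = x, OF assms(2)[OF that]]
        has_frechet_derivative[of f x] Suc.prems that by simp
    show "Ck_on k (\<lambda>x. - (inverse (f x) * frechet_derivative f (at x) v * inverse (f x))) U" for v
      by (intro Ck_on_linear[OF _ bounded_linear_minus[OF bounded_linear_ident]] Ck_on_bilinear[OF _ bounded_bilinear_mult] assms(1) ih)
        (use Suc.prems in simp)
  qed
qed

text \<open>The derivative of \<open>R = A\<^sup>-\<^sup>1\<close> is \<open>- R A' R\<close>.\<close>
lemma Ck_on_blinfun_inverse: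
  fixes A :: "'a::euclidean_space \<Rightarrow> 'b::real_normed_vector \<Rightarrow>\<^sub>L 'c::real_normed_vector"
  assumes "open U" "Ck_on k A U"
    and RA: "\<And>x. x \<in> U \<Longrightarrow> R x o\<^sub>L A x = id_blinfun" and AR: "\<And>x. x \<in> U \<Longrightarrow> A x o\<^sub>L R x = id_blinfun"
  shows "Ck_on k R U"
proof -
  \<comment> \<open>The resolvent identity: differences of \<open>R\<close> are controlled by
    differences of \<open>A\<close>.\<close>
  have diff: "R y - R x = - (R y o\<^sub>L (A y - A x) o\<^sub>L R x)" if "x \<in> U" "y \<in> U" for x y
  proof -
    have "R y (A y w) = w" "A x (R x w') = w'" for w w'
      using RA[OF that(2)] AR[OF that(1)] by (metis blinfun_apply_blinfun_compose blinfun_apply_id_blinfun)+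
    then show ?thesis by (intro blinfun_eqI) (simp add: blinfun.bilinear_simps)
  qed
  have cont: "isCont R x" if x: "x \<in> U" and A: "isCont A x" for x
  proof -
    \<comment> \<open>With this \<open>e\<close>, the norm of \<open>R y - R x\<close> is at most
      half the norm of \<open>R y\<close> as soon as \<open>A y\<close> is \<open>e\<close>-close to
      \<open>A x\<close>. So \<open>R\<close> is bounded near \<open>x\<close> before its continuity
      is known.\<close>
    define e where "e = inverse (2 * (norm (R x) + 1))"
    have e: "e > 0" "e * norm (R x) \<le> 1/2"
      by (auto simp: e_def field_simps add_pos_nonneg intro!: add_pos_nonneg)
    have "((\<lambda>y. A y - A x) \<longlongrightarrow> 0) (at x)" using A by (simp add: isCont_def LIM_zero)
    then have "eventually (\<lambda>y. norm (A y - A x) < e) (at x)"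
      using e(1) by (auto simp: tendsto_iff)
    moreover have U: "eventually (\<lambda>y. y \<in> U) (at x)"
      using assms(1) x by (auto simp: eventually_at_topological)
    ultimately have b: "eventually (\<lambda>y. norm (R y) \<le> 2 * norm (R x)) (at x)"
    proof eventually_elim
      case (elim y)
      have "norm (R y - R x) \<le> norm (R y) * norm (A y - A x) * norm (R x)"
        unfolding diff[OF x elim(2)] norm_minus_cancel
        by (meson norm_blinfun_compose mult_right_mono norm_ge_zero order_trans)
      also have "\<dots> \<le> norm (R y) * (e * norm (R x))"
        using elim(1) by (simp add: mult_left_mono mult_right_mono mult.assoc)
      also have "\<dots> \<le> norm (R y) * (1/2)" using e(2) by (intro mult_left_mono) auto
      finally show ?case using norm_triangle_ineq2[of "R y" "R x"] by simp
    qed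
    have "((\<lambda>y. R y - R x) \<longlongrightarrow> 0) (at x)"
    proof (rule Lim_null_comparison)
      show "eventually (\<lambda>y. norm (R y - R x) \<le> (2 * norm (R x)) * norm (A y - A x) * norm (R x)) (at x)"
        using b U
      proof eventually_elim
        case (elim y)
        have "norm (R y - R x) \<le> norm (R y) * norm (A y - A x) * norm (R x)"
          unfolding diff[OF x elim(2)] norm_minus_cancel
          by (meson norm_blinfun_compose mult_right_mono norm_ge_zero order_trans)
        also have "\<dots> \<le> (2 * norm (R x)) * norm (A y - A x) * norm (R x)"
          using elim(1) by (intro mult_right_mono) auto
        finally show ?case .
      qed
      have "((\<lambda>y. norm (A y - A x)) \<longlongrightarrow> 0) (at x)"
        using A by (simp add: isCont_def LIM_zero tendsto_norm_zero)
      then show "((\<lambda>y. (2 * norm (R x)) * norm (A y - A x) * norm (R x)) \<longlongrightarrow> 0) (at x)"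
        using tendsto_mult_left_zero tendsto_mult_right_zero by blast
    qed
    then show "isCont R x" by (simp add: isCont_def LIM_zero_iff)
  qed
  show ?thesis using assms(2)
  proof (induction k)
    case 0
    then have "isCont A x" if "x \<in> U" for x using that assms(1) by (simp add: continuous_on_eq_continuous_at)
    then show ?case using cont by (simp add: continuous_at_imp_continuous_on)
  next
    case (Suc k)
    have dA: "(A has_derivative frechet_derivative A (at x)) (at x)" if "x \<in> U" for x
      using Suc.prems that has_frechet_derivative by auto
    have cR: "isCont R x" if "x \<in> U" for x
      using cont[OF that] has_derivative_continuous[OF dA[OF that]] by blast
    have ih: "Ck_on k R U" using Suc Ck_on_SucD by blast
    show ?case
    proof (rule Ck_on_SucI[OF assms(1)])
      show "(R has_derivative (\<lambda>v. - (R x o\<^sub>L frechet_derivative A (at x) v o\<^sub>L R x))) (at x)" if x: "x \<in> U" for x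
      proof -
        let ?A' = "frechet_derivative A (at x)"
        have bl: "bounded_linear ?A'" using dA[OF x] has_derivative_bounded_linear by blast
        \<comment> \<open>The factor \<open>A y - A x\<close> vanishes at \<open>x\<close>, so this
          product is differentiable at \<open>x\<close> although \<open>R\<close> is only known to
          be continuous there. The resolvent identity then differentiates \<open>R\<close>
          itself.\<close>
        have d: "((\<lambda>y. R y o\<^sub>L (A y - A x)) has_derivative (\<lambda>v. R x o\<^sub>L ?A' v)) (at x)"
        proof -
          have A': "((\<lambda>y. (1 / norm (y - x)) *\<^sub>R (A y - A x - ?A' (y - x))) \<longlongrightarrow> 0) (at x)"
            using dA[OF x] by (simp add: has_derivative_within diff_diff_eq)
          obtain K where K: "\<And>v. norm (?A' v) \<le> norm v * K" using bl bounded_linear.bounded by blast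
          have R0: "((\<lambda>y. norm (R y - R x)) \<longlongrightarrow> 0) (at x)"
            using cR[OF x] by (simp add: isCont_def LIM_zero tendsto_norm_zero)
          have nR: "((\<lambda>y. norm (R y)) \<longlongrightarrow> norm (R x)) (at x)"
            using cR[OF x] by (simp add: isCont_def tendsto_norm)
          have "((\<lambda>y. (1 / norm (y - x)) *\<^sub>R ((R y o\<^sub>L (A y - A x)) - (R x o\<^sub>L (A x - A x)) - (R x o\<^sub>L ?A' (y - x)))) \<longlongrightarrow> 0) (at x)"
          proof (rule Lim_null_comparison)
            show "eventually (\<lambda>y. norm ((1 / norm (y - x)) *\<^sub>R ((R y o\<^sub>L (A y - A x)) - (R x o\<^sub>L (A x - A x)) - (R x o\<^sub>L ?A' (y - x))))
               \<le> norm (R y) * norm ((1 / norm (y - x)) *\<^sub>R (A y - A x - ?A' (y - x))) + norm (R y - R x) * K) (at x)"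
            proof (rule eventually_mono[OF eventually_at_ball'[of 1]])
              fix y assume "y \<in> ball x 1 \<and> y \<noteq> x \<and> y \<in> UNIV"
              then have yx: "norm (y - x) > 0" by auto
              have "(1 / norm (y - x)) *\<^sub>R ((R y o\<^sub>L (A y - A x)) - (R x o\<^sub>L (A x - A x)) - (R x o\<^sub>L ?A' (y - x)))
                = (R y o\<^sub>L ((1 / norm (y - x)) *\<^sub>R (A y - A x - ?A' (y - x)))) + ((R y - R x) o\<^sub>L ((1 / norm (y - x)) *\<^sub>R ?A' (y - x)))"
                by (intro blinfun_eqI) (simp add: blinfun.bilinear_simps algebra_simps)
              also have "norm \<dots> \<le> norm (R y) * norm ((1 / norm (y - x)) *\<^sub>R (A y - A x - ?A' (y - x))) +
                 norm (R y - R x) * norm ((1 / norm (y - x)) *\<^sub>R ?A' (y - x))"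
                by (intro order_trans[OF norm_triangle_ineq] add_mono norm_blinfun_compose)
              also have "norm ((1 / norm (y - x)) *\<^sub>R ?A' (y - x)) \<le> K"
                using K[of "y - x"] yx by (simp add: field_simps)
              finally show "norm ((1 / norm (y - x)) *\<^sub>R ((R y o\<^sub>L (A y - A x)) - (R x o\<^sub>L (A x - A x)) - (R x o\<^sub>L ?A' (y - x))))
                 \<le> norm (R y) * norm ((1 / norm (y - x)) *\<^sub>R (A y - A x - ?A' (y - x))) + norm (R y - R x) * K"
                by (simp add: mult_left_mono)
            qed simp
            show "((\<lambda>y. norm (R y) * norm ((1 / norm (y - x)) *\<^sub>R (A y - A x - ?A' (y - x))) + norm (R y - R x) * K) \<longlongrightarrow> 0) (at x)"
              using tendsto_add[OF tendsto_mult[OF nR tendsto_norm[OF A']] tendsto_mult_right[OF R0, of K]] by simp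
          qed
          then show ?thesis
            using bounded_linear_compose[OF bounded_bilinear.bounded_linear_right[OF bounded_bilinear_blinfun_compose] bl]
            by (simp add: has_derivative_within)
        qed
        have d2: "((\<lambda>y. R x - ((R y o\<^sub>L (A y - A x)) o\<^sub>L R x)) has_derivative (\<lambda>v. - (R x o\<^sub>L ?A' v o\<^sub>L R x))) (at x)"
          using has_derivative_diff[OF has_derivative_const
            bounded_linear.has_derivative[OF bounded_bilinear.bounded_linear_left[OF bounded_bilinear_blinfun_compose] d]]
          by simp
        show ?thesis
          by (rule has_derivative_transform_within_open[OF d2 assms(1) x]) (use diff[OF x] in \<open>simp add: algebra_simps\<close>)
      qed
      show "Ck_on k (\<lambda>x. - (R x o\<^sub>L frechet_derivative A (at x) v o\<^sub>L R x)) U" for v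
        by (intro Ck_on_linear[OF _ bounded_linear_minus[OF bounded_linear_ident]]
            Ck_on_bilinear[OF _ bounded_bilinear_blinfun_compose] assms(1) ih) (use Suc.prems in simp)
    qed
  qed
qed

subsection \<open>Smooth maps on open sets\<close>

lemma smooth_on_imp_Ck: "smooth_on U f \<Longrightarrow> Ck_on k f U"
  by (simp add: smooth_on_def)

lemma smooth_on_mono: "smooth_on U f \<Longrightarrow> V \<subseteq> U \<Longrightarrow> smooth_on V f"
  by (auto simp: smooth_on_def intro: Ck_on_mono)

lemma smooth_on_cong: "open U \<Longrightarrow> (\<And>x. x \<in> U \<Longrightarrow> f x = g x) \<Longrightarrow> smooth_on U f \<Longrightarrow> smooth_on U g"
  by (auto simp: smooth_on_def intro: Ck_on_cong)

lemma smooth_on_local: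
  "(\<And>x. x \<in> U \<Longrightarrow> \<exists>V. open V \<and> x \<in> V \<and> smooth_on V f) \<Longrightarrow> smooth_on U f"
  unfolding smooth_on_def by (intro allI Ck_on_local) metis

lemma smooth_on_const [simp]: "smooth_on U (\<lambda>x. c)"
  by (simp add: smooth_on_def)

lemma smooth_on_ident: "open U \<Longrightarrow> smooth_on U (\<lambda>x. x)"
  by (simp add: smooth_on_def Ck_on_ident)

lemma smooth_on_linear:
  "open U \<Longrightarrow> bounded_linear L \<Longrightarrow> smooth_on U f \<Longrightarrow> smooth_on U (\<lambda>x. L (f x))"
  by (simp add: smooth_on_def Ck_on_linear)

lemma smooth_on_bilinear:
  "open U \<Longrightarrow> bounded_bilinear B \<Longrightarrow> smooth_on U f \<Longrightarrow> smooth_on U g \<Longrightarrow> smooth_on U (\<lambda>x. B (f x) (g x))"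
  by (simp add: smooth_on_def Ck_on_bilinear)

lemma smooth_on_add:
  "open U \<Longrightarrow> smooth_on U f \<Longrightarrow> smooth_on U g \<Longrightarrow> smooth_on U (\<lambda>x. f x + g x)"
  by (simp add: smooth_on_def Ck_on_add)

lemma smooth_on_minus: "open U \<Longrightarrow> smooth_on U f \<Longrightarrow> smooth_on U (\<lambda>x. - f x)"
  by (rule smooth_on_linear[OF _ bounded_linear_minus[OF bounded_linear_ident]])

lemma smooth_on_diff:
  "open U \<Longrightarrow> smooth_on U f \<Longrightarrow> smooth_on U g \<Longrightarrow> smooth_on U (\<lambda>x. f x - g x)"
  using smooth_on_add[of U f "\<lambda>x. - g x"] smooth_on_minus[of U g] by simp

lemma smooth_on_sum:
  "open U \<Longrightarrow> (\<And>i. i \<in> I \<Longrightarrow> smooth_on U (f i)) \<Longrightarrow> smooth_on U (\<lambda>x. \<Sum>i\<in>I. f i x)"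
  by (simp add: smooth_on_def Ck_on_sum)

lemma smooth_on_scaleR:
  "open U \<Longrightarrow> smooth_on U f \<Longrightarrow> smooth_on U g \<Longrightarrow> smooth_on U (\<lambda>x. f x *\<^sub>R g x)"
  by (rule smooth_on_bilinear[OF _ bounded_bilinear_scaleR])

lemma smooth_on_mult:
  fixes f g :: "'a::euclidean_space \<Rightarrow> real"
  shows "open U \<Longrightarrow> smooth_on U f \<Longrightarrow> smooth_on U g \<Longrightarrow> smooth_on U (\<lambda>x. f x * g x)"
  by (rule smooth_on_bilinear[OF _ bounded_bilinear_mult])

lemma smooth_on_inverse:
  fixes f :: "'a::euclidean_space \<Rightarrow> real"
  shows "open U \<Longrightarrow> (\<And>x. x \<in> U \<Longrightarrow> f x \<noteq> 0) \<Longrightarrow> smooth_on U f \<Longrightarrow> smooth_on U (\<lambda>x. inverse (f x))"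
  by (simp add: smooth_on_def Ck_on_inverse)

lemma smooth_on_Pair:
  "open U \<Longrightarrow> smooth_on U f \<Longrightarrow> smooth_on U g \<Longrightarrow> smooth_on U (\<lambda>x. (f x, g x))"
  by (simp add: smooth_on_def Ck_on_Pair)

lemma smooth_on_compose:
  fixes f :: "'a::euclidean_space \<Rightarrow> 'b::euclidean_space"
  shows "open U \<Longrightarrow> open V \<Longrightarrow> f ` U \<subseteq> V \<Longrightarrow> smooth_on V g \<Longrightarrow> smooth_on U f \<Longrightarrow> smooth_on U (\<lambda>x. g (f x))"
  by (simp add: smooth_on_def Ck_on_compose)

lemma smooth_on_blinfun_inverse:
  fixes A :: "'a::euclidean_space \<Rightarrow> 'b::real_normed_vector \<Rightarrow>\<^sub>L 'c::real_normed_vector"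
  assumes "open U" "smooth_on U A"
    and "\<And>x. x \<in> U \<Longrightarrow> R x o\<^sub>L A x = id_blinfun" "\<And>x. x \<in> U \<Longrightarrow> A x o\<^sub>L R x = id_blinfun"
  shows "smooth_on U R"
  using Ck_on_blinfun_inverse[OF assms(1) _ assms(3,4)] assms(2) by (simp add: smooth_on_def)

lemma smooth_on_differentiable: "smooth_on U f \<Longrightarrow> x \<in> U \<Longrightarrow> f differentiable (at x)"
  using smooth_on_imp_Ck[of U f "Suc 0"] by simp

lemma smooth_on_has_derivative:
  "smooth_on U f \<Longrightarrow> x \<in> U \<Longrightarrow> (f has_derivative frechet_derivative f (at x)) (at x)"
  by (intro has_frechet_derivative smooth_on_differentiable)

lemma smooth_on_bounded_linear:
  "smooth_on U f \<Longrightarrow> x \<in> U \<Longrightarrow> bounded_linear (frechet_derivative f (at x))"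
  by (intro frechet_derivative_linear smooth_on_differentiable)

lemma smooth_on_linear_derivative:
  "smooth_on U f \<Longrightarrow> x \<in> U \<Longrightarrow> linear (frechet_derivative f (at x))"
  using smooth_on_bounded_linear bounded_linear.linear by blast

lemma smooth_on_continuous: "smooth_on U f \<Longrightarrow> continuous_on U f"
  using smooth_on_imp_Ck Ck_on_continuous by blast

lemma smooth_on_derivative:
  "smooth_on U f \<Longrightarrow> smooth_on U (\<lambda>x. frechet_derivative f (at x) v)"
  unfolding smooth_on_def using Ck_on.simps(2) by fast

lemma smooth_on_apply_linear:
  fixes v :: "'a::euclidean_space \<Rightarrow> 'b::euclidean_space" and L :: "'a \<Rightarrow> 'b \<Rightarrow> 'c::real_normed_vector"
  assumes "open U" "\<And>x. x \<in> U \<Longrightarrow> linear (L x)" "\<And>b. b \<in> Basis \<Longrightarrow> smooth_on U (\<lambda>x. L x b)" "smooth_on U v"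
  shows "smooth_on U (\<lambda>x. L x (v x))"
  using assms Ck_on_apply_linear[of U L _ v] by (simp add: smooth_on_def)

lemma smooth_on_derivative_field:
  fixes f :: "'a::euclidean_space \<Rightarrow> 'b::real_normed_vector"
  assumes "open U" "smooth_on U f" "smooth_on U v"
  shows "smooth_on U (\<lambda>x. frechet_derivative f (at x) (v x))"
  by (rule smooth_on_apply_linear[OF assms(1) _ _ assms(3)])
    (use assms smooth_on_derivative smooth_on_linear_derivative in auto)

section \<open>Smooth families of operators\<close>

definition blinfun_outer :: "'a::euclidean_space \<Rightarrow> 'b::real_normed_vector \<Rightarrow> 'a \<Rightarrow>\<^sub>L 'b" where
  "blinfun_outer e c = blinfun_scaleR_left c o\<^sub>L blinfun_inner_left e"

lemma blinfun_outer_apply [simp]: "blinfun_outer e c v = (v \<bullet> e) *\<^sub>R c"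
  by (simp add: blinfun_outer_def blinfun_inner_left.rep_eq)

text \<open>An operator is the sum of the rank-one operators \<open>blinfun_outer b (L x b)\<close>,
  and these are bounded linear in \<open>L x b\<close>. Hence smoothness on each basis vector gives
  smoothness in the operator norm, the form in which operators can be inverted.\<close>

lemma smooth_on_Blinfun:
  fixes L :: "'x::euclidean_space \<Rightarrow> 'a::euclidean_space \<Rightarrow> 'b::real_normed_vector"
  assumes "open U" "\<And>x. x \<in> U \<Longrightarrow> linear (L x)" "\<And>b. b \<in> Basis \<Longrightarrow> smooth_on U (\<lambda>x. L x b)"
  shows "smooth_on U (\<lambda>x. Blinfun (L x))"
proof (rule smooth_on_cong[OF assms(1)])
  have bl: "bounded_linear (blinfun_outer e :: 'b \<Rightarrow> 'a \<Rightarrow>\<^sub>L 'b)" for e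
    unfolding blinfun_outer_def
    by (intro bounded_linear_compose[OF bounded_bilinear.bounded_linear_left[OF bounded_bilinear_blinfun_compose]]
        bounded_linear_blinfun_scaleR_left)
  show "smooth_on U (\<lambda>x. \<Sum>b\<in>Basis. blinfun_outer b (L x b))"
    by (intro smooth_on_sum smooth_on_linear[OF _ bl] assms) auto
  show "(\<Sum>b\<in>Basis. blinfun_outer b (L x b)) = Blinfun (L x)" if "x \<in> U" for x
  proof (rule blinfun_eqI)
    fix v
    have "bounded_linear (L x)" using assms(2)[OF that] by (simp add: linear_conv_bounded_linear)
    then show "blinfun_apply (\<Sum>b\<in>Basis. blinfun_outer b (L x b)) v = blinfun_apply (Blinfun (L x)) v"
      using linear_sum_Basis[OF assms(2)[OF that], of v]
      by (simp add: bounded_linear_Blinfun_apply blinfun.sum_left)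
  qed
qed

lemma smooth_on_Blinfun_derivative:
  fixes f :: "'a::euclidean_space \<Rightarrow> 'b::real_normed_vector"
  assumes "open U" "smooth_on U f"
  shows "smooth_on U (\<lambda>x. Blinfun (frechet_derivative f (at x)))"
  by (rule smooth_on_Blinfun[OF assms(1)])
    (use assms smooth_on_derivative smooth_on_linear_derivative in auto)

lemma smooth_on_apply_Blinfun_derivative:
  fixes f :: "'a::euclidean_space \<Rightarrow> 'b::real_normed_vector"
  assumes "smooth_on U f" "x \<in> U"
  shows "blinfun_apply (Blinfun (frechet_derivative f (at x))) = frechet_derivative f (at x)"
  using smooth_on_bounded_linear[OF assms] by (simp add: bounded_linear_Blinfun_apply)

text \<open>A two-sided inverse of a linear map is linear, so \<open>R x\<close> is an operator and
  smooth inversion of operators applies.\<close>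

lemma smooth_on_linear_inverse:
  fixes L R :: "'x::euclidean_space \<Rightarrow> 'a::euclidean_space \<Rightarrow> 'a"
  assumes "open U" "\<And>x. x \<in> U \<Longrightarrow> linear (L x)" "\<And>b. b \<in> Basis \<Longrightarrow> smooth_on U (\<lambda>x. L x b)"
    and "\<And>x v. x \<in> U \<Longrightarrow> R x (L x v) = v" "\<And>x v. x \<in> U \<Longrightarrow> L x (R x v) = v" "smooth_on U w"
  shows "smooth_on U (\<lambda>x. R x (w x))"
proof -
  have lR: "linear (R x)" if "x \<in> U" for x
  proof (rule linearI)
    note l = assms(2)[OF that] and i = assms(4)[OF that] and j = assms(5)[OF that]
    show "R x (a + b) = R x a + R x b" for a b
      using i[of "R x a + R x b"] by (simp add: linear_add[OF l] j)
    show "R x (r *\<^sub>R a) = r *\<^sub>R R x a" for r a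
      using i[of "r *\<^sub>R R x a"] by (simp add: linear_scale[OF l] j)
  qed
  have bL: "bounded_linear (L x)" and bR: "bounded_linear (R x)" if "x \<in> U" for x
    using lR assms(2) that by (auto simp: linear_conv_bounded_linear)
  have "smooth_on U (\<lambda>x. Blinfun (R x))"
    by (rule smooth_on_blinfun_inverse[OF assms(1) smooth_on_Blinfun[OF assms(1-3)]])
      (auto intro!: blinfun_eqI simp: bounded_linear_Blinfun_apply bL bR assms(4,5))
  then have "smooth_on U (\<lambda>x. blinfun_apply (Blinfun (R x)) (w x))"
    by (intro smooth_on_bilinear[OF assms(1) bounded_bilinear_blinfun_apply] assms(6))
  then show ?thesis
    by (rule smooth_on_cong[OF assms(1), rotated]) (simp add: bounded_linear_Blinfun_apply bR)
qed

text \<open>Two nested mean value estimates: one in direction \<open>u\<close> for the increment of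
  \<open>f\<close> along \<open>h *\<^sub>R v\<close>, whose derivative is in turn bounded by one in
  direction \<open>v\<close> for \<open>fu\<close>. Continuity of the mixed derivative makes the
  error uniform over the parallelogram.\<close>

lemma mixed_difference_bound:
  fixes f :: "'a::euclidean_space \<Rightarrow> 'b::real_normed_vector"
  assumes f: "smooth_on U f" and U: "open U" and x: "x \<in> U" and e: "0 < e"
  shows "eventually (\<lambda>h. norm (f (x + h *\<^sub>R u + h *\<^sub>R v) - f (x + h *\<^sub>R u) - f (x + h *\<^sub>R v) + f x
      - h\<^sup>2 *\<^sub>R frechet_derivative (\<lambda>y. frechet_derivative f (at y) u) (at x) v) \<le> e * h\<^sup>2) (at_right 0)"
proof -
  define fu where "fu = (\<lambda>y. frechet_derivative f (at y) u)"
  define fuv where "fuv = (\<lambda>y. frechet_derivative fu (at y) v)"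
  have sfu: "smooth_on U fu" and sfuv: "smooth_on U fuv"
    unfolding fu_def fuv_def using smooth_on_derivative[OF f] smooth_on_derivative by blast+
  have "isCont fuv x" using smooth_on_continuous[OF sfuv] U x continuous_on_eq_continuous_at by blast
  then obtain d0 where d0: "d0 > 0" "\<And>y. dist y x < d0 \<Longrightarrow> dist (fuv y) (fuv x) < e"
    using e unfolding continuous_at_eps_delta by metis
  obtain d1 where d1: "d1 > 0" "ball x d1 \<subseteq> U" using U x open_contains_ball by metis
  define d where "d = min d0 d1"
  \<comment> \<open>Parallelograms with both factors below \<open>d'\<close> stay in the ball of
    radius \<open>d\<close>; the summand 1 keeps the denominator positive when \<open>u\<close> and
    \<open>v\<close> vanish.\<close>
  define d' where "d' = d / (norm u + norm v + 1)"
  have d: "d > 0" using d0 d1 by (simp add: d_def)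
  have pos: "norm u + norm v + 1 > 0" by (simp add: add_nonneg_pos)
  have d': "d' > 0" using d pos by (simp add: d'_def)
  have inb: "x + s *\<^sub>R u + t *\<^sub>R v \<in> ball x d" if "0 \<le> s" "s \<le> h" "0 \<le> t" "t \<le> h" "h < d'" for s t h
  proof -
    have "norm (s *\<^sub>R u + t *\<^sub>R v) \<le> s * norm u + t * norm v"
      using norm_triangle_ineq[of "s *\<^sub>R u" "t *\<^sub>R v"] that by simp
    also have "\<dots> \<le> h * norm u + h * norm v"
      using that by (intro add_mono mult_right_mono) auto
    also have "\<dots> \<le> h * (norm u + norm v + 1)" using that by (simp add: algebra_simps)
    also have "\<dots> < d' * (norm u + norm v + 1)" using that pos by (intro mult_strict_right_mono) auto
    also have "\<dots> = d" using pos by (simp add: d'_def)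
    finally show ?thesis by (simp add: dist_norm algebra_simps norm_minus_commute)
  qed
  have key: "norm (f (x + h *\<^sub>R u + h *\<^sub>R v) - f (x + h *\<^sub>R u) - f (x + h *\<^sub>R v) + f x - h\<^sup>2 *\<^sub>R fuv x) \<le> e * h\<^sup>2"
    if h: "0 < h" "h < d'" for h
  proof -
    have inU: "x + s *\<^sub>R u + t *\<^sub>R v \<in> U" and fuvb: "norm (fuv (x + s *\<^sub>R u + t *\<^sub>R v) - fuv x) \<le> e"
      if "0 \<le> s" "s \<le> h" "0 \<le> t" "t \<le> h" for s t
      using inb[OF that h(2)] d1(2) d0(2)[of "x + s *\<^sub>R u + t *\<^sub>R v"]
      by (auto simp: d_def dist_commute dist_norm norm_minus_commute less_eq_real_def subset_eq)
    have inner: "norm (fu (x + s *\<^sub>R u + h *\<^sub>R v) - fu (x + s *\<^sub>R u) - h *\<^sub>R fuv x) \<le> e * h"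
      if s: "0 \<le> s" "s \<le> h" for s
    proof -
      define \<psi> where "\<psi> = (\<lambda>t. fu (x + s *\<^sub>R u + t *\<^sub>R v) - t *\<^sub>R fuv x)"
      have der: "(\<psi> has_derivative (\<lambda>r. r *\<^sub>R (fuv (x + s *\<^sub>R u + t *\<^sub>R v) - fuv x))) (at t within {0..h})"
        if "t \<in> {0..h}" for t
      proof -
        have "linear (frechet_derivative fu (at (x + s *\<^sub>R u + t *\<^sub>R v)))"
          using smooth_on_linear_derivative[OF sfu inU] s that by auto
        then have eq: "r *\<^sub>R fuv (x + s *\<^sub>R u + t *\<^sub>R v) =
            frechet_derivative fu (at (x + s *\<^sub>R u + t *\<^sub>R v)) (r *\<^sub>R v)" for r
          by (simp add: fuv_def linear_scale)
        have "((\<lambda>t. fu (x + s *\<^sub>R u + t *\<^sub>R v)) has_derivative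
            (\<lambda>r. frechet_derivative fu (at (x + s *\<^sub>R u + t *\<^sub>R v)) (r *\<^sub>R v))) (at t within {0..h})"
        proof (rule has_derivative_compose[where f = "\<lambda>t. x + s *\<^sub>R u + t *\<^sub>R v"])
          show "((\<lambda>t. x + s *\<^sub>R u + t *\<^sub>R v) has_derivative (\<lambda>r. r *\<^sub>R v)) (at t within {0..h})"
            by (auto intro!: derivative_eq_intros)
          show "(fu has_derivative frechet_derivative fu (at (x + s *\<^sub>R u + t *\<^sub>R v))) (at (x + s *\<^sub>R u + t *\<^sub>R v))"
            using smooth_on_has_derivative[OF sfu inU] s that by auto
        qed
        then have "((\<lambda>t. fu (x + s *\<^sub>R u + t *\<^sub>R v)) has_derivative
            (\<lambda>r. r *\<^sub>R fuv (x + s *\<^sub>R u + t *\<^sub>R v))) (at t within {0..h})"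
          by (simp add: eq)
        then show ?thesis unfolding \<psi>_def
          by (auto intro!: derivative_eq_intros simp: algebra_simps)
      qed
      have "norm (\<psi> h - \<psi> 0) \<le> e * norm (h - 0)"
      proof (rule differentiable_bound[OF _ der])
        show "onorm (\<lambda>r. r *\<^sub>R (fuv (x + s *\<^sub>R u + t *\<^sub>R v) - fuv x)) \<le> e" if "t \<in> {0..h}" for t
          using mult_left_mono[OF fuvb[OF s, of t] abs_ge_zero] that e by (intro onorm_bound) (auto simp: mult.commute)
      qed (use h in auto)
      then show ?thesis using h by (simp add: \<psi>_def algebra_simps)
    qed
    define \<phi> where "\<phi> = (\<lambda>s. f (x + s *\<^sub>R u + h *\<^sub>R v) - f (x + s *\<^sub>R u) - (s * h) *\<^sub>R fuv x)"
    have der: "(\<phi> has_derivative (\<lambda>r. r *\<^sub>R (fu (x + s *\<^sub>R u + h *\<^sub>R v) - fu (x + s *\<^sub>R u) - h *\<^sub>R fuv x))) (at s within {0..h})"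
      if "s \<in> {0..h}" for s
    proof -
      have gen: "((\<lambda>s. f (x + s *\<^sub>R u + t *\<^sub>R v)) has_derivative (\<lambda>r. r *\<^sub>R fu (x + s *\<^sub>R u + t *\<^sub>R v))) (at s within {0..h})"
        if t: "0 \<le> t" "t \<le> h" for t
      proof -
        have "linear (frechet_derivative f (at (x + s *\<^sub>R u + t *\<^sub>R v)))"
          using smooth_on_linear_derivative[OF f inU] \<open>s \<in> _\<close> t by auto
        then have eq: "r *\<^sub>R fu (x + s *\<^sub>R u + t *\<^sub>R v) =
            frechet_derivative f (at (x + s *\<^sub>R u + t *\<^sub>R v)) (r *\<^sub>R u)" for r
          by (simp add: fu_def linear_scale)
        show ?thesis unfolding eq
        proof (rule has_derivative_compose[where f = "\<lambda>s. x + s *\<^sub>R u + t *\<^sub>R v"])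
          show "((\<lambda>s. x + s *\<^sub>R u + t *\<^sub>R v) has_derivative (\<lambda>r. r *\<^sub>R u)) (at s within {0..h})"
            by (auto intro!: derivative_eq_intros)
          show "(f has_derivative frechet_derivative f (at (x + s *\<^sub>R u + t *\<^sub>R v))) (at (x + s *\<^sub>R u + t *\<^sub>R v))"
            using smooth_on_has_derivative[OF f inU] \<open>s \<in> _\<close> t by auto
        qed
      qed
      show ?thesis unfolding \<phi>_def
        using gen[of h] gen[of 0] h by (auto intro!: derivative_eq_intros simp: algebra_simps)
    qed
    have "norm (\<phi> h - \<phi> 0) \<le> (e * h) * norm (h - 0)"
    proof (rule differentiable_bound[OF _ der])
      show "onorm (\<lambda>r. r *\<^sub>R (fu (x + s *\<^sub>R u + h *\<^sub>R v) - fu (x + s *\<^sub>R u) - h *\<^sub>R fuv x)) \<le> e * h" if "s \<in> {0..h}" for s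
        using mult_left_mono[OF inner[of s] abs_ge_zero] that h e by (intro onorm_bound) (auto simp: mult.commute)
    qed (use h in auto)
    then show ?thesis using h by (simp add: \<phi>_def algebra_simps power2_eq_square)
  qed
  show ?thesis
    unfolding eventually_at_right_field using d' key by (auto simp: fuv_def fu_def)
qed

text \<open>The second difference is symmetric in \<open>u\<close> and \<open>v\<close>, so both
  mixed derivatives approximate the same quantity. With \<open>e\<close> a quarter of their
  distance, two errors of size e h^2 cannot account for 4 e h^2.\<close>

lemma smooth_on_symmetric_derivative:
  fixes f :: "'a::euclidean_space \<Rightarrow> 'b::real_normed_vector"
  assumes f: "smooth_on U f" and U: "open U" and x: "x \<in> U"
  shows "frechet_derivative (\<lambda>y. frechet_derivative f (at y) u) (at x) v
       = frechet_derivative (\<lambda>y. frechet_derivative f (at y) v) (at x) u" (is "?a = ?b")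
proof (rule ccontr)
  assume "?a \<noteq> ?b"
  define e where "e = norm (?a - ?b) / 4"
  have e: "e > 0" using \<open>?a \<noteq> ?b\<close> by (simp add: e_def)
  have "eventually (\<lambda>h::real. False) (at_right 0)"
    using mixed_difference_bound[OF f U x e, of u v] mixed_difference_bound[OF f U x e, of v u]
      eventually_at_right_less[of 0]
  proof eventually_elim
    case (elim h)
    define D where "D = f (x + h *\<^sub>R u + h *\<^sub>R v) - f (x + h *\<^sub>R u) - f (x + h *\<^sub>R v) + f x"
    have 1: "norm (D - h\<^sup>2 *\<^sub>R ?a) \<le> e * h\<^sup>2" using elim(1) by (simp add: D_def)
    have 2: "norm (D - h\<^sup>2 *\<^sub>R ?b) \<le> e * h\<^sup>2" using elim(2) by (simp add: D_def algebra_simps)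
    have "h\<^sup>2 * norm (?a - ?b) = norm ((D - h\<^sup>2 *\<^sub>R ?b) - (D - h\<^sup>2 *\<^sub>R ?a))"
      by (simp add: scaleR_diff_right[symmetric] del: scaleR_diff_right)
    also have "\<dots> \<le> e * h\<^sup>2 + e * h\<^sup>2"
      using norm_triangle_ineq4[of "D - h\<^sup>2 *\<^sub>R ?b" "D - h\<^sup>2 *\<^sub>R ?a"] 1 2 by linarith
    finally have "h\<^sup>2 * (4 * e) \<le> h\<^sup>2 * (2 * e)" by (simp add: e_def algebra_simps)
    then show False using elim(3) e by (simp add: power2_eq_square)
  qed
  then show False by simp
qed

text \<open>The inverse \<open>g\<close> comes with the derivative \<open>g' y\<close>, the inverse
  operator of \<open>f' (g y)\<close>. If \<open>g\<close> is of order k, then so is this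
  expression, hence \<open>g\<close> is of order k + 1.\<close>

lemma smooth_inverse_function:
  fixes f :: "'a::euclidean_space \<Rightarrow> 'a"
  assumes f: "smooth_on U f" and U: "open U" and x: "x \<in> U"
    and inj: "\<And>v. frechet_derivative f (at x) v = 0 \<Longrightarrow> v = 0"
  obtains U' V g where "open U'" "U' \<subseteq> U" "x \<in> U'" "open V" "homeomorphism U' V f g" "smooth_on V g"
    "\<And>y. y \<in> U' \<Longrightarrow> bij (frechet_derivative f (at y))"
proof -
  define f' where "f' = (\<lambda>x. Blinfun (frechet_derivative f (at x)))"
  have f': "blinfun_apply (f' y) = frechet_derivative f (at y)" if "y \<in> U" for y
    using smooth_on_apply_Blinfun_derivative[OF f that] by (simp add: f'_def)
  have sf': "smooth_on U f'" unfolding f'_def by (rule smooth_on_Blinfun_derivative[OF U f])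
  have lin: "linear (frechet_derivative f (at x))" using smooth_on_linear_derivative[OF f x] .
  have "inj (frechet_derivative f (at x))"
    using inj linear_injective_0[OF lin] by blast
  then obtain r where r: "linear r" "r \<circ> frechet_derivative f (at x) = id"
    using linear_injective_left_inverse[OF lin] by blast
  have "Blinfun r o\<^sub>L f' x = id_blinfun"
    using r by (intro blinfun_eqI)
      (simp add: f'[OF x] bounded_linear_Blinfun_apply linear_conv_bounded_linear[symmetric] pointfree_idE)
  then obtain U' V g g' where *: "open U'" "U' \<subseteq> U" "x \<in> U'" "open V" "homeomorphism U' V f g"
    "\<And>y. y \<in> V \<Longrightarrow> (g has_derivative (g' y)) (at y)"
    "\<And>y. y \<in> V \<Longrightarrow> g' y = inv (blinfun_apply (f'(g y)))"
    "\<And>y. y \<in> V \<Longrightarrow> bij (blinfun_apply (f'(g y)))"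
    using inverse_function_theorem[OF U _ smooth_on_continuous[OF sf'] x]
    by (metis f' smooth_on_has_derivative[OF f])
  have gV: "g ` V \<subseteq> U'" using *(5) by (auto simp: homeomorphism_def)
  have bg': "bounded_linear (g' y)" if "y \<in> V" for y using *(6)[OF that] has_derivative_bounded_linear by blast
  have "Ck_on k g V" for k
  proof (induction k)
    case 0 then show ?case using *(5) by (auto simp: homeomorphism_def)
  next
    case (Suc k)
    have 1: "Ck_on k (\<lambda>y. f' (g y)) V"
      by (rule Ck_on_compose[OF \<open>open V\<close> U _ smooth_on_imp_Ck[OF sf'] Suc]) (use gV *(2) in auto)
    have 2: "Ck_on k (\<lambda>y. Blinfun (g' y)) V"
    proof (rule Ck_on_blinfun_inverse[OF \<open>open V\<close> 1])
      fix y assume y: "y \<in> V"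
      note b = *(8)[OF y] and g' = *(7)[OF y]
      have "g' y (f' (g y) v) = v" "f' (g y) (g' y v) = v" for v
        unfolding g' using b by (simp_all add: bij_is_inj bij_is_surj surj_f_inv_f)
      then show "Blinfun (g' y) o\<^sub>L f' (g y) = id_blinfun" "f' (g y) o\<^sub>L Blinfun (g' y) = id_blinfun"
        by (auto intro!: blinfun_eqI simp: bounded_linear_Blinfun_apply bg'[OF y])
    qed
    show ?case
    proof (rule Ck_on_SucI[OF \<open>open V\<close> *(6)])
      show "Ck_on k (\<lambda>y. g' y v) V" for v
        by (rule Ck_on_cong[OF \<open>open V\<close> _ Ck_on_linear[OF \<open>open V\<close> blinfun.bounded_linear_left 2, of v]])
          (simp add: bounded_linear_Blinfun_apply bg')
    qed
  qed
  then have "smooth_on V g" by (simp add: smooth_on_def)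
  moreover have "bij (frechet_derivative f (at y))" if "y \<in> U'" for y
    using *(8)[of "f y"] *(5) that f'[of y] *(2) by (auto simp: homeomorphism_def)
  ultimately show ?thesis using that * by blast
qed

subsection \<open>Smooth dependence of flows on the initial value\<close>

type_synonym 'a path = "real \<Rightarrow>\<^sub>C 'a"

definition path_bil :: "('a::real_normed_vector \<Rightarrow> 'b::real_normed_vector \<Rightarrow> 'c::real_normed_vector) \<Rightarrow>
    'a path \<Rightarrow> 'b path \<Rightarrow> 'c path" where
  "path_bil B f g = Bcontfun (\<lambda>t. B (f t) (g t))"

definition path_lin :: "('a::real_normed_vector \<Rightarrow> 'b::real_normed_vector) \<Rightarrow> 'a path \<Rightarrow> 'b path" where
  "path_lin L f = Bcontfun (\<lambda>t. L (f t))"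

lemma Bcontfun_apply:
  assumes "continuous_on UNIV f" "\<And>t. norm (f t) \<le> b"
  shows "apply_bcontfun (Bcontfun f) = f"
  by (rule Bcontfun_inverse) (use bcontfun_normI[OF assms] in simp)

lemma path_bil_apply:
  assumes "bounded_bilinear B"
  shows "path_bil B f g t = B (f t) (g t)"
proof -
  obtain K where K: "\<And>a b. norm (B a b) \<le> norm a * norm b * K" "K \<ge> 0"
    using bounded_bilinear.nonneg_bounded[OF assms] by blast
  have "norm (B (f t) (g t)) \<le> norm f * norm g * K" for t
    by (rule order_trans[OF K(1)]) (intro mult_right_mono mult_mono norm_bounded K; simp)
  then show ?thesis unfolding path_bil_def
    by (subst Bcontfun_apply) (auto intro!: bounded_bilinear.continuous_on[OF assms])
qed

lemma path_lin_apply: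
  assumes "bounded_linear L"
  shows "path_lin L f t = L (f t)"
proof -
  obtain K where K: "\<And>a. norm (L a) \<le> norm a * K" "K \<ge> 0"
    using bounded_linear.nonneg_bounded[OF assms] by blast
  have "norm (L (f t)) \<le> norm f * K" for t
    by (rule order_trans[OF K(1)]) (intro mult_right_mono norm_bounded K)
  then show ?thesis unfolding path_lin_def
    by (subst Bcontfun_apply) (auto intro!: bounded_linear.continuous_on[OF assms])
qed

lemma bounded_bilinear_path_bil:
  assumes "bounded_bilinear B"
  shows "bounded_bilinear (path_bil B)"
proof -
  interpret B: bounded_bilinear B by fact
  obtain K where K: "\<And>a b. norm (B a b) \<le> norm a * norm b * K" "K \<ge> 0"
    using B.nonneg_bounded by blast
  show ?thesis
  proof
    show "\<exists>K. \<forall>a b. norm (path_bil B a b) \<le> norm a * norm b * K"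
    proof (intro exI allI norm_bound)
      show "norm (path_bil B a b t) \<le> norm a * norm b * K" for a b t
        unfolding path_bil_apply[OF assms]
        by (rule order_trans[OF K(1)]) (intro mult_right_mono mult_mono norm_bounded K; simp)
    qed
  qed (auto intro!: bcontfun_eqI simp: path_bil_apply[OF assms] B.add_left B.add_right B.scaleR_left B.scaleR_right)
qed

lemma bounded_linear_path_lin:
  assumes "bounded_linear L"
  shows "bounded_linear (path_lin L)"
proof -
  interpret L: bounded_linear L by fact
  obtain K where K: "\<And>a. norm (L a) \<le> norm a * K" "K \<ge> 0"
    using L.nonneg_bounded by blast
  show ?thesis
  proof
    show "\<exists>K. \<forall>a. norm (path_lin L a) \<le> norm a * K"
    proof (intro exI allI norm_bound)
      show "norm (path_lin L a t) \<le> norm a * K" for a t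
        unfolding path_lin_apply[OF assms]
        by (rule order_trans[OF K(1)]) (intro mult_right_mono norm_bounded K)
    qed
  qed (auto intro!: bcontfun_eqI simp: path_lin_apply[OF assms] L.add L.scaleR)
qed

lemma bounded_linear_const_bcontfun: "bounded_linear (const_bcontfun :: 'b::real_normed_vector \<Rightarrow> 'b path)"
  by standard (auto intro!: bcontfun_eqI exI[of _ 1] norm_bound)

text \<open>Clipping the time to the unit interval keeps the integral bounded and continuous on the
  whole real line, so that it is again a path, with norm at most that of \<open>f\<close>. Solutions
  of the integral equations below are therefore constant outside the unit interval.\<close>

definition path_int :: "'a::banach path \<Rightarrow> 'a path" where
  "path_int f = Bcontfun (\<lambda>t. integral {0..max 0 (min 1 t)} f)"

lemma path_integrable [simp]: "(f :: 'a::banach path) integrable_on {a..b}"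
  by (rule integrable_continuous_real) simp

lemma norm_integral_path:
  fixes f :: "'a::banach path"
  shows "norm (integral {0..max 0 (min 1 t)} f) \<le> norm f"
proof -
  have "norm (integral {0..max 0 (min 1 t)} f) \<le> norm f * (max 0 (min 1 t) - 0)"
    by (rule integral_bound) (auto intro: norm_bounded)
  also have "\<dots> \<le> norm f * 1" by (intro mult_left_mono) auto
  finally show ?thesis by simp
qed

lemma path_int_apply: "path_int f t = integral {0..max 0 (min 1 t)} f"
proof -
  have "continuous_on UNIV (\<lambda>t. integral {0..max 0 (min 1 t)} f)"
    by (rule continuous_on_compose2[OF indefinite_integral_continuous_1[of f 0 1]])
      (auto intro!: continuous_intros)
  then show ?thesis unfolding path_int_def by (subst Bcontfun_apply) (auto intro: norm_integral_path)
qed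

lemma norm_path_int: "norm (path_int f) \<le> norm f"
  by (rule norm_bound) (simp add: path_int_apply norm_integral_path)

lemma bounded_linear_path_int: "bounded_linear (path_int :: 'a::banach path \<Rightarrow> 'a path)"
proof
  show "\<exists>K. \<forall>x::'a path. norm (path_int x) \<le> norm x * K"
    by (rule exI[of _ 1]) (simp add: norm_path_int)
qed (auto intro!: bcontfun_eqI simp: path_int_apply integral_add)

text \<open>The superposition operator; it yields junk if \<open>F \<circ> y\<close> is not bounded and continuous.\<close>
definition path_map :: "('a::metric_space \<Rightarrow> 'b::metric_space) \<Rightarrow> 'a path \<Rightarrow> 'b path" where
  "path_map F y = Bcontfun (\<lambda>t. F (y t))"

lemma path_map_apply:
  fixes F :: "'a::euclidean_space \<Rightarrow> 'b::real_normed_vector" and y :: "'a path"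
  assumes "continuous_on (cball z0 r) F" "\<And>t. y t \<in> cball z0 r"
  shows "path_map F y t = F (y t)"
proof -
  have "compact (F ` cball z0 r)" by (rule compact_continuous_image[OF assms(1)]) simp
  then obtain b where "\<And>x. x \<in> F ` cball z0 r \<Longrightarrow> norm x \<le> b"
    using compact_imp_bounded bounded_iff by metis
  then have "norm (F (y t)) \<le> b" for t using assms(2) by blast
  moreover have "continuous_on UNIV (\<lambda>t. F (y t))"
    by (rule continuous_on_compose2[OF assms(1)]) (use assms(2) in auto)
  ultimately show ?thesis unfolding path_map_def by (subst Bcontfun_apply) auto
qed

text \<open>Uniform continuity of the derivative on the compact ball makes the linearization error
  uniform in the base point \<open>a\<close>. The estimate runs along the segment from
  \<open>a\<close> to \<open>b\<close>, which stays in the ball by convexity.\<close>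

lemma uniformly_differentiable_on_cball:
  fixes F :: "'a::euclidean_space \<Rightarrow> 'b::real_normed_vector"
  assumes F: "smooth_on U F" and U: "open U" "cball z0 r \<subseteq> U" and e: "0 < e"
  obtains d where "0 < d" "\<And>a b. a \<in> cball z0 r \<Longrightarrow> b \<in> cball z0 r \<Longrightarrow> norm (b - a) < d \<Longrightarrow>
    norm (F b - F a - frechet_derivative F (at a) (b - a)) \<le> e * norm (b - a)"
proof -
  define F' where "F' = (\<lambda>x. Blinfun (frechet_derivative F (at x)))"
  have F': "blinfun_apply (F' x) = frechet_derivative F (at x)" if "x \<in> U" for x
    using smooth_on_apply_Blinfun_derivative[OF F that] by (simp add: F'_def)
  have "continuous_on (cball z0 r) F'"
    using continuous_on_subset[OF smooth_on_continuous[OF smooth_on_Blinfun_derivative[OF U(1) F]] U(2)]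
    by (simp add: F'_def)
  then have "uniformly_continuous_on (cball z0 r) F'" using compact_uniformly_continuous compact_cball by blast
  then obtain d where d: "0 < d" "\<And>x x'. x \<in> cball z0 r \<Longrightarrow> x' \<in> cball z0 r \<Longrightarrow> dist x' x < d \<Longrightarrow> dist (F' x') (F' x) < e"
    using e unfolding uniformly_continuous_on_def by metis
  show ?thesis
  proof (rule that[OF d(1)])
    fix a b assume a: "a \<in> cball z0 r" and b: "b \<in> cball z0 r" and ab: "norm (b - a) < d"
    have seg: "a + t *\<^sub>R (b - a) \<in> closed_segment a b" if "t \<in> {0..1}" for t
      using that by (auto simp: closed_segment_def algebra_simps intro!: exI[of _ t])
    have sub: "closed_segment a b \<subseteq> cball z0 r" using closed_segment_subset[OF a b] by simp
    have "norm (F b - F a - F' a (b - a)) \<le> norm (b - a) * e"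
    proof (rule differentiable_bound_linearization[OF seg])
      show "(F has_derivative F' x) (at x within closed_segment a b)" if "x \<in> closed_segment a b" for x
      proof -
        have "x \<in> U" using that sub U(2) by blast
        then show ?thesis using smooth_on_has_derivative[OF F] F' has_derivative_at_withinI by metis
      qed
      show "onorm (blinfun_apply (F' x) - blinfun_apply (F' a)) \<le> e" if "x \<in> closed_segment a b" for x
      proof -
        have "norm (x - a) \<le> norm (b - a)" using segment_bound(1)[OF that] .
        then have "norm (F' x - F' a) \<le> e" using d(2)[of a x] a that sub ab by (force simp: dist_norm)
        then show ?thesis by (simp add: norm_blinfun.rep_eq minus_blinfun.rep_eq fun_diff_def)
      qed
    qed auto
    then show "norm (F b - F a - frechet_derivative F (at a) (b - a)) \<le> e * norm (b - a)"
      using F'[of a] a U(2) by (auto simp: mult.commute)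
  qed
qed

definition paths_in :: "'a::metric_space set \<Rightarrow> 'a path set" where
  "paths_in C = {y. \<forall>t. apply_bcontfun y t \<in> C}"

text \<open>The linearization of \<open>path_map F\<close> at the path \<open>y\<close>: the
  derivatives of \<open>F\<close> along \<open>y\<close> form a path of operators, which acts
  pointwise on the path of directions. In this form it is bilinear in the operator path and the
  direction.\<close>

definition path_deriv :: "('a::euclidean_space \<Rightarrow> 'b::real_normed_vector) \<Rightarrow> 'a path \<Rightarrow> 'a path \<Rightarrow> 'b path" where
  "path_deriv F y = path_bil blinfun_apply (path_map (\<lambda>x. Blinfun (frechet_derivative F (at x))) y)"

lemma path_deriv_apply:
  fixes F :: "'a::euclidean_space \<Rightarrow> 'b::real_normed_vector"
  assumes F: "smooth_on U F" and U: "open U" "cball z0 r \<subseteq> U" and y: "y \<in> paths_in (cball z0 r)"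
  shows "path_deriv F y w t = frechet_derivative F (at (y t)) (w t)"
proof -
  have c: "continuous_on (cball z0 r) (\<lambda>x. Blinfun (frechet_derivative F (at x)))"
    using continuous_on_subset[OF smooth_on_continuous[OF smooth_on_Blinfun_derivative[OF U(1) F]] U(2)] .
  have yt: "y t \<in> cball z0 r" for t using y by (simp add: paths_in_def)
  show ?thesis
    unfolding path_deriv_def path_bil_apply[OF bounded_bilinear_blinfun_apply] path_map_apply[OF c yt]
    using smooth_on_apply_Blinfun_derivative[OF F subsetD[OF U(2) yt]] by simp
qed

lemma bounded_linear_path_deriv: "bounded_linear (path_deriv F y)"
  unfolding path_deriv_def
  by (rule bounded_bilinear.bounded_linear_right[OF bounded_bilinear_path_bil[OF bounded_bilinear_blinfun_apply]])

text \<open>The linearization estimate is uniform over the ball, so the pointwise errors are bounded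
  in the supremum norm. The derivative is taken within \<open>paths_in (cball z0 r)\<close>, since
  \<open>path_map F\<close> may be junk for paths that leave the domain of \<open>F\<close>.\<close>

lemma path_map_has_derivative:
  fixes F :: "'a::euclidean_space \<Rightarrow> 'b::real_normed_vector"
  assumes F: "smooth_on U F" and U: "open U" "cball z0 r \<subseteq> U" and y: "y \<in> paths_in (cball z0 r)"
  shows "(path_map F has_derivative path_deriv F y) (at y within paths_in (cball z0 r))"
  unfolding has_derivative_within_alt
proof (intro conjI allI impI bounded_linear_path_deriv)
  fix e :: real assume "0 < e"
  then obtain d where d: "0 < d" "\<And>a b. a \<in> cball z0 r \<Longrightarrow> b \<in> cball z0 r \<Longrightarrow> norm (b - a) < d \<Longrightarrow>
    norm (F b - F a - frechet_derivative F (at a) (b - a)) \<le> e * norm (b - a)"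
    using uniformly_differentiable_on_cball[OF F U] by metis
  have cF: "continuous_on (cball z0 r) F" using smooth_on_continuous[OF F] continuous_on_subset U(2) by blast
  show "\<exists>d>0. \<forall>y'\<in>paths_in (cball z0 r). norm (y' - y) < d \<longrightarrow>
      norm (path_map F y' - path_map F y - path_deriv F y (y' - y)) \<le> e * norm (y' - y)"
  proof (intro exI conjI ballI impI norm_bound)
    show "0 < d" by fact
    fix y' t assume y': "y' \<in> paths_in (cball z0 r)" and lt: "norm (y' - y) < d"
    have a: "y t \<in> cball z0 r" "y' t \<in> cball z0 r" for t using y y' by (auto simp: paths_in_def)
    have le: "norm (y' t - y t) \<le> norm (y' - y)" using norm_bounded[of "y' - y" t] by simp
    have "norm (F (y' t) - F (y t) - frechet_derivative F (at (y t)) (y' t - y t)) \<le> e * norm (y' t - y t)"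
      using d(2)[OF a] le lt by simp
    also have "\<dots> \<le> e * norm (y' - y)" using le \<open>0 < e\<close> by simp
    finally show "norm ((path_map F y' - path_map F y - path_deriv F y (y' - y)) t) \<le> e * norm (y' - y)"
      by (simp add: path_map_apply[OF cF a(1)] path_map_apply[OF cF a(2)] path_deriv_apply[OF F U y])
  qed
qed

text \<open>The induction ranges over maps \<open>F\<close> with a fixed value type. The derivative
  of \<open>F\<close> as an operator-valued map would leave this type, so \<open>path_deriv\<close>
  is expanded over \<open>Basis\<close> and the induction hypothesis is applied to the directional
  derivatives of \<open>F\<close>.\<close>

lemma Ck_on_path_map:
  fixes F :: "'a::euclidean_space \<Rightarrow> 'b::real_normed_vector" and y :: "'p::euclidean_space \<Rightarrow> 'a path"
  assumes F: "smooth_on U F" and U: "open U" "cball z0 r \<subseteq> U"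
    and N: "open N" "\<And>z. z \<in> N \<Longrightarrow> y z \<in> paths_in (cball z0 r)" and y: "Ck_on k y N"
  shows "Ck_on k (\<lambda>z. path_map F (y z)) N"
  using F y
proof (induction k arbitrary: F)
  case 0
  have "continuous_on (paths_in (cball z0 r)) (path_map F)"
    using path_map_has_derivative[OF 0(1) U] has_derivative_continuous continuous_on_eq_continuous_within by blast
  then show ?case using 0(2) N(2) continuous_on_compose2[of "paths_in (cball z0 r)" "path_map F" N y] by auto
next
  case (Suc k)
  show ?case
  proof (rule Ck_on_SucI[OF N(1)])
    show "((\<lambda>z. path_map F (y z)) has_derivative (\<lambda>v. path_deriv F (y z) (frechet_derivative y (at z) v))) (at z)"
      if z: "z \<in> N" for z
    proof -
      have "(y has_derivative frechet_derivative y (at z)) (at z within N)"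
        using Suc.prems(2) z by (auto intro!: has_derivative_at_withinI has_frechet_derivative)
      moreover have "(path_map F has_derivative path_deriv F (y z)) (at (y z) within y ` N)"
        using has_derivative_subset[OF path_map_has_derivative[OF Suc.prems(1) U N(2)[OF z]]] N(2) by blast
      ultimately have "((\<lambda>z. path_map F (y z)) has_derivative (\<lambda>v. path_deriv F (y z) (frechet_derivative y (at z) v))) (at z within N)"
        by (rule has_derivative_in_compose)
      then show ?thesis using at_within_open[OF z N(1)] by simp
    qed
    fix v
    let ?g = "\<lambda>z. \<Sum>b\<in>Basis. path_bil (*\<^sub>R) (path_lin (\<lambda>x. x \<bullet> b) (frechet_derivative y (at z) v))
      (path_map (\<lambda>x. frechet_derivative F (at x) b) (y z))"
    show "Ck_on k (\<lambda>z. path_deriv F (y z) (frechet_derivative y (at z) v)) N"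
    proof (rule Ck_on_cong[OF N(1)])
      show "Ck_on k ?g N"
        by (intro Ck_on_sum N(1) Ck_on_bilinear[OF N(1) bounded_bilinear_path_bil[OF bounded_bilinear_scaleR]]
            Ck_on_linear[OF N(1) bounded_linear_path_lin[OF bounded_linear_inner_left]] Suc.IH
            smooth_on_derivative Suc.prems(1) Ck_on_SucD[OF Suc.prems(2)])
          (use Suc.prems(2) in simp)
      show "?g z = path_deriv F (y z) (frechet_derivative y (at z) v)" if z: "z \<in> N" for z
      proof (rule bcontfun_eqI)
        fix t
        define w where "w = frechet_derivative y (at z) v"
        have yt: "y z t \<in> cball z0 r" for t using N(2)[OF z] by (simp add: paths_in_def)
        have c: "continuous_on (cball z0 r) (\<lambda>x. frechet_derivative F (at x) b)" for b
          using smooth_on_continuous[OF smooth_on_derivative[OF Suc.prems(1)]] continuous_on_subset U(2) by blast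
        have l: "linear (frechet_derivative F (at (y z t)))"
          using smooth_on_linear_derivative[OF Suc.prems(1)] yt U(2) by blast
        have "apply_bcontfun (\<Sum>b\<in>B. p b) t = (\<Sum>b\<in>B. p b t)" for B :: "'a set" and p :: "'a \<Rightarrow> 'b path"
          by (induction B rule: infinite_finite_induct) auto
        then have "?g z t = (\<Sum>b\<in>Basis. (w t \<bullet> b) *\<^sub>R frechet_derivative F (at (y z t)) b)"
          by (simp add: path_bil_apply[OF bounded_bilinear_scaleR] path_lin_apply[OF bounded_linear_inner_left]
              path_map_apply[OF c yt] w_def)
        also have "\<dots> = path_deriv F (y z) w t"
          unfolding path_deriv_apply[OF Suc.prems(1) U N(2)[OF z]] by (rule linear_sum_Basis[OF l, symmetric])
        finally show "?g z t = path_deriv F (y z) (frechet_derivative y (at z) v) t" by (simp add: w_def)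
      qed
    qed
  qed
qed

text \<open>Instead of summing a series, \<open>R h\<close> is taken as the fixed point of the
  contraction sending \<open>w\<close> to \<open>h + A w\<close>. Uniqueness of fixed points yields
  linearity and \<open>R (w - A w) = w\<close>; the norm bound 1/2 for \<open>A\<close> gives the
  factor 2.\<close>

lemma neumann_inverse:
  fixes A :: "'e::{real_normed_vector,complete_space} \<Rightarrow>\<^sub>L 'e"
  assumes "norm A \<le> 1/2"
  obtains R where "R o\<^sub>L (id_blinfun - A) = id_blinfun" "(id_blinfun - A) o\<^sub>L R = id_blinfun"
    "\<And>h. norm (R h) \<le> 2 * norm h"
proof -
  have nA: "norm (A w) \<le> norm w / 2" for w
    using order_trans[OF norm_blinfun[of A w] mult_right_mono[OF assms norm_ge_zero]] by simp
  have "\<exists>!w. h + A w = w" for h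
  proof (rule banach_fix_type[of "1/2"])
    show "\<forall>x y. dist (h + A x) (h + A y) \<le> 1 / 2 * dist x y"
      using nA by (simp add: dist_norm flip: blinfun.diff_right)
  qed auto
  then obtain R where R: "\<And>h. h + A (R h) = R h" and uniq: "\<And>h w. h + A w = w \<Longrightarrow> w = R h" by metis
  have b: "norm (R h) \<le> 2 * norm h" for h
  proof -
    have "norm (R h) \<le> norm h + norm (A (R h))" using norm_triangle_ineq[of h "A (R h)"] R[of h] by simp
    then show ?thesis using nA[of "R h"] by simp
  qed
  have bl: "bounded_linear R"
  proof
    show "R (x + y) = R x + R y" for x y
    proof (rule uniq[symmetric])
      have "(x + A (R x)) + (y + A (R y)) = R x + R y" by (simp only: R)
      then show "x + y + A (R x + R y) = R x + R y" by (simp add: blinfun.add_right add_ac)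
    qed
    show "R (c *\<^sub>R x) = c *\<^sub>R R x" for c x
      by (rule uniq[symmetric]) (simp add: blinfun.scaleR_right R flip: scaleR_add_right)
    show "\<exists>K. \<forall>x. norm (R x) \<le> norm x * K" using b by (auto intro!: exI[of _ 2] simp: mult.commute)
  qed
  show ?thesis
  proof (rule that[of "Blinfun R"])
    have 1: "R (w - A w) = w" for w by (rule uniq[symmetric]) simp
    have 2: "R h - A (R h) = h" for h using R[of h] by (simp add: algebra_simps)
    show "Blinfun R o\<^sub>L (id_blinfun - A) = id_blinfun" "(id_blinfun - A) o\<^sub>L Blinfun R = id_blinfun"
      by (auto intro!: blinfun_eqI simp: bounded_linear_Blinfun_apply[OF bl] blinfun.diff_left 1 2)
    show "norm (Blinfun R h) \<le> 2 * norm h" for h by (simp add: bounded_linear_Blinfun_apply[OF bl] b)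
  qed
qed

text \<open>The integral equation of the flow up to time 1 is a fixed point equation on paths, a
  contraction with factor 1/2 by \<open>lip\<close>. Its linearization is invertible by the same
  bound; this gives the derivative in the initial value, and the formula for it raises the
  regularity step by step. The last two conclusions characterize the derivative as the only solution
  of the linearized equation, which is how explicit formulas for it are verified later.\<close>

lemma smooth_flow:
  fixes F :: "'a::euclidean_space \<Rightarrow> 'a"
  assumes F: "smooth_on U F" and U: "open U" "cball z0 r \<subseteq> U" and r: "0 < r" and F0: "F z0 = 0"
    and lip: "\<And>x v. x \<in> cball z0 r \<Longrightarrow> norm (frechet_derivative F (at x) v) \<le> norm v / 2"
  obtains y :: "'a \<Rightarrow> 'a path" where "smooth_on (ball z0 (r/2)) y"
    "\<And>z. z \<in> ball z0 (r/2) \<Longrightarrow> y z \<in> paths_in (cball z0 r)"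
    "\<And>z. z \<in> ball z0 (r/2) \<Longrightarrow> y z = const_bcontfun z + path_int (path_map F (y z))"
    "\<And>z v. z \<in> ball z0 (r/2) \<Longrightarrow> frechet_derivative y (at z) v =
       const_bcontfun v + path_int (path_deriv F (y z) (frechet_derivative y (at z) v))"
    "\<And>z w. z \<in> ball z0 (r/2) \<Longrightarrow> w = path_int (path_deriv F (y z) w) \<Longrightarrow> w = 0"
proof -
  let ?C = "cball z0 r" and ?N = "ball z0 (r/2)"
  let ?S = "paths_in ?C"
  have cF: "continuous_on ?C F" using smooth_on_continuous[OF F] continuous_on_subset U(2) by blast
  have inS: "p t \<in> ?C" if "p \<in> ?S" for p :: "'a path" and t using that by (simp add: paths_in_def)
  have Flip: "norm (F a - F b) \<le> norm (a - b) / 2" if "a \<in> ?C" "b \<in> ?C" for a b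
  proof -
    have "norm (F a - F b) \<le> 1/2 * norm (a - b)"
    proof (rule differentiable_bound[where S = ?C and f' = "\<lambda>x. frechet_derivative F (at x)"])
      show "(F has_derivative frechet_derivative F (at x)) (at x within ?C)" if "x \<in> ?C" for x
        by (rule has_derivative_at_withinI[OF smooth_on_has_derivative[OF F subsetD[OF U(2) that]]])
      show "onorm (frechet_derivative F (at x)) \<le> 1/2" if "x \<in> ?C" for x
        using lip[OF that] by (intro onorm_bound) (auto simp: field_simps)
    qed (use that in auto)
    then show ?thesis by simp
  qed
  have nA: "norm (path_int (path_deriv F p w)) \<le> norm w / 2" if "p \<in> ?S" for p w
  proof (rule order_trans[OF norm_path_int norm_bound])
    show "norm (path_deriv F p w t) \<le> norm w / 2" for t
      unfolding path_deriv_apply[OF F U that]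
      using lip[OF inS[OF that], of t "w t"] norm_bounded[of w t] by simp
  qed
  have diffS: "norm (path_int (path_map F p) - path_int (path_map F q)) \<le> norm (p - q) / 2"
    if "p \<in> ?S" "q \<in> ?S" for p q
  proof -
    have "path_int (path_map F p) - path_int (path_map F q) = path_int (path_map F p - path_map F q)"
      by (rule linear_diff[OF bounded_linear.linear[OF bounded_linear_path_int], symmetric])
    also have "norm \<dots> \<le> norm (p - q) / 2"
    proof (rule order_trans[OF norm_path_int norm_bound])
      fix t
      have "norm (F (p t) - F (q t)) \<le> norm (p t - q t) / 2" using Flip inS that by blast
      also have "\<dots> \<le> norm (p - q) / 2" using norm_bounded[of "p - q" t] by simp
      finally show "norm ((path_map F p - path_map F q) t) \<le> norm (p - q) / 2"
        by (simp add: path_map_apply[OF cF inS[OF that(1)]] path_map_apply[OF cF inS[OF that(2)]])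
    qed
    finally show ?thesis .
  qed
  \<comment> \<open>Initial values in the half ball and \<open>F z0 = 0\<close> keep the paths in
    the ball: the integral term vanishes at the constant path \<open>z0\<close>, so its norm is at
    most r / 2 everywhere.\<close>
  have "\<exists>!p\<in>?S. const_bcontfun z + path_int (path_map F p) = p" if z: "z \<in> ?N" for z
  proof (rule Banach_fix[of _ "1/2"])
    have "?S = PiC UNIV (\<lambda>_. ?C)" by (auto simp: paths_in_def mem_PiC_iff Pi_iff)
    then show "complete ?S" by (simp add: complete_eq_closed closed_PiC)
    have c0: "const_bcontfun z0 \<in> ?S" using r by (simp add: paths_in_def)
    then show "?S \<noteq> {}" by blast
    show "dist (const_bcontfun z + path_int (path_map F p)) (const_bcontfun z + path_int (path_map F q)) \<le> 1 / 2 * dist p q"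
      if "p \<in> ?S" "q \<in> ?S" for p q using diffS[OF that] by (simp add: dist_norm)
    have "const_bcontfun z + path_int (path_map F p) \<in> ?S" if p: "p \<in> ?S" for p
    proof -
      have 0: "path_int (path_map F (const_bcontfun z0)) = 0"
      proof -
        have "path_map F (const_bcontfun z0) = 0"
          using r F0 by (intro bcontfun_eqI) (simp add: path_map_apply[OF cF])
        then show ?thesis by (simp add: linear_0[OF bounded_linear.linear[OF bounded_linear_path_int]])
      qed
      have "norm (p - const_bcontfun z0) \<le> r"
        using inS[OF p] by (intro norm_bound) (simp add: dist_norm norm_minus_commute)
      then have b: "norm (path_int (path_map F p)) \<le> r / 2" using diffS[OF p c0] 0 by simp
      have "norm (z + path_int (path_map F p) t - z0) \<le> r" for t
      proof -
        have "norm (z - z0) \<le> r / 2" using z by (simp add: dist_norm norm_minus_commute)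
        then show ?thesis using norm_triangle_ineq[of "z - z0" "path_int (path_map F p) t"]
            norm_bounded[of "path_int (path_map F p)" t] b by (simp add: algebra_simps)
      qed
      then show ?thesis by (simp add: paths_in_def dist_norm norm_minus_commute)
    qed
    then show "(\<lambda>p. const_bcontfun z + path_int (path_map F p)) ` ?S \<subseteq> ?S" by blast
  qed auto
  then obtain y where yS: "\<And>z. z \<in> ?N \<Longrightarrow> y z \<in> ?S"
    and y: "\<And>z. z \<in> ?N \<Longrightarrow> const_bcontfun z + path_int (path_map F (y z)) = y z" by metis
  define A where "A z = Blinfun (\<lambda>w. path_int (path_deriv F (y z) w))" for z
  have A: "blinfun_apply (A z) w = path_int (path_deriv F (y z) w)" for z w
    unfolding A_def by (subst bounded_linear_Blinfun_apply)
      (auto intro!: bounded_linear_compose[OF bounded_linear_path_int bounded_linear_path_deriv])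
  have nAz: "norm (A z) \<le> 1/2" if "z \<in> ?N" for z
    using nA[OF yS[OF that]] by (intro norm_blinfun_bound) (auto simp: A mult.commute)
  have "\<exists>R. R o\<^sub>L (id_blinfun - A z) = id_blinfun \<and> (id_blinfun - A z) o\<^sub>L R = id_blinfun \<and> (\<forall>h. norm (R h) \<le> 2 * norm h)"
    if "z \<in> ?N" for z using neumann_inverse[OF nAz[OF that]] by metis
  then obtain R where R: "\<And>z. z \<in> ?N \<Longrightarrow> R z o\<^sub>L (id_blinfun - A z) = id_blinfun"
    "\<And>z. z \<in> ?N \<Longrightarrow> (id_blinfun - A z) o\<^sub>L R z = id_blinfun" "\<And>z h. z \<in> ?N \<Longrightarrow> norm (R z h) \<le> 2 * norm h"
    by metis
  have R1: "R z (w - A z w) = w" and R2: "R z w - A z (R z w) = w" if "z \<in> ?N" for z w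
    using R(1,2)[OF that, THEN arg_cong[where f = "\<lambda>B. blinfun_apply B w"]]
    by (simp_all add: blinfun.diff_left)
  have dy: "(y has_derivative (\<lambda>v. R z (const_bcontfun v))) (at z)" if z: "z \<in> ?N" for z
  proof -
    have lips: "norm (y z' - y z) \<le> 2 * norm (z' - z)" if z': "z' \<in> ?N" for z'
    proof -
      have "y z' - y z = const_bcontfun (z' - z) + (path_int (path_map F (y z')) - path_int (path_map F (y z)))"
        by (subst y[OF z', symmetric], subst y[OF z, symmetric]) (auto intro: bcontfun_eqI)
      then have "norm (y z' - y z) \<le> norm (const_bcontfun (z' - z) :: 'a path) + norm (y z' - y z) / 2"
        using norm_triangle_ineq[of "const_bcontfun (z' - z)"
            "path_int (path_map F (y z')) - path_int (path_map F (y z))"] diffS[OF yS[OF z'] yS[OF z]] by simp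
      moreover have "norm (const_bcontfun (z' - z) :: 'a path) \<le> norm (z' - z)" by (rule norm_bound) simp
      ultimately show ?thesis by simp
    qed
    have "(y has_derivative (\<lambda>v. R z (const_bcontfun v))) (at z within ?N)"
      unfolding has_derivative_within_alt
    proof (intro conjI allI impI)
      show "bounded_linear (\<lambda>v. R z (const_bcontfun v))"
        by (rule bounded_linear_compose[OF blinfun.bounded_linear_right bounded_linear_const_bcontfun])
      fix e :: real assume e: "0 < e"
      \<comment> \<open>The quarter absorbs two factors 2: the bound for \<open>R z\<close> and the
        Lipschitz constant of \<open>y\<close>.\<close>
      obtain d where d: "d > 0" "\<And>p. p \<in> ?S \<Longrightarrow> norm (p - y z) < d \<Longrightarrow>
          norm (path_map F p - path_map F (y z) - path_deriv F (y z) (p - y z)) \<le> e / 4 * norm (p - y z)"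
        using path_map_has_derivative[OF F U yS[OF z]] e unfolding has_derivative_within_alt
        by (metis divide_pos_pos zero_less_numeral)
      show "\<exists>d>0. \<forall>z'\<in>?N. norm (z' - z) < d \<longrightarrow>
        norm (y z' - y z - R z (const_bcontfun (z' - z))) \<le> e * norm (z' - z)"
      proof (intro exI conjI ballI impI)
        show "d / 2 > 0" using d by simp
        fix z' assume z': "z' \<in> ?N" and lt: "norm (z' - z) < d / 2"
        define E where "E = y z' - y z - R z (const_bcontfun (z' - z))"
        define Q where "Q = path_map F (y z') - path_map F (y z) - path_deriv F (y z) (y z' - y z)"
        have li: "linear (path_int :: 'a path \<Rightarrow> 'a path)" using bounded_linear.linear[OF bounded_linear_path_int] .
        \<comment> \<open>The error \<open>E\<close> of the candidate derivative solves the
          linearized equation with the integrated Taylor remainder \<open>path_int Q\<close> as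
          right-hand side.\<close>
        have "E - A z E = (y z' - y z) - A z (y z' - y z) - const_bcontfun (z' - z)"
          using R2[OF z, of "const_bcontfun (z' - z)"] by (simp add: E_def blinfun.diff_right blinfun.add_right algebra_simps)
        also have "\<dots> = path_int Q"
        proof -
          have "y z' - y z - const_bcontfun (z' - z) = path_int (path_map F (y z')) - path_int (path_map F (y z))"
            by (subst y[OF z', symmetric], subst y[OF z, symmetric]) (auto intro: bcontfun_eqI)
          then show ?thesis unfolding A Q_def linear_diff[OF li] by (simp add: algebra_simps)
        qed
        finally have "E = R z (path_int Q)" using R1[OF z, of E] by simp
        then have "norm E \<le> 2 * norm Q"
          using R(3)[OF z, of "path_int Q"] norm_path_int[of Q] by simp
        also have "norm Q \<le> e / 4 * norm (y z' - y z)"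
          unfolding Q_def using d(2)[OF yS[OF z']] lips[OF z'] lt by simp
        also have "\<dots> \<le> e / 4 * (2 * norm (z' - z))" using lips[OF z'] e by (intro mult_left_mono) auto
        finally show "norm (y z' - y z - R z (const_bcontfun (z' - z))) \<le> e * norm (z' - z)"
          by (simp add: E_def)
      qed
    qed
    then show ?thesis using at_within_open[OF z] by simp
  qed
  have "Ck_on k y ?N" for k
  proof (induction k)
    case 0
    show ?case unfolding Ck_on.simps
      by (intro continuous_at_imp_continuous_on ballI) (rule has_derivative_continuous[OF dy])
  next
    case (Suc k)
    let ?F' = "\<lambda>x. Blinfun (frechet_derivative F (at x))"
    \<comment> \<open>\<open>M\<close> turns a path of operators into the operator on paths that
      applies it pointwise and integrates. As \<open>M\<close> is bounded linear and
      \<open>A\<close> is \<open>M\<close> after a superposition operator along \<open>y\<close>,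
      the family \<open>A\<close> inherits the regularity of \<open>y\<close>.\<close>
    define M where "M p = (Blinfun (\<lambda>w. path_int (path_bil blinfun_apply p w)) :: 'a path \<Rightarrow>\<^sub>L 'a path)" for p :: "('a \<Rightarrow>\<^sub>L 'a) path"
    have bb: "bounded_bilinear (path_bil blinfun_apply :: ('a \<Rightarrow>\<^sub>L 'a) path \<Rightarrow> 'a path \<Rightarrow> 'a path)"
      by (rule bounded_bilinear_path_bil[OF bounded_bilinear_blinfun_apply])
    have M: "blinfun_apply (M p) w = path_int (path_bil blinfun_apply p w)" for p w
      unfolding M_def by (subst bounded_linear_Blinfun_apply)
        (auto intro!: bounded_linear_compose[OF bounded_linear_path_int bounded_bilinear.bounded_linear_right[OF bb]])
    have li: "linear (path_int :: 'a path \<Rightarrow> 'a path)" using bounded_linear.linear[OF bounded_linear_path_int] .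
    have blM: "bounded_linear M"
    proof
      show "M (a + b) = M a + M b" for a b
        by (intro blinfun_eqI) (simp add: M blinfun.add_left bounded_bilinear.add_left[OF bb] linear_add[OF li])
      show "M (c *\<^sub>R a) = c *\<^sub>R M a" for a c
        by (intro blinfun_eqI) (simp add: M blinfun.scaleR_left bounded_bilinear.scaleR_left[OF bb] linear_scale[OF li])
      obtain K where K: "K \<ge> 0" "\<And>a b. norm (path_bil blinfun_apply a b :: 'a path) \<le> norm (a :: ('a \<Rightarrow>\<^sub>L 'a) path) * norm b * K"
        using bounded_bilinear.nonneg_bounded[OF bb] by blast
      show "\<exists>K. \<forall>x. norm (M x) \<le> norm x * K"
      proof (intro exI allI norm_blinfun_bound)
        show "0 \<le> norm x * K" for x :: "('a \<Rightarrow>\<^sub>L 'a) path" using K(1) by simp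
        show "norm (M x w) \<le> norm x * K * norm w" for x w
          unfolding M using order_trans[OF norm_path_int K(2)] by (simp add: algebra_simps)
      qed
    qed
    have "A = (\<lambda>z. M (path_map ?F' (y z)))"
      by (intro ext blinfun_eqI) (simp add: A M path_deriv_def)
    moreover have "Ck_on k (\<lambda>z. M (path_map ?F' (y z))) ?N"
      by (intro Ck_on_linear[OF open_ball blM] Ck_on_path_map[OF smooth_on_Blinfun_derivative[OF U(1) F] U open_ball yS] Suc)
    ultimately have "Ck_on k A ?N" by simp
    then have "Ck_on k (\<lambda>z. id_blinfun - A z) ?N"
      using Ck_on_add[OF open_ball Ck_on_const Ck_on_linear[OF open_ball bounded_linear_minus[OF bounded_linear_ident]]]
      by simp
    then have "Ck_on k R ?N" by (rule Ck_on_blinfun_inverse[OF open_ball _ R(1,2)])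
    then have "Ck_on k (\<lambda>z. R z (const_bcontfun v)) ?N" for v
      by (rule Ck_on_linear[OF open_ball blinfun.bounded_linear_left])
    with dy show ?case by (rule Ck_on_SucI[OF open_ball])
  qed
  then have "smooth_on ?N y" by (simp add: smooth_on_def)
  moreover have "frechet_derivative y (at z) v = const_bcontfun v + path_int (path_deriv F (y z) (frechet_derivative y (at z) v))"
    if z: "z \<in> ?N" for z v
    using R2[OF z, of "const_bcontfun v"] frechet_derivative_eq[OF dy[OF z]] by (simp add: A algebra_simps)
  moreover have "w = 0" if "z \<in> ?N" "w = path_int (path_deriv F (y z) w)" for z w
    using nA[OF yS[OF that(1)], of w] that(2) by simp
  ultimately show ?thesis using that yS y by metis
qed

subsection \<open>The Frobenius theorem\<close>

text \<open>The graph form: the total differential equation \<open>dY(\<xi>) = B(Y) d\<xi>\<close> is solved along the rays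
  \<open>t \<mapsto> t \<xi>\<close>, i.e. by the flow of \<open>(\<xi>, y) \<mapsto> (0, B(y) \<xi>)\<close>; involutivity makes the solution along the
  rays a solution in all directions.\<close>

lemma frobenius_graph:
  fixes B :: "'e::euclidean_space \<Rightarrow> 'e \<Rightarrow> 'e" and P :: "'e \<Rightarrow> 'e"
  assumes U: "open U" "x0 \<in> U" and P: "linear P" "\<And>v. P (P v) = P v"
    and B: "\<And>x. x \<in> U \<Longrightarrow> linear (B x)" "\<And>v. smooth_on U (\<lambda>x. B x v)"
    and PB: "\<And>x v. x \<in> U \<Longrightarrow> P (B x v) = P v" "\<And>x v. x \<in> U \<Longrightarrow> B x (P v) = B x v"
    and inv: "\<And>x k l. x \<in> U \<Longrightarrow> frechet_derivative (\<lambda>y. B y l) (at x) (B x k) =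
       frechet_derivative (\<lambda>y. B y k) (at x) (B x l)"
  obtains V u where "open V" "x0 \<in> V" "V \<subseteq> U" "smooth_on V (u :: 'e \<Rightarrow> 'e)"
    "\<And>x v. x \<in> V \<Longrightarrow> frechet_derivative u (at x) v = 0 \<longleftrightarrow> v \<in> range (B x)"
proof -
  define \<B> where "\<B> = (\<lambda>x. Blinfun (B x))"
  have \<B>: "blinfun_apply (\<B> x) = B x" if "x \<in> U" for x
    using B(1)[OF that] by (simp add: \<B>_def bounded_linear_Blinfun_apply linear_conv_bounded_linear)
  have s\<B>: "smooth_on U \<B>" unfolding \<B>_def by (rule smooth_on_Blinfun[OF U(1) B])
  define B' where "B' x b = frechet_derivative \<B> (at x) b" for x b
  have d\<B>: "(\<B> has_derivative B' x) (at x)" if "x \<in> U" for x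
    using smooth_on_has_derivative[OF s\<B> that] by (simp add: B'_def[abs_def])
  have dB: "((\<lambda>y. B y k) has_derivative (\<lambda>b. B' x b k)) (at x)" if "x \<in> U" for x k
  proof (rule has_derivative_transform_within_open[OF _ U(1) that])
    show "((\<lambda>y. \<B> y k) has_derivative (\<lambda>b. B' x b k)) (at x)"
      by (rule bounded_linear.has_derivative[OF blinfun.bounded_linear_left d\<B>[OF that]])
  qed (simp add: \<B>)
  have inv': "B' x (B x k) l = B' x (B x l) k" if "x \<in> U" for x k l
    using inv[OF that, of l k] unfolding frechet_derivative_eq[OF dB[OF that]] by simp
  define O2 :: "('e \<times> 'e) set" where "O2 = UNIV \<times> U"
  have O2: "open O2" unfolding O2_def by (rule open_Times[OF open_UNIV U(1)])
  define G where "G z = ((0::'e), \<B> (snd z) (fst z))" for z :: "'e \<times> 'e"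
  have sB2: "smooth_on O2 (\<lambda>z. \<B> (snd z))"
    by (rule smooth_on_compose[OF O2 U(1) _ s\<B> smooth_on_linear[OF O2 bounded_linear_snd smooth_on_ident[OF O2]]])
      (auto simp: O2_def)
  have sG: "smooth_on O2 G" unfolding G_def
    by (intro smooth_on_Pair O2 smooth_on_const smooth_on_bilinear[OF O2 bounded_bilinear_blinfun_apply sB2]
        smooth_on_linear[OF O2 bounded_linear_fst smooth_on_ident[OF O2]])
  define z0 where "z0 = ((0::'e), x0)"
  have "z0 \<in> O2" using U by (simp add: O2_def z0_def)
  then obtain r where r: "r > 0" "cball z0 r \<subseteq> O2" using O2 open_contains_cball by metis
  let ?G' = "\<lambda>z. Blinfun (frechet_derivative G (at z))"
  have "compact (?G' ` cball z0 r)"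
    by (rule compact_continuous_image[OF continuous_on_subset[OF smooth_on_continuous r(2)] compact_cball])
      (rule smooth_on_Blinfun_derivative[OF O2 sG])
  from compact_imp_bounded[OF this] obtain M where M: "M > 0" "\<And>z. z \<in> cball z0 r \<Longrightarrow> norm (?G' z) \<le> M"
    unfolding bounded_pos by (elim exE conjE) (rule that, auto)
  \<comment> \<open>Slowing the field down by this factor brings its Lipschitz constant on the ball
    to 1/2, as required for solving up to time 1.\<close>
  define \<epsilon> where "\<epsilon> = 1 / (2 * M)"
  have eps: "\<epsilon> > 0" using M by (simp add: \<epsilon>_def)
  define F where "F z = \<epsilon> *\<^sub>R G z" for z
  have sF: "smooth_on O2 F" unfolding F_def
    by (rule smooth_on_linear[OF O2 bounded_linear_scaleR_right sG])
  have dG: "(G has_derivative (\<lambda>(a, b). (0, B y a + B' y b \<xi>))) (at (\<xi>, y))" if "y \<in> U" for \<xi> y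
  proof -
    have d2: "((\<lambda>z. \<B> (snd z)) has_derivative (\<lambda>w. B' y (snd w))) (at (\<xi>, y))"
    proof (rule has_derivative_compose[where f = snd and g = \<B> and f' = snd and g' = "B' y"])
      show "(snd has_derivative snd) (at (\<xi>, y))" by (rule bounded_linear_imp_has_derivative[OF bounded_linear_snd])
      show "(\<B> has_derivative B' y) (at (snd (\<xi>, y)))" using d\<B>[OF that] by simp
    qed
    have d1: "(fst has_derivative fst) (at (\<xi>, y))"
      by (rule bounded_linear_imp_has_derivative[OF bounded_linear_fst])
    have "(G has_derivative (\<lambda>w. (0, \<B> y (fst w) + B' y (snd w) \<xi>))) (at (\<xi>, y))"
      unfolding G_def
      using has_derivative_Pair[OF has_derivative_const bounded_bilinear.FDERIV[OF bounded_bilinear_blinfun_apply d2 d1]]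
      by simp
    then show ?thesis using \<B>[OF that] by (simp add: case_prod_unfold)
  qed
  have dF: "frechet_derivative F (at (\<xi>, y)) (a, b) = (0, \<epsilon> *\<^sub>R (B y a + B' y b \<xi>))" if "y \<in> U" for \<xi> y a b
  proof -
    have "(F has_derivative (\<lambda>w. \<epsilon> *\<^sub>R (case w of (a, b) \<Rightarrow> (0, B y a + B' y b \<xi>)))) (at (\<xi>, y))"
      unfolding F_def by (rule bounded_linear.has_derivative[OF bounded_linear_scaleR_right dG[OF that]])
    then show ?thesis by (simp add: frechet_derivative_eq)
  qed
  have lip: "norm (frechet_derivative F (at z) v) \<le> norm v / 2" if z: "z \<in> cball z0 r" for z v
  proof -
    have "z \<in> O2" using z r by blast
    have "(F has_derivative (\<lambda>v. \<epsilon> *\<^sub>R frechet_derivative G (at z) v)) (at z)"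
      unfolding F_def
      by (rule bounded_linear.has_derivative[OF bounded_linear_scaleR_right smooth_on_has_derivative[OF sG \<open>z \<in> O2\<close>]])
    then have "frechet_derivative F (at z) v = \<epsilon> *\<^sub>R ?G' z v"
      using smooth_on_apply_Blinfun_derivative[OF sG \<open>z \<in> O2\<close>] by (simp add: frechet_derivative_eq)
    then have "norm (frechet_derivative F (at z) v) \<le> \<epsilon> * (norm (?G' z) * norm v)"
      using norm_blinfun[of "?G' z" v] eps by (simp add: mult_left_mono)
    also have "\<dots> \<le> \<epsilon> * (M * norm v)" using M(2)[OF z] eps by (intro mult_left_mono mult_right_mono) auto
    also have "\<dots> = norm v / 2" using M(1) by (simp add: \<epsilon>_def)
    finally show ?thesis .
  qed
  have B0: "B x 0 = 0" if "x \<in> U" for x using B(1)[OF that] by (rule linear_0)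
  have Feq: "F (\<xi>, y) = (0, \<epsilon> *\<^sub>R B y \<xi>)" if "y \<in> U" for \<xi> y using \<B>[OF that] by (simp add: F_def G_def)
  have F0: "F z0 = 0" using U(2) B0 by (simp add: z0_def Feq zero_prod_def)
  define N where "N = ball z0 (r/2)"
  obtain y where sy: "smooth_on N y" and yin: "\<And>z. z \<in> N \<Longrightarrow> y z \<in> paths_in (cball z0 r)"
    and yeq: "\<And>z. z \<in> N \<Longrightarrow> y z = const_bcontfun z + path_int (path_map F (y z))"
    and Dy: "\<And>z v. z \<in> N \<Longrightarrow> frechet_derivative y (at z) v =
       const_bcontfun v + path_int (path_deriv F (y z) (frechet_derivative y (at z) v))"
    and yuniq: "\<And>z w. z \<in> N \<Longrightarrow> w = path_int (path_deriv F (y z) w) \<Longrightarrow> w = 0"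
    using smooth_flow[OF sF O2 r(2,1) F0 lip] unfolding N_def by metis
  have N: "open N" "z0 \<in> N" using r(1) by (auto simp: N_def)
  have cF: "continuous_on (cball z0 r) F"
    using smooth_on_continuous[OF sF] continuous_on_subset r(2) by blast
  have yC: "y z t \<in> cball z0 r" if "z \<in> N" for z t using yin[OF that] by (simp add: paths_in_def)
  have Y: "snd (y z t) \<in> U" if "z \<in> N" for z t
    using yC[OF that, of t] r(2) unfolding O2_def by (auto simp: mem_Times_iff)
  have Fy: "F (y z t) = (0, \<epsilon> *\<^sub>R B (snd (y z t)) (fst (y z t)))" if "z \<in> N" for z t
    using Feq[OF Y[OF that, of t], of "fst (y z t)"] by simp
  have li: "linear (path_int :: ('e \<times> 'e) path \<Rightarrow> ('e \<times> 'e) path)"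
    using bounded_linear.linear[OF bounded_linear_path_int] .
  have lin_int: "L (integral {a..b} p) = integral {a..b} (\<lambda>s. L (p s))" if "bounded_linear L"
    for L :: "'e \<times> 'e \<Rightarrow> 'e" and p :: "('e \<times> 'e) path" and a b
    using integral_linear[OF path_integrable that] by (simp add: o_def)
  have yt: "y z t = z + integral {0..max 0 (min 1 t)} (path_map F (y z))" if "z \<in> N" for z t
    by (subst yeq[OF that]) (simp add: path_int_apply)
  have fsty: "fst (y z t) = fst z" if "z \<in> N" for z t
    unfolding yt[OF that, of t] fst_add lin_int[OF bounded_linear_fst]
    by (simp add: path_map_apply[OF cF yC[OF that]] Fy[OF that])
  have Fy': "F (y z t) = (0, \<epsilon> *\<^sub>R B (snd (y z t)) (fst z))" if "z \<in> N" for z t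
    unfolding Fy[OF that] fsty[OF that] ..
  \<comment> \<open>The difference of two solutions of the linearized equation solves the
    homogeneous one, hence vanishes.\<close>
  have uniq: "frechet_derivative y (at z) v = V"
    if z: "z \<in> N" and V: "V = const_bcontfun v + path_int (path_deriv F (y z) V)" for z v V
  proof -
    let ?W = "frechet_derivative y (at z) v"
    have "?W - V = path_int (path_deriv F (y z) ?W) - path_int (path_deriv F (y z) V)"
      by (subst Dy[OF z], subst V) simp
    also have "\<dots> = path_int (path_deriv F (y z) (?W - V))"
      by (simp add: linear_diff[OF li] linear_diff[OF bounded_linear.linear[OF bounded_linear_path_deriv]])
    finally show ?thesis using yuniq[OF z] by (metis eq_iff_diff_eq_0)
  qed
  have bl_eval: "bounded_linear (\<lambda>p. snd (apply_bcontfun (p :: ('e \<times> 'e) path) t))" for t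
  proof (rule bounded_linear_compose[OF bounded_linear_snd])
    show "bounded_linear (\<lambda>p. apply_bcontfun (p :: ('e \<times> 'e) path) t)"
      by standard (auto intro!: exI[of _ 1] norm_bounded)
  qed
  define \<Phi> where "\<Phi> z = snd (y z 1)" for z
  have s\<Phi>: "smooth_on N \<Phi>" unfolding \<Phi>_def by (rule smooth_on_linear[OF N(1) bl_eval sy])
  have D\<Phi>: "frechet_derivative \<Phi> (at z) v = snd (frechet_derivative y (at z) v 1)" if "z \<in> N" for z v
    unfolding \<Phi>_def
    by (subst frechet_derivative_eq[OF bounded_linear.has_derivative[OF bl_eval smooth_on_has_derivative[OF sy that]]]) simp
  \<comment> \<open>The heart of the argument: the variation of the solution with respect to the ray
    direction is guessed as the path \<open>V\<close>, whose second component is \<open>B\<close>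
    applied to \<open>k\<close>, scaled by time and \<epsilon>. Involutivity makes \<open>V\<close>
    satisfy the linearized equation.\<close>
  have D\<Phi>1: "frechet_derivative \<Phi> (at z) (k, 0) = \<epsilon> *\<^sub>R B (\<Phi> z) k" if z: "z \<in> N" for z k
  proof -
    let ?c = "\<lambda>t::real. max 0 (min 1 t)"
    define c where "c = (Bcontfun ?c :: real path)"
    have c: "apply_bcontfun c = ?c" unfolding c_def
      by (rule Bcontfun_apply[where b = 1]) (auto intro!: continuous_intros)
    let ?Bk = "\<lambda>w. \<B> (snd w) k"
    have cBk: "continuous_on (cball z0 r) ?Bk"
      using smooth_on_continuous[OF smooth_on_linear[OF O2 blinfun.bounded_linear_left sB2]] continuous_on_subset r(2) by blast
    have bl0: "bounded_linear (\<lambda>w::'e. (0::'e, \<epsilon> *\<^sub>R w))"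
      by (intro bounded_linear_Pair bounded_linear_zero bounded_linear_scaleR_right)
    define V where "V = const_bcontfun (k, 0) + path_lin (\<lambda>w. (0, \<epsilon> *\<^sub>R w)) (path_bil (*\<^sub>R) c (path_map ?Bk (y z)))"
    have V: "V t = (k, (?c t * \<epsilon>) *\<^sub>R B (snd (y z t)) k)" for t
      unfolding V_def using \<B>[OF Y[OF z]]
      by (simp add: path_lin_apply[OF bl0] path_bil_apply[OF bounded_bilinear_scaleR] path_map_apply[OF cBk yC[OF z]] c mult.commute)
    define h where "h s = B (snd (y z s)) k + (s * \<epsilon>) *\<^sub>R B' (snd (y z s)) (B (snd (y z s)) (fst z)) k" for s
    have dV: "path_deriv F (y z) V s = (0, \<epsilon> *\<^sub>R h s)" if "s \<in> {0..1}" for s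
    proof -
      have s: "?c s = s" using that by auto
      have e: "y z s = (fst z, snd (y z s))" using fsty[OF z, of s] by (metis prod.collapse)
      have l: "linear (B' (snd (y z s)))"
        using d\<B>[OF Y[OF z]] has_derivative_bounded_linear bounded_linear.linear by blast
      have "path_deriv F (y z) V s = frechet_derivative F (at (fst z, snd (y z s))) (k, (s * \<epsilon>) *\<^sub>R B (snd (y z s)) k)"
        unfolding path_deriv_apply[OF sF O2 r(2) yin[OF z]] V s using e by simp
      \<comment> \<open>Involutivity exchanges \<open>k\<close> and the ray direction
        \<open>fst z\<close> in the term with \<open>B'\<close>; only then is the integrand the time
        derivative of \<open>V\<close>.\<close>
      also have "\<dots> = (0, \<epsilon> *\<^sub>R h s)"
        unfolding dF[OF Y[OF z]] h_def linear_scale[OF l] using inv'[OF Y[OF z, of s], of "fst z" k]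
        by (simp add: blinfun.scaleR_left)
      finally show ?thesis .
    qed
    have dY: "((\<lambda>s. snd (y z s)) has_vector_derivative \<epsilon> *\<^sub>R B (snd (y z s)) (fst z)) (at s within {0..1})"
      if s: "s \<in> {0..1}" for s
    proof -
      let ?p = "path_map F (y z)"
      have "((\<lambda>t. integral {0..t} ?p) has_vector_derivative ?p s) (at s within {0..1})"
        by (rule integral_has_vector_derivative[OF _ s]) simp
      from has_vector_derivative_add[OF has_vector_derivative_const[of z] this]
      have "((\<lambda>t. z + integral {0..t} ?p) has_vector_derivative ?p s) (at s within {0..1})" by simp
      from bounded_linear.has_vector_derivative[OF bounded_linear_snd this]
      have "((\<lambda>t. snd (y z t)) has_vector_derivative snd (?p s)) (at s within {0..1})"
        by (rule has_vector_derivative_transform[OF s, rotated]) (simp add: yt[OF z])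
      then show ?thesis by (simp add: path_map_apply[OF cF yC[OF z]] Fy'[OF z])
    qed
    have "V = const_bcontfun (k, 0) + path_int (path_deriv F (y z) V)"
    proof (rule bcontfun_eqI)
      fix t
      let ?t = "?c t"
      have t: "0 \<le> ?t" "{0..?t} \<subseteq> {0..1}" by auto
      have "((\<lambda>s. (0::'e, (s * \<epsilon>) *\<^sub>R B (snd (y z s)) k)) has_vector_derivative path_deriv F (y z) V s) (at s within {0..?t})"
        if s: "s \<in> {0..?t}" for s
      proof -
        have s1: "s \<in> {0..1}" using s t by blast
        have "((\<lambda>s. B (snd (y z s)) k) has_derivative (\<lambda>x. B' (snd (y z s)) (x *\<^sub>R (\<epsilon> *\<^sub>R B (snd (y z s)) (fst z))) k)) (at s within {0..1})"
          using has_derivative_compose[OF dY[OF s1, unfolded has_vector_derivative_def] dB[OF Y[OF z]]] .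
        moreover have l: "linear (B' (snd (y z s)))"
          using d\<B>[OF Y[OF z]] has_derivative_bounded_linear bounded_linear.linear by blast
        ultimately have "((\<lambda>s. B (snd (y z s)) k) has_vector_derivative \<epsilon> *\<^sub>R B' (snd (y z s)) (B (snd (y z s)) (fst z)) k) (at s within {0..1})"
          by (simp add: has_vector_derivative_def linear_scale[OF l] blinfun.scaleR_left)
        then have "((\<lambda>s. (s * \<epsilon>) *\<^sub>R B (snd (y z s)) k) has_vector_derivative
            (s * \<epsilon>) *\<^sub>R (\<epsilon> *\<^sub>R B' (snd (y z s)) (B (snd (y z s)) (fst z)) k) + \<epsilon> *\<^sub>R B (snd (y z s)) k) (at s within {0..1})"
          by (intro has_vector_derivative_scaleR) (auto intro!: derivative_eq_intros)
        then have "((\<lambda>s. (0::'e, (s * \<epsilon>) *\<^sub>R B (snd (y z s)) k)) has_vector_derivative (0, \<epsilon> *\<^sub>R h s)) (at s within {0..1})"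
          by (intro has_vector_derivative_Pair) (auto intro!: derivative_intros simp: h_def algebra_simps)
        then show ?thesis using dV[OF s1] has_vector_derivative_within_subset t(2) by metis
      qed
      then have "(path_deriv F (y z) V has_integral
          (0::'e, (?t * \<epsilon>) *\<^sub>R B (snd (y z ?t)) k) - (0, (0 * \<epsilon>) *\<^sub>R B (snd (y z 0)) k)) {0..?t}"
        by (rule fundamental_theorem_of_calculus[OF t(1)])
      then have "integral {0..?t} (path_deriv F (y z) V) = (0, (?t * \<epsilon>) *\<^sub>R B (snd (y z ?t)) k)"
        by (simp add: integral_unique)
      moreover have "y z ?t = y z t" unfolding yt[OF z] by simp
      ultimately show "V t = (const_bcontfun (k, 0) + path_int (path_deriv F (y z) V)) t"
        by (simp add: V path_int_apply)
    qed
    from uniq[OF z this] have "frechet_derivative y (at z) (k, 0) 1 = V 1" by simp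
    then show ?thesis unfolding D\<Phi>[OF z] \<Phi>_def V by simp
  qed
  have y0: "y z0 = const_bcontfun z0"
  proof -
    have "path_map F (y z0) = 0"
    proof (rule bcontfun_eqI)
      fix t
      have "fst z0 = 0" by (simp add: z0_def)
      then show "apply_bcontfun (path_map F (y z0)) t = apply_bcontfun 0 t"
        by (simp add: path_map_apply[OF cF yC[OF N(2)]] Fy'[OF N(2)] B0[OF Y[OF N(2)]] zero_prod_def)
    qed
    then show ?thesis using yeq[OF N(2)] by (simp add: linear_0[OF li])
  qed
  \<comment> \<open>Over \<open>z0\<close> the ray direction is 0 and the path is constant, so
    varying the initial point alone just shifts the path.\<close>
  have D\<Phi>2: "frechet_derivative \<Phi> (at z0) (0, v) = v" for v
  proof -
    have "frechet_derivative y (at z0) (0, v) = const_bcontfun (0, v)"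
    proof (rule uniq[OF N(2)])
      have "path_deriv F (y z0) (const_bcontfun (0, v)) = 0"
      proof (rule bcontfun_eqI)
        fix t
        have "path_deriv F (y z0) (const_bcontfun (0, v)) t = frechet_derivative F (at z0) (0, v)"
          unfolding path_deriv_apply[OF sF O2 r(2) yin[OF N(2)]] unfolding y0 by simp
        also have "\<dots> = 0" unfolding z0_def dF[OF U(2)] by (simp add: B0[OF U(2)] zero_prod_def)
        finally show "path_deriv F (y z0) (const_bcontfun (0, v)) t = apply_bcontfun 0 t" by simp
      qed
      then show "const_bcontfun (0, v) = const_bcontfun (0, v) + path_int (path_deriv F (y z0) (const_bcontfun (0, v)))"
        by (simp add: linear_0[OF li])
    qed
    then show ?thesis by (simp add: D\<Phi>[OF N(2)])
  qed
  define Q where "Q v = v - P v" for v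
  have blP: "bounded_linear P" using P(1) by (simp add: linear_conv_bounded_linear)
  have blQ: "bounded_linear Q" unfolding Q_def[abs_def] by (intro bounded_linear_sub bounded_linear_ident blP)
  \<comment> \<open>The \<open>P\<close>-part of a displacement becomes the ray direction, with
    1/\<epsilon> undoing the change of speed, and the \<open>Q\<close>-part displaces the initial
    point. Thus \<open>\<Theta>\<close> flattens the distribution: on the range of \<open>P\<close>
    its derivative is \<open>B (\<Theta> \<zeta>)\<close>.\<close>
  define \<iota> where "\<iota> v = (inverse \<epsilon> *\<^sub>R P v, Q v)" for v
  have bl\<iota>: "bounded_linear \<iota>" unfolding \<iota>_def[abs_def]
    by (intro bounded_linear_Pair blQ bounded_linear_compose[OF bounded_linear_scaleR_right blP])
  define \<Theta> where "\<Theta> \<zeta> = \<Phi> (z0 + \<iota> (\<zeta> - x0))" for \<zeta>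
  define N' where "N' = (\<lambda>\<zeta>. z0 + \<iota> (\<zeta> - x0)) -` N"
  have d\<iota>: "((\<lambda>\<zeta>. z0 + \<iota> (\<zeta> - x0)) has_derivative \<iota>) (at \<zeta>)" for \<zeta>
  proof -
    have "((\<lambda>\<zeta>. \<zeta> - x0) has_derivative (\<lambda>v. v)) (at \<zeta>)" by (auto intro!: derivative_eq_intros)
    from has_derivative_add[OF has_derivative_const bounded_linear.has_derivative[OF bl\<iota> this]]
    show ?thesis by simp
  qed
  have N': "open N'" unfolding N'_def
    using N(1) d\<iota> by (intro open_vimage) (auto intro!: continuous_at_imp_continuous_on has_derivative_continuous)
  have \<iota>0: "\<iota> 0 = 0" using bounded_linear.linear[OF bl\<iota>] by (rule linear_0)
  have x0: "x0 \<in> N'" using N(2) \<iota>0 by (simp add: N'_def)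
  have s\<Theta>: "smooth_on N' \<Theta>" unfolding \<Theta>_def
  proof (rule smooth_on_compose[OF N' N(1) _ s\<Phi>])
    show "smooth_on N' (\<lambda>\<zeta>. z0 + \<iota> (\<zeta> - x0))"
      by (intro smooth_on_add[OF N' smooth_on_const] smooth_on_linear[OF N' bl\<iota>]
          smooth_on_diff[OF N' smooth_on_ident[OF N'] smooth_on_const])
  qed (auto simp: N'_def)
  have d\<Theta>: "frechet_derivative \<Theta> (at \<zeta>) v = frechet_derivative \<Phi> (at (z0 + \<iota> (\<zeta> - x0))) (\<iota> v)" if "\<zeta> \<in> N'" for \<zeta> v
  proof -
    have "z0 + \<iota> (\<zeta> - x0) \<in> N" using that by (simp add: N'_def)
    from has_derivative_compose[OF d\<iota> smooth_on_has_derivative[OF s\<Phi> this]]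
    have "(\<Theta> has_derivative (\<lambda>v. frechet_derivative \<Phi> (at (z0 + \<iota> (\<zeta> - x0))) (\<iota> v))) (at \<zeta>)"
      by (simp add: \<Theta>_def[abs_def])
    then show ?thesis by (simp add: frechet_derivative_eq)
  qed
  have d\<Theta>P: "frechet_derivative \<Theta> (at \<zeta>) v = B (\<Theta> \<zeta>) v" if "\<zeta> \<in> N'" "P v = v" for \<zeta> v
  proof -
    have z: "z0 + \<iota> (\<zeta> - x0) \<in> N" using that by (simp add: N'_def)
    have "\<iota> v = (inverse \<epsilon> *\<^sub>R v, 0)" using that(2) by (simp add: \<iota>_def Q_def)
    then show ?thesis
      using B(1)[OF Y[OF z]] eps unfolding d\<Theta>[OF that(1)] by (simp add: D\<Phi>1[OF z] \<Theta>_def \<Phi>_def linear_scale)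
  qed
  have \<Phi>0: "\<Phi> z0 = x0" unfolding \<Phi>_def y0 by (simp add: z0_def)
  have \<Theta>0: "\<Theta> x0 = x0" by (simp add: \<Theta>_def \<iota>0 \<Phi>0)
  have inj: "v = 0" if "frechet_derivative \<Theta> (at x0) v = 0" for v
  proof -
    have l: "linear (frechet_derivative \<Phi> (at z0))" by (rule smooth_on_linear_derivative[OF s\<Phi> N(2)])
    have "frechet_derivative \<Theta> (at x0) v = frechet_derivative \<Phi> (at z0) ((inverse \<epsilon> *\<^sub>R P v, 0) + (0, Q v))"
      using \<iota>0 unfolding d\<Theta>[OF x0] by (simp add: \<iota>_def[of v])
    also have "\<dots> = B x0 v + Q v"
      unfolding linear_add[OF l] D\<Phi>1[OF N(2)] D\<Phi>2 using B(1)[OF U(2)] eps PB(2)[OF U(2)]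
      by (simp add: \<Phi>0 linear_scale)
    finally have eq: "B x0 v + Q v = 0" using that by simp
    then have "P (B x0 v) + P (Q v) = 0" using linear_add[OF P(1), of "B x0 v" "Q v"] linear_0[OF P(1)] by simp
    then have Pv: "P v = 0" using PB(1)[OF U(2)] P by (simp add: Q_def linear_diff)
    then have "B x0 v = 0" using PB(2)[OF U(2), of v] B0[OF U(2)] by simp
    then show "v = 0" using eq Pv by (simp add: Q_def)
  qed
  obtain U' V g where UV: "open U'" "U' \<subseteq> N'" "x0 \<in> U'" "open V" "homeomorphism U' V \<Theta> g" "smooth_on V g"
    "\<And>\<zeta>. \<zeta> \<in> U' \<Longrightarrow> bij (frechet_derivative \<Theta> (at \<zeta>))"
    using smooth_inverse_function[OF s\<Theta> N' x0 inj] by blast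
  have gV: "g x \<in> U'" "\<Theta> (g x) = x" if "x \<in> V" for x using UV(5) that by (auto simp: homeomorphism_def)
  have "x0 \<in> V" using homeomorphism_image1[OF UV(5)] imageI[OF UV(3), of \<Theta>] \<Theta>0 by simp
  moreover have "V \<subseteq> U"
  proof
    fix x assume "x \<in> V"
    then have "g x \<in> N'" using gV UV(2) by blast
    then show "x \<in> U" using Y[of "z0 + \<iota> (g x - x0)" 1] gV(2)[OF \<open>x \<in> V\<close>]
      by (simp add: N'_def \<Theta>_def \<Phi>_def)
  qed
  \<comment> \<open>In the coordinates given by \<open>g\<close> the distribution is the range of
    \<open>P\<close>, so the transverse coordinate \<open>Q (g x)\<close> is a first
    integral.\<close>
  moreover have "smooth_on V (\<lambda>x. Q (g x))" by (rule smooth_on_linear[OF UV(4) blQ UV(6)])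
  moreover have "frechet_derivative (\<lambda>x. Q (g x)) (at x) v = 0 \<longleftrightarrow> v \<in> range (B x)" if x: "x \<in> V" for x v
  proof -
    have xU: "x \<in> U" using x \<open>V \<subseteq> U\<close> by blast
    let ?g = "frechet_derivative g (at x)" and ?T = "frechet_derivative \<Theta> (at (g x))"
    have gN: "g x \<in> N'" using gV(1)[OF x] UV(2) by blast
    have 1: "frechet_derivative (\<lambda>x. Q (g x)) (at x) v = Q (?g v)" for v
      by (rule fun_cong[OF frechet_derivative_eq[OF bounded_linear.has_derivative[OF blQ smooth_on_has_derivative[OF UV(6) x]]]])
    have Tg: "?T (?g w) = w" for w
    proof -
      have "((\<lambda>x. \<Theta> (g x)) has_derivative (\<lambda>w. ?T (?g w))) (at x)"
        by (rule has_derivative_compose[OF smooth_on_has_derivative[OF UV(6) x] smooth_on_has_derivative[OF s\<Theta> gN]])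
      then have "((\<lambda>x. x) has_derivative (\<lambda>w. ?T (?g w))) (at x)"
        by (rule has_derivative_transform_within_open[OF _ UV(4) x]) (simp add: gV)
      then have "(\<lambda>w. ?T (?g w)) = (\<lambda>w. w)" using has_derivative_unique has_derivative_ident by blast
      then show ?thesis by meson
    qed
    have gT: "?g (?T w) = w" for w
      using Tg[of "?T w"] UV(7)[OF gV(1)[OF x]] by (metis bij_is_inj injD)
    show ?thesis
    proof
      assume "frechet_derivative (\<lambda>x. Q (g x)) (at x) v = 0"
      then have "P (?g v) = ?g v" unfolding 1 by (simp add: Q_def)
      then have "v = B x (?g v)" using d\<Theta>P[OF gN, of "?g v"] Tg[of v] gV(2)[OF x] by simp
      then show "v \<in> range (B x)" by blast
    next
      assume "v \<in> range (B x)"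
      then obtain k where "v = B x k" by blast
      then have "v = ?T (P k)" using d\<Theta>P[OF gN, of "P k"] P(2) gV(2)[OF x] PB(2)[OF xU] by simp
      then show "frechet_derivative (\<lambda>x. Q (g x)) (at x) v = 0" unfolding 1 by (simp add: gT Q_def P(2))
    qed
  qed
  ultimately show ?thesis using that UV(4) by blast
qed

text \<open>Near \<open>x0\<close> the distribution is a graph over \<open>\<Delta> x0\<close> along
  the kernel of a projection \<open>P\<close>. Parametrizing it by \<open>P\<close>-components gives
  fields \<open>B x v\<close> whose \<open>P\<close>-component is constant in \<open>x\<close>.
  Their brackets are killed by \<open>P\<close> and lie in \<open>\<Delta> x\<close>, where
  \<open>P\<close> is injective; so the fields commute and the graph form applies.\<close>

lemma frobenius:
  fixes \<Delta> :: "'e::euclidean_space \<Rightarrow> 'e set"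
  assumes U: "open U" "x0 \<in> U" and S: "finite S" "\<And>X. X \<in> S \<Longrightarrow> smooth_on U X"
    and frame: "\<And>x. x \<in> U \<Longrightarrow> inj_on (\<lambda>X. X x) S \<and> independent ((\<lambda>X. X x) ` S) \<and> span ((\<lambda>X. X x) ` S) = \<Delta> x"
    and inv: "\<And>O' \<xi> \<eta> x. open O' \<Longrightarrow> O' \<subseteq> U \<Longrightarrow> smooth_on O' \<xi> \<Longrightarrow> smooth_on O' \<eta> \<Longrightarrow>
      (\<And>x. x \<in> O' \<Longrightarrow> \<xi> x \<in> \<Delta> x \<and> \<eta> x \<in> \<Delta> x) \<Longrightarrow> x \<in> O' \<Longrightarrow>
      frechet_derivative \<eta> (at x) (\<xi> x) - frechet_derivative \<xi> (at x) (\<eta> x) \<in> \<Delta> x"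
  obtains V u where "open V" "x0 \<in> V" "V \<subseteq> U" "smooth_on V (u :: 'e \<Rightarrow> 'e)"
    "\<And>x v. x \<in> V \<Longrightarrow> frechet_derivative u (at x) v = 0 \<longleftrightarrow> v \<in> \<Delta> x"
proof -
  let ?b = "\<lambda>X. X x0"
  have sub\<Delta>: "subspace (\<Delta> x)" if "x \<in> U" for x using frame[OF that] by (metis subspace_span)
  obtain P :: "'e \<Rightarrow> 'e" where P: "linear P" "range P \<subseteq> \<Delta> x0" "\<And>v. v \<in> \<Delta> x0 \<Longrightarrow> P v = v"
    using linear_exists_left_inverse_on[OF linear_id sub\<Delta>[OF U(2)]] by auto
  have "\<exists>c::'e \<Rightarrow> real. linear c \<and> (\<forall>Y\<in>S. c (Y x0) = (if Y = X then 1 else 0))" if X: "X \<in> S" for X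
  proof -
    obtain c :: "'e \<Rightarrow> real" where c: "linear c" "\<forall>b\<in>?b ` S. c b = (if b = X x0 then 1 else 0)"
      using linear_independent_extend[of "?b ` S" "\<lambda>b. if b = X x0 then 1 else 0"] frame[OF U(2)] by blast
    then show ?thesis using frame[OF U(2)] X by (intro exI[of _ c]) (auto simp: inj_on_def)
  qed
  then obtain c :: "('e \<Rightarrow> 'e) \<Rightarrow> 'e \<Rightarrow> real" where c: "\<And>X. X \<in> S \<Longrightarrow> linear (c X)"
    "\<And>X Y. X \<in> S \<Longrightarrow> Y \<in> S \<Longrightarrow> c X (Y x0) = (if Y = X then 1 else 0)" by metis
  \<comment> \<open>The functionals \<open>c X\<close> are dual to the frame at \<open>x0\<close>,
    so \<open>L x\<close> carries the frame at \<open>x0\<close> to the frame at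
    \<open>x\<close>.\<close>
  define L where "L x v = (\<Sum>X\<in>S. c X v *\<^sub>R X x)" for x v
  have linL: "linear (L x)" for x unfolding L_def[abs_def]
    using c(1) by (intro linear_compose_sum ballI linearI) (simp_all add: linear_add linear_scale scaleR_add_left)
  have L0: "L x (Y x0) = Y x" if "Y \<in> S" for x Y
  proof -
    have "L x (Y x0) = (\<Sum>X\<in>S. if X = Y then Y x else 0)" unfolding L_def
      by (intro sum.cong) (auto simp: c(2) that)
    then show ?thesis using S(1) that by simp
  qed
  have Lx0: "L x0 v = v" if "v \<in> \<Delta> x0" for v
  proof (rule linear_eq_on_span[OF linL linear_ident])
    show "v \<in> span (?b ` S)" using that frame[OF U(2)] by simp
  qed (use L0 in auto)
  have Lin: "L x v \<in> \<Delta> x" if "x \<in> U" for x v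
    unfolding L_def by (intro subspace_sum[OF sub\<Delta>[OF that]] subspace_scale[OF sub\<Delta>[OF that]])
      (metis frame[OF that] imageI span_base)
  have Lsurj: "\<exists>k\<in>\<Delta> x0. d = L x k" if x: "x \<in> U" and d: "d \<in> \<Delta> x" for x d
  proof -
    have "d \<in> span ((\<lambda>X. X x) ` S)" using d frame[OF x] by simp
    also have "(\<lambda>X. X x) ` S = L x ` ?b ` S" unfolding image_image by (intro image_cong refl) (simp add: L0)
    also have "span (L x ` ?b ` S) = L x ` span (?b ` S)" using linear_span_image[OF linL] .
    finally show ?thesis using frame[OF U(2)] by auto
  qed
  have sL: "smooth_on U (\<lambda>x. L x v)" for v unfolding L_def
    by (intro smooth_on_sum U smooth_on_linear[OF U(1) bounded_linear_scaleR_right] S(2))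
  \<comment> \<open>On \<open>\<Delta> x0\<close> this is \<open>P\<close> after \<open>L x\<close>,
    on the kernel of \<open>P\<close> the identity. The extension makes the map to be inverted an
    endomorphism of the whole space that is close to the identity near \<open>x0\<close>.\<close>
  define M where "M x v = v - P v + P (L x (P v))" for x v
  have blP: "bounded_linear P" using P(1) by (simp add: linear_conv_bounded_linear)
  have linM: "linear (M x)" for x
    unfolding M_def[abs_def]
    by (intro linear_compose_add linear_compose_sub linear_ident P(1) linear_compose[OF P(1), unfolded o_def] linL
       linear_compose[OF linL, unfolded o_def])
  have sM: "smooth_on U (\<lambda>x. M x v)" for v unfolding M_def
    by (intro smooth_on_add smooth_on_linear[OF U(1) blP] sL smooth_on_const U)
  have PP: "P (P v) = P v" for v using P(2,3) by blast
  define \<M> where "\<M> x = Blinfun (M x)" for x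
  have \<M>: "blinfun_apply (\<M> x) = M x" for x
    using linM[of x] by (simp add: \<M>_def bounded_linear_Blinfun_apply linear_conv_bounded_linear)
  have "smooth_on U \<M>" unfolding \<M>_def[abs_def] by (rule smooth_on_Blinfun[OF U(1) linM sM])
  then have "isCont \<M> x0" using smooth_on_continuous U continuous_on_eq_continuous_at by blast
  then obtain d where d: "d > 0" "\<And>x. dist x x0 < d \<Longrightarrow> dist (\<M> x) (\<M> x0) < 1/2"
    unfolding continuous_at_eps_delta by (metis half_gt_zero zero_less_one)
  have M0: "M x0 v = v" for v
    using P(2) by (simp add: M_def Lx0[OF subsetD[OF P(2) rangeI]] PP)
  define U1 where "U1 = U \<inter> ball x0 d"
  have U1: "open U1" "x0 \<in> U1" "U1 \<subseteq> U" using U d by (auto simp: U1_def)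
  have injM: "v = 0" if "x \<in> U1" "M x v = 0" for x v
  proof -
    have "norm (\<M> x - \<M> x0) \<le> 1/2" using d(2)[of x] that(1) by (simp add: U1_def dist_norm norm_minus_commute)
    then have "norm ((\<M> x - \<M> x0) v) \<le> 1/2 * norm v"
      by (rule order_trans[OF norm_blinfun mult_right_mono]) simp
    moreover have "(\<M> x - \<M> x0) v = - v" using that(2) by (simp add: blinfun.diff_left \<M> M0)
    ultimately show ?thesis by simp
  qed
  define R where "R x = inv (M x)" for x
  have "inj (M x)" if "x \<in> U1" for x using injM[OF that] linear_injective_0[OF linM] by blast
  moreover have "surj (M x)" if "x \<in> U1" for x using calculation[OF that] linear_inj_imp_surj[OF linM] by blast
  ultimately have RM: "R x (M x v) = v" and MR: "M x (R x v) = v" if "x \<in> U1" for x v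
    using that by (simp_all add: R_def surj_f_inv_f)
  have sR: "smooth_on U1 (\<lambda>x. R x v)" for v
    by (rule smooth_on_linear_inverse[OF U1(1) linM smooth_on_mono[OF sM U1(3)] RM MR smooth_on_const])
  have linR: "linear (R x)" if "x \<in> U1" for x
  proof (rule linearI)
    note i = RM[OF that] and j = MR[OF that]
    show "R x (a + b) = R x a + R x b" for a b
      using i[of "R x a + R x b"] by (simp add: linear_add[OF linM] j)
    show "R x (r *\<^sub>R a) = r *\<^sub>R R x a" for r a
      using i[of "r *\<^sub>R R x a"] by (simp add: linear_scale[OF linM] j)
  qed
  \<comment> \<open>The vector of \<open>\<Delta> x\<close> with the same \<open>P\<close>-component
    as \<open>v\<close>: the inverse of \<open>M x\<close> finds the corresponding vector of
    \<open>\<Delta> x0\<close>, and \<open>L x\<close> moves it to \<open>x\<close>.\<close>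
  define B where "B x v = L x (P (R x (P v)))" for x v
  have linB: "linear (B x)" if "x \<in> U1" for x
    unfolding B_def[abs_def]
    using linear_compose[OF linear_compose[OF linear_compose[OF P(1) linR[OF that]] P(1)] linL] by (simp add: o_def)
  have sB: "smooth_on U1 (\<lambda>x. B x v)" for v unfolding B_def
    by (rule smooth_on_apply_linear[OF U1(1) linL smooth_on_mono[OF sL U1(3)] smooth_on_linear[OF U1(1) blP sR]])
  have B\<Delta>: "B x v \<in> \<Delta> x" if "x \<in> U1" for x v using Lin that U1(3) by (auto simp: B_def)
  have PB: "P (B x v) = P v" if "x \<in> U1" for x v
  proof -
    define w where "w = R x (P v)"
    have eq: "w - P w + P (L x (P w)) = P v" using MR[OF that, of "P v"] by (simp add: w_def M_def)
    have "P (w - P w + P (L x (P w))) = P (L x (P w))"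
      using P(1) by (simp add: linear_add linear_diff PP)
    then have "P (L x (P w)) = P v" using eq PP by metis
    then show ?thesis by (simp add: B_def w_def)
  qed
  have BP: "B x (P v) = B x v" for x v by (simp add: B_def PP)
  have B_id: "B x d = d" if x: "x \<in> U1" and d: "d \<in> \<Delta> x" for x d
  proof -
    obtain k where k: "k \<in> \<Delta> x0" "d = L x k" using Lsurj[of x d] x d U1(3) by blast
    have "M x k = P d" using P(3)[OF k(1)] k(2) by (simp add: M_def)
    then have "R x (P d) = k" using RM[OF x, of k] by simp
    then show ?thesis using P(3)[OF k(1)] k(2) by (simp add: B_def)
  qed
  have inv': "frechet_derivative (\<lambda>y. B y l) (at x) (B x k) = frechet_derivative (\<lambda>y. B y k) (at x) (B x l)"
    if x: "x \<in> U1" for x k l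
  proof -
    let ?b = "frechet_derivative (\<lambda>y. B y l) (at x) (B x k) - frechet_derivative (\<lambda>y. B y k) (at x) (B x l)"
    have "?b \<in> \<Delta> x" by (rule inv[OF U1(1,3) sB sB _ x]) (simp add: B\<Delta>)
    moreover have "P (frechet_derivative (\<lambda>y. B y k) (at x) w) = 0" for k w
    proof -
      have "((\<lambda>y. P (B y k)) has_derivative (\<lambda>w. P (frechet_derivative (\<lambda>y. B y k) (at x) w))) (at x)"
        by (rule bounded_linear.has_derivative[OF blP smooth_on_has_derivative[OF sB x]])
      then have "((\<lambda>y. P k) has_derivative (\<lambda>w. P (frechet_derivative (\<lambda>y. B y k) (at x) w))) (at x)"
        by (rule has_derivative_transform_within_open[OF _ U1(1) x]) (simp add: PB)
      then have "(\<lambda>w. P (frechet_derivative (\<lambda>y. B y k) (at x) w)) = (\<lambda>w. 0)"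
        using has_derivative_unique has_derivative_const by blast
      then show ?thesis by meson
    qed
    then have "P ?b = 0" by (simp add: linear_diff[OF P(1)])
    ultimately show ?thesis
      using B_id[OF x, of ?b] BP[of x ?b] linear_0[OF linB[OF x]] by simp
  qed
  obtain V u where V: "open V" "x0 \<in> V" "V \<subseteq> U1" "smooth_on V (u :: 'e \<Rightarrow> 'e)"
    "\<And>x v. x \<in> V \<Longrightarrow> frechet_derivative u (at x) v = 0 \<longleftrightarrow> v \<in> range (B x)"
    using frobenius_graph[OF U1(1,2) P(1) PP linB sB PB BP inv'] by blast
  moreover have "range (B x) = \<Delta> x" if "x \<in> V" for x
    using B\<Delta> B_id that V(3) by (metis (no_types, lifting) image_subset_iff rangeI subsetD subsetI subset_antisym)
  ultimately show ?thesis using that[of V u] U1(3) by auto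
qed

text \<open>The product rule for the derivative of \<open>f\<close> applied to a varying vector. The
  second derivative of \<open>f\<close> appears with \<open>X x\<close> frozen, so that its symmetry
  can cancel it in brackets.\<close>

lemma has_derivative_derivative_field:
  fixes f :: "'a::euclidean_space \<Rightarrow> 'b::real_normed_vector"
  assumes f: "smooth_on U f" and U: "open U" "x \<in> U" and X: "(X has_derivative X') (at x)"
  shows "((\<lambda>y. frechet_derivative f (at y) (X y)) has_derivative
    (\<lambda>w. frechet_derivative (\<lambda>y. frechet_derivative f (at y) (X x)) (at x) w + frechet_derivative f (at x) (X' w))) (at x)"
proof -
  define f' where "f' = (\<lambda>x. Blinfun (frechet_derivative f (at x)))"
  have f': "blinfun_apply (f' y) = frechet_derivative f (at y)" if "y \<in> U" for y
    using smooth_on_apply_Blinfun_derivative[OF f that] by (simp add: f'_def)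
  have "smooth_on U f'" unfolding f'_def by (rule smooth_on_Blinfun_derivative[OF U(1) f])
  then have d: "(f' has_derivative frechet_derivative f' (at x)) (at x)"
    by (rule smooth_on_has_derivative[OF _ U(2)])
  have e: "frechet_derivative f' (at x) w u = frechet_derivative (\<lambda>y. frechet_derivative f (at y) u) (at x) w" for w u
  proof -
    have "((\<lambda>y. f' y u) has_derivative (\<lambda>w. frechet_derivative f' (at x) w u)) (at x)"
      by (rule bounded_linear.has_derivative[OF blinfun.bounded_linear_left d])
    then have "((\<lambda>y. frechet_derivative f (at y) u) has_derivative (\<lambda>w. frechet_derivative f' (at x) w u)) (at x)"
      by (rule has_derivative_transform_within_open[OF _ U]) (simp add: f')
    then show ?thesis by (simp add: frechet_derivative_eq)
  qed
  have "((\<lambda>y. f' y (X y)) has_derivative (\<lambda>w. f' x (X' w) + frechet_derivative f' (at x) w (X x))) (at x)"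
    by (rule bounded_bilinear.FDERIV[OF bounded_bilinear_blinfun_apply d X])
  then have "((\<lambda>y. f' y (X y)) has_derivative
    (\<lambda>w. frechet_derivative (\<lambda>y. frechet_derivative f (at y) (X x)) (at x) w + frechet_derivative f (at x) (X' w))) (at x)"
    by (simp add: e f'[OF U(2)] add.commute)
  then show ?thesis by (rule has_derivative_transform_within_open[OF _ U]) (simp add: f')
qed

subsection \<open>Charts and tangent maps\<close>

text \<open>Membership in the smooth structure generated by \<open>A\<close>. Slice charts of
  submanifolds and adapted charts need not belong to \<open>A\<close>, so the coordinate
  computations are stated for compatible charts.\<close>

definition compatible :: "('m::topological_space, 'e::euclidean_space) chart set \<Rightarrow> ('m, 'e) chart \<Rightarrow> bool" where
  "compatible A c \<longleftrightarrow> smooth_atlas (insert c A)"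

lemma atlas_compatible: "smooth_atlas A \<Longrightarrow> c \<in> A \<Longrightarrow> compatible A c"
  by (simp add: compatible_def insert_absorb)

lemma compatible_open:
  assumes "compatible A c"
  shows "open (cdom c)" "open (cmap c ` cdom c)" "homeomorphism (cdom c) (cmap c ` cdom c) (cmap c) (cinv c)"
  using assms by (auto simp: compatible_def smooth_atlas_def)

lemma cinv_cmap: "compatible A c \<Longrightarrow> q \<in> cdom c \<Longrightarrow> cinv c (cmap c q) = q"
  using compatible_open(3) homeomorphism_apply1 by blast

lemma cmap_cinv: "x \<in> cmap c ` cdom c \<Longrightarrow> cmap c (cinv c x) = x"
  by (rule f_inv_into_f)

lemma cinv_in: "x \<in> cmap c ` cdom c \<Longrightarrow> cinv c x \<in> cdom c"
  by (rule inv_into_into)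

lemma compatible_inj: "compatible A c \<Longrightarrow> inj_on (cmap c) (cdom c)"
  by (metis cinv_cmap inj_onI)

lemma open_cmap_image:
  assumes "compatible A c" "open V" "V \<subseteq> cdom c"
  shows "open (cmap c ` V)"
  using homeomorphism_imp_open_map[OF compatible_open(3)[OF assms(1)], of V] assms compatible_open(2)[OF assms(1)]
  by (metis open_openin_trans openin_open_trans open_subset)

lemma continuous_cmap: "compatible A c \<Longrightarrow> continuous_on (cdom c) (cmap c)"
  using compatible_open(3) homeomorphism_cont1 by blast

lemma continuous_cinv: "compatible A c \<Longrightarrow> continuous_on (cmap c ` cdom c) (cinv c)"
  using compatible_open(3) homeomorphism_cont2 by blast

lemma atlas_cover: "smooth_atlas A \<Longrightarrow> \<exists>c\<in>A. p \<in> cdom c"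
  unfolding smooth_atlas_def by blast

lemma chart_at: "smooth_atlas A \<Longrightarrow> chart_at A p \<in> A \<and> p \<in> cdom (chart_at A p)"
  unfolding chart_at_def using someI_ex[of "\<lambda>c. c \<in> A \<and> p \<in> cdom c"] atlas_cover by blast

lemma chart_at_compatible: "smooth_atlas A \<Longrightarrow> compatible A (chart_at A p)"
  using chart_at atlas_compatible by blast

lemma open_chart_overlap:
  "compatible A c \<Longrightarrow> compatible A d \<Longrightarrow> open (cmap c ` (cdom c \<inter> cdom d))"
  by (rule open_cmap_image) (auto intro: compatible_open)

lemma transition_atlas:
  assumes "compatible A c" "a \<in> A"
  shows "smooth_on (cmap c ` (cdom c \<inter> cdom a)) (\<lambda>x. cmap a (cinv c x))"
    and "smooth_on (cmap a ` (cdom a \<inter> cdom c)) (\<lambda>x. cmap c (cinv a x))"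
proof -
  have "\<forall>c'\<in>insert c A. \<forall>d\<in>insert c A. smooth_on (cmap c' ` (cdom c' \<inter> cdom d)) (cmap d \<circ> cinv c')"
    using assms(1) unfolding compatible_def smooth_atlas_def by blast
  then show "smooth_on (cmap c ` (cdom c \<inter> cdom a)) (\<lambda>x. cmap a (cinv c x))"
    and "smooth_on (cmap a ` (cdom a \<inter> cdom c)) (\<lambda>x. cmap c (cinv a x))"
    using assms(2) by (auto simp: o_def)
qed

text \<open>Compatibility only compares a chart with the charts of \<open>A\<close>, so the
  transition between two compatible charts is factored locally through a chart of
  \<open>A\<close>.\<close>

lemma transition_smooth:
  assumes A: "smooth_atlas A" and c: "compatible A c" and d: "compatible A d"
  shows "smooth_on (cmap c ` (cdom c \<inter> cdom d)) (\<lambda>x. cmap d (cinv c x))"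
proof (rule smooth_on_local)
  fix x assume x: "x \<in> cmap c ` (cdom c \<inter> cdom d)"
  then obtain p where p: "p \<in> cdom c" "p \<in> cdom d" "x = cmap c p" by blast
  obtain a where a: "a \<in> A" "p \<in> cdom a" using atlas_cover[OF A] by blast
  note ca = atlas_compatible[OF A a(1)]
  let ?W = "cdom c \<inter> cdom d \<inter> cdom a"
  have W: "open ?W" by (intro open_Int compatible_open(1)[OF c] compatible_open(1)[OF d] compatible_open(1)[OF ca])
  have oc: "open (cmap c ` ?W)" by (rule open_cmap_image[OF c W]) blast
  have oa: "open (cmap a ` ?W)" by (rule open_cmap_image[OF ca W]) blast
  have "smooth_on (cmap c ` ?W) (\<lambda>x. (\<lambda>y. cmap d (cinv a y)) (cmap a (cinv c x)))"
  proof (rule smooth_on_compose[OF oc oa, where f = "\<lambda>x. cmap a (cinv c x)" and g = "\<lambda>y. cmap d (cinv a y)"])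
    show "(\<lambda>x. cmap a (cinv c x)) ` cmap c ` ?W \<subseteq> cmap a ` ?W" using cinv_cmap[OF c] by auto
    show "smooth_on (cmap a ` ?W) (\<lambda>y. cmap d (cinv a y))"
      by (rule smooth_on_mono[OF transition_atlas(2)[OF d a(1)]]) blast
    show "smooth_on (cmap c ` ?W) (\<lambda>x. cmap a (cinv c x))"
      by (rule smooth_on_mono[OF transition_atlas(1)[OF c a(1)]]) blast
  qed
  then have "smooth_on (cmap c ` ?W) (\<lambda>x. cmap d (cinv c x))"
    by (rule smooth_on_cong[OF oc, rotated]) (auto simp: cinv_cmap[OF c] cinv_cmap[OF ca])
  then show "\<exists>V. open V \<and> x \<in> V \<and> smooth_on V (\<lambda>x. cmap d (cinv c x))" using oc p a by blast
qed

lemma transition_has_derivative: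
  assumes "smooth_atlas A" "compatible A c" "compatible A d" "p \<in> cdom c" "p \<in> cdom d"
  shows "((\<lambda>x. cmap d (cinv c x)) has_derivative frechet_derivative (\<lambda>x. cmap d (cinv c x)) (at (cmap c p))) (at (cmap c p))"
  by (rule smooth_on_has_derivative[OF transition_smooth[OF assms(1-3)]]) (use assms in auto)

lemma to_chart_eq:
  "to_chart A c p = frechet_derivative (\<lambda>x. cmap c (cinv (chart_at A p) x)) (at (cmap (chart_at A p) p))"
  by (simp add: to_chart_def o_def)

lemma to_chart_change:
  assumes A: "smooth_atlas A" and c: "compatible A c" "p \<in> cdom c" and d: "compatible A d" "p \<in> cdom d"
  shows "to_chart A d p v = frechet_derivative (\<lambda>x. cmap d (cinv c x)) (at (cmap c p)) (to_chart A c p v)"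
proof -
  let ?a = "chart_at A p"
  have a: "compatible A ?a" "p \<in> cdom ?a" using chart_at_compatible[OF A] chart_at[OF A] by blast+
  let ?W = "cdom ?a \<inter> cdom c \<inter> cdom d"
  have oa: "open (cmap ?a ` ?W)"
    by (rule open_cmap_image[OF a(1)]) (auto intro: compatible_open(1)[OF c(1)] compatible_open(1)[OF d(1)] compatible_open(1)[OF a(1)])
  have p: "cmap ?a p \<in> cmap ?a ` ?W" using a c d by blast
  have "((\<lambda>x. (\<lambda>y. cmap d (cinv c y)) (cmap c (cinv ?a x))) has_derivative
     (\<lambda>v. frechet_derivative (\<lambda>x. cmap d (cinv c x)) (at (cmap c p)) (to_chart A c p v))) (at (cmap ?a p))"
  proof (rule has_derivative_compose[where g = "\<lambda>y. cmap d (cinv c y)" and f = "\<lambda>x. cmap c (cinv ?a x)" and f' = "to_chart A c p"])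
    show "((\<lambda>x. cmap c (cinv ?a x)) has_derivative to_chart A c p) (at (cmap ?a p))"
      unfolding to_chart_eq by (rule transition_has_derivative[OF A a(1) c(1) a(2) c(2)])
    show "((\<lambda>y. cmap d (cinv c y)) has_derivative frechet_derivative (\<lambda>x. cmap d (cinv c x)) (at (cmap c p)))
        (at (cmap c (cinv ?a (cmap ?a p))))"
      using transition_has_derivative[OF A c(1) d(1) c(2) d(2)] cinv_cmap[OF a] by simp
  qed
  then have "((\<lambda>x. cmap d (cinv ?a x)) has_derivative
     (\<lambda>v. frechet_derivative (\<lambda>x. cmap d (cinv c x)) (at (cmap c p)) (to_chart A c p v))) (at (cmap ?a p))"
    by (rule has_derivative_transform_within_open[OF _ oa p]) (auto simp: cinv_cmap[OF a(1)] cinv_cmap[OF c(1)])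
  then show ?thesis unfolding to_chart_eq[of A d p] by (simp add: frechet_derivative_eq)
qed

lemma to_chart_linear:
  assumes A: "smooth_atlas A" and c: "compatible A c" "p \<in> cdom c"
  shows "linear (to_chart A c p)"
  unfolding to_chart_eq using chart_at_compatible[OF A] chart_at[OF A] c
  by (intro smooth_on_linear_derivative[OF transition_smooth[OF A]]) auto

lemma to_chart_chart_at:
  assumes A: "smooth_atlas A"
  shows "to_chart A (chart_at A p) p v = v"
proof -
  let ?a = "chart_at A p"
  have a: "compatible A ?a" "p \<in> cdom ?a" using chart_at_compatible[OF A] chart_at[OF A] by blast+
  have "((\<lambda>x. cmap ?a (cinv ?a x)) has_derivative (\<lambda>v. v)) (at (cmap ?a p))"
    by (rule has_derivative_transform_within_open[OF has_derivative_ident compatible_open(2)[OF a(1)]])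
      (use a(2) in \<open>auto simp: cinv_cmap[OF a(1)]\<close>)
  then show ?thesis unfolding to_chart_eq by (simp add: frechet_derivative_eq)
qed

lemma to_chart_bij:
  assumes A: "smooth_atlas A" and c: "compatible A c" "p \<in> cdom c"
  shows "bij (to_chart A c p)"
proof -
  have "inj (to_chart A c p)"
  proof (rule injI)
    fix u v assume "to_chart A c p u = to_chart A c p v"
    then have "to_chart A (chart_at A p) p u = to_chart A (chart_at A p) p v"
      using to_chart_change[OF A c chart_at_compatible[OF A]] chart_at[OF A] by metis
    then show "u = v" by (simp add: to_chart_chart_at[OF A])
  qed
  then show ?thesis using linear_inj_imp_surj[OF to_chart_linear[OF assms]] by (simp add: bij_def)
qed

definition from_chart :: "('m::topological_space, 'e::euclidean_space) chart set \<Rightarrow> ('m, 'e) chart \<Rightarrow> 'm \<Rightarrow> 'e \<Rightarrow> 'e" where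
  "from_chart A c p = inv (to_chart A c p)"

lemma to_from_chart [simp]:
  "smooth_atlas A \<Longrightarrow> compatible A c \<Longrightarrow> p \<in> cdom c \<Longrightarrow> to_chart A c p (from_chart A c p v) = v"
  using to_chart_bij by (metis bij_is_surj from_chart_def surj_f_inv_f)

lemma from_to_chart [simp]:
  "smooth_atlas A \<Longrightarrow> compatible A c \<Longrightarrow> p \<in> cdom c \<Longrightarrow> from_chart A c p (to_chart A c p v) = v"
  using to_chart_bij by (metis bij_is_inj from_chart_def inv_f_f)

lemma from_chart_linear:
  assumes "smooth_atlas A" "compatible A c" "p \<in> cdom c"
  shows "linear (from_chart A c p)"
proof (rule linearI)
  note l = to_chart_linear[OF assms] and i = from_to_chart[OF assms] and j = to_from_chart[OF assms]
  show "from_chart A c p (a + b) = from_chart A c p a + from_chart A c p b" for a b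
    using i[of "from_chart A c p a + from_chart A c p b"] by (simp add: linear_add[OF l] j)
  show "from_chart A c p (r *\<^sub>R a) = r *\<^sub>R from_chart A c p a" for r a
    using i[of "r *\<^sub>R from_chart A c p a"] by (simp add: linear_scale[OF l] j)
qed

subsection \<open>Smooth maps and their differentials in charts\<close>

lemma smooth_map_on_open_rep:
  assumes "compatible A c" "compatible B d" "open W" "continuous_on W f"
  shows "open (cdom c \<inter> W \<inter> f -` cdom d)" "open (cmap c ` (cdom c \<inter> W \<inter> f -` cdom d))"
proof -
  have "open (W \<inter> f -` cdom d)"
    by (rule continuous_open_preimage[OF assms(4,3) compatible_open(1)[OF assms(2)]])
  then show "open (cdom c \<inter> W \<inter> f -` cdom d)"
    using compatible_open(1)[OF assms(1)] by (simp add: Int_assoc open_Int)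
  then show "open (cmap c ` (cdom c \<inter> W \<inter> f -` cdom d))"
    by (rule open_cmap_image[OF assms(1)]) blast
qed

text \<open>Smoothness is tested in charts of \<open>A\<close> and \<open>B\<close> only; near each
  point the representation in other compatible charts is such a test composed with transition maps
  on both sides.\<close>

lemma smooth_map_on_rep:
  assumes A: "smooth_atlas A" and B: "smooth_atlas B" and c: "compatible A c" and d: "compatible B d"
    and W: "open W" and f: "smooth_map_on A B W f"
  shows "smooth_on (cmap c ` (cdom c \<inter> W \<inter> f -` cdom d)) (\<lambda>x. cmap d (f (cinv c x)))"
proof (rule smooth_on_local)
  have cf: "continuous_on W f" using f by (simp add: smooth_map_on_def)
  fix x assume "x \<in> cmap c ` (cdom c \<inter> W \<inter> f -` cdom d)"
  then obtain p where p: "p \<in> cdom c" "p \<in> W" "f p \<in> cdom d" "x = cmap c p" by blast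
  obtain a where a: "a \<in> A" "p \<in> cdom a" using atlas_cover[OF A] by blast
  obtain b where b: "b \<in> B" "f p \<in> cdom b" using atlas_cover[OF B] by blast
  note ca = atlas_compatible[OF A a(1)] and cb = atlas_compatible[OF B b(1)]
  let ?V = "(cdom c \<inter> W \<inter> f -` cdom d) \<inter> (cdom a \<inter> W \<inter> f -` cdom b)"
  have V: "open ?V"
    by (intro open_Int smooth_map_on_open_rep(1)[OF c d W cf] smooth_map_on_open_rep(1)[OF ca cb W cf])
  have oc: "open (cmap c ` ?V)" by (rule open_cmap_image[OF c V]) blast
  have oa: "open (cmap a ` ?V)" by (rule open_cmap_image[OF ca V]) blast
  have ob: "open (cmap b ` (cdom b \<inter> cdom d))" by (rule open_chart_overlap[OF cb d])
  have s1: "smooth_on (cmap a ` ?V) (\<lambda>x. cmap b (f (cinv a x)))"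
  proof (rule smooth_on_mono)
    show "smooth_on (cmap a ` (cdom a \<inter> W \<inter> f -` cdom b)) (\<lambda>x. cmap b (f (cinv a x)))"
      using f a b by (auto simp: smooth_map_on_def o_def)
  qed blast
  have "smooth_on (cmap a ` ?V) (\<lambda>x. (\<lambda>y. cmap d (cinv b y)) (cmap b (f (cinv a x))))"
    by (rule smooth_on_compose[OF oa ob _ transition_smooth[OF B cb d] s1]) (auto simp: cinv_cmap[OF ca])
  then have s2: "smooth_on (cmap a ` ?V) (\<lambda>x. cmap d (f (cinv a x)))"
    by (rule smooth_on_cong[OF oa, rotated]) (auto simp: cinv_cmap[OF ca] cinv_cmap[OF cb])
  have "smooth_on (cmap c ` ?V) (\<lambda>x. (\<lambda>y. cmap d (f (cinv a y))) (cmap a (cinv c x)))"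
  proof (rule smooth_on_compose[OF oc oa _ s2])
    show "smooth_on (cmap c ` ?V) (\<lambda>x. cmap a (cinv c x))"
      by (rule smooth_on_mono[OF transition_smooth[OF A c ca]]) blast
  qed (auto simp: cinv_cmap[OF c])
  then have "smooth_on (cmap c ` ?V) (\<lambda>x. cmap d (f (cinv c x)))"
    by (rule smooth_on_cong[OF oc, rotated]) (auto simp: cinv_cmap[OF ca] cinv_cmap[OF c])
  then show "\<exists>V. open V \<and> x \<in> V \<and> smooth_on V (\<lambda>x. cmap d (f (cinv c x)))" using oc p a b by blast
qed

lemma smooth_map_on_has_derivative:
  assumes "smooth_atlas A" "smooth_atlas B" "compatible A c" "compatible B d" "open W" "smooth_map_on A B W f"
    "p \<in> cdom c" "p \<in> W" "f p \<in> cdom d"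
  shows "((\<lambda>x. cmap d (f (cinv c x))) has_derivative frechet_derivative (\<lambda>x. cmap d (f (cinv c x))) (at (cmap c p))) (at (cmap c p))"
  by (rule smooth_on_has_derivative[OF smooth_map_on_rep[OF assms(1-6)]]) (use assms in auto)

lemma differential_chart:
  assumes A: "smooth_atlas A" and B: "smooth_atlas B" and c: "compatible A c" "p \<in> cdom c"
    and d: "compatible B d" "f p \<in> cdom d" and W: "open W" "p \<in> W" and f: "smooth_map_on A B W f"
  shows "to_chart B d (f p) (differential A B f p v) =
    frechet_derivative (\<lambda>x. cmap d (f (cinv c x))) (at (cmap c p)) (to_chart A c p v)"
proof -
  let ?a = "chart_at A p" and ?b = "chart_at B (f p)"
  have a: "compatible A ?a" "p \<in> cdom ?a" using chart_at_compatible[OF A] chart_at[OF A] by blast+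
  have b: "compatible B ?b" "f p \<in> cdom ?b" using chart_at_compatible[OF B] chart_at[OF B] by blast+
  have cf: "continuous_on W f" using f by (simp add: smooth_map_on_def)
  let ?V = "(cdom c \<inter> W \<inter> f -` cdom d) \<inter> (cdom ?a \<inter> W \<inter> f -` cdom ?b)"
  have V: "open ?V"
    by (intro open_Int smooth_map_on_open_rep(1)[OF c(1) d(1) W(1) cf] smooth_map_on_open_rep(1)[OF a(1) b(1) W(1) cf])
  have oa: "open (cmap ?a ` ?V)" by (rule open_cmap_image[OF a(1) V]) blast
  have pV: "cmap ?a p \<in> cmap ?a ` ?V" using a b c d W by blast
  have 1: "((\<lambda>x. (\<lambda>y. cmap d (cinv ?b y)) (cmap ?b (f (cinv ?a x)))) has_derivative
    (\<lambda>v. to_chart B d (f p) (differential A B f p v))) (at (cmap ?a p))"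
  proof (rule has_derivative_compose[where g = "\<lambda>y. cmap d (cinv ?b y)" and f = "\<lambda>x. cmap ?b (f (cinv ?a x))" and f' = "differential A B f p"])
    show "((\<lambda>x. cmap ?b (f (cinv ?a x))) has_derivative differential A B f p) (at (cmap ?a p))"
      using smooth_map_on_has_derivative[OF A B a(1) b(1) W(1) f a(2) W(2) b(2)] by (simp add: differential_def o_def)
    show "((\<lambda>y. cmap d (cinv ?b y)) has_derivative to_chart B d (f p)) (at (cmap ?b (f (cinv ?a (cmap ?a p)))))"
      unfolding to_chart_eq using transition_has_derivative[OF B b(1) d(1) b(2) d(2)] cinv_cmap[OF a] by simp
  qed
  have 2: "((\<lambda>x. (\<lambda>y. cmap d (f (cinv c y))) (cmap c (cinv ?a x))) has_derivative
    (\<lambda>v. frechet_derivative (\<lambda>x. cmap d (f (cinv c x))) (at (cmap c p)) (to_chart A c p v))) (at (cmap ?a p))"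
  proof (rule has_derivative_compose[where g = "\<lambda>y. cmap d (f (cinv c y))" and f = "\<lambda>x. cmap c (cinv ?a x)" and f' = "to_chart A c p"])
    show "((\<lambda>x. cmap c (cinv ?a x)) has_derivative to_chart A c p) (at (cmap ?a p))"
      unfolding to_chart_eq by (rule transition_has_derivative[OF A a(1) c(1) a(2) c(2)])
    show "((\<lambda>y. cmap d (f (cinv c y))) has_derivative frechet_derivative (\<lambda>x. cmap d (f (cinv c x))) (at (cmap c p)))
        (at (cmap c (cinv ?a (cmap ?a p))))"
      using smooth_map_on_has_derivative[OF A B c(1) d(1) W(1) f c(2) W(2) d(2)] cinv_cmap[OF a] by simp
  qed
  have "((\<lambda>x. (\<lambda>y. cmap d (f (cinv c y))) (cmap c (cinv ?a x))) has_derivative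
    (\<lambda>v. to_chart B d (f p) (differential A B f p v))) (at (cmap ?a p))"
    by (rule has_derivative_transform_within_open[OF 1 oa pV]) (auto simp: cinv_cmap[OF a(1)] cinv_cmap[OF b(1)] cinv_cmap[OF c(1)])
  from fun_cong[OF has_derivative_unique[OF 2 this], of v] show ?thesis by simp
qed

text \<open>Continuity is part of smoothness. It is recovered from the local representation with
  \<open>cinv d\<close>, which is possible because \<open>f\<close> maps the neighbourhood into the
  domain of \<open>d\<close>.\<close>

lemma smooth_map_onI:
  assumes A: "smooth_atlas A" and B: "smooth_atlas B"
    and loc: "\<And>p. p \<in> W \<Longrightarrow> \<exists>c d V. compatible A c \<and> compatible B d \<and> open V \<and> p \<in> V \<and> V \<subseteq> W \<inter> cdom c \<and>
      f ` V \<subseteq> cdom d \<and> smooth_on (cmap c ` V) (\<lambda>x. cmap d (f (cinv c x)))"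
  shows "smooth_map_on A B W f"
  unfolding smooth_map_on_def
proof (intro conjI ballI)
  have key: "\<exists>V. open V \<and> p \<in> V \<and> V \<subseteq> W \<and> continuous_on V f \<and>
     (\<forall>a\<in>A. \<forall>b\<in>B. p \<in> cdom a \<longrightarrow> f p \<in> cdom b \<longrightarrow>
       (\<exists>X. open X \<and> cmap a p \<in> X \<and> smooth_on X (\<lambda>x. cmap b (f (cinv a x)))))" if "p \<in> W" for p
  proof -
    obtain c d V where c: "compatible A c" and d: "compatible B d" and V: "open V" "p \<in> V" "V \<subseteq> W \<inter> cdom c"
      "f ` V \<subseteq> cdom d" and s: "smooth_on (cmap c ` V) (\<lambda>x. cmap d (f (cinv c x)))"
      using loc[OF \<open>p \<in> W\<close>] by blast
    have oc: "open (cmap c ` V)" by (rule open_cmap_image[OF c V(1)]) (use V in blast)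
    have "continuous_on V (\<lambda>q. cinv d (cmap d (f (cinv c (cmap c q)))))"
    proof (rule continuous_on_compose2[OF continuous_cinv[OF d]])
      show "continuous_on V (\<lambda>q. cmap d (f (cinv c (cmap c q))))"
        by (rule continuous_on_compose2[OF smooth_on_continuous[OF s] continuous_on_subset[OF continuous_cmap[OF c]]])
          (use V in auto)
      show "(\<lambda>q. cmap d (f (cinv c (cmap c q)))) ` V \<subseteq> cmap d ` cdom d" using V cinv_cmap[OF c] by (auto simp: subset_eq)
    qed
    moreover have "cinv d (cmap d (f (cinv c (cmap c q)))) = f q" if "q \<in> V" for q
      using that V cinv_cmap[OF c] cinv_cmap[OF d] by (metis Int_iff image_subset_iff subsetD)
    ultimately have cf: "continuous_on V f" using continuous_on_cong by (metis (no_types, lifting))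
    moreover have "\<exists>X. open X \<and> cmap a p \<in> X \<and> smooth_on X (\<lambda>x. cmap b (f (cinv a x)))"
      if a: "a \<in> A" "p \<in> cdom a" and b: "b \<in> B" "f p \<in> cdom b" for a b
    proof -
      note ca = atlas_compatible[OF A a(1)] and cb = atlas_compatible[OF B b(1)]
      let ?V = "cdom a \<inter> V \<inter> f -` cdom b"
      have oV: "open ?V" by (rule smooth_map_on_open_rep(1)[OF ca cb V(1) cf])
      have oc: "open (cmap c ` ?V)" by (rule open_cmap_image[OF c oV]) (use V in blast)
      have oa: "open (cmap a ` ?V)" by (rule open_cmap_image[OF ca oV]) blast
      have od: "open (cmap d ` (cdom d \<inter> cdom b))" by (rule open_chart_overlap[OF d cb])
      have "smooth_on (cmap c ` ?V) (\<lambda>x. (\<lambda>y. cmap b (cinv d y)) (cmap d (f (cinv c x))))"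
        by (rule smooth_on_compose[OF oc od _ transition_smooth[OF B d cb] smooth_on_mono[OF s]])
          (use V cinv_cmap[OF c] in \<open>auto simp: subset_eq\<close>)
      then have "smooth_on (cmap a ` ?V) (\<lambda>x. (\<lambda>y. cmap b (cinv d (cmap d (f (cinv c y))))) (cmap c (cinv a x)))"
        using smooth_on_compose[OF oa oc _ _ smooth_on_mono[OF transition_smooth[OF A ca c]]] V cinv_cmap[OF ca]
        by (auto simp: subset_eq)
      then have "smooth_on (cmap a ` ?V) (\<lambda>x. cmap b (f (cinv a x)))"
      proof (rule smooth_on_cong[OF oa, rotated])
        fix x assume "x \<in> cmap a ` ?V"
        then obtain q where q: "q \<in> ?V" "x = cmap a q" by blast
        then have "cinv a x = q" "cinv c (cmap c q) = q" "f q \<in> cdom d"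
          using cinv_cmap[OF ca] cinv_cmap[OF c] V by blast+
        then show "cmap b (cinv d (cmap d (f (cinv c (cmap c (cinv a x)))))) = cmap b (f (cinv a x))"
          by (simp add: cinv_cmap[OF d])
      qed
      then show ?thesis using oa a b V by blast
    qed
    ultimately show ?thesis using V by blast
  qed
  show "continuous_on W f"
  proof -
    let ?S = "{V. open V \<and> V \<subseteq> W \<and> continuous_on V f}"
    have "continuous_on (\<Union>?S) f" by (rule continuous_on_open_Union) auto
    moreover have "\<Union>?S = W" using key by blast
    ultimately show ?thesis by simp
  qed
  fix a b assume a: "a \<in> A" and b: "b \<in> B"
  show "smooth_on (cmap a ` (cdom a \<inter> W \<inter> f -` cdom b)) (cmap b \<circ> f \<circ> cinv a)"
    unfolding o_def by (rule smooth_on_local) (use key a b in blast)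
qed

lemma smooth_atlas_model: "smooth_atlas model_atlas"
proof -
  have "homeomorphism UNIV UNIV (id :: 'a \<Rightarrow> 'a) (inv id)" by (simp add: homeomorphism_def)
  moreover have "smooth_on UNIV (id \<circ> inv id :: 'a \<Rightarrow> 'a)" using smooth_on_ident[of UNIV] by (simp add: id_def[symmetric])
  ultimately show ?thesis by (simp add: smooth_atlas_def model_atlas_def)
qed

lemma compatible_model: "compatible model_atlas (UNIV, id)"
  using atlas_compatible[OF smooth_atlas_model] by (simp add: model_atlas_def)

lemma chart_at_model: "chart_at model_atlas p = (UNIV, id)"
  using chart_at[OF smooth_atlas_model, of p] by (simp add: model_atlas_def)

lemma to_chart_model: "to_chart model_atlas (UNIV, id) p v = v"
  using to_chart_chart_at[OF smooth_atlas_model, of p v] by (simp add: chart_at_model)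

lemma smooth_function_rep:
  assumes "smooth_atlas A" "compatible A c" "open W" "smooth_map_on A model_atlas W f"
  shows "smooth_on (cmap c ` (cdom c \<inter> W)) (\<lambda>x. f (cinv c x))"
  using smooth_map_on_rep[OF assms(1) smooth_atlas_model assms(2) compatible_model assms(3,4)] by simp

lemma smooth_functionI:
  assumes A: "smooth_atlas A" and "\<And>p. p \<in> W \<Longrightarrow> \<exists>c V. compatible A c \<and> open V \<and> p \<in> V \<and> V \<subseteq> W \<inter> cdom c \<and>
      smooth_on (cmap c ` V) (\<lambda>x. f (cinv c x))"
  shows "smooth_map_on A model_atlas W f"
proof (rule smooth_map_onI[OF A smooth_atlas_model])
  fix p assume "p \<in> W"
  then obtain c V where "compatible A c" "open V" "p \<in> V" "V \<subseteq> W \<inter> cdom c" "smooth_on (cmap c ` V) (\<lambda>x. f (cinv c x))"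
    using assms(2) by blast
  then show "\<exists>c d V. compatible A c \<and> compatible model_atlas d \<and> open V \<and> p \<in> V \<and> V \<subseteq> W \<inter> cdom c \<and>
      f ` V \<subseteq> cdom d \<and> smooth_on (cmap c ` V) (\<lambda>x. cmap d (f (cinv c x)))"
    using compatible_model by (intro exI[of _ c] exI[of _ "(UNIV, id)"] exI[of _ V]) auto
qed

lemma differential_function:
  assumes A: "smooth_atlas A" and c: "compatible A c" "p \<in> cdom c" and W: "open W" "p \<in> W"
    and f: "smooth_map_on A model_atlas W f"
  shows "differential A model_atlas f p v = frechet_derivative (\<lambda>x. f (cinv c x)) (at (cmap c p)) (to_chart A c p v)"
  using differential_chart[OF A smooth_atlas_model c compatible_model _ W f] by (simp add: to_chart_model)

subsection \<open>Vector fields in charts\<close>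

lemma field_rep_eq: "field_rep A c X x = to_chart A c (cinv c x) (X (cinv c x))"
  by (simp add: field_rep_def)

lemma field_rep_cmap:
  "compatible A c \<Longrightarrow> q \<in> cdom c \<Longrightarrow> field_rep A c X (cmap c q) = to_chart A c q (X q)"
  by (simp add: field_rep_eq cinv_cmap)

lemma field_rep_change:
  assumes "smooth_atlas A" "compatible A c" "q \<in> cdom c" "compatible A d" "q \<in> cdom d"
  shows "field_rep A d X (cmap d q) = frechet_derivative (\<lambda>x. cmap d (cinv c x)) (at (cmap c q)) (field_rep A c X (cmap c q))"
  using assms by (simp add: field_rep_cmap to_chart_change[OF assms])

lemma smooth_field_rep_change:
  assumes A: "smooth_atlas A" and c: "compatible A c" and d: "compatible A d" and V: "open V" "V \<subseteq> cdom c \<inter> cdom d"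
    and s: "smooth_on (cmap c ` V) (field_rep A c X)"
  shows "smooth_on (cmap d ` V) (field_rep A d X)"
proof -
  have oc: "open (cmap c ` V)" by (rule open_cmap_image[OF c V(1)]) (use V in blast)
  have od: "open (cmap d ` V)" by (rule open_cmap_image[OF d V(1)]) (use V in blast)
  have "smooth_on (cmap c ` V) (\<lambda>y. frechet_derivative (\<lambda>x. cmap d (cinv c x)) (at y) (field_rep A c X y))"
    by (rule smooth_on_derivative_field[OF oc smooth_on_mono[OF transition_smooth[OF A c d]] s]) (use V in blast)
  moreover have "smooth_on (cmap d ` V) (\<lambda>x. cmap c (cinv d x))"
    by (rule smooth_on_mono[OF transition_smooth[OF A d c]]) (use V in blast)
  ultimately have "smooth_on (cmap d ` V) (\<lambda>z. (\<lambda>y. frechet_derivative (\<lambda>x. cmap d (cinv c x)) (at y) (field_rep A c X y)) (cmap c (cinv d z)))"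
    by (rule smooth_on_compose[OF od oc, rotated]) (use V cinv_cmap[OF d] in \<open>auto simp: subset_eq\<close>)
  then show ?thesis
  proof (rule smooth_on_cong[OF od, rotated])
    fix z assume "z \<in> cmap d ` V"
    then obtain q where q: "q \<in> V" "z = cmap d q" by blast
    then show "frechet_derivative (\<lambda>x. cmap d (cinv c x)) (at (cmap c (cinv d z))) (field_rep A c X (cmap c (cinv d z))) = field_rep A d X z"
      using field_rep_change[OF A c _ d, of q X] V cinv_cmap[OF d, of q] by (auto simp: subset_eq)
  qed
qed

lemma vector_field_onI:
  assumes A: "smooth_atlas A" and loc: "\<And>p. p \<in> W \<Longrightarrow> \<exists>c V. compatible A c \<and> open V \<and> p \<in> V \<and> V \<subseteq> W \<inter> cdom c \<and>
      smooth_on (cmap c ` V) (field_rep A c X)"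
  shows "vector_field_on A W X"
  unfolding vector_field_on_def
proof (intro ballI smooth_on_local)
  fix a x assume a: "a \<in> A" and "x \<in> cmap a ` (cdom a \<inter> W)"
  then obtain p where p: "p \<in> cdom a" "p \<in> W" "x = cmap a p" by blast
  obtain c V where c: "compatible A c" and V: "open V" "p \<in> V" "V \<subseteq> W \<inter> cdom c"
    and s: "smooth_on (cmap c ` V) (field_rep A c X)" using loc[OF p(2)] by blast
  note ca = atlas_compatible[OF A a]
  let ?V = "V \<inter> cdom a"
  have oV: "open ?V" using V compatible_open(1)[OF ca] by blast
  have "smooth_on (cmap a ` ?V) (field_rep A a X)"
    by (rule smooth_field_rep_change[OF A c ca oV _ smooth_on_mono[OF s]]) (use V in auto)
  moreover have "open (cmap a ` ?V)" by (rule open_cmap_image[OF ca oV]) blast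
  ultimately show "\<exists>V. open V \<and> x \<in> V \<and> smooth_on V (field_rep A a X)" using p V by blast
qed

lemma vector_field_on_rep:
  assumes A: "smooth_atlas A" and c: "compatible A c" and W: "open W" and X: "vector_field_on A W X"
  shows "smooth_on (cmap c ` (cdom c \<inter> W)) (field_rep A c X)"
proof (rule smooth_on_local)
  fix x assume "x \<in> cmap c ` (cdom c \<inter> W)"
  then obtain p where p: "p \<in> cdom c" "p \<in> W" "x = cmap c p" by blast
  obtain a where a: "a \<in> A" "p \<in> cdom a" using atlas_cover[OF A] by blast
  note ca = atlas_compatible[OF A a(1)]
  let ?V = "cdom a \<inter> cdom c \<inter> W"
  have oV: "open ?V" using W compatible_open(1)[OF ca] compatible_open(1)[OF c] by blast
  have "smooth_on (cmap a ` (cdom a \<inter> W)) (field_rep A a X)" using X a by (auto simp: vector_field_on_def)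
  then have "smooth_on (cmap a ` ?V) (field_rep A a X)" by (rule smooth_on_mono) blast
  then have "smooth_on (cmap c ` ?V) (field_rep A c X)"
    by (rule smooth_field_rep_change[OF A ca c oV, rotated]) blast
  moreover have "open (cmap c ` ?V)" by (rule open_cmap_image[OF c oV]) blast
  ultimately show "\<exists>V. open V \<and> x \<in> V \<and> smooth_on V (field_rep A c X)" using p a by blast
qed

lemma vector_field_on_mono:
  "vector_field_on A W X \<Longrightarrow> V \<subseteq> W \<Longrightarrow> vector_field_on A V X"
  unfolding vector_field_on_def by (blast intro: smooth_on_mono)

lemma vector_field_on_cong:
  assumes A: "smooth_atlas A" and W: "open W" and X: "vector_field_on A W X" and eq: "\<And>q. q \<in> W \<Longrightarrow> X q = Y q"
  shows "vector_field_on A W Y"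
  unfolding vector_field_on_def
proof
  fix c assume c: "c \<in> A"
  note cc = atlas_compatible[OF A c]
  have o: "open (cmap c ` (cdom c \<inter> W))" by (rule open_cmap_image[OF cc]) (auto intro: W compatible_open(1)[OF cc])
  have "smooth_on (cmap c ` (cdom c \<inter> W)) (field_rep A c X)" using X c by (simp add: vector_field_on_def)
  then show "smooth_on (cmap c ` (cdom c \<inter> W)) (field_rep A c Y)"
    by (rule smooth_on_cong[OF o, rotated]) (auto simp: field_rep_cmap[OF cc] eq)
qed

lemma vector_field_from_chart:
  assumes A: "smooth_atlas A" and c: "compatible A c" and V: "open V" "V \<subseteq> cdom c" and s: "smooth_on (cmap c ` V) \<xi>"
  shows "vector_field_on A V (\<lambda>q. from_chart A c q (\<xi> (cmap c q)))"
proof (rule vector_field_onI[OF A])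
  fix p assume p: "p \<in> V"
  have "smooth_on (cmap c ` V) (field_rep A c (\<lambda>q. from_chart A c q (\<xi> (cmap c q))))"
    by (rule smooth_on_cong[OF open_cmap_image[OF c V] _ s])
      (use V A c in \<open>auto simp: field_rep_cmap[OF c] subset_eq\<close>)
  then show "\<exists>c' V'. compatible A c' \<and> open V' \<and> p \<in> V' \<and> V' \<subseteq> V \<inter> cdom c' \<and>
      smooth_on (cmap c' ` V') (field_rep A c' (\<lambda>q. from_chart A c q (\<xi> (cmap c q))))"
    using c V p by (intro exI[of _ c] exI[of _ V]) auto
qed

lemma vector_field_on_zero: "smooth_atlas A \<Longrightarrow> vector_field_on A W (\<lambda>q. 0)"
proof -
  assume A: "smooth_atlas A"
  have "smooth_on (cmap c ` (cdom c \<inter> W)) (field_rep A c (\<lambda>q. 0))" if "c \<in> A" for c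
  proof (rule smooth_on_mono[OF smooth_on_cong[OF compatible_open(2)[OF atlas_compatible[OF A that]] _ smooth_on_const[of _ 0]]])
    show "0 = field_rep A c (\<lambda>q. 0) x" if "x \<in> cmap c ` cdom c" for x
      using linear_0[OF to_chart_linear[OF A atlas_compatible[OF A \<open>c \<in> A\<close>] cinv_in[OF that]]]
      by (simp add: field_rep_eq)
  qed blast
  then show ?thesis by (simp add: vector_field_on_def)
qed

lemma vector_field_on_add:
  assumes A: "smooth_atlas A" and W: "open W" and X: "vector_field_on A W X" and Y: "vector_field_on A W Y"
  shows "vector_field_on A W (\<lambda>q. X q + Y q)"
  unfolding vector_field_on_def
proof
  fix c assume c: "c \<in> A"
  note cc = atlas_compatible[OF A c]
  have o: "open (cmap c ` (cdom c \<inter> W))" by (rule open_cmap_image[OF cc]) (auto intro: W compatible_open(1)[OF cc])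
  have "smooth_on (cmap c ` (cdom c \<inter> W)) (\<lambda>x. field_rep A c X x + field_rep A c Y x)"
    using X Y c by (intro smooth_on_add o) (auto simp: vector_field_on_def)
  then show "smooth_on (cmap c ` (cdom c \<inter> W)) (field_rep A c (\<lambda>q. X q + Y q))"
    by (rule smooth_on_cong[OF o, rotated]) (auto simp: field_rep_cmap[OF cc] linear_add[OF to_chart_linear[OF A cc]])
qed

lemma vector_field_on_scaleR:
  assumes A: "smooth_atlas A" and W: "open W" and f: "smooth_map_on A model_atlas W f" and Y: "vector_field_on A W Y"
  shows "vector_field_on A W (\<lambda>q. f q *\<^sub>R Y q)"
  unfolding vector_field_on_def
proof
  fix c assume c: "c \<in> A"
  note cc = atlas_compatible[OF A c]
  have o: "open (cmap c ` (cdom c \<inter> W))" by (rule open_cmap_image[OF cc]) (auto intro: W compatible_open(1)[OF cc])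
  have "smooth_on (cmap c ` (cdom c \<inter> W)) (\<lambda>x. f (cinv c x) *\<^sub>R field_rep A c Y x)"
    using smooth_function_rep[OF A cc W f] Y c by (intro smooth_on_scaleR o) (auto simp: vector_field_on_def)
  then show "smooth_on (cmap c ` (cdom c \<inter> W)) (field_rep A c (\<lambda>q. f q *\<^sub>R Y q))"
    by (rule smooth_on_cong[OF o, rotated])
      (auto simp: field_rep_cmap[OF cc] cinv_cmap[OF cc] linear_scale[OF to_chart_linear[OF A cc]])
qed

lemma smooth_function_const: "smooth_atlas A \<Longrightarrow> smooth_map_on A model_atlas W (\<lambda>q. r)"
  by (simp add: smooth_map_on_def o_def model_atlas_def)

lemma vector_field_on_diff:
  assumes A: "smooth_atlas A" and W: "open W" and X: "vector_field_on A W X" and Y: "vector_field_on A W Y"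
  shows "vector_field_on A W (\<lambda>q. X q - Y q)"
  using vector_field_on_add[OF A W X vector_field_on_scaleR[OF A W smooth_function_const[OF A, of W "-1"] Y]] by simp

lemma vector_field_on_sum:
  assumes A: "smooth_atlas A" and W: "open W" and X: "\<And>i. i \<in> I \<Longrightarrow> vector_field_on A W (X i)"
  shows "vector_field_on A W (\<lambda>q. \<Sum>i\<in>I. X i q)"
  using X by (induction I rule: infinite_finite_induct)
    (auto intro: vector_field_on_zero[OF A] vector_field_on_add[OF A W])

text \<open>The bracket of \<open>T\<close>-related fields: the second derivative of the transition map \<open>T\<close> is
  symmetric and cancels.\<close>
lemma lie_bracket_chart:
  assumes A: "smooth_atlas A" and c: "compatible A c" "p \<in> cdom c" and W: "open W" "p \<in> W"
    and X: "vector_field_on A W X" and Y: "vector_field_on A W Y"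
  shows "to_chart A c p (lie_bracket A X Y p) =
    frechet_derivative (field_rep A c Y) (at (cmap c p)) (to_chart A c p (X p)) -
    frechet_derivative (field_rep A c X) (at (cmap c p)) (to_chart A c p (Y p))"
proof -
  let ?a = "chart_at A p"
  have a: "compatible A ?a" "p \<in> cdom ?a" using chart_at_compatible[OF A] chart_at[OF A] by blast+
  let ?V = "cdom ?a \<inter> cdom c \<inter> W"
  have V: "open ?V" by (intro open_Int compatible_open(1)[OF a(1)] compatible_open(1)[OF c(1)] W(1))
  let ?U = "cmap ?a ` ?V"
  have oa: "open ?U" by (rule open_cmap_image[OF a(1) V]) blast
  let ?x = "cmap ?a p"
  have x: "?x \<in> ?U" using a c W by blast
  define T where "T = (\<lambda>x. cmap c (cinv ?a x))"
  have sT: "smooth_on ?U T" unfolding T_def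
    by (rule smooth_on_mono[OF transition_smooth[OF A a(1) c(1)]]) blast
  have Tx: "T ?x = cmap c p" by (simp add: T_def cinv_cmap[OF a])
  have tc: "to_chart A c p = frechet_derivative T (at ?x)" by (simp add: to_chart_eq T_def)
  define D2 where "D2 u w = frechet_derivative (\<lambda>y. frechet_derivative T (at y) u) (at ?x) w" for u w
  have sym: "D2 u w = D2 w u" for u w unfolding D2_def by (rule smooth_on_symmetric_derivative[OF sT oa x])
  have key: "frechet_derivative (field_rep A c Z) (at (cmap c p)) (frechet_derivative T (at ?x) w) =
      D2 (Z p) w + frechet_derivative T (at ?x) (frechet_derivative (field_rep A ?a Z) (at ?x) w)"
    if Z: "vector_field_on A W Z" for Z w
  proof -
    have dc: "(field_rep A c Z has_derivative frechet_derivative (field_rep A c Z) (at (cmap c p))) (at (T ?x))"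
      unfolding Tx by (rule smooth_on_has_derivative[OF vector_field_on_rep[OF A c(1) W(1) Z]]) (use c W in blast)
    have da: "(field_rep A ?a Z has_derivative frechet_derivative (field_rep A ?a Z) (at ?x)) (at ?x)"
      by (rule smooth_on_has_derivative[OF vector_field_on_rep[OF A a(1) W(1) Z]]) (use a W in blast)
    have Zx: "field_rep A ?a Z ?x = Z p" by (simp add: field_rep_cmap[OF a] to_chart_chart_at[OF A])
    have 1: "((\<lambda>x. field_rep A c Z (T x)) has_derivative
        (\<lambda>w. frechet_derivative (field_rep A c Z) (at (cmap c p)) (frechet_derivative T (at ?x) w))) (at ?x)"
      by (rule has_derivative_compose[OF smooth_on_has_derivative[OF sT x] dc])
    have 2: "((\<lambda>x. frechet_derivative T (at x) (field_rep A ?a Z x)) has_derivative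
        (\<lambda>w. D2 (Z p) w + frechet_derivative T (at ?x) (frechet_derivative (field_rep A ?a Z) (at ?x) w))) (at ?x)"
      using has_derivative_derivative_field[OF sT oa x da] unfolding Zx D2_def .
    have 3: "frechet_derivative T (at y) (field_rep A ?a Z y) = field_rep A c Z (T y)" if "y \<in> ?U" for y
    proof -
      from \<open>y \<in> ?U\<close> obtain q where q: "q \<in> ?V" "y = cmap ?a q" by blast
      then show ?thesis using field_rep_change[OF A a(1) _ c(1), of q Z] cinv_cmap[OF a(1), of q] by (auto simp: T_def)
    qed
    from has_derivative_transform_within_open[OF 2 oa x 3]
    have "((\<lambda>x. field_rep A c Z (T x)) has_derivative
        (\<lambda>w. D2 (Z p) w + frechet_derivative T (at ?x) (frechet_derivative (field_rep A ?a Z) (at ?x) w))) (at ?x)" .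
    from fun_cong[OF has_derivative_unique[OF 1 this], of w] show ?thesis .
  qed
  have Zx: "field_rep A ?a Z ?x = Z p" for Z by (simp add: field_rep_cmap[OF a] to_chart_chart_at[OF A])
  have lT: "linear (frechet_derivative T (at ?x))" by (rule smooth_on_linear_derivative[OF sT x])
  show ?thesis
    unfolding tc key[OF X] key[OF Y] lie_bracket_def Let_def Zx linear_diff[OF lT] using sym by simp
qed

lemma smooth_function_divide:
  fixes f h :: "'m::topological_space \<Rightarrow> real"
  assumes A: "smooth_atlas A" and W: "open W" and f: "smooth_map_on A model_atlas W f"
    and h: "smooth_map_on A model_atlas W h" "\<And>q. q \<in> W \<Longrightarrow> h q \<noteq> 0"
  shows "smooth_map_on A model_atlas W (\<lambda>q. f q / h q)"
proof (rule smooth_functionI[OF A])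
  fix p assume p: "p \<in> W"
  obtain c where c: "c \<in> A" "p \<in> cdom c" using atlas_cover[OF A] by blast
  note cc = atlas_compatible[OF A c(1)]
  have oV: "open (cdom c \<inter> W)" using W compatible_open(1)[OF cc] by blast
  have o: "open (cmap c ` (cdom c \<inter> W))" by (rule open_cmap_image[OF cc oV]) blast
  have "smooth_on (cmap c ` (cdom c \<inter> W)) (\<lambda>x. f (cinv c x) * inverse (h (cinv c x)))"
    by (intro smooth_on_mult[OF o] smooth_on_inverse[OF o] smooth_function_rep[OF A cc W] f h)
      (auto simp: cinv_cmap[OF cc])
  then show "\<exists>c V. compatible A c \<and> open V \<and> p \<in> V \<and> V \<subseteq> W \<inter> cdom c \<and> smooth_on (cmap c ` V) (\<lambda>x. f (cinv c x) / h (cinv c x))"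
    using cc oV c p by (intro exI[of _ c] exI[of _ "cdom c \<inter> W"]) (auto simp: divide_inverse)
qed

lemma vector_field_on_local:
  assumes A: "smooth_atlas A" and "\<And>p. p \<in> W \<Longrightarrow> \<exists>V. open V \<and> p \<in> V \<and> V \<subseteq> W \<and> vector_field_on A V X"
  shows "vector_field_on A W X"
proof (rule vector_field_onI[OF A])
  fix p assume "p \<in> W"
  then obtain V where V: "open V" "p \<in> V" "V \<subseteq> W" "vector_field_on A V X" using assms(2) by blast
  obtain c where c: "c \<in> A" "p \<in> cdom c" using atlas_cover[OF A] by blast
  note cc = atlas_compatible[OF A c(1)]
  show "\<exists>c V. compatible A c \<and> open V \<and> p \<in> V \<and> V \<subseteq> W \<inter> cdom c \<and> smooth_on (cmap c ` V) (field_rep A c X)"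
    using cc c V vector_field_on_rep[OF A cc V(1) V(4)] compatible_open(1)[OF cc]
    by (intro exI[of _ c] exI[of _ "cdom c \<inter> V"]) auto
qed

lemma differential_cong:
  assumes A: "smooth_atlas A" and W: "open W" "p \<in> W" and eq: "\<And>q. q \<in> W \<Longrightarrow> f q = h q"
    and f: "smooth_map_on A model_atlas W f" and h: "smooth_map_on A model_atlas W h"
  shows "differential A model_atlas f p v = differential A model_atlas h p v"
proof -
  obtain c where c: "c \<in> A" "p \<in> cdom c" using atlas_cover[OF A] by blast
  note cc = atlas_compatible[OF A c(1)]
  have o: "open (cmap c ` (cdom c \<inter> W))"
    by (rule open_cmap_image[OF cc]) (use W compatible_open(1)[OF cc] in auto)
  show ?thesis
    unfolding differential_function[OF A cc c(2) W f] differential_function[OF A cc c(2) W h]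
    by (subst frechet_derivative_cong[OF o, of _ _ "\<lambda>x. h (cinv c x)"]) (use c W eq in \<open>auto simp: cinv_cmap[OF cc]\<close>)
qed

lemma differential_const:
  assumes A: "smooth_atlas A"
  shows "differential A model_atlas (\<lambda>q. r) p v = 0"
proof -
  obtain c where c: "c \<in> A" "p \<in> cdom c" using atlas_cover[OF A] by blast
  show ?thesis
    using differential_function[OF A atlas_compatible[OF A c(1)] c(2) open_UNIV UNIV_I smooth_function_const[OF A]]
    by (simp add: frechet_derivative_eq[OF has_derivative_const])
qed

subsection \<open>Calculus with the Levi-Civita connection\<close>

locale riem =
  fixes A :: "('m::topological_space, 'e::euclidean_space) chart set"
    and g :: "'m \<Rightarrow> 'e \<Rightarrow> 'e \<Rightarrow> real" and nabla :: "('m \<Rightarrow> 'e) \<Rightarrow> ('m \<Rightarrow> 'e) \<Rightarrow> 'm \<Rightarrow> 'e"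
  assumes A: "smooth_atlas A" and metric: "riemannian_metric A g" and LC: "levi_civita A g nabla"
begin

abbreviation "vf \<equiv> vector_field_on A"
abbreviation "sf \<equiv> \<lambda>W (f :: 'm \<Rightarrow> real). smooth_map_on A model_atlas W f"
abbreviation "der \<equiv> \<lambda>(f :: 'm \<Rightarrow> real) p v. differential A model_atlas f p v"

lemma g_bilinear: "bilinear (g p)" and g_sym: "g p u v = g p v u" and g_pos: "u \<noteq> 0 \<Longrightarrow> 0 < g p u u"
  and sf_g: "open W \<Longrightarrow> vf W X \<Longrightarrow> vf W Y \<Longrightarrow> sf W (\<lambda>q. g q (X q) (Y q))"
  using metric unfolding riemannian_metric_def by blast+

lemma g_linear: "linear (g p u)" "linear (\<lambda>u. g p u v)"
  using g_bilinear[of p] by (auto simp: bilinear_def)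

lemmas g_simps = linear_add[OF g_linear(1)] linear_add[OF g_linear(2)] linear_diff[OF g_linear(1)] linear_diff[OF g_linear(2)]
  linear_scale[OF g_linear(1)] linear_scale[OF g_linear(2)] linear_0[OF g_linear(1)] linear_0[OF g_linear(2)]
  linear_neg[OF g_linear(1)] linear_neg[OF g_linear(2)] linear_sum[OF g_linear(1)] linear_sum[OF g_linear(2)]

lemma g_zero: "g p u u = 0 \<longleftrightarrow> u = 0"
  using g_pos[of u p] by (cases "u = 0") (auto simp: g_simps)

lemma connection: "affine_connection A nabla"
  using LC by (simp add: levi_civita_def)

lemma nabla_add_left: "open W \<Longrightarrow> vf W X \<Longrightarrow> vf W Y \<Longrightarrow> vf W Z \<Longrightarrow> p \<in> W \<Longrightarrow>
    nabla (\<lambda>q. X q + Y q) Z p = nabla X Z p + nabla Y Z p"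
  and nabla_add_right: "open W \<Longrightarrow> vf W X \<Longrightarrow> vf W Y \<Longrightarrow> vf W Z \<Longrightarrow> p \<in> W \<Longrightarrow>
    nabla Z (\<lambda>q. X q + Y q) p = nabla Z X p + nabla Z Y p"
  and nabla_scale_left: "open W \<Longrightarrow> vf W X \<Longrightarrow> vf W Y \<Longrightarrow> sf W f \<Longrightarrow> p \<in> W \<Longrightarrow>
    nabla (\<lambda>q. f q *\<^sub>R X q) Y p = f p *\<^sub>R nabla X Y p"
  and nabla_leibniz: "open W \<Longrightarrow> vf W X \<Longrightarrow> vf W Y \<Longrightarrow> sf W f \<Longrightarrow> p \<in> W \<Longrightarrow>
    nabla X (\<lambda>q. f q *\<^sub>R Y q) p = der f p (X p) *\<^sub>R Y p + f p *\<^sub>R nabla X Y p"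
  using connection unfolding affine_connection_def by blast+

lemma nabla_torsion: "open W \<Longrightarrow> vf W X \<Longrightarrow> vf W Y \<Longrightarrow> p \<in> W \<Longrightarrow> nabla X Y p - nabla Y X p = lie_bracket A X Y p"
  and nabla_metric: "open W \<Longrightarrow> vf W X \<Longrightarrow> vf W Y \<Longrightarrow> vf W Z \<Longrightarrow> p \<in> W \<Longrightarrow>
    der (\<lambda>q. g q (X q) (Y q)) p (Z p) = g p (nabla Z X p) (Y p) + g p (X p) (nabla Z Y p)"
  using LC unfolding levi_civita_def by blast+

lemma sf_const: "sf W (\<lambda>q. r)"
  by (rule smooth_function_const[OF A])

lemma nabla_scale_const:
  "open W \<Longrightarrow> vf W X \<Longrightarrow> vf W Y \<Longrightarrow> p \<in> W \<Longrightarrow> nabla X (\<lambda>q. r *\<^sub>R Y q) p = r *\<^sub>R nabla X Y p"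
  using nabla_leibniz[OF _ _ _ sf_const] by (simp add: differential_const[OF A])

text \<open>The function that is 0 on \<open>W\<close> and 1 elsewhere is smooth on
  \<open>W\<close>. It writes a field vanishing on \<open>W\<close> as a multiple of itself with a
  coefficient vanishing on \<open>W\<close>, which is how locality follows from the linearity rules
  of a connection.\<close>

lemma vf_indicator:
  assumes "open W" "vf W Z" "\<And>q. q \<in> W \<Longrightarrow> Z q = 0"
  obtains f where "sf W f" "\<And>q. q \<in> W \<Longrightarrow> f q = 0" "\<And>q. f q *\<^sub>R Z q = Z q"
proof
  let ?f = "\<lambda>q. if q \<in> W then 0 else 1 :: real"
  show "sf W ?f"
  proof (rule smooth_functionI[OF A])
    fix p assume p: "p \<in> W"
    obtain c where c: "c \<in> A" "p \<in> cdom c" using atlas_cover[OF A] by blast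
    note cc = atlas_compatible[OF A c(1)]
    let ?V = "W \<inter> cdom c"
    have V: "open ?V" using assms(1) compatible_open(1)[OF cc] by blast
    have o: "open (cmap c ` ?V)" by (rule open_cmap_image[OF cc V]) blast
    have "smooth_on (cmap c ` ?V) (\<lambda>x. ?f (cinv c x))"
      by (rule smooth_on_cong[OF o _ smooth_on_const[of _ 0]]) (auto simp: cinv_cmap[OF cc])
    then show "\<exists>c V. compatible A c \<and> open V \<and> p \<in> V \<and> V \<subseteq> W \<inter> cdom c \<and> smooth_on (cmap c ` V) (\<lambda>x. ?f (cinv c x))"
      using cc V p c by blast
  qed
qed (use assms in auto)

lemma nabla_cong:
  assumes W: "open W" "p \<in> W" and X: "vf W X" and X': "vf W X'" and Y: "vf W Y" and Y': "vf W Y'"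
    and eq: "\<And>q. q \<in> W \<Longrightarrow> X q = X' q" "\<And>q. q \<in> W \<Longrightarrow> Y q = Y' q"
  shows "nabla X Y p = nabla X' Y' p"
proof -
  have "nabla X Y p = nabla X' Y p"
  proof -
    let ?Z = "\<lambda>q. X q - X' q"
    have Z: "vf W ?Z" by (rule vector_field_on_diff[OF A W(1) X X'])
    obtain f where f: "sf W f" "\<And>q. q \<in> W \<Longrightarrow> f q = 0" "\<And>q. f q *\<^sub>R ?Z q = ?Z q"
      using vf_indicator[OF W(1) Z] eq(1) by auto
    have "nabla X Y p = nabla (\<lambda>q. X' q + f q *\<^sub>R ?Z q) Y p" unfolding f(3) by simp
    also have "\<dots> = nabla X' Y p + nabla (\<lambda>q. f q *\<^sub>R ?Z q) Y p"
      by (rule nabla_add_left[OF W(1) X' vector_field_on_scaleR[OF A W(1) f(1) Z] Y W(2)])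
    finally show ?thesis using nabla_scale_left[OF W(1) Z Y f(1) W(2)] f(2)[OF W(2)] by simp
  qed
  moreover have "nabla X' Y p = nabla X' Y' p"
  proof -
    let ?Z = "\<lambda>q. Y q - Y' q"
    have Z: "vf W ?Z" by (rule vector_field_on_diff[OF A W(1) Y Y'])
    obtain f where f: "sf W f" "\<And>q. q \<in> W \<Longrightarrow> f q = 0" "\<And>q. f q *\<^sub>R ?Z q = ?Z q"
      using vf_indicator[OF W(1) Z] eq(2) by auto
    \<comment> \<open>In the second argument of the connection a Leibniz term remains; it vanishes
      as \<open>f\<close> is constant on \<open>W\<close>.\<close>
    have "der f p (X' p) = 0"
      using differential_cong[OF A W _ f(1) sf_const, of 0] f(2) by (simp add: differential_const[OF A])
    moreover have "nabla X' Y p = nabla X' (\<lambda>q. Y' q + f q *\<^sub>R ?Z q) p" unfolding f(3) by simp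
    moreover have "\<dots> = nabla X' Y' p + nabla X' (\<lambda>q. f q *\<^sub>R ?Z q) p"
      by (rule nabla_add_right[OF W(1) Y' vector_field_on_scaleR[OF A W(1) f(1) Z] X' W(2)])
    ultimately show ?thesis using nabla_leibniz[OF W(1) X' Z f(1) W(2)] f(2)[OF W(2)] by simp
  qed
  ultimately show ?thesis by simp
qed

lemma nabla_zero_left: "open W \<Longrightarrow> vf W Y \<Longrightarrow> p \<in> W \<Longrightarrow> nabla (\<lambda>q. 0) Y p = 0"
  using nabla_scale_left[OF _ vector_field_on_zero[OF A] _ sf_const, of W Y p 0] by simp

lemma nabla_sum_left:
  assumes W: "open W" "p \<in> W" and X: "\<And>i. i \<in> I \<Longrightarrow> vf W (X i)" and f: "\<And>i. i \<in> I \<Longrightarrow> sf W (f i)" and Y: "vf W Y"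
  shows "nabla (\<lambda>q. \<Sum>i\<in>I. f i q *\<^sub>R X i q) Y p = (\<Sum>i\<in>I. f i p *\<^sub>R nabla (X i) Y p)"
  using X f
proof (induction I rule: infinite_finite_induct)
  case (insert i I)
  have "nabla (\<lambda>q. f i q *\<^sub>R X i q + (\<Sum>i\<in>I. f i q *\<^sub>R X i q)) Y p =
      nabla (\<lambda>q. f i q *\<^sub>R X i q) Y p + nabla (\<lambda>q. \<Sum>i\<in>I. f i q *\<^sub>R X i q) Y p"
    using insert.prems
    by (intro nabla_add_left[OF W(1) _ _ Y W(2)] vector_field_on_sum[OF A W(1)] vector_field_on_scaleR[OF A W(1)]) auto
  then show ?case
    using insert nabla_scale_left[OF W(1) _ Y _ W(2), of "X i" "f i"] by simp
qed (use nabla_zero_left[OF W(1) Y W(2)] in auto)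

lemma vf_from_chart_const:
  assumes "compatible A c"
  shows "vf (cdom c) (\<lambda>q. from_chart A c q v)"
  using vector_field_from_chart[OF A assms compatible_open(1)[OF assms] subset_refl smooth_on_const] .

text \<open>The difference of the two fields is expanded in the coordinate frame; linearity over
  functions leaves the coefficients at \<open>p\<close>, which are 0.\<close>

lemma nabla_tensorial:
  assumes W: "open W" "p \<in> W" and X: "vf W X" and X': "vf W X'" and Y: "vf W Y" and eq: "X p = X' p"
  shows "nabla X Y p = nabla X' Y p"
proof -
  let ?Z = "\<lambda>q. X q + (-1) *\<^sub>R X' q"
  have mX': "vf W (\<lambda>q. (-1) *\<^sub>R X' q)" by (rule vector_field_on_scaleR[OF A W(1) sf_const X'])
  have Z: "vf W ?Z" by (rule vector_field_on_add[OF A W(1) X mX'])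
  obtain c where c: "c \<in> A" "p \<in> cdom c" using atlas_cover[OF A] by blast
  note cc = atlas_compatible[OF A c(1)]
  let ?V = "W \<inter> cdom c"
  have V: "open ?V" "p \<in> ?V" using W c compatible_open(1)[OF cc] by auto
  define f where "f b q = to_chart A c q (?Z q) \<bullet> b" for b q
  have sff: "sf ?V (f b)" for b
  proof (rule smooth_functionI[OF A])
    fix p assume p: "p \<in> ?V"
    have o: "open (cmap c ` ?V)" by (rule open_cmap_image[OF cc V(1)]) blast
    have "smooth_on (cmap c ` ?V) (\<lambda>x. field_rep A c ?Z x \<bullet> b)"
      by (rule smooth_on_linear[OF o bounded_linear_inner_left smooth_on_mono[OF vector_field_on_rep[OF A cc W(1) Z]]]) blast
    then have "smooth_on (cmap c ` ?V) (\<lambda>x. f b (cinv c x))" by (simp add: f_def field_rep_eq)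
    then show "\<exists>c V. compatible A c \<and> open V \<and> p \<in> V \<and> V \<subseteq> ?V \<inter> cdom c \<and> smooth_on (cmap c ` V) (\<lambda>x. f b (cinv c x))"
      using cc V p by (intro exI[of _ c] exI[of _ ?V]) auto
  qed
  let ?e = "\<lambda>b q. from_chart A c q b"
  have e: "vf ?V (?e b)" for b by (rule vector_field_on_mono[OF vf_from_chart_const[OF cc]]) blast
  have YV: "vf ?V Y" and ZV: "vf ?V ?Z" using Y Z by (auto intro: vector_field_on_mono)
  have "nabla ?Z Y p = nabla (\<lambda>q. \<Sum>b\<in>Basis. f b q *\<^sub>R ?e b q) Y p"
  proof (rule nabla_cong[OF V ZV _ YV YV])
    show "vf ?V (\<lambda>q. \<Sum>b\<in>Basis. f b q *\<^sub>R ?e b q)"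
      by (intro vector_field_on_sum[OF A V(1)] vector_field_on_scaleR[OF A V(1)] sff e)
    show "?Z q = (\<Sum>b\<in>Basis. f b q *\<^sub>R ?e b q)" if "q \<in> ?V" for q
      using linear_sum_Basis[OF from_chart_linear[OF A cc], of q "to_chart A c q (?Z q)"] that
      unfolding f_def by (simp add: from_to_chart[OF A cc])
  qed simp
  also have "\<dots> = (\<Sum>b\<in>Basis. f b p *\<^sub>R nabla (?e b) Y p)" by (rule nabla_sum_left[OF V e sff YV])
  also have "\<dots> = 0" using eq linear_0[OF to_chart_linear[OF A cc c(2)]] by (simp add: f_def)
  finally have "nabla X Y p + nabla (\<lambda>q. (-1) *\<^sub>R X' q) Y p = 0"
    using nabla_add_left[OF W(1) X mX' Y W(2)] by simp
  then show ?thesis using nabla_scale_left[OF W(1) X' Y sf_const W(2), of "-1"] by simp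
qed

lemma nabla_orthogonal:
  assumes W: "open W" "p \<in> W" and X: "vf W X" and Y: "vf W Y" and Z: "vf W Z"
    and orth: "\<And>q. q \<in> W \<Longrightarrow> g q (X q) (Y q) = 0"
  shows "g p (nabla Z X p) (Y p) = - g p (X p) (nabla Z Y p)"
proof -
  have "der (\<lambda>q. g q (X q) (Y q)) p (Z p) = 0"
    using differential_cong[OF A W orth sf_g[OF W(1) X Y] sf_const] by (simp add: differential_const[OF A])
  then show ?thesis using nabla_metric[OF W(1) X Y Z W(2)] by simp
qed

section \<open>Koszul's formula and its form in a chart\<close>

lemma koszul:
  assumes W: "open W" "p \<in> W" and X: "vf W X" and Y: "vf W Y" and Z: "vf W Z"
  shows "2 * g p (nabla X Y p) (Z p) =
    der (\<lambda>q. g q (Y q) (Z q)) p (X p) + der (\<lambda>q. g q (X q) (Z q)) p (Y p) - der (\<lambda>q. g q (X q) (Y q)) p (Z p)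
    + g p (lie_bracket A X Y p) (Z p) - g p (lie_bracket A X Z p) (Y p) - g p (lie_bracket A Y Z p) (X p)"
  unfolding nabla_metric[OF W(1) Y Z X W(2)] nabla_metric[OF W(1) X Z Y W(2)] nabla_metric[OF W(1) X Y Z W(2)]
    nabla_torsion[OF W(1) X Y W(2), symmetric] nabla_torsion[OF W(1) X Z W(2), symmetric]
    nabla_torsion[OF W(1) Y Z W(2), symmetric]
  by (simp add: g_simps g_sym[of p "X p"] g_sym[of p "Y p"])

text \<open>The metric in chart components, curried into an operator so that it is a single smooth
  function of \<open>x\<close> with a derivative and a product rule. The values of \<open>g\<close>
  itself refer to charts that jump with the point.\<close>

definition metric_rep :: "('m, 'e) chart \<Rightarrow> 'e \<Rightarrow> 'e \<Rightarrow>\<^sub>L 'e \<Rightarrow>\<^sub>L real" where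
  "metric_rep c x = Blinfun (\<lambda>u. Blinfun (\<lambda>v. g (cinv c x) (from_chart A c (cinv c x) u) (from_chart A c (cinv c x) v)))"

lemma metric_rep:
  assumes c: "compatible A c" "x \<in> cmap c ` cdom c"
  shows "metric_rep c x u v = g (cinv c x) (from_chart A c (cinv c x) u) (from_chart A c (cinv c x) v)" (is "_ = ?G u v")
proof -
  have lf: "linear (from_chart A c (cinv c x))" by (rule from_chart_linear[OF A c(1) cinv_in[OF c(2)]])
  have 1: "bounded_linear (?G u)" for u
    unfolding linear_conv_bounded_linear[symmetric] using linear_compose[OF lf g_linear(1)] by (simp add: o_def)
  have 2: "linear (\<lambda>u. Blinfun (?G u))"
    by (rule linearI; rule blinfun_eqI;
        simp only: blinfun.add_left blinfun.scaleR_left bounded_linear_Blinfun_apply[OF 1])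
      (simp_all add: g_simps linear_add[OF lf] linear_scale[OF lf])
  then have "bounded_linear (\<lambda>u. Blinfun (?G u))" by (simp add: linear_conv_bounded_linear)
  then show ?thesis unfolding metric_rep_def by (simp add: bounded_linear_Blinfun_apply 1)
qed

lemma metric_rep_cmap:
  assumes "compatible A c" "q \<in> cdom c"
  shows "metric_rep c (cmap c q) (to_chart A c q u) (to_chart A c q v) = g q u v"
  using assms by (simp add: metric_rep cinv_cmap A)

text \<open>Smoothness of \<open>g\<close> is given on pairs of vector fields. Fields with constant
  components in the chart suffice, since a family of operators is smooth once it is smooth on each
  vector; this is used once per argument.\<close>

lemma smooth_metric_rep:
  assumes c: "compatible A c"
  shows "smooth_on (cmap c ` cdom c) (metric_rep c)"
proof -
  let ?U = "cmap c ` cdom c"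
  note U = compatible_open(2)[OF c]
  have s: "smooth_on ?U (\<lambda>x. metric_rep c x u v)" for u v
  proof (rule smooth_on_cong[OF U])
    have "smooth_on (cmap c ` (cdom c \<inter> cdom c)) (\<lambda>x. g (cinv c x) (from_chart A c (cinv c x) u) (from_chart A c (cinv c x) v))"
      by (rule smooth_function_rep[OF A c compatible_open(1)[OF c]
            sf_g[OF compatible_open(1)[OF c] vf_from_chart_const[OF c] vf_from_chart_const[OF c]]])
    then show "smooth_on ?U (\<lambda>x. g (cinv c x) (from_chart A c (cinv c x) u) (from_chart A c (cinv c x) v))" by simp
  qed (simp add: metric_rep[OF c])
  have "smooth_on ?U (\<lambda>x. Blinfun (\<lambda>v. metric_rep c x u v))" for u
    by (rule smooth_on_Blinfun[OF U _ s]) (simp add: bounded_linear.linear blinfun.bounded_linear_right)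
  then have "smooth_on ?U (\<lambda>x. metric_rep c x u)" for u by (simp add: blinfun_apply_inverse)
  then have "smooth_on ?U (\<lambda>x. Blinfun (\<lambda>u. metric_rep c x u))"
    by (intro smooth_on_Blinfun[OF U]) (simp_all add: bounded_linear.linear blinfun.bounded_linear_right)
  then show ?thesis by (simp add: blinfun_apply_inverse)
qed

lemma metric_product_rule:
  assumes c: "compatible A c" "x \<in> cmap c ` cdom c" and h: "(h has_derivative h') (at z)" "h z = x"
    and Y: "(Y has_derivative Y') (at z)" and Z: "(Z has_derivative Z') (at z)"
  shows "((\<lambda>z. metric_rep c (h z) (Y z) (Z z)) has_derivative
    (\<lambda>w. frechet_derivative (metric_rep c) (at x) (h' w) (Y z) (Z z) + metric_rep c x (Y' w) (Z z) + metric_rep c x (Y z) (Z' w))) (at z)"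
proof -
  have "((\<lambda>z. metric_rep c (h z)) has_derivative (\<lambda>w. frechet_derivative (metric_rep c) (at x) (h' w))) (at z)"
    by (rule has_derivative_compose[OF h(1)])
      (use smooth_on_has_derivative[OF smooth_metric_rep[OF c(1)] c(2)] h(2) in simp)
  from bounded_bilinear.FDERIV[OF bounded_bilinear_blinfun_apply
      bounded_bilinear.FDERIV[OF bounded_bilinear_blinfun_apply this Y] Z]
  show ?thesis using h(2) by (simp add: blinfun.add_left algebra_simps)
qed

text \<open>When derivatives and brackets are written out in the chart, all derivatives of
  \<open>X\<close> and \<open>Z\<close> cancel. What remains is the derivative of \<open>Y\<close>
  and the three derivatives of the metric that make up the Christoffel symbols of the first
  kind.\<close>

lemma koszul_chart:
  assumes W: "open W" "p \<in> W" and X: "vf W X" and Y: "vf W Y" and Z: "vf W Z"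
    and c: "compatible A c" "p \<in> cdom c"
  defines "x \<equiv> cmap c p" and "X' \<equiv> to_chart A c p (X p)" and "Y' \<equiv> to_chart A c p (Y p)" and "Z' \<equiv> to_chart A c p (Z p)"
  shows "2 * g p (nabla X Y p) (Z p) =
    2 * metric_rep c x (frechet_derivative (field_rep A c Y) (at x) X') Z'
    + frechet_derivative (metric_rep c) (at x) X' Y' Z' + frechet_derivative (metric_rep c) (at x) Y' X' Z'
    - frechet_derivative (metric_rep c) (at x) Z' X' Y'"
proof -
  let ?W = "cdom c \<inter> W"
  have o: "open (cmap c ` ?W)" by (rule open_cmap_image[OF c(1)]) (use W compatible_open(1)[OF c(1)] in auto)
  have x: "x \<in> cmap c ` cdom c" "x \<in> cmap c ` ?W" using c W by (auto simp: x_def)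
  have rep: "field_rep A c R x = to_chart A c p (R p)" for R by (simp add: x_def field_rep_cmap[OF c])
  have dR: "(field_rep A c R has_derivative frechet_derivative (field_rep A c R) (at x)) (at x)" if "vf W R" for R
    by (rule smooth_on_has_derivative[OF vector_field_on_rep[OF A c(1) W(1) that] x(2)])
  have D: "der (\<lambda>q. g q (R q) (S q)) p v =
      frechet_derivative (metric_rep c) (at x) (to_chart A c p v) (to_chart A c p (R p)) (to_chart A c p (S p))
      + metric_rep c x (frechet_derivative (field_rep A c R) (at x) (to_chart A c p v)) (to_chart A c p (S p))
      + metric_rep c x (to_chart A c p (R p)) (frechet_derivative (field_rep A c S) (at x) (to_chart A c p v))"
    if R: "vf W R" and S: "vf W S" for R S v
  proof -
    have "((\<lambda>y. metric_rep c y (field_rep A c R y) (field_rep A c S y)) has_derivative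
      (\<lambda>w. frechet_derivative (metric_rep c) (at x) w (to_chart A c p (R p)) (to_chart A c p (S p))
      + metric_rep c x (frechet_derivative (field_rep A c R) (at x) w) (to_chart A c p (S p))
      + metric_rep c x (to_chart A c p (R p)) (frechet_derivative (field_rep A c S) (at x) w))) (at x)"
      using metric_product_rule[OF c(1) x(1) has_derivative_ident refl dR[OF R] dR[OF S]] unfolding rep .
    then have "((\<lambda>y. g (cinv c y) (R (cinv c y)) (S (cinv c y))) has_derivative
      (\<lambda>w. frechet_derivative (metric_rep c) (at x) w (to_chart A c p (R p)) (to_chart A c p (S p))
      + metric_rep c x (frechet_derivative (field_rep A c R) (at x) w) (to_chart A c p (S p))
      + metric_rep c x (to_chart A c p (R p)) (frechet_derivative (field_rep A c S) (at x) w))) (at x)"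
      by (rule has_derivative_transform_within_open[OF _ o x(2)])
        (auto simp: field_rep_cmap[OF c(1)] metric_rep_cmap[OF c(1)] cinv_cmap[OF c(1)])
    then show ?thesis
      unfolding differential_function[OF A c W sf_g[OF W(1) R S]] x_def[symmetric] by (simp add: frechet_derivative_eq)
  qed
  have B: "g p (lie_bracket A R S p) v = metric_rep c x (frechet_derivative (field_rep A c S) (at x) (to_chart A c p (R p)) -
      frechet_derivative (field_rep A c R) (at x) (to_chart A c p (S p))) (to_chart A c p v)"
    if "vf W R" "vf W S" for R S v
    unfolding metric_rep_cmap[OF c, symmetric, of "lie_bracket A R S p"] lie_bracket_chart[OF A c W that] x_def ..
  have sym: "metric_rep c x u v = metric_rep c x v u" for u v by (simp add: metric_rep[OF c(1) x(1)] g_sym)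
  show ?thesis
    unfolding koszul[OF W X Y Z] D[OF Y Z] D[OF X Z] D[OF X Y] B[OF X Y] B[OF X Z] B[OF Y Z] X'_def Y'_def Z'_def
    by (simp add: blinfun.diff_left blinfun.diff_right sym[of "to_chart A c p (X p)"] sym[of "to_chart A c p (Y p)"])
qed

subsection \<open>Orthogonal projections onto distributions\<close>

lemma orth_proj_eqI:
  assumes "subspace D" "v \<in> D" "\<And>w. w \<in> D \<Longrightarrow> g p (u - v) w = 0"
  shows "orth_proj (g p) D u = v"
  unfolding orth_proj_def
proof (rule the_equality)
  fix v' assume v': "v' \<in> D \<and> (\<forall>w\<in>D. g p (u - v') w = 0)"
  have d: "v' - v \<in> D" using assms v' by (simp add: subspace_diff)
  have "g p (v' - v) (v' - v) = g p (u - v) (v' - v) - g p (u - v') (v' - v)" by (simp add: g_simps)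
  then have "g p (v' - v) (v' - v) = 0" using assms(3)[OF d] v' d by simp
  then show "v' = v" by (simp add: g_zero)
qed (use assms in blast)

text \<open>Gram-Schmidt, one field of the frame at a time: the new field is replaced by its part
  \<open>Z'\<close> orthogonal to the earlier ones, and the projection onto the line of
  \<open>Z'\<close> is added. The coefficients are quotients of smooth functions, which makes the
  projection smooth.\<close>

lemma frame_projection:
  assumes W: "open W" and S: "finite S" "\<And>X. X \<in> S \<Longrightarrow> vf W X"
    and ind: "\<And>q. q \<in> W \<Longrightarrow> inj_on (\<lambda>X. X q) S \<and> independent ((\<lambda>X. X q) ` S)" and X: "vf W X"
  shows "\<exists>Y. vf W Y \<and> (\<forall>q\<in>W. Y q \<in> span ((\<lambda>X. X q) ` S) \<and> (\<forall>w\<in>span ((\<lambda>X. X q) ` S). g q (X q - Y q) w = 0))"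
  using S ind X
proof (induction S arbitrary: X rule: finite_induct)
  case empty
  then show ?case using vector_field_on_zero[OF A] by (intro exI[of _ "\<lambda>q. 0"]) (simp add: g_simps)
next
  case (insert Z S)
  let ?sp = "\<lambda>q. span ((\<lambda>X. X q) ` S)"
  have ind': "inj_on (\<lambda>X. X q) S \<and> independent ((\<lambda>X. X q) ` S)" if "q \<in> W" for q
    using insert.prems(2)[OF that] independent_mono[of "(\<lambda>X. X q) ` insert Z S" "(\<lambda>X. X q) ` S"] by auto
  have Zn: "Z q \<notin> ?sp q" if "q \<in> W" for q
  proof -
    have "Z q \<notin> (\<lambda>X. X q) ` S" using insert.prems(2)[OF that] insert.hyps(2) by (auto simp: inj_on_def)
    then show ?thesis using insert.prems(2)[OF that] by (simp add: independent_insert)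
  qed
  obtain Y where Y: "vf W Y" "\<And>q. q \<in> W \<Longrightarrow> Y q \<in> ?sp q" "\<And>q w. q \<in> W \<Longrightarrow> w \<in> ?sp q \<Longrightarrow> g q (X q - Y q) w = 0"
    using insert.IH[of X] insert.prems ind' by auto
  obtain Z0 where Z0: "vf W Z0" "\<And>q. q \<in> W \<Longrightarrow> Z0 q \<in> ?sp q" "\<And>q w. q \<in> W \<Longrightarrow> w \<in> ?sp q \<Longrightarrow> g q (Z q - Z0 q) w = 0"
    using insert.IH[of Z] insert.prems ind' by auto
  define Z' where "Z' q = Z q - Z0 q" for q
  have Z': "vf W Z'" unfolding Z'_def[abs_def] by (rule vector_field_on_diff[OF A W]) (use insert.prems Z0 in auto)
  have n: "g q (Z' q) (Z' q) \<noteq> 0" if "q \<in> W" for q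
    using Zn[OF that] Z0(2)[OF that] by (auto simp: g_zero Z'_def)
  define f where "f q = g q (X q) (Z' q) / g q (Z' q) (Z' q)" for q
  have f: "sf W f" unfolding f_def
    by (rule smooth_function_divide[OF A W sf_g[OF W insert.prems(3) Z'] sf_g[OF W Z' Z'] n])
  show ?case
  proof (intro exI[of _ "\<lambda>q. Y q + f q *\<^sub>R Z' q"] conjI ballI)
    show "vf W (\<lambda>q. Y q + f q *\<^sub>R Z' q)"
      by (rule vector_field_on_add[OF A W Y(1) vector_field_on_scaleR[OF A W f Z']])
    fix q assume q: "q \<in> W"
    let ?sp' = "span ((\<lambda>X. X q) ` insert Z S)"
    have sub: "?sp q \<subseteq> ?sp'" by (rule span_mono) auto
    have "Z' q \<in> ?sp'" unfolding Z'_def by (rule span_diff[OF span_base subsetD[OF sub Z0(2)[OF q]]]) simp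
    then show "Y q + f q *\<^sub>R Z' q \<in> ?sp'" by (intro span_add[OF subsetD[OF sub Y(2)[OF q]]] span_scale)
    fix w assume "w \<in> ?sp'"
    then obtain k where k: "w - k *\<^sub>R Z q \<in> ?sp q" using span_breakdown_eq[of w "Z q"] by auto
    define w1 where "w1 = (w - k *\<^sub>R Z q) + k *\<^sub>R Z0 q"
    have w1: "w1 \<in> ?sp q" unfolding w1_def using k Z0(2)[OF q] by (intro span_add span_scale)
    have w: "w = k *\<^sub>R Z' q + w1" by (simp add: w1_def Z'_def algebra_simps)
    have o1: "g q (Y q) (Z' q) = 0" using Z0(3)[OF q Y(2)[OF q]] by (simp add: Z'_def g_sym[of q "Y q"])
    have o2: "g q (Z' q) w1 = 0" using Z0(3)[OF q w1] by (simp add: Z'_def)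
    have o3: "g q (X q) w1 = g q (Y q) w1" using Y(3)[OF q w1] by (simp add: g_simps)
    show "g q (X q - (Y q + f q *\<^sub>R Z' q)) w = 0"
      using n[OF q] unfolding w by (simp add: g_simps o1 o2 o3 f_def)
  qed
qed

lemma vf_extension: "\<exists>W X. open W \<and> p \<in> W \<and> vf W X \<and> X p = u"
proof -
  let ?c = "chart_at A p"
  have c: "compatible A ?c" "p \<in> cdom ?c" using chart_at_compatible[OF A] chart_at[OF A] by auto
  show ?thesis
    using compatible_open(1)[OF c(1)] c vf_from_chart_const[OF c(1)] from_to_chart[OF A c, of u]
    by (intro exI[of _ "cdom ?c"] exI[of _ "\<lambda>q. from_chart A ?c q (to_chart A ?c p u)"]) auto
qed

context
  fixes D assumes D: "smooth_distribution A D"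
begin

lemma dist_subspace: "subspace (D p)"
  using D by (simp add: smooth_distribution_def)

lemma dist_frame:
  obtains W S where "open W" "p \<in> W" "finite S" "\<And>X. X \<in> S \<Longrightarrow> vf W X"
    "\<And>q. q \<in> W \<Longrightarrow> inj_on (\<lambda>X. X q) S \<and> independent ((\<lambda>X. X q) ` S) \<and> span ((\<lambda>X. X q) ` S) = D q"
  using D unfolding smooth_distribution_def by metis

lemma dist_proj:
  assumes W: "open W" and X: "vf W X" and p: "p \<in> W"
  shows "\<exists>V. open V \<and> p \<in> V \<and> V \<subseteq> W \<and> vf V (\<lambda>q. orth_proj (g q) (D q) (X q)) \<and>
    (\<forall>q\<in>V. orth_proj (g q) (D q) (X q) \<in> D q \<and> (\<forall>w\<in>D q. g q (X q - orth_proj (g q) (D q) (X q)) w = 0))"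
proof -
  obtain V S where V: "open V" "p \<in> V" and S: "finite S" "\<And>X. X \<in> S \<Longrightarrow> vf V X"
    "\<And>q. q \<in> V \<Longrightarrow> inj_on (\<lambda>X. X q) S \<and> independent ((\<lambda>X. X q) ` S) \<and> span ((\<lambda>X. X q) ` S) = D q"
    using dist_frame by metis
  have VW: "open (V \<inter> W)" using V W by blast
  obtain Y where Y: "vf (V \<inter> W) Y" "\<And>q. q \<in> V \<inter> W \<Longrightarrow> Y q \<in> D q"
    "\<And>q w. q \<in> V \<inter> W \<Longrightarrow> w \<in> D q \<Longrightarrow> g q (X q - Y q) w = 0"
  proof -
    have S': "vf (V \<inter> W) X" if "X \<in> S" for X by (rule vector_field_on_mono[OF S(2)[OF that]]) blast
    have X': "vf (V \<inter> W) X" by (rule vector_field_on_mono[OF X]) blast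
    have "inj_on (\<lambda>X. X q) S \<and> independent ((\<lambda>X. X q) ` S)" if "q \<in> V \<inter> W" for q using S(3) that by blast
    from frame_projection[OF VW S(1) S' this X'] S(3) show ?thesis using that by auto
  qed
  have eq: "orth_proj (g q) (D q) (X q) = Y q" if "q \<in> V \<inter> W" for q
    using orth_proj_eqI[OF dist_subspace Y(2)[OF that] Y(3)[OF that]] .
  have "vf (V \<inter> W) (\<lambda>q. orth_proj (g q) (D q) (X q))"
    by (rule vector_field_on_cong[OF A VW Y(1)]) (simp add: eq)
  then show ?thesis using VW V p Y eq by (intro exI[of _ "V \<inter> W"]) auto
qed

lemma orth_proj_in: "orth_proj (g p) (D p) u \<in> D p"
  and orth_proj_orth: "w \<in> D p \<Longrightarrow> g p (u - orth_proj (g p) (D p) u) w = 0"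
proof -
  obtain W X where W: "open W" "p \<in> W" "vf W X" "X p = u" using vf_extension by blast
  from dist_proj[OF W(1,3,2)] obtain V where "p \<in> V"
    "\<forall>q\<in>V. orth_proj (g q) (D q) (X q) \<in> D q \<and> (\<forall>w\<in>D q. g q (X q - orth_proj (g q) (D q) (X q)) w = 0)" by blast
  then show "orth_proj (g p) (D p) u \<in> D p" "w \<in> D p \<Longrightarrow> g p (u - orth_proj (g p) (D p) u) w = 0"
    using W(4) by auto
qed

lemma orth_proj_id: "u \<in> D p \<Longrightarrow> orth_proj (g p) (D p) u = u"
  by (rule orth_proj_eqI[OF dist_subspace]) (auto simp: g_simps)

lemma vf_orth_proj: "open W \<Longrightarrow> vf W X \<Longrightarrow> vf W (\<lambda>q. orth_proj (g q) (D q) (X q))"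
proof (rule vector_field_on_local[OF A])
  fix p assume "open W" "vf W X" "p \<in> W"
  from dist_proj[OF this] show "\<exists>V. open V \<and> p \<in> V \<and> V \<subseteq> W \<and> vf V (\<lambda>q. orth_proj (g q) (D q) (X q))" by blast
qed

text \<open>Extend \<open>u\<close> with constant chart components and project onto the
  distribution; the projection fixes \<open>u\<close>.\<close>

lemma section_extension:
  assumes "u \<in> D p"
  obtains W X where "open W" "p \<in> W" "section_on A D W X" "X p = u"
proof -
  obtain W X where W: "open W" "p \<in> W" "vf W X" "X p = u" using vf_extension by blast
  show ?thesis
    by (rule that[OF W(1,2), of "\<lambda>q. orth_proj (g q) (D q) (X q)"])
      (use W assms in \<open>auto simp: section_on_def orth_proj_in orth_proj_id vf_orth_proj\<close>)
qed

end

end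

subsection \<open>The second fundamental forms of the slant distributions\<close>

locale bislant = riem A g nabla
  for A :: "('m::topological_space, 'e::euclidean_space) chart set" and g nabla +
  fixes B :: "('n::topological_space, 'f::euclidean_space) chart set" and g\<^sub>N :: "'n \<Rightarrow> 'f \<Rightarrow> 'f \<Rightarrow> real"
    and J :: "'m \<Rightarrow> 'e \<Rightarrow> 'e" and \<pi> :: "'m \<Rightarrow> 'n" and D\<^sub>1 D\<^sub>2 :: "'m \<Rightarrow> 'e set" and \<theta>\<^sub>1 \<theta>\<^sub>2 :: real
  assumes B: "smooth_atlas B" and K: "kaehler A g nabla J"
    and bs: "proper_bi_slant_submersion A g J B g\<^sub>N \<pi> D\<^sub>1 \<theta>\<^sub>1 D\<^sub>2 \<theta>\<^sub>2"
    and basic1: "locally_spanned_by_basic A g B \<pi> (\<lambda>p. J_hor A g B \<pi> J p ` D\<^sub>1 p)"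
    and basic2: "locally_spanned_by_basic A g B \<pi> (\<lambda>p. J_hor A g B \<pi> J p ` D\<^sub>2 p)"
begin

text \<open>Results that single out one distribution are proved for \<open>D\<^sub>1\<close> and
  obtained for \<open>D\<^sub>2\<close> by this symmetry.\<close>

lemma swap: "bislant A g nabla B g\<^sub>N J \<pi> D\<^sub>2 D\<^sub>1 \<theta>\<^sub>2 \<theta>\<^sub>1"
proof
  have "{u + v | u v. u \<in> X \<and> v \<in> Y} = {u + v | u v. u \<in> Y \<and> v \<in> X}" for X Y :: "'e set"
    by (auto simp: add.commute) (metis add.commute)+
  then show "proper_bi_slant_submersion A g J B g\<^sub>N \<pi> D\<^sub>2 \<theta>\<^sub>2 D\<^sub>1 \<theta>\<^sub>1"
    using bs unfolding proper_bi_slant_submersion_def bi_slant_submersion_def by (metis g_sym)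
qed (fact B K basic1 basic2)+

abbreviation "Ver \<equiv> vertical A B \<pi>"
abbreviation "ver' \<equiv> ver A g B \<pi>"
abbreviation "hor' \<equiv> hor A g B \<pi>"
abbreviation "P \<equiv> J_ver A g B \<pi> J"
abbreviation "F \<equiv> J_hor A g B \<pi> J"

lemma bi_slant: "bi_slant_submersion A g J B g\<^sub>N \<pi> D\<^sub>1 \<theta>\<^sub>1 D\<^sub>2 \<theta>\<^sub>2"
  and angles: "0 < \<theta>\<^sub>1" "\<theta>\<^sub>1 < pi / 2"
  using bs by (auto simp: proper_bi_slant_submersion_def)

lemma submersion: "riemannian_submersion A g B g\<^sub>N \<pi>"
  and D1: "smooth_distribution A D\<^sub>1" and D2: "smooth_distribution A D\<^sub>2"
  and slant1: "slant g J D\<^sub>1 \<theta>\<^sub>1"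
  and Ver_D: "\<forall>p. Ver p = {u + v | u v. u \<in> D\<^sub>1 p \<and> v \<in> D\<^sub>2 p} \<and> (\<forall>u\<in>D\<^sub>1 p. \<forall>v\<in>D\<^sub>2 p. g p u v = 0)"
  and P_D: "\<forall>p. P p ` D\<^sub>1 p \<subseteq> D\<^sub>1 p \<and> P p ` D\<^sub>2 p \<subseteq> D\<^sub>2 p"
  using bi_slant unfolding bi_slant_submersion_def by - (elim conjE, assumption)+

lemma Ver_sum: "Ver p = {u + v | u v. u \<in> D\<^sub>1 p \<and> v \<in> D\<^sub>2 p}"
  using Ver_D[THEN spec, of p] by (rule conjunct1)

lemma D_orth: "u \<in> D\<^sub>1 p \<Longrightarrow> v \<in> D\<^sub>2 p \<Longrightarrow> g p u v = 0"
  using Ver_D[THEN spec, of p, THEN conjunct2] by blast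

lemma P_D1: "u \<in> D\<^sub>1 p \<Longrightarrow> P p u \<in> D\<^sub>1 p" and P_D2: "u \<in> D\<^sub>2 p \<Longrightarrow> P p u \<in> D\<^sub>2 p"
  using P_D[THEN spec, of p] by (auto simp: image_subset_iff)

lemma pi: "smooth_map_on A B UNIV \<pi>" and pi_surj: "surj (differential A B \<pi> p)"
  using submersion unfolding riemannian_submersion_def by - (elim conjE, (assumption | erule spec))+

lemma J_alg: "linear (J p) \<and> (\<forall>u. J p (J p u) = - u) \<and> (\<forall>u v. g p (J p u) (J p v) = g p u v)"
  using K[unfolded kaehler_def, THEN conjunct1] by (rule spec)

lemma J_linear: "linear (J p)" and J_sq: "J p (J p u) = - u" and J_iso: "g p (J p u) (J p v) = g p u v"
  using J_alg by blast+

lemma vf_J: "open W \<Longrightarrow> vf W X \<Longrightarrow> vf W (\<lambda>q. J q (X q))"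
  using K[unfolded kaehler_def, THEN conjunct2, THEN conjunct1] by blast

lemma nabla_J: "open W \<Longrightarrow> vf W X \<Longrightarrow> vf W Y \<Longrightarrow> p \<in> W \<Longrightarrow> nabla X (\<lambda>q. J q (Y q)) p = J p (nabla X Y p)"
  using K[unfolded kaehler_def, THEN conjunct2, THEN conjunct2, rule_format, of W X Y p] by simp

lemma J_skew: "g p (J p u) v = - g p u (J p v)"
  using J_iso[of p u "J p v"] by (simp add: J_sq g_simps)

lemma D1_subspace: "subspace (D\<^sub>1 p)" and D2_subspace: "subspace (D\<^sub>2 p)"
  using dist_subspace[OF D1] dist_subspace[OF D2] by auto

lemma D1_Ver: "u \<in> D\<^sub>1 p \<Longrightarrow> u \<in> Ver p" and D2_Ver: "u \<in> D\<^sub>2 p \<Longrightarrow> u \<in> Ver p"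
  unfolding Ver_sum using subspace_0[OF D1_subspace[of p]] subspace_0[OF D2_subspace[of p]]
  by (auto, metis add.right_neutral, metis add.left_neutral)

lemma pi_chart_linear: "compatible A c \<Longrightarrow> p \<in> cdom c \<Longrightarrow> compatible B d \<Longrightarrow> \<pi> p \<in> cdom d \<Longrightarrow>
    linear (frechet_derivative (\<lambda>x. cmap d (\<pi> (cinv c x))) (at (cmap c p)))"
  using smooth_map_on_has_derivative[OF A B _ _ open_UNIV pi] has_derivative_bounded_linear bounded_linear.linear by blast

lemma Ver_chart:
  assumes "compatible A c" "p \<in> cdom c" "compatible B d" "\<pi> p \<in> cdom d"
  shows "v \<in> Ver p \<longleftrightarrow> frechet_derivative (\<lambda>x. cmap d (\<pi> (cinv c x))) (at (cmap c p)) (to_chart A c p v) = 0"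
proof -
  have "differential A B \<pi> p v = 0 \<longleftrightarrow> to_chart B d (\<pi> p) (differential A B \<pi> p v) = 0"
    using from_to_chart[OF B assms(3,4)] linear_0[OF to_chart_linear[OF B assms(3,4)]]
      linear_0[OF from_chart_linear[OF B assms(3,4)]] by metis
  then show ?thesis
    using differential_chart[where f = \<pi>, OF A B assms(1,2) assms(3,4) open_UNIV UNIV_I pi] by (simp add: vertical_def)
qed

lemma Ver_subspace: "subspace (Ver p)"
  unfolding Ver_sum by (rule subspace_sums[OF D1_subspace D2_subspace, unfolded Collect_mem_eq])

text \<open>The vertical space is an orthogonal sum, so its projection is the sum of the two
  projections. The vertical projection thus inherits smoothness from the distributions.\<close>

lemma ver_eq: "ver' p u = orth_proj (g p) (D\<^sub>1 p) u + orth_proj (g p) (D\<^sub>2 p) u"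
  unfolding ver_def
proof (rule orth_proj_eqI[OF Ver_subspace])
  note i1 = orth_proj_in[OF D1, of p u] and i2 = orth_proj_in[OF D2, of p u]
  show "orth_proj (g p) (D\<^sub>1 p) u + orth_proj (g p) (D\<^sub>2 p) u \<in> Ver p" unfolding Ver_sum using i1 i2 by blast
  fix w assume "w \<in> Ver p"
  then obtain a b where w: "w = a + b" "a \<in> D\<^sub>1 p" "b \<in> D\<^sub>2 p" unfolding Ver_sum by blast
  show "g p (u - (orth_proj (g p) (D\<^sub>1 p) u + orth_proj (g p) (D\<^sub>2 p) u)) w = 0"
    using orth_proj_orth[OF D1 w(2), of u] orth_proj_orth[OF D2 w(3), of u] D_orth[OF i1 w(3)] D_orth[OF w(2) i2]
    unfolding w(1) by (simp add: g_simps g_sym)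
qed

lemma ver_in: "ver' p u \<in> Ver p"
  unfolding ver_eq Ver_sum using orth_proj_in[OF D1] orth_proj_in[OF D2] by blast

lemma ver_orth: "w \<in> Ver p \<Longrightarrow> g p (ver' p u) w = g p u w"
proof -
  assume "w \<in> Ver p"
  then obtain a b where w: "w = a + b" "a \<in> D\<^sub>1 p" "b \<in> D\<^sub>2 p" unfolding Ver_sum by blast
  show ?thesis
    using orth_proj_orth[OF D1 w(2), of u] orth_proj_orth[OF D2 w(3), of u]
      D_orth[OF orth_proj_in[OF D1] w(3), of u] D_orth[OF w(2) orth_proj_in[OF D2], of u]
    unfolding w(1) ver_eq by (simp add: g_simps g_sym)
qed

lemma ver_id: "u \<in> Ver p \<Longrightarrow> ver' p u = u"
  unfolding ver_def by (rule orth_proj_eqI[OF Ver_subspace]) (auto simp: g_simps)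

lemma vf_ver: "open W \<Longrightarrow> vf W X \<Longrightarrow> vf W (\<lambda>q. ver' q (X q))"
  unfolding ver_eq by (intro vector_field_on_add[OF A] vf_orth_proj[OF D1] vf_orth_proj[OF D2])

lemma horizontalD: "h \<in> horizontal A B \<pi> g p \<Longrightarrow> v \<in> Ver p \<Longrightarrow> g p h v = 0"
  by (simp add: horizontal_def)

lemma hor_eq: "hor' p u = u - ver' p u"
  unfolding hor_def
proof (rule orth_proj_eqI)
  show "subspace (horizontal A B \<pi> g p)"
    unfolding horizontal_def subspace_def by (simp add: g_simps)
  show "u - ver' p u \<in> horizontal A B \<pi> g p" by (simp add: horizontal_def g_simps ver_orth)
  show "g p (u - (u - ver' p u)) w = 0" if "w \<in> horizontal A B \<pi> g p" for w
    using horizontalD[OF that ver_in, of u] by (simp add: g_sym)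
qed

lemma hor_orth: "v \<in> Ver p \<Longrightarrow> g p (hor' p u) v = 0" "v \<in> Ver p \<Longrightarrow> g p v (hor' p u) = 0"
  using ver_orth[of v p u] by (auto simp: hor_eq g_simps g_sym[of p v])

lemma hor_hor: "hor' p (hor' p u) = hor' p u"
proof -
  have "ver' p (hor' p u) = 0"
    using ver_orth[OF ver_in, of p "hor' p u" "hor' p u"] hor_orth(1)[OF ver_in, of p u "hor' p u"] by (simp add: g_zero)
  then show ?thesis by (simp add: hor_eq[of p "hor' p u"])
qed

lemma vf_hor: "open W \<Longrightarrow> vf W X \<Longrightarrow> vf W (\<lambda>q. hor' q (X q))"
  unfolding hor_eq by (intro vector_field_on_diff[OF A] vf_ver)

section \<open>Algebra of the vertical and horizontal parts of J\<close>

lemma J_split: "J p u = P p u + F p u"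
  by (simp add: J_ver_def J_hor_def hor_eq)

lemma P_Ver: "P p u \<in> Ver p" by (simp add: J_ver_def ver_in)
lemma F_orth: "v \<in> Ver p \<Longrightarrow> g p (F p u) v = 0" "v \<in> Ver p \<Longrightarrow> g p v (F p u) = 0"
  by (simp_all add: J_hor_def hor_orth)

lemma vf_P: "open W \<Longrightarrow> vf W X \<Longrightarrow> vf W (\<lambda>q. P q (X q))"
  and vf_F: "open W \<Longrightarrow> vf W X \<Longrightarrow> vf W (\<lambda>q. F q (X q))"
  by (simp_all add: J_ver_def J_hor_def vf_ver vf_hor vf_J)

lemma g_P: "v \<in> Ver p \<Longrightarrow> g p (P p u) v = g p (J p u) v"
  by (simp add: J_ver_def ver_orth)

text \<open>\<open>J\<close> is an isometry and \<open>P\<close> preserves both distributions: in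
  g(Ju, Jv) = g(Pu, Pv) + g(Fu, Fv) the left side and the first summand vanish.\<close>

lemma g_F_orth: "u \<in> D\<^sub>1 p \<Longrightarrow> v \<in> D\<^sub>2 p \<Longrightarrow> g p (F p u) (F p v) = 0"
proof -
  assume u: "u \<in> D\<^sub>1 p" and v: "v \<in> D\<^sub>2 p"
  have "g p (J p u) (J p v) = g p (P p u) (P p v) + g p (F p u) (F p v)"
    unfolding J_split[of p u] J_split[of p v] by (simp add: g_simps F_orth P_Ver)
  then show ?thesis using D_orth[OF P_D1[OF u] P_D2[OF v]] D_orth[OF u v] by (simp add: J_iso)
qed

lemma P_linear: "linear (P p)"
proof -
  have "linear (ver' p)"
  proof (rule linearI)
    have uniq: "ver' p u = v" if "v \<in> Ver p" "\<And>w. w \<in> Ver p \<Longrightarrow> g p (u - v) w = 0" for u v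
      unfolding ver_def using orth_proj_eqI[OF Ver_subspace that] .
    show "ver' p (a + b) = ver' p a + ver' p b" for a b
      by (rule uniq) (simp_all add: subspace_add[OF Ver_subspace] ver_in g_simps ver_orth)
    show "ver' p (r *\<^sub>R a) = r *\<^sub>R ver' p a" for r a
      by (rule uniq) (simp_all add: subspace_scale[OF Ver_subspace] ver_in g_simps ver_orth)
  qed
  from linear_compose[OF J_linear this] show ?thesis by (simp add: J_ver_def[abs_def] o_def)
qed

text \<open>As \<open>P\<close> maps \<open>D\<^sub>1\<close> to itself, \<open>P p u\<close> is the
  orthogonal projection of \<open>J p u\<close> to \<open>D\<^sub>1 p\<close>. Hence the cosine of
  the slant angle is the ratio of the lengths of \<open>P p u\<close> and \<open>u\<close>.\<close>

lemma norm_P: "u \<in> D\<^sub>1 p \<Longrightarrow> g p (P p u) (P p u) = (cos \<theta>\<^sub>1)\<^sup>2 * g p u u"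
proof (cases "u = 0")
  case True
  then show ?thesis using linear_0[OF P_linear] by (simp add: g_simps)
next
  case False
  assume u: "u \<in> D\<^sub>1 p"
  have pr: "orth_proj (g p) (D\<^sub>1 p) (J p u) = P p u"
    by (rule orth_proj_eqI[OF D1_subspace P_D1[OF u]]) (simp add: g_simps g_P D1_Ver)
  let ?a = "sqrt (g p (P p u) (P p u))" and ?b = "sqrt (g p u u)"
  have b: "?b > 0" using g_pos[OF False] by simp
  have gP: "g p (J p u) (P p u) = g p (P p u) (P p u)" by (simp add: g_P P_Ver)
  have th: "arccos (g p (P p u) (P p u) / (?b * ?a)) = \<theta>\<^sub>1"
    using slant1 u False unfolding slant_def angle_to_subspace_def inner_angle_def by (metis pr gP J_iso)
  \<comment> \<open>If the projection vanished, the quotient would be 0 by the convention for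
    division by 0 and the angle would be pi / 2, which properness excludes.\<close>
  have a: "?a \<noteq> 0"
  proof
    assume "?a = 0"
    then have "\<theta>\<^sub>1 = pi / 2" using th by simp
    then show False using angles by simp
  qed
  have nn: "g p (P p u) (P p u) \<ge> 0" using g_pos[of "P p u" p] by (cases "P p u = 0") (auto simp: g_simps)
  have e: "g p (P p u) (P p u) / (?b * ?a) = ?a / ?b"
    using mult_divide_mult_cancel_right[OF a, of ?a ?b] nn by (simp only: real_sqrt_mult_self abs_of_nonneg)
  have "g p (J p u) (J p u) = g p (P p u) (P p u) + g p (F p u) (F p u)"
    unfolding J_split[of p u] by (simp add: g_simps F_orth P_Ver)
  moreover have "g p (F p u) (F p u) \<ge> 0" using g_pos[of "F p u" p] by (cases "F p u = 0") (auto simp: g_simps)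
  ultimately have "g p (P p u) (P p u) \<le> g p u u" by (simp add: J_iso)
  then have "?a / ?b \<le> 1" using b by simp
  moreover have "?a / ?b \<ge> 0" using b nn by simp
  ultimately have "cos \<theta>\<^sub>1 = ?a / ?b" using th cos_arccos[of "?a / ?b"] unfolding e by auto
  then have "(cos \<theta>\<^sub>1)\<^sup>2 = g p (P p u) (P p u) / g p u u" using nn g_pos[OF False, of p] by (simp add: power_divide)
  then show ?thesis using g_pos[OF False, of p] by simp
qed

text \<open>Polarization turns the length formula into one for inner products, and \<open>P\<close>
  is skew on vertical vectors. So the vector \<open>w\<close>, the difference of the two sides, is
  orthogonal to all of \<open>D\<^sub>1 p\<close>, in particular to itself.\<close>

lemma P_P: "u \<in> D\<^sub>1 p \<Longrightarrow> P p (P p u) = - ((cos \<theta>\<^sub>1)\<^sup>2) *\<^sub>R u"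
proof -
  assume u: "u \<in> D\<^sub>1 p"
  have pol: "g p (P p u) (P p v) = (cos \<theta>\<^sub>1)\<^sup>2 * g p u v" if v: "v \<in> D\<^sub>1 p" for v
  proof -
    have "g p (P p (u + v)) (P p (u + v)) = (cos \<theta>\<^sub>1)\<^sup>2 * g p (u + v) (u + v)"
      by (rule norm_P[OF subspace_add[OF D1_subspace u v]])
    then show ?thesis
      using norm_P[OF u] norm_P[OF v] by (simp add: linear_add[OF P_linear] g_simps g_sym[of p "P p v" "P p u"] g_sym[of p v u] algebra_simps)
  qed
  define w where "w = P p (P p u) + ((cos \<theta>\<^sub>1)\<^sup>2) *\<^sub>R u"
  have w: "w \<in> D\<^sub>1 p" unfolding w_def
    by (intro subspace_add[OF D1_subspace] subspace_scale[OF D1_subspace] P_D1 u)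
  have "g p (P p (P p u)) w = - g p (P p u) (P p w)"
    using J_skew[of p "P p u" w] g_P[OF D1_Ver[OF w], of "P p u"] g_P[OF P_Ver, of p w u]
      g_P[OF P_Ver, of p u w] by (simp add: g_sym[of p "P p u" "J p w"] g_sym[of p "P p u" "P p w"])
  moreover have "g p w w = g p (P p (P p u)) w + (cos \<theta>\<^sub>1)\<^sup>2 * g p u w"
  proof -
    have "g p w w = g p (P p (P p u) + ((cos \<theta>\<^sub>1)\<^sup>2) *\<^sub>R u) w" unfolding w_def ..
    then show ?thesis by (simp add: g_simps)
  qed
  ultimately have "g p w w = 0" using pol[OF w] by simp
  then have "w = 0" by (simp add: g_zero)
  then show ?thesis by (simp add: w_def add_eq_0_iff2)
qed

text \<open>In charts \<open>\<pi>\<close> is a map \<open>h\<close>, and relatedness reads Dh(X) =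
  0 and Dh(Y) = \<eta>(h). The second is differentiated along \<open>X\<close> and the first along
  \<open>Y\<close>: the second derivatives of \<open>h\<close> agree by symmetry, and the derivative
  of \<open>\<eta>\<close> is evaluated at Dh(X) = 0. Subtracting shows that Dh kills the
  bracket.\<close>

lemma related_bracket_vertical:
  assumes W: "open W" "p \<in> W" and X: "vf W X" "\<And>q. q \<in> W \<Longrightarrow> X q \<in> Ver q" and Y: "vf W Y"
    and d: "compatible B d" "\<pi> p \<in> cdom d" and \<eta>: "\<eta> differentiable (at (cmap d (\<pi> p)))"
    and rel: "\<And>q. q \<in> W \<Longrightarrow> \<pi> q \<in> cdom d \<Longrightarrow> to_chart B d (\<pi> q) (differential A B \<pi> q (Y q)) = \<eta> (cmap d (\<pi> q))"
  shows "lie_bracket A X Y p \<in> Ver p"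
proof -
  obtain c where c: "c \<in> A" "p \<in> cdom c" using atlas_cover[OF A] by blast
  note cc = atlas_compatible[OF A c(1)]
  define h where "h = (\<lambda>x. cmap d (\<pi> (cinv c x)))"
  let ?V = "cdom c \<inter> UNIV \<inter> \<pi> -` cdom d" and ?x = "cmap c p"
  have cpi: "continuous_on UNIV \<pi>" using pi by (simp add: smooth_map_on_def)
  have V: "open ?V" "open (cmap c ` ?V)" by (rule smooth_map_on_open_rep[OF cc d(1) open_UNIV cpi])+
  have sh: "smooth_on (cmap c ` ?V) h" unfolding h_def by (rule smooth_map_on_rep[OF A B cc d(1) open_UNIV pi])
  let ?U = "cmap c ` (?V \<inter> W)"
  have U: "open ?U" by (rule open_cmap_image[OF cc]) (use V W in auto)
  have xU: "?x \<in> ?U" "?x \<in> cmap c ` ?V" using c d W by auto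
  have hx: "h ?x = cmap d (\<pi> p)" by (simp add: h_def cinv_cmap[OF cc c(2)])
  define D2h where "D2h u w = frechet_derivative (\<lambda>y. frechet_derivative h (at y) u) (at ?x) w" for u w
  have sym: "D2h u w = D2h w u" for u w unfolding D2h_def by (rule smooth_on_symmetric_derivative[OF sh V(2) xU(2)])
  let ?dh = "frechet_derivative h (at ?x)" and ?X = "to_chart A c p (X p)" and ?Y = "to_chart A c p (Y p)"
  have key: "D2h (to_chart A c p (Z p)) w + ?dh (frechet_derivative (field_rep A c Z) (at ?x) w) =
      frechet_derivative \<zeta> (at (cmap d (\<pi> p))) (?dh w)"
    if Z: "vf W Z" and \<zeta>: "\<zeta> differentiable (at (cmap d (\<pi> p)))"
      and relZ: "\<And>q. q \<in> W \<Longrightarrow> \<pi> q \<in> cdom d \<Longrightarrow> to_chart B d (\<pi> q) (differential A B \<pi> q (Z q)) = \<zeta> (cmap d (\<pi> q))"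
    for Z \<zeta> w
  proof -
    have dZ: "(field_rep A c Z has_derivative frechet_derivative (field_rep A c Z) (at ?x)) (at ?x)"
      by (rule smooth_on_has_derivative[OF vector_field_on_rep[OF A cc W(1) Z]]) (use c W in blast)
    have 1: "((\<lambda>y. frechet_derivative h (at y) (field_rep A c Z y)) has_derivative
        (\<lambda>w. D2h (to_chart A c p (Z p)) w + ?dh (frechet_derivative (field_rep A c Z) (at ?x) w))) (at ?x)"
      using has_derivative_derivative_field[OF sh V(2) xU(2) dZ] by (simp add: D2h_def field_rep_cmap[OF cc c(2)])
    have 2: "((\<lambda>y. \<zeta> (h y)) has_derivative (\<lambda>w. frechet_derivative \<zeta> (at (cmap d (\<pi> p))) (?dh w))) (at ?x)"
      by (rule has_derivative_compose[OF smooth_on_has_derivative[OF sh xU(2)]])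
        (use has_frechet_derivative[OF \<zeta>] hx in simp)
    have "((\<lambda>y. \<zeta> (h y)) has_derivative
        (\<lambda>w. D2h (to_chart A c p (Z p)) w + ?dh (frechet_derivative (field_rep A c Z) (at ?x) w))) (at ?x)"
    proof (rule has_derivative_transform_within_open[OF 1 U xU(1)])
      fix y assume "y \<in> ?U"
      then obtain q where q: "q \<in> cdom c" "\<pi> q \<in> cdom d" "q \<in> W" "y = cmap c q" by blast
      show "frechet_derivative h (at y) (field_rep A c Z y) = \<zeta> (h y)"
        using relZ[OF q(3,2)] differential_chart[where f = \<pi>, OF A B cc q(1) d(1) q(2) open_UNIV UNIV_I pi]
        by (simp add: q(4) field_rep_cmap[OF cc q(1)] h_def cinv_cmap[OF cc q(1)])
    qed
    from has_derivative_unique[OF this 2] show ?thesis by meson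
  qed
  have ver0: "?dh ?X = 0" using X(2)[OF W(2)] Ver_chart[OF cc c(2) d] by (simp add: h_def)
  have l\<eta>: "linear (frechet_derivative \<eta> (at (cmap d (\<pi> p))))"
    using frechet_derivative_linear[OF \<eta>] bounded_linear.linear by blast
  have "D2h ?Y ?X + ?dh (frechet_derivative (field_rep A c Y) (at ?x) ?X) = 0"
    using key[OF Y \<eta> rel, of ?X] by (simp add: ver0 linear_0[OF l\<eta>])
  moreover have "D2h ?X ?Y + ?dh (frechet_derivative (field_rep A c X) (at ?x) ?Y) = 0"
  proof -
    have "to_chart B d (\<pi> q) (differential A B \<pi> q (X q)) = 0" if "q \<in> W" "\<pi> q \<in> cdom d" for q
      using X(2)[OF that(1)] linear_0[OF to_chart_linear[OF B d(1) that(2)]] by (simp add: vertical_def)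
    then show ?thesis using key[OF X(1), of "\<lambda>_. 0" ?Y] by (simp add: frechet_derivative_eq[OF has_derivative_const])
  qed
  ultimately have "?dh (frechet_derivative (field_rep A c Y) (at ?x) ?X - frechet_derivative (field_rep A c X) (at ?x) ?Y) = 0"
    using sym[of ?X ?Y] pi_chart_linear[OF cc c(2) d] unfolding h_def[symmetric] by (simp add: linear_diff) (metis add_left_imp_eq)
  then show ?thesis
    unfolding Ver_chart[OF cc c(2) d] lie_bracket_chart[OF A cc c(2) W X(1) Y] h_def .
qed

lemma bracket_vertical:
  assumes W: "open W" "p \<in> W" and X: "vf W X" "\<And>q. q \<in> W \<Longrightarrow> X q \<in> Ver q" and Y: "vf W Y" "\<And>q. q \<in> W \<Longrightarrow> Y q \<in> Ver q"
  shows "lie_bracket A X Y p \<in> Ver p"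
proof -
  obtain d where d: "d \<in> B" "\<pi> p \<in> cdom d" using atlas_cover[OF B] by blast
  note dd = atlas_compatible[OF B d(1)]
  have "to_chart B d (\<pi> q) (differential A B \<pi> q (Y q)) = 0" if "q \<in> W" "\<pi> q \<in> cdom d" for q
    using Y(2)[OF that(1)] linear_0[OF to_chart_linear[OF B dd that(2)]] by (simp add: vertical_def)
  then show ?thesis by (intro related_bracket_vertical[OF W X Y(1) dd d(2), of "\<lambda>_. 0"]) auto
qed

lemma bracket_basic:
  assumes W: "open W" "p \<in> W" and X: "vf W X" "\<And>q. q \<in> W \<Longrightarrow> X q \<in> Ver q" and Y: "basic_on A g B \<pi> W Y"
  shows "lie_bracket A X Y p \<in> Ver p"
proof -
  have vY: "vf W Y" using Y by (simp add: basic_on_def section_on_def)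
  obtain V Z where V: "open V" "\<pi> ` W \<subseteq> V" and Z: "vector_field_on B V Z" "\<And>q. q \<in> W \<Longrightarrow> differential A B \<pi> q (Y q) = Z (\<pi> q)"
    using Y unfolding basic_on_def by blast
  obtain d where d: "d \<in> B" "\<pi> p \<in> cdom d" using atlas_cover[OF B] by blast
  note dd = atlas_compatible[OF B d(1)]
  show ?thesis
  proof (rule related_bracket_vertical[OF W X vY dd d(2)])
    show "field_rep B d Z differentiable (at (cmap d (\<pi> p)))"
      by (rule smooth_on_differentiable[OF vector_field_on_rep[OF B dd V(1) Z(1)]]) (use V W d in blast)
  qed (simp_all add: field_rep_cmap[OF dd] Z(2))
qed

text \<open>Symmetry of the second fundamental form of the fibres in the direction \<open>H\<close>:
  metric compatibility moves the derivative from \<open>H\<close> to the vertical field, and the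
  bracket of vertical fields is vertical, hence orthogonal to \<open>H\<close>.\<close>

lemma nabla_swap:
  assumes W: "open W" "p \<in> W" and X: "vf W X" "\<And>q. q \<in> W \<Longrightarrow> X q \<in> Ver q" and V: "vf W V" "\<And>q. q \<in> W \<Longrightarrow> V q \<in> Ver q"
    and H: "vf W H" "\<And>q v. q \<in> W \<Longrightarrow> v \<in> Ver q \<Longrightarrow> g q (H q) v = 0"
  shows "g p (nabla X H p) (V p) = g p (nabla V H p) (X p)"
proof -
  have "g p (nabla X H p) (V p) = - g p (H p) (nabla X V p)"
    by (rule nabla_orthogonal[OF W H(1) V(1) X(1)]) (use H V in blast)
  also have "g p (H p) (nabla X V p) = g p (H p) (nabla V X p)"
    using H(2)[OF W(2) bracket_vertical[OF W X V]]
    unfolding nabla_torsion[OF W(1) X(1) V(1) W(2), symmetric] by (simp add: g_simps)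
  also have "- \<dots> = g p (nabla V H p) (X p)"
    using nabla_orthogonal[OF W H(1) X(1) V(1)] H(2) X(2) by simp
  finally show ?thesis .
qed

text \<open>The place where basic fields are used. For a basic section \<open>C\<close> of
  \<open>F D\<^sub>2\<close>, the field FY is orthogonal to \<open>C\<close> and the bracket of
  \<open>X\<close> and \<open>C\<close> is vertical, so g(\<nabla>_X FY, C) = -g(FY, \<nabla>_X C) =
  -g(FY, \<nabla>_C X) = g(\<nabla>_C FY, X). Both ends depend only on the value of \<open>C\<close>
  at \<open>p\<close>, so FU may be expanded in basic fields at this one point.\<close>

lemma nabla_F_F:
  assumes W: "open W" "p \<in> W" and X: "section_on A D\<^sub>1 W X" and Y: "section_on A D\<^sub>1 W Y" and U: "section_on A D\<^sub>2 W U"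
  shows "g p (nabla X (\<lambda>q. F q (Y q)) p) (F p (U p)) = g p (nabla (\<lambda>q. F q (U q)) (\<lambda>q. F q (Y q)) p) (X p)"
proof -
  obtain W0 S where W0: "open W0" "p \<in> W0" and S: "finite S" "\<And>C. C \<in> S \<Longrightarrow> basic_on A g B \<pi> W0 C"
    "\<And>q. q \<in> W0 \<Longrightarrow> span ((\<lambda>C. C q) ` S) = F q ` D\<^sub>2 q"
    using basic2 unfolding locally_spanned_by_basic_def by metis
  let ?V = "W \<inter> W0"
  have V: "open ?V" "p \<in> ?V" using W W0 by auto
  have X': "vf ?V X" "\<And>q. q \<in> ?V \<Longrightarrow> X q \<in> D\<^sub>1 q" "\<And>q. q \<in> ?V \<Longrightarrow> X q \<in> Ver q"
    using X D1_Ver by (auto simp: section_on_def intro: vector_field_on_mono)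
  have Y': "vf ?V Y" "\<And>q. q \<in> ?V \<Longrightarrow> Y q \<in> D\<^sub>1 q" using Y by (auto simp: section_on_def intro: vector_field_on_mono)
  have U': "vf ?V U" "\<And>q. q \<in> ?V \<Longrightarrow> U q \<in> D\<^sub>2 q" using U by (auto simp: section_on_def intro: vector_field_on_mono)
  let ?FY = "\<lambda>q. F q (Y q)" and ?FU = "\<lambda>q. F q (U q)"
  have FY: "vf ?V ?FY" and FU: "vf ?V ?FU" using vf_F[OF V(1)] Y' U' by auto
  have C: "basic_on A g B \<pi> ?V C" "vf ?V C" if "C \<in> S" for C
  proof -
    have sec: "section_on A (horizontal A B \<pi> g) W0 C" using S(2)[OF that] by (simp add: basic_on_def)
    obtain V' Z where Z: "open V'" "\<pi> ` W0 \<subseteq> V'" "vector_field_on B V' Z" "\<forall>q\<in>W0. differential A B \<pi> q (C q) = Z (\<pi> q)"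
      using S(2)[OF \<open>C \<in> S\<close>] unfolding basic_on_def by blast
    show vC: "vf ?V C" using sec by (auto simp: section_on_def intro: vector_field_on_mono)
    have "section_on A (horizontal A B \<pi> g) ?V C" using sec vC by (simp add: section_on_def)
    then show "basic_on A g B \<pi> ?V C" using Z unfolding basic_on_def by blast
  qed
  have key: "g p (nabla X ?FY p) (C p) = g p (nabla C ?FY p) (X p)" if "C \<in> S" for C
  proof -
    have 1: "g q (?FY q) (C q) = 0" if q: "q \<in> ?V" for q
    proof -
      have "C q \<in> span ((\<lambda>C. C q) ` S)" using \<open>C \<in> S\<close> by (intro span_base) auto
      then obtain v where "v \<in> D\<^sub>2 q" "C q = F q v" using S(3)[of q] q by auto
      then show ?thesis using g_F_orth Y'(2)[OF q] by simp
    qed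
    have "g p (nabla X ?FY p) (C p) = - g p (?FY p) (nabla X C p)"
      by (rule nabla_orthogonal[OF V FY C(2)[OF that] X'(1) 1])
    also have "g p (?FY p) (nabla X C p) = g p (?FY p) (nabla C X p)"
      using F_orth(1)[OF bracket_basic[OF V X'(1,3) C(1)[OF that]], of "Y p"]
      unfolding nabla_torsion[OF V(1) X'(1) C(2)[OF that] V(2), symmetric] by (simp add: g_simps)
    also have "- \<dots> = g p (nabla C ?FY p) (X p)"
      using nabla_orthogonal[OF V FY X'(1) C(2)[OF that]] F_orth(1) X'(3) by simp
    finally show ?thesis .
  qed
  have "?FU p \<in> span ((\<lambda>C. C p) ` S)" using S(3)[OF W0(2)] U'(2)[OF V(2)] by simp
  then obtain k where k: "?FU p = (\<Sum>v\<in>(\<lambda>C. C p) ` S. k v *\<^sub>R v)"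
    using span_finite[OF finite_imageI[OF S(1)]] by auto
  \<comment> \<open>Different fields of \<open>S\<close> may coincide at \<open>p\<close>; one field
    is kept for each value, so that a sum over vectors becomes a sum over fields.\<close>
  obtain S' where S': "S' \<subseteq> S" "inj_on (\<lambda>C. C p) S'" "(\<lambda>C. C p) ` S' = (\<lambda>C. C p) ` S"
    using subset_image_inj[of "(\<lambda>C. C p) ` S" "\<lambda>C. C p" S] by auto
  define a where "a C = k (C p)" for C :: "'m \<Rightarrow> 'e"
  have FUp: "?FU p = (\<Sum>C\<in>S'. a C *\<^sub>R C p)"
  proof -
    have "?FU p = (\<Sum>v\<in>(\<lambda>C. C p) ` S'. k v *\<^sub>R v)" unfolding S'(3) by (rule k)
    also have "\<dots> = (\<Sum>C\<in>S'. a C *\<^sub>R C p)" unfolding a_def using sum.reindex[OF S'(2)] by (simp add: o_def)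
    finally show ?thesis .
  qed
  have vC: "vf ?V C" if "C \<in> S'" for C using C(2) S'(1) that by blast
  have "nabla ?FU ?FY p = nabla (\<lambda>q. \<Sum>C\<in>S'. a C *\<^sub>R C q) ?FY p"
    by (rule nabla_tensorial[of ?V p ?FU "\<lambda>q. \<Sum>C\<in>S'. a C *\<^sub>R C q", OF V FU _ FY FUp])
      (intro vector_field_on_sum[OF A V(1)] vector_field_on_scaleR[OF A V(1)] sf_const vC)
  also have "\<dots> = (\<Sum>C\<in>S'. a C *\<^sub>R nabla C ?FY p)" by (rule nabla_sum_left[OF V vC sf_const FY])
  finally have "g p (nabla ?FU ?FY p) (X p) = (\<Sum>C\<in>S'. a C * g p (nabla C ?FY p) (X p))"
    by (simp add: g_simps)
  also have "\<dots> = (\<Sum>C\<in>S'. a C * g p (nabla X ?FY p) (C p))" using key S'(1) by (intro sum.cong) auto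
  also have "\<dots> = g p (nabla X ?FY p) (?FU p)" unfolding FUp by (simp add: g_simps)
  finally show ?thesis by simp
qed

lemma g_T: "v \<in> Ver p \<Longrightarrow> g p (oneill_T A g B \<pi> nabla E G p) v = g p (nabla (\<lambda>q. ver' q (E q)) (\<lambda>q. hor' q (G q)) p) v"
  by (simp add: oneill_T_def Let_def g_simps ver_orth hor_orth)

lemma g_A: "v \<in> Ver p \<Longrightarrow> g p (oneill_A A g B \<pi> nabla E G p) v = g p (nabla (\<lambda>q. hor' q (E q)) (\<lambda>q. hor' q (G q)) p) v"
  by (simp add: oneill_A_def Let_def g_simps ver_orth hor_orth)

text \<open>Since \<nabla>J = 0, g(\<nabla>_X Y, U) = g(\<nabla>_X JY, JU) with JY = PY + FY. In the
  PY term, \<open>J\<close> is moved from \<open>U\<close> back to the derivative, where PPY =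
  -cos^2 Y reproduces cos^2 times the left side, plus a term with FPY. The terms with horizontal
  fields are turned by \<open>nabla_swap\<close> and \<open>nabla_F_F\<close> into derivatives
  paired with \<open>X\<close>, which are the values of the O'Neill tensors. The factor 1 - cos^2 is
  the square of the sine.\<close>

lemma tensor_identity:
  assumes W: "open W" "p \<in> W" and X: "section_on A D\<^sub>1 W X" and Y: "section_on A D\<^sub>1 W Y" and U: "section_on A D\<^sub>2 W U"
  shows "g p (oneill_T A g B \<pi> nabla (\<lambda>q. P q (U q)) (\<lambda>q. F q (Y q)) p
      - oneill_T A g B \<pi> nabla U (\<lambda>q. F q (P q (Y q))) p
      + oneill_A A g B \<pi> nabla (\<lambda>q. F q (U q)) (\<lambda>q. F q (Y q)) p) (X p) = (sin \<theta>\<^sub>1)\<^sup>2 * g p (nabla X Y p) (U p)"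
proof -
  have X': "vf W X" "\<And>q. q \<in> W \<Longrightarrow> X q \<in> D\<^sub>1 q" "\<And>q. q \<in> W \<Longrightarrow> X q \<in> Ver q" using X D1_Ver by (auto simp: section_on_def)
  have Y': "vf W Y" "\<And>q. q \<in> W \<Longrightarrow> Y q \<in> D\<^sub>1 q" "\<And>q. q \<in> W \<Longrightarrow> Y q \<in> Ver q" using Y D1_Ver by (auto simp: section_on_def)
  have U': "vf W U" "\<And>q. q \<in> W \<Longrightarrow> U q \<in> D\<^sub>2 q" "\<And>q. q \<in> W \<Longrightarrow> U q \<in> Ver q" using U D2_Ver by (auto simp: section_on_def)
  let ?PY = "\<lambda>q. P q (Y q)" and ?FY = "\<lambda>q. F q (Y q)" and ?PU = "\<lambda>q. P q (U q)" and ?FU = "\<lambda>q. F q (U q)"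
  let ?PPY = "\<lambda>q. P q (P q (Y q))" and ?FPY = "\<lambda>q. F q (P q (Y q))"
  note v = vf_P[OF W(1)] vf_F[OF W(1)]
  have vfs: "vf W ?PY" "vf W ?FY" "vf W ?PU" "vf W ?FU" "vf W ?PPY" "vf W ?FPY"
    using v(1)[OF Y'(1)] v(2)[OF Y'(1)] v(1)[OF U'(1)] v(2)[OF U'(1)] v(1)[OF v(1)[OF Y'(1)]] v(2)[OF v(1)[OF Y'(1)]] by auto
  have J_fun: "(\<lambda>q. J q (Z q)) = (\<lambda>q. P q (Z q) + F q (Z q))" for Z by (rule ext, rule J_split)
  have split1: "nabla X (\<lambda>q. J q (Y q)) p = nabla X ?PY p + nabla X ?FY p"
    unfolding J_fun by (rule nabla_add_right[OF W(1) vfs(1,2) X'(1) W(2)])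
  have split2: "nabla X (\<lambda>q. J q (P q (Y q))) p = nabla X ?PPY p + nabla X ?FPY p"
    unfolding J_fun by (rule nabla_add_right[OF W(1) vfs(5,6) X'(1) W(2)])
  have PP: "nabla X ?PPY p = - ((cos \<theta>\<^sub>1)\<^sup>2) *\<^sub>R nabla X Y p"
    by (rule trans[OF nabla_cong[OF W X'(1) X'(1) vfs(5) vector_field_on_scaleR[OF A W(1) sf_const Y'(1)] refl P_P[OF Y'(2)]]
      nabla_scale_const[OF W(1) X'(1) Y'(1) W(2)]])
  have "g p (nabla X Y p) (U p) = g p (J p (nabla X Y p)) (J p (U p))" by (simp add: J_iso)
  also have "\<dots> = g p (nabla X ?PY p + nabla X ?FY p) (J p (U p))"
    using nabla_J[OF W(1) X'(1) Y'(1) W(2)] split1 by simp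
  also have "\<dots> = g p (nabla X ?PY p) (J p (U p)) + g p (nabla X ?FY p) (?PU p) + g p (nabla X ?FY p) (?FU p)"
    by (simp add: g_simps J_split[of p "U p"])
  also have "g p (nabla X ?PY p) (J p (U p)) = - g p (nabla X ?PPY p + nabla X ?FPY p) (U p)"
    using nabla_J[OF W(1) X'(1) vfs(1) W(2)] split2 J_skew[of p "nabla X ?PY p" "U p"] by simp
  also have "\<dots> = (cos \<theta>\<^sub>1)\<^sup>2 * g p (nabla X Y p) (U p) - g p (nabla X ?FPY p) (U p)"
    unfolding PP by (simp add: g_simps)
  finally have "(1 - (cos \<theta>\<^sub>1)\<^sup>2) * g p (nabla X Y p) (U p) =
      g p (nabla X ?FY p) (?PU p) - g p (nabla X ?FPY p) (U p) + g p (nabla X ?FY p) (?FU p)"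
    by (simp add: algebra_simps)
  also have "g p (nabla X ?FY p) (?PU p) = g p (nabla ?PU ?FY p) (X p)"
    by (rule nabla_swap[OF W X'(1,3) vfs(3) P_Ver vfs(2) F_orth(1)])
  also have "g p (nabla X ?FPY p) (U p) = g p (nabla U ?FPY p) (X p)"
    by (rule nabla_swap[OF W X'(1,3) U'(1,3) vfs(6) F_orth(1)])
  also have "g p (nabla X ?FY p) (?FU p) = g p (nabla ?FU ?FY p) (X p)" by (rule nabla_F_F[OF W X Y U])
  finally have main: "(sin \<theta>\<^sub>1)\<^sup>2 * g p (nabla X Y p) (U p) =
      g p (nabla ?PU ?FY p) (X p) - g p (nabla U ?FPY p) (X p) + g p (nabla ?FU ?FY p) (X p)"
    by (simp add: sin_squared_eq)
  have h: "hor' q (F q u) = F q u" and vP: "ver' q (P q u) = P q u" for q u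
    by (simp_all add: J_hor_def hor_hor ver_id[OF P_Ver])
  have nU: "nabla (\<lambda>q. ver' q (U q)) ?FPY p = nabla U ?FPY p"
    by (rule nabla_cong[OF W vf_ver[OF W(1) U'(1)] U'(1) vfs(6) vfs(6) ver_id[OF U'(3)] refl])
  show ?thesis
    unfolding main using X'(3)[OF W(2)] by (simp add: g_simps g_T g_A h vP nU)
qed

end

subsection \<open>Product charts\<close>

definition prod_chart :: "('m, 'e) chart \<Rightarrow> ('n, 'f) chart \<Rightarrow> ('m \<times> 'n, 'e \<times> 'f) chart" where
  "prod_chart c d = (cdom c \<times> cdom d, map_prod (cmap c) (cmap d))"

lemma prod_atlas_eq: "prod_atlas A B = {prod_chart c d | c d. c \<in> A \<and> d \<in> B}"
  by (simp add: prod_atlas_def prod_chart_def)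

lemma prod_chart_simps [simp]:
  "cdom (prod_chart c d) = cdom c \<times> cdom d" "cmap (prod_chart c d) = map_prod (cmap c) (cmap d)"
  by (simp_all add: prod_chart_def)

lemma prod_chart_image: "map_prod (cmap c) (cmap d) ` (X \<times> Y) = (cmap c ` X) \<times> (cmap d ` Y)"
  by auto

lemma cinv_prod_chart:
  assumes "compatible A c" "compatible B d" "x \<in> cmap c ` cdom c" "y \<in> cmap d ` cdom d"
  shows "cinv (prod_chart c d) (x, y) = (cinv c x, cinv d y)"
proof (rule inv_into_f_eq)
  show "inj_on (cmap (prod_chart c d)) (cdom (prod_chart c d))"
    using compatible_inj[OF assms(1)] compatible_inj[OF assms(2)] by (auto simp: inj_on_def)
qed (use assms in \<open>auto simp: cmap_cinv cinv_in\<close>)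

lemma smooth_atlas_prod:
  assumes A: "smooth_atlas A" and B: "smooth_atlas B"
  shows "smooth_atlas (prod_atlas A B)"
  unfolding smooth_atlas_def
proof (intro conjI ballI)
  fix k assume "k \<in> prod_atlas A B"
  then obtain c d where k: "k = prod_chart c d" "c \<in> A" "d \<in> B" by (auto simp: prod_atlas_eq)
  note c = atlas_compatible[OF A k(2)] and d = atlas_compatible[OF B k(3)]
  show "open (cdom k)" using compatible_open(1)[OF c] compatible_open(1)[OF d] by (simp add: k open_Times)
  show "open (cmap k ` cdom k)"
    using compatible_open(2)[OF c] compatible_open(2)[OF d] by (simp add: k prod_chart_image open_Times)
  show "homeomorphism (cdom k) (cmap k ` cdom k) (cmap k) (cinv k)"
  proof (rule homeomorphismI)
    show "continuous_on (cdom k) (cmap k)"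
      unfolding k prod_chart_simps map_prod_def case_prod_unfold
      by (intro continuous_on_Pair continuous_on_compose2[OF continuous_cmap[OF c]]
          continuous_on_compose2[OF continuous_cmap[OF d]] continuous_on_fst continuous_on_snd continuous_on_id) auto
    have "continuous_on (cmap k ` cdom k) (\<lambda>z. (cinv c (fst z), cinv d (snd z)))"
      unfolding k prod_chart_simps prod_chart_image
      by (intro continuous_on_Pair continuous_on_compose2[OF continuous_cinv[OF c]]
          continuous_on_compose2[OF continuous_cinv[OF d]] continuous_on_fst continuous_on_snd continuous_on_id) auto
    moreover have "cinv k z = (cinv c (fst z), cinv d (snd z))" if "z \<in> cmap k ` cdom k" for z
      using that cinv_prod_chart[OF c d] unfolding k prod_chart_simps prod_chart_image by (metis mem_Times_iff prod.collapse)
    ultimately show "continuous_on (cmap k ` cdom k) (cinv k)" using continuous_on_cong by (metis (no_types, lifting))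
    have i: "inj_on (cmap k) (cdom k)"
      using compatible_inj[OF c] compatible_inj[OF d] by (auto simp: k inj_on_def)
    show "cinv k ` cmap k ` cdom k \<subseteq> cdom k" using i by (auto simp: inv_into_f_f)
    show "cinv k (cmap k x) = x" if "x \<in> cdom k" for x using i that by (simp add: inv_into_f_f)
  qed (auto simp: f_inv_into_f)
next
  show "(\<Union>k\<in>prod_atlas A B. cdom k) = UNIV"
  proof (rule set_eqI)
    fix z :: "'a \<times> 'c"
    obtain c where c: "c \<in> A" "fst z \<in> cdom c" using atlas_cover[OF A] by blast
    obtain d where d: "d \<in> B" "snd z \<in> cdom d" using atlas_cover[OF B] by blast
    have "prod_chart c d \<in> prod_atlas A B" "z \<in> cdom (prod_chart c d)"
      unfolding prod_atlas_eq prod_chart_simps mem_Times_iff using c d by blast+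
    then show "z \<in> (\<Union>k\<in>prod_atlas A B. cdom k) \<longleftrightarrow> z \<in> UNIV" by blast
  qed
next
  fix k l assume "k \<in> prod_atlas A B" "l \<in> prod_atlas A B"
  then obtain c d c' d' where k: "k = prod_chart c d" "c \<in> A" "d \<in> B" and l: "l = prod_chart c' d'" "c' \<in> A" "d' \<in> B"
    by (auto simp: prod_atlas_eq)
  note c = atlas_compatible[OF A k(2)] and d = atlas_compatible[OF B k(3)]
    and c' = atlas_compatible[OF A l(2)] and d' = atlas_compatible[OF B l(3)]
  let ?X = "cmap c ` (cdom c \<inter> cdom c')" and ?Y = "cmap d ` (cdom d \<inter> cdom d')"
  have oX: "open ?X" and oY: "open ?Y" by (rule open_chart_overlap[OF c c'], rule open_chart_overlap[OF d d'])
  have o: "open (?X \<times> ?Y)" by (rule open_Times[OF oX oY])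
  have "smooth_on (?X \<times> ?Y) (\<lambda>z. (cmap c' (cinv c (fst z)), cmap d' (cinv d (snd z))))"
    by (intro smooth_on_Pair o smooth_on_compose[OF o oX _ transition_smooth[OF A c c']]
        smooth_on_compose[OF o oY _ transition_smooth[OF B d d']]
        smooth_on_linear[OF o bounded_linear_fst smooth_on_ident[OF o]]
        smooth_on_linear[OF o bounded_linear_snd smooth_on_ident[OF o]]) auto
  moreover have "cmap k ` (cdom k \<inter> cdom l) = ?X \<times> ?Y" by (auto simp: k l)
  ultimately show "smooth_on (cmap k ` (cdom k \<inter> cdom l)) (cmap l \<circ> cinv k)"
  proof (simp only:, elim smooth_on_cong[OF o, rotated])
    fix z assume "z \<in> ?X \<times> ?Y"
    then have "fst z \<in> cmap c ` cdom c" "snd z \<in> cmap d ` cdom d" by auto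
    from cinv_prod_chart[OF c d this]
    show "(cmap c' (cinv c (fst z)), cmap d' (cinv d (snd z))) = (cmap l \<circ> cinv k) z" by (simp add: k l)
  qed
qed

lemma smooth_atlas_subset:
  assumes "smooth_atlas A'" "A \<subseteq> A'" "(\<Union>c\<in>A. cdom c) = UNIV"
  shows "smooth_atlas A"
  using assms unfolding smooth_atlas_def by (auto simp: subset_eq)

text \<open>The product of two compatible charts need not lie in the product atlas, but it lies in
  the product of the two enlarged atlases, and a covering part of an atlas is an atlas.\<close>

lemma compatible_prod:
  assumes A: "smooth_atlas A" and B: "smooth_atlas B" and c: "compatible A c" and d: "compatible B d"
  shows "compatible (prod_atlas A B) (prod_chart c d)"
  unfolding compatible_def
proof (rule smooth_atlas_subset)
  show "smooth_atlas (prod_atlas (insert c A) (insert d B))"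
    using smooth_atlas_prod c d by (auto simp: compatible_def)
  show "insert (prod_chart c d) (prod_atlas A B) \<subseteq> prod_atlas (insert c A) (insert d B)"
    unfolding prod_atlas_eq by blast
  have "(\<Union>c\<in>prod_atlas A B. cdom c) = UNIV" using smooth_atlas_prod[OF A B] by (simp add: smooth_atlas_def)
  then show "(\<Union>c\<in>insert (prod_chart c d) (prod_atlas A B). cdom c) = UNIV" by auto
qed

lemma smooth_map_on_prod_rep:
  assumes A: "smooth_atlas A" and B: "smooth_atlas B" and C: "smooth_atlas C"
    and c: "compatible A c" and d: "compatible B d" and k: "compatible C k"
    and W: "open W" and f: "smooth_map_on (prod_atlas A B) C W f"
  defines "N \<equiv> map_prod (cmap c) (cmap d) ` (cdom c \<times> cdom d \<inter> W \<inter> f -` cdom k)"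
  shows "open N" "smooth_on N (\<lambda>z. cmap k (f (cinv c (fst z), cinv d (snd z))))"
proof -
  note AB = smooth_atlas_prod[OF A B] and cd = compatible_prod[OF A B c d]
  have cf: "continuous_on W f" using f by (simp add: smooth_map_on_def)
  show o: "open N" using smooth_map_on_open_rep(2)[OF cd k W cf] by (simp add: N_def)
  have "smooth_on N (\<lambda>z. cmap k (f (cinv (prod_chart c d) z)))"
    using smooth_map_on_rep[OF AB C cd k W f] by (simp add: N_def)
  then show "smooth_on N (\<lambda>z. cmap k (f (cinv c (fst z), cinv d (snd z))))"
  proof (rule smooth_on_cong[OF o, rotated])
    fix z assume "z \<in> N"
    then have "fst z \<in> cmap c ` cdom c" "snd z \<in> cmap d ` cdom d" by (auto simp: N_def)
    from cinv_prod_chart[OF c d this]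
    show "cmap k (f (cinv (prod_chart c d) z)) = cmap k (f (cinv c (fst z), cinv d (snd z)))" by simp
  qed
qed

lemma open_section_fst: "open W \<Longrightarrow> open {x. (x, y) \<in> W}" and open_section_snd: "open W \<Longrightarrow> open {y. (x, y) \<in> W}"
  for W :: "('a::topological_space \<times> 'b::topological_space) set"
proof -
  assume W: "open W"
  have "open ((\<lambda>x. (x, y)) -` W)" "open ((\<lambda>y. (x, y)) -` W)"
    by (intro open_vimage[OF W] continuous_on_Pair continuous_on_id continuous_on_const)+
  then show "open {x. (x, y) \<in> W}" "open {y. (x, y) \<in> W}" by (simp_all add: vimage_def)
qed

text \<open>Links the partial differentials in the definition of a local product to the chart
  representation \<open>H\<close>: they are the restrictions of its derivative to the two factors,
  hence linear.\<close>

lemma partial_differential: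
  assumes A: "smooth_atlas A" and B: "smooth_atlas B" and C: "smooth_atlas C"
    and c: "compatible A c" "x \<in> cdom c" and d: "compatible B d" "y \<in> cdom d" and k: "compatible C k" "f (x, y) \<in> cdom k"
    and W: "open W" "(x, y) \<in> W" and f: "smooth_map_on (prod_atlas A B) C W f"
  defines "H \<equiv> \<lambda>z. cmap k (f (cinv c (fst z), cinv d (snd z)))"
  shows "to_chart C k (f (x, y)) (differential A C (\<lambda>x'. f (x', y)) x u) =
      frechet_derivative H (at (cmap c x, cmap d y)) (to_chart A c x u, 0)" (is ?fst)
    and "to_chart C k (f (x, y)) (differential B C (\<lambda>y'. f (x, y')) y v) =
      frechet_derivative H (at (cmap c x, cmap d y)) (0, to_chart B d y v)" (is ?snd)
    and "linear (differential A C (\<lambda>x'. f (x', y)) x)" "linear (differential B C (\<lambda>y'. f (x, y')) y)"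
proof -
  let ?N = "\<lambda>c d k. map_prod (cmap c) (cmap d) ` (cdom c \<times> cdom d \<inter> W \<inter> f -` cdom k)"
  have cf: "continuous_on W f" using f by (simp add: smooth_map_on_def)
  have z: "(cmap c x, cmap d y) \<in> ?N c d k" using c d k W by force
  have dH: "(H has_derivative frechet_derivative H (at (cmap c x, cmap d y))) (at (cmap c x, cmap d y))"
    unfolding H_def by (rule smooth_on_has_derivative[OF smooth_map_on_prod_rep(2)[OF A B C c(1) d(1) k(1) W(1) f] z])
  have s1: "smooth_map_on A C {x'. (x', y) \<in> W} (\<lambda>x'. f (x', y))"
  proof (rule smooth_map_onI[OF A C])
    fix x' assume x': "x' \<in> {x'. (x', y) \<in> W}"
    obtain c' where c': "c' \<in> A" "x' \<in> cdom c'" using atlas_cover[OF A] by blast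
    obtain k' where k': "k' \<in> C" "f (x', y) \<in> cdom k'" using atlas_cover[OF C] by blast
    note cc = atlas_compatible[OF A c'(1)] and kk = atlas_compatible[OF C k'(1)]
    let ?M = "cdom c' \<times> cdom d \<inter> W \<inter> f -` cdom k'"
    have oM: "open ?M" using smooth_map_on_open_rep(1)[OF compatible_prod[OF A B cc d(1)] kk W(1) cf] by simp
    let ?V = "{x'. (x', y) \<in> ?M}"
    have V: "open ?V" by (rule open_section_fst[OF oM])
    have oV: "open (cmap c' ` ?V)" by (rule open_cmap_image[OF cc V]) auto
    note r = smooth_map_on_prod_rep[OF A B C cc d(1) kk W(1) f]
    have "smooth_on (cmap c' ` ?V) (\<lambda>s. (\<lambda>z. cmap k' (f (cinv c' (fst z), cinv d (snd z)))) (s, cmap d y))"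
    proof (rule smooth_on_compose[OF oV r(1) _ r(2)])
      show "smooth_on (cmap c' ` ?V) (\<lambda>s. (s, cmap d y))"
        by (rule smooth_on_Pair[OF oV smooth_on_ident[OF oV] smooth_on_const])
      show "(\<lambda>s. (s, cmap d y)) ` cmap c' ` ?V \<subseteq> ?N c' d k'" by (auto intro!: rev_image_eqI)
    qed
    then have "smooth_on (cmap c' ` ?V) (\<lambda>s. cmap k' (f (cinv c' s, y)))" by (simp add: cinv_cmap[OF d])
    then show "\<exists>c d V. compatible A c \<and> compatible C d \<and> open V \<and> x' \<in> V \<and> V \<subseteq> {x'. (x', y) \<in> W} \<inter> cdom c \<and>
        (\<lambda>x'. f (x', y)) ` V \<subseteq> cdom d \<and> smooth_on (cmap c ` V) (\<lambda>x. cmap d (f (cinv c x, y)))"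
      using cc kk V c' k' x' d by (intro exI[of _ c'] exI[of _ k'] exI[of _ ?V]) auto
  qed
  have s2: "smooth_map_on B C {y'. (x, y') \<in> W} (\<lambda>y'. f (x, y'))"
  proof (rule smooth_map_onI[OF B C])
    fix y' assume y': "y' \<in> {y'. (x, y') \<in> W}"
    obtain d' where d': "d' \<in> B" "y' \<in> cdom d'" using atlas_cover[OF B] by blast
    obtain k' where k': "k' \<in> C" "f (x, y') \<in> cdom k'" using atlas_cover[OF C] by blast
    note dd = atlas_compatible[OF B d'(1)] and kk = atlas_compatible[OF C k'(1)]
    let ?M = "cdom c \<times> cdom d' \<inter> W \<inter> f -` cdom k'"
    have oM: "open ?M" using smooth_map_on_open_rep(1)[OF compatible_prod[OF A B c(1) dd] kk W(1) cf] by simp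
    let ?V = "{y'. (x, y') \<in> ?M}"
    have V: "open ?V" by (rule open_section_snd[OF oM])
    have oV: "open (cmap d' ` ?V)" by (rule open_cmap_image[OF dd V]) auto
    note r = smooth_map_on_prod_rep[OF A B C c(1) dd kk W(1) f]
    have "smooth_on (cmap d' ` ?V) (\<lambda>s. (\<lambda>z. cmap k' (f (cinv c (fst z), cinv d' (snd z)))) (cmap c x, s))"
    proof (rule smooth_on_compose[OF oV r(1) _ r(2)])
      show "smooth_on (cmap d' ` ?V) (\<lambda>s. (cmap c x, s))"
        by (rule smooth_on_Pair[OF oV smooth_on_const smooth_on_ident[OF oV]])
      show "(\<lambda>s. (cmap c x, s)) ` cmap d' ` ?V \<subseteq> ?N c d' k'" by (auto intro!: rev_image_eqI)
    qed
    then have "smooth_on (cmap d' ` ?V) (\<lambda>s. cmap k' (f (x, cinv d' s)))" by (simp add: cinv_cmap[OF c])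
    then show "\<exists>c d V. compatible B c \<and> compatible C d \<and> open V \<and> y' \<in> V \<and> V \<subseteq> {y'. (x, y') \<in> W} \<inter> cdom c \<and>
        (\<lambda>y'. f (x, y')) ` V \<subseteq> cdom d \<and> smooth_on (cmap c ` V) (\<lambda>y. cmap d (f (x, cinv c y)))"
      using dd kk V d' k' y' c by (intro exI[of _ d'] exI[of _ k'] exI[of _ ?V]) auto
  qed
  note o1 = open_section_fst[OF W(1), of y] and o2 = open_section_snd[OF W(1), of x]
  have e1: "to_chart C k (f (x, y)) (differential A C (\<lambda>x'. f (x', y)) x u) =
      frechet_derivative H (at (cmap c x, cmap d y)) (to_chart A c x u, 0)" for u
  proof -
    have "((\<lambda>s. H (s, cmap d y)) has_derivative (\<lambda>v. frechet_derivative H (at (cmap c x, cmap d y)) (v, 0))) (at (cmap c x))"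
      by (rule has_derivative_compose[where f = "\<lambda>s. (s, cmap d y)" and f' = "\<lambda>v. (v, 0)" and g = H, OF _ dH])
        (auto intro!: derivative_eq_intros)
    then have "frechet_derivative (\<lambda>s. cmap k (f (cinv c s, y))) (at (cmap c x)) v =
        frechet_derivative H (at (cmap c x, cmap d y)) (v, 0)" for v
      by (simp add: H_def cinv_cmap[OF d] frechet_derivative_eq)
    then show ?thesis
      using differential_chart[where f = "\<lambda>x'. f (x', y)", OF A C c k(1) _ o1 _ s1, of u] k W by simp
  qed
  have e2: "to_chart C k (f (x, y)) (differential B C (\<lambda>y'. f (x, y')) y v) =
      frechet_derivative H (at (cmap c x, cmap d y)) (0, to_chart B d y v)" for v
  proof -
    have "((\<lambda>s. H (cmap c x, s)) has_derivative (\<lambda>v. frechet_derivative H (at (cmap c x, cmap d y)) (0, v))) (at (cmap d y))"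
      by (rule has_derivative_compose[where f = "\<lambda>s. (cmap c x, s)" and f' = "\<lambda>v. (0, v)" and g = H, OF _ dH])
        (auto intro!: derivative_eq_intros)
    then have "frechet_derivative (\<lambda>s. cmap k (f (x, cinv d s))) (at (cmap d y)) v =
        frechet_derivative H (at (cmap c x, cmap d y)) (0, v)" for v
      by (simp add: H_def cinv_cmap[OF c] frechet_derivative_eq)
    then show ?thesis
      using differential_chart[where f = "\<lambda>y'. f (x, y')", OF B C d k(1) _ o2 _ s2, of v] k W by simp
  qed
  show ?fst ?snd by (rule e1, rule e2)
  have lH: "linear (frechet_derivative H (at (cmap c x, cmap d y)))"
    using has_derivative_bounded_linear[OF dH] bounded_linear.linear by blast
  have i1: "differential A C (\<lambda>x'. f (x', y)) x u = from_chart C k (f (x, y)) (frechet_derivative H (at (cmap c x, cmap d y)) (to_chart A c x u, 0))" for u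
    using from_to_chart[OF C k] e1 by metis
  have i2: "differential B C (\<lambda>y'. f (x, y')) y v = from_chart C k (f (x, y)) (frechet_derivative H (at (cmap c x, cmap d y)) (0, to_chart B d y v))" for v
    using from_to_chart[OF C k] e2 by metis
  have l1: "linear (\<lambda>v::'b. (v, 0::'d))" and l2: "linear (\<lambda>v::'d. (0::'b, v))" by (auto intro!: linearI)
  show "linear (differential A C (\<lambda>x'. f (x', y)) x)" "linear (differential B C (\<lambda>y'. f (x, y')) y)"
    using linear_compose[OF linear_compose[OF linear_compose[OF to_chart_linear[OF A c] l1] lH] from_chart_linear[OF C k]]
      linear_compose[OF linear_compose[OF linear_compose[OF to_chart_linear[OF B d] l2] lH] from_chart_linear[OF C k]]
    unfolding i1[abs_def] i2[abs_def] by (simp_all add: o_def)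
qed

subsection \<open>Variation of the metric along a product parametrization\<close>

text \<open>The derivative in a direction \<open>u\<close> of \<open>T\<close> is computed along the
  line through \<open>z0\<close> in that direction, so only the values on the affine slice through
  \<open>z0\<close> enter.\<close>

lemma slice_derivative_zero:
  fixes \<phi> :: "'a::real_normed_vector \<Rightarrow> 'b::real_normed_vector"
  assumes \<phi>: "(\<phi> has_derivative \<phi>') (at z0)" and N: "open N" "z0 \<in> N" and T: "subspace T" "u \<in> T"
    and c: "\<And>z. z \<in> N \<Longrightarrow> z - z0 \<in> T \<Longrightarrow> \<phi> z = k"
  shows "\<phi>' u = 0"
proof -
  let ?\<gamma> = "\<lambda>s::real. z0 + s *\<^sub>R u"
  have \<gamma>: "(?\<gamma> has_derivative (\<lambda>s. s *\<^sub>R u)) (at 0)" by (auto intro!: derivative_eq_intros)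
  have 1: "((\<lambda>s. \<phi> (?\<gamma> s)) has_derivative (\<lambda>s. \<phi>' (s *\<^sub>R u))) (at 0)"
    by (rule has_derivative_compose[OF \<gamma>]) (use \<phi> in simp)
  have o: "open (?\<gamma> -` N)" by (intro open_vimage N continuous_intros)
  have 2: "((\<lambda>s. \<phi> (?\<gamma> s)) has_derivative (\<lambda>s. 0)) (at 0)"
    by (rule has_derivative_transform_within_open[OF has_derivative_const[of k] o])
      (use N T c in \<open>auto simp: subspace_scale\<close>)
  have "(\<lambda>s. \<phi>' (s *\<^sub>R u)) 1 = (\<lambda>s. 0) (1::real)" using has_derivative_unique[OF 1 2] by (rule fun_cong)
  then show ?thesis by simp
qed

context riem
begin

text \<open>The relations \<open>o1\<close>, \<open>o2\<close>, \<open>o3\<close> are differentiated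
  along the slice, in the directions \<open>u\<close>, \<open>v\<close>, \<open>u\<close>. Comparing
  the first with the third shows that, paired with the image of \<open>w\<close>, the derivative of
  \<open>Y\<close> along \<open>X\<close> equals the second derivative of \<open>H\<close> in
  \<open>u\<close> and \<open>v\<close>. The last two, with the symmetry of second derivatives,
  eliminate the second derivatives in the direction \<open>w\<close>. What remains is the chart form
  of Koszul's formula with the opposite sign.\<close>

lemma metric_variation:
  fixes H :: "'h::euclidean_space \<Rightarrow> 'e"
  assumes W: "open W" "p \<in> W" and X: "vf W X" and Y: "vf W Y" and Z: "vf W Z"
    and c: "compatible A c" "p \<in> cdom c"
    and N: "open N" "z0 \<in> N" and H: "smooth_on N H" "H z0 = cmap c p"
    and T: "subspace T" "u \<in> T" "v \<in> T"
    and XH: "to_chart A c p (X p) = frechet_derivative H (at z0) u"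
    and YH: "to_chart A c p (Y p) = frechet_derivative H (at z0) v"
    and ZH: "to_chart A c p (Z p) = frechet_derivative H (at z0) w"
    and o1: "\<And>z. z \<in> N \<Longrightarrow> z - z0 \<in> T \<Longrightarrow> metric_rep c (H z) (field_rep A c Y (H z)) (frechet_derivative H (at z) w) = 0"
    and o2: "\<And>z. z \<in> N \<Longrightarrow> z - z0 \<in> T \<Longrightarrow> metric_rep c (H z) (frechet_derivative H (at z) u) (frechet_derivative H (at z) w) = 0"
    and o3: "\<And>z. z \<in> N \<Longrightarrow> z - z0 \<in> T \<Longrightarrow> metric_rep c (H z) (frechet_derivative H (at z) v) (frechet_derivative H (at z) w) = 0"
  shows "((\<lambda>z. metric_rep c (H z) (frechet_derivative H (at z) u) (frechet_derivative H (at z) v)) has_derivative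
      frechet_derivative (\<lambda>z. metric_rep c (H z) (frechet_derivative H (at z) u) (frechet_derivative H (at z) v)) (at z0)) (at z0)"
    and "frechet_derivative (\<lambda>z. metric_rep c (H z) (frechet_derivative H (at z) u) (frechet_derivative H (at z) v)) (at z0) w
      = - 2 * g p (nabla X Y p) (Z p)"
proof -
  let ?x = "cmap c p" and ?DH = "\<lambda>u z. frechet_derivative H (at z) u"
  let ?G' = "frechet_derivative (metric_rep c) (at ?x)"
  define D2 where "D2 a b = frechet_derivative (?DH a) (at z0) b" for a b
  have x: "?x \<in> cmap c ` cdom c" using c by blast
  have dH: "(H has_derivative frechet_derivative H (at z0)) (at z0)" by (rule smooth_on_has_derivative[OF H(1) N(2)])
  have dDH: "(?DH a has_derivative D2 a) (at z0)" for a
    unfolding D2_def by (rule smooth_on_has_derivative[OF smooth_on_derivative[OF H(1)] N(2)])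
  have sym: "D2 a b = D2 b a" for a b unfolding D2_def by (rule smooth_on_symmetric_derivative[OF H(1) N])
  have prod: "((\<lambda>z. metric_rep c (H z) (?DH a z) (?DH b z)) has_derivative
      (\<lambda>r. ?G' (?DH r z0) (?DH a z0) (?DH b z0) + metric_rep c ?x (D2 a r) (?DH b z0) + metric_rep c ?x (?DH a z0) (D2 b r))) (at z0)" for a b
    by (rule metric_product_rule[OF c(1) x dH H(2) dDH dDH])
  from prod[of u v] show "((\<lambda>z. metric_rep c (H z) (?DH u z) (?DH v z)) has_derivative
      frechet_derivative (\<lambda>z. metric_rep c (H z) (?DH u z) (?DH v z)) (at z0)) (at z0)"
    by (simp add: frechet_derivative_eq)
  have dY: "(field_rep A c Y has_derivative frechet_derivative (field_rep A c Y) (at ?x)) (at (H z0))"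
    unfolding H(2) by (rule smooth_on_has_derivative[OF vector_field_on_rep[OF A c(1) W(1) Y]]) (use c W in blast)
  have YH': "field_rep A c Y (H z0) = ?DH v z0" using YH by (simp add: H(2) field_rep_cmap[OF c])
  let ?YX = "frechet_derivative (field_rep A c Y) (at ?x) (?DH u z0)"
  have s: "metric_rep c ?x a b = metric_rep c ?x b a" for a b by (simp add: metric_rep[OF c(1) x] g_sym)
  have 1: "?G' (?DH u z0) (?DH v z0) (?DH w z0) + metric_rep c ?x ?YX (?DH w z0) + metric_rep c ?x (?DH v z0) (D2 w u) = 0"
    using slice_derivative_zero[OF metric_product_rule[OF c(1) x dH H(2) has_derivative_compose[OF dH dY] dDH] N T(1,2) o1]
    by (simp add: YH')
  have 2: "?G' (?DH v z0) (?DH u z0) (?DH w z0) + metric_rep c ?x (D2 u v) (?DH w z0) + metric_rep c ?x (?DH u z0) (D2 w v) = 0"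
    by (rule slice_derivative_zero[OF prod N T(1,3) o2])
  have 3: "?G' (?DH u z0) (?DH v z0) (?DH w z0) + metric_rep c ?x (D2 v u) (?DH w z0) + metric_rep c ?x (?DH v z0) (D2 w u) = 0"
    by (rule slice_derivative_zero[OF prod N T(1,2) o3])
  have 4: "frechet_derivative (\<lambda>z. metric_rep c (H z) (?DH u z) (?DH v z)) (at z0) w =
      ?G' (?DH w z0) (?DH u z0) (?DH v z0) + metric_rep c ?x (D2 u w) (?DH v z0) + metric_rep c ?x (?DH u z0) (D2 v w)"
    using frechet_derivative_eq[OF prod[of u v]] by simp
  have 5: "2 * g p (nabla X Y p) (Z p) = 2 * metric_rep c ?x ?YX (?DH w z0) + ?G' (?DH u z0) (?DH v z0) (?DH w z0)
      + ?G' (?DH v z0) (?DH u z0) (?DH w z0) - ?G' (?DH w z0) (?DH u z0) (?DH v z0)"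
    using koszul_chart[OF W X Y Z c] by (simp add: XH YH ZH)
  show "frechet_derivative (\<lambda>z. metric_rep c (H z) (?DH u z) (?DH v z)) (at z0) w = - 2 * g p (nabla X Y p) (Z p)"
    using 1 2 3 4 5 sym[of u v] sym[of u w] sym[of v w] s[of "D2 u w" "?DH v z0"] by simp
qed

end

section \<open>Product parametrizations in charts\<close>

lemma slice_derivative_eq:
  fixes f h :: "'a::real_normed_vector \<Rightarrow> 'b::real_normed_vector"
  assumes "(f has_derivative f') (at z0)" "(h has_derivative h') (at z0)" and N: "open N" "z0 \<in> N"
    and T: "subspace T" "u \<in> T" and eq: "\<And>z. z \<in> N \<Longrightarrow> z - z0 \<in> T \<Longrightarrow> f z = h z"
  shows "f' u = h' u"
  using slice_derivative_zero[OF has_derivative_diff[OF assms(1,2)] N T, of 0] eq by simp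

lemma integral_manifold_chart:
  assumes "integral_manifold A D L" "p \<in> L"
  shows "\<exists>c S. compatible A c \<and> p \<in> cdom c \<and> subspace S \<and> cmap c ` (cdom c \<inter> L) = cmap c ` cdom c \<inter> S \<and>
    (\<forall>q\<in>cdom c \<inter> L. to_chart A c q ` D q = S)"
  using assms(1)[unfolded integral_manifold_def, THEN bspec, OF assms(2)] unfolding compatible_def
  by (elim exE conjE) (intro exI conjI; assumption)

context riem
begin

text \<open>The smooth extensions in the definition of a local product change with the point. The
  map \<open>H\<close> is built from the single extension at \<open>(p, p)\<close>; along the slice
  it agrees with all the others, so its derivatives tangent to the factors have the properties
  postulated for those. The functions \<open>\<gamma>\<^sub>1\<close> and
  \<open>\<gamma>\<^sub>2\<close> are the metrics of the factors, each of which sees only one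
  coordinate.\<close>

lemma product_data:
  assumes prod: "local_riemannian_product_at A g D\<^sub>1 D\<^sub>2 M p"
    and zero: "\<And>x. 0 \<in> D\<^sub>1 x" "\<And>x. 0 \<in> D\<^sub>2 x"
  obtains c N z0 and H :: "'e \<times> 'e \<Rightarrow> 'e" and S\<^sub>1 S\<^sub>2 \<gamma>\<^sub>1 \<gamma>\<^sub>2 where
    "compatible A c" "p \<in> cdom c" "open N" "z0 \<in> N" "smooth_on N H" "H z0 = cmap c p" "H ` N \<subseteq> cmap c ` cdom c"
    "subspace S\<^sub>1" "subspace S\<^sub>2"
    "\<And>z u. z \<in> N \<Longrightarrow> z - z0 \<in> S\<^sub>1 \<times> S\<^sub>2 \<Longrightarrow> u \<in> S\<^sub>1 \<Longrightarrow>
      frechet_derivative H (at z) (u, 0) \<in> to_chart A c (cinv c (H z)) ` D\<^sub>1 (cinv c (H z))"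
    "\<And>z w. z \<in> N \<Longrightarrow> z - z0 \<in> S\<^sub>1 \<times> S\<^sub>2 \<Longrightarrow> w \<in> S\<^sub>2 \<Longrightarrow>
      frechet_derivative H (at z) (0, w) \<in> to_chart A c (cinv c (H z)) ` D\<^sub>2 (cinv c (H z))"
    "\<And>z u u'. z \<in> N \<Longrightarrow> z - z0 \<in> S\<^sub>1 \<times> S\<^sub>2 \<Longrightarrow> u \<in> S\<^sub>1 \<Longrightarrow> u' \<in> S\<^sub>1 \<Longrightarrow>
      metric_rep c (H z) (frechet_derivative H (at z) (u, 0)) (frechet_derivative H (at z) (u', 0)) = \<gamma>\<^sub>1 (fst z) u u'"
    "\<And>z w w'. z \<in> N \<Longrightarrow> z - z0 \<in> S\<^sub>1 \<times> S\<^sub>2 \<Longrightarrow> w \<in> S\<^sub>2 \<Longrightarrow> w' \<in> S\<^sub>2 \<Longrightarrow>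
      metric_rep c (H z) (frechet_derivative H (at z) (0, w)) (frechet_derivative H (at z) (0, w')) = \<gamma>\<^sub>2 (snd z) w w'"
    "\<And>\<xi>. \<xi> \<in> D\<^sub>1 p \<Longrightarrow> \<exists>u\<in>S\<^sub>1. to_chart A c p \<xi> = frechet_derivative H (at z0) (u, 0)"
    "\<And>\<xi>. \<xi> \<in> D\<^sub>2 p \<Longrightarrow> \<exists>w\<in>S\<^sub>2. to_chart A c p \<xi> = frechet_derivative H (at z0) (0, w)"
proof -
  obtain Wf L\<^sub>1 L\<^sub>2 \<Phi> where im: "integral_manifold A D\<^sub>1 L\<^sub>1" "integral_manifold A D\<^sub>2 L\<^sub>2" and pL: "p \<in> L\<^sub>1" "p \<in> L\<^sub>2"
    and \<Phi>p: "\<forall>x\<in>L\<^sub>1. \<Phi> (x, p) = x"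
    and FF: "\<forall>x\<in>L\<^sub>1. \<forall>y\<in>L\<^sub>2. \<exists>F. smooth_extension_at (prod_atlas A A) A (L\<^sub>1 \<times> L\<^sub>2) \<Phi> (x, y) F \<and>
           (let a = differential A A (\<lambda>x'. F (x', y)) x;
                b = differential A A (\<lambda>y'. F (x, y')) y;
                q = \<Phi> (x, y)
            in a ` D\<^sub>1 x = D\<^sub>1 q \<and> b ` D\<^sub>2 y = D\<^sub>2 q \<and>
               (\<forall>u\<in>D\<^sub>1 x. \<forall>u'\<in>D\<^sub>1 x. \<forall>v\<in>D\<^sub>2 y. \<forall>v'\<in>D\<^sub>2 y.
                  g q (a u + b v) (a u' + b v') = g x u u' + g y v v'))"
    using prod unfolding local_riemannian_product_at_def by (elim exE conjE) (rule that; assumption)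
  obtain c1 S\<^sub>1 where c1: "compatible A c1" "p \<in> cdom c1" and S1: "subspace S\<^sub>1"
    "cmap c1 ` (cdom c1 \<inter> L\<^sub>1) = cmap c1 ` cdom c1 \<inter> S\<^sub>1" "\<And>q. q \<in> cdom c1 \<inter> L\<^sub>1 \<Longrightarrow> to_chart A c1 q ` D\<^sub>1 q = S\<^sub>1"
    using integral_manifold_chart[OF im(1) pL(1)] by (elim exE conjE) (rule that, assumption+, erule bspec)
  obtain c2 S\<^sub>2 where c2: "compatible A c2" "p \<in> cdom c2" and S2: "subspace S\<^sub>2"
    "cmap c2 ` (cdom c2 \<inter> L\<^sub>2) = cmap c2 ` cdom c2 \<inter> S\<^sub>2" "\<And>q. q \<in> cdom c2 \<inter> L\<^sub>2 \<Longrightarrow> to_chart A c2 q ` D\<^sub>2 q = S\<^sub>2"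
    using integral_manifold_chart[OF im(2) pL(2)] by (elim exE conjE) (rule that, assumption+, erule bspec)
  have ext: "\<exists>W F. open W \<and> (x, y) \<in> W \<and> smooth_map_on (prod_atlas A A) A W F \<and> (\<forall>z\<in>W \<inter> (L\<^sub>1 \<times> L\<^sub>2). F z = \<Phi> z) \<and>
      differential A A (\<lambda>x'. F (x', y)) x ` D\<^sub>1 x = D\<^sub>1 (\<Phi> (x, y)) \<and> differential A A (\<lambda>y'. F (x, y')) y ` D\<^sub>2 y = D\<^sub>2 (\<Phi> (x, y)) \<and>
      (\<forall>u\<in>D\<^sub>1 x. \<forall>u'\<in>D\<^sub>1 x. \<forall>v\<in>D\<^sub>2 y. \<forall>v'\<in>D\<^sub>2 y.
        g (\<Phi> (x, y)) (differential A A (\<lambda>x'. F (x', y)) x u + differential A A (\<lambda>y'. F (x, y')) y v)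
          (differential A A (\<lambda>x'. F (x', y)) x u' + differential A A (\<lambda>y'. F (x, y')) y v') = g x u u' + g y v v')"
    if "x \<in> L\<^sub>1" "y \<in> L\<^sub>2" for x y
    using FF[THEN bspec, OF that(1), THEN bspec, OF that(2)] unfolding Let_def smooth_extension_at_def
    by (elim exE conjE) (intro exI conjI; assumption)
  obtain W0 F0 where W0: "open W0" "(p, p) \<in> W0" and F0: "smooth_map_on (prod_atlas A A) A W0 F0"
    "\<And>z. z \<in> W0 \<inter> (L\<^sub>1 \<times> L\<^sub>2) \<Longrightarrow> F0 z = \<Phi> z"
    using ext[OF pL] by (elim exE conjE) (rule that, assumption+, erule bspec)
  let ?c = "chart_at A p"
  have c: "compatible A ?c" "p \<in> cdom ?c" using chart_at_compatible[OF A] chart_at[OF A] by auto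
  define N where "N = map_prod (cmap c1) (cmap c2) ` (cdom c1 \<times> cdom c2 \<inter> W0 \<inter> F0 -` cdom ?c)"
  define H where "H = (\<lambda>z. cmap ?c (F0 (cinv c1 (fst z), cinv c2 (snd z))))"
  define z0 where "z0 = (cmap c1 p, cmap c2 p)"
  have F0p: "F0 (p, p) = p" using F0(2)[of "(p, p)"] \<Phi>p pL W0(2) by simp
  have N: "open N" "smooth_on N H"
    using smooth_map_on_prod_rep[OF A A A c1(1) c2(1) c(1) W0(1) F0(1)] by (simp_all add: N_def H_def)
  have z0N: "z0 \<in> N" unfolding N_def z0_def using c1 c2 c W0 F0p by force
  have Hz0: "H z0 = cmap ?c p" by (simp add: H_def z0_def cinv_cmap[OF c1] cinv_cmap[OF c2] F0p)
  have z0S: "z0 \<in> S\<^sub>1 \<times> S\<^sub>2" using S1(2) S2(2) c1(2) c2(2) pL unfolding z0_def by blast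
  have sub: "subspace (S\<^sub>1 \<times> S\<^sub>2)" by (rule subspace_Times[OF S1(1) S2(1)])
  have Nx: "cinv c1 (fst z) \<in> cdom c1" "cinv c2 (snd z) \<in> cdom c2" "(cinv c1 (fst z), cinv c2 (snd z)) \<in> W0"
     "F0 (cinv c1 (fst z), cinv c2 (snd z)) \<in> cdom ?c" "fst z = cmap c1 (cinv c1 (fst z))" "snd z = cmap c2 (cinv c2 (snd z))"
    if "z \<in> N" for z
    using that by (auto simp: N_def cinv_cmap[OF c1(1)] cinv_cmap[OF c2(1)])
  have HN: "H ` N \<subseteq> cmap ?c ` cdom ?c" using Nx(4) by (auto simp: H_def)
  have slice: "cinv c1 s \<in> L\<^sub>1" if "s \<in> cmap c1 ` cdom c1" "s \<in> S\<^sub>1" for s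
  proof -
    have "s \<in> cmap c1 ` (cdom c1 \<inter> L\<^sub>1)" unfolding S1(2) using that by blast
    then show ?thesis using cinv_cmap[OF c1(1)] by auto
  qed
  have slice2: "cinv c2 s \<in> L\<^sub>2" if "s \<in> cmap c2 ` cdom c2" "s \<in> S\<^sub>2" for s
  proof -
    have "s \<in> cmap c2 ` (cdom c2 \<inter> L\<^sub>2)" unfolding S2(2) using that by blast
    then show ?thesis using cinv_cmap[OF c2(1)] by auto
  qed
  have inS: "z \<in> S\<^sub>1 \<times> S\<^sub>2" if "z - z1 \<in> S\<^sub>1 \<times> S\<^sub>2" "z1 \<in> S\<^sub>1 \<times> S\<^sub>2" for z z1
    using subspace_add[OF sub that] by simp
  have key: "\<exists>a b. linear a \<and> linear b \<and>
      a ` D\<^sub>1 (cinv c1 (fst z)) = D\<^sub>1 (cinv ?c (H z)) \<and> b ` D\<^sub>2 (cinv c2 (snd z)) = D\<^sub>2 (cinv ?c (H z)) \<and>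
      (\<forall>u\<in>D\<^sub>1 (cinv c1 (fst z)). \<forall>u'\<in>D\<^sub>1 (cinv c1 (fst z)). \<forall>v\<in>D\<^sub>2 (cinv c2 (snd z)). \<forall>v'\<in>D\<^sub>2 (cinv c2 (snd z)).
        g (cinv ?c (H z)) (a u + b v) (a u' + b v') = g (cinv c1 (fst z)) u u' + g (cinv c2 (snd z)) v v') \<and>
      (\<forall>u\<in>D\<^sub>1 (cinv c1 (fst z)). frechet_derivative H (at z) (to_chart A c1 (cinv c1 (fst z)) u, 0) = to_chart A ?c (cinv ?c (H z)) (a u)) \<and>
      (\<forall>w\<in>D\<^sub>2 (cinv c2 (snd z)). frechet_derivative H (at z) (0, to_chart A c2 (cinv c2 (snd z)) w) = to_chart A ?c (cinv ?c (H z)) (b w))"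
    if z: "z \<in> N" and zS: "z - z0 \<in> S\<^sub>1 \<times> S\<^sub>2" for z
  proof -
    let ?x = "cinv c1 (fst z)" and ?y = "cinv c2 (snd z)"
    note Nz = Nx[OF z]
    have zS': "z \<in> S\<^sub>1 \<times> S\<^sub>2" by (rule inS[OF zS z0S])
    have fs: "fst z \<in> cmap c1 ` cdom c1" "snd z \<in> cmap c2 ` cdom c2" "fst z \<in> S\<^sub>1" "snd z \<in> S\<^sub>2"
      using Nz zS' by (auto simp: mem_Times_iff)
    have x: "?x \<in> L\<^sub>1" and y: "?y \<in> L\<^sub>2" using slice slice2 fs by auto
    obtain W1 F1 where W1: "open W1" "(?x, ?y) \<in> W1" and F1: "smooth_map_on (prod_atlas A A) A W1 F1"
      "\<And>z. z \<in> W1 \<inter> (L\<^sub>1 \<times> L\<^sub>2) \<Longrightarrow> F1 z = \<Phi> z"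
      and ab: "differential A A (\<lambda>x'. F1 (x', ?y)) ?x ` D\<^sub>1 ?x = D\<^sub>1 (\<Phi> (?x, ?y))"
        "differential A A (\<lambda>y'. F1 (?x, y')) ?y ` D\<^sub>2 ?y = D\<^sub>2 (\<Phi> (?x, ?y))"
        "\<forall>u\<in>D\<^sub>1 ?x. \<forall>u'\<in>D\<^sub>1 ?x. \<forall>v\<in>D\<^sub>2 ?y. \<forall>v'\<in>D\<^sub>2 ?y.
          g (\<Phi> (?x, ?y)) (differential A A (\<lambda>x'. F1 (x', ?y)) ?x u + differential A A (\<lambda>y'. F1 (?x, y')) ?y v)
          (differential A A (\<lambda>x'. F1 (x', ?y)) ?x u' + differential A A (\<lambda>y'. F1 (?x, y')) ?y v') = g ?x u u' + g ?y v v'"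
      using ext[OF x y] by (elim exE conjE) (rule that, assumption+, erule bspec, assumption+)
    have F0q: "F0 (?x, ?y) = \<Phi> (?x, ?y)" using F0(2) x y Nz(3) by blast
    have F1q: "F1 (?x, ?y) = \<Phi> (?x, ?y)" using F1(2) x y W1(2) by blast
    have q: "\<Phi> (?x, ?y) \<in> cdom ?c" using Nz(4) F0q by simp
    have Hz: "cinv ?c (H z) = \<Phi> (?x, ?y)" using q by (simp add: H_def F0q cinv_cmap[OF c(1)])
    let ?H1 = "\<lambda>z. cmap ?c (F1 (cinv c1 (fst z), cinv c2 (snd z)))"
    let ?N1 = "map_prod (cmap c1) (cmap c2) ` (cdom c1 \<times> cdom c2 \<inter> W1 \<inter> F1 -` cdom ?c)"
    note r1 = smooth_map_on_prod_rep[OF A A A c1(1) c2(1) c(1) W1(1) F1(1)]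
    have e: "z = (cmap c1 ?x, cmap c2 ?y)" using Nz(5,6) by (metis prod.collapse)
    have z1: "z \<in> ?N1" using Nz(1,2) W1(2) q F1q by (subst e) (auto intro!: imageI)
    \<comment> \<open>Both extensions equal \<open>\<Phi>\<close> on
      \<open>L\<^sub>1 \<times> L\<^sub>2\<close>, which in the slice charts is the slice, so their
      derivatives agree in its directions.\<close>
    have HH1: "frechet_derivative H (at z) r = frechet_derivative ?H1 (at z) r" if r: "r \<in> S\<^sub>1 \<times> S\<^sub>2" for r
    proof (rule slice_derivative_eq[OF smooth_on_has_derivative[OF N(2) z] smooth_on_has_derivative[OF r1(2) z1]
          open_Int[OF N(1) r1(1)] IntI[OF z z1] sub r])
      fix z' assume z': "z' \<in> N \<inter> ?N1" and d: "z' - z \<in> S\<^sub>1 \<times> S\<^sub>2"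
      have "z' \<in> S\<^sub>1 \<times> S\<^sub>2" by (rule inS[OF d zS'])
      moreover have n: "z' \<in> N" using z' by blast
      ultimately have L: "cinv c1 (fst z') \<in> L\<^sub>1" "cinv c2 (snd z') \<in> L\<^sub>2"
        using slice[of "fst z'"] slice2[of "snd z'"] Nx[OF n] by (metis imageI mem_Times_iff)+
      have "(cinv c1 (fst z'), cinv c2 (snd z')) \<in> W1"
        using z' by (auto simp: cinv_cmap[OF c1(1)] cinv_cmap[OF c2(1)])
      then show "H z' = ?H1 z'" using F0(2) F1(2) L Nx(3)[OF n] by (simp add: H_def)
    qed
    note pd = partial_differential[OF A A A c1(1) Nz(1) c2(1) Nz(2) c(1) _ W1(1,2) F1(1), unfolded F1q, OF q]
    show ?thesis unfolding Hz
    proof (intro exI conjI ballI)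
      show "linear (differential A A (\<lambda>x'. F1 (x', ?y)) ?x)" "linear (differential A A (\<lambda>y'. F1 (?x, y')) ?y)"
        by (rule pd(3), rule pd(4))
      show "frechet_derivative H (at z) (to_chart A c1 ?x u, 0) = to_chart A ?c (\<Phi> (?x, ?y)) (differential A A (\<lambda>x'. F1 (x', ?y)) ?x u)"
        if "u \<in> D\<^sub>1 ?x" for u
      proof -
        have "to_chart A c1 ?x u \<in> S\<^sub>1" using S1(3)[of ?x] x Nz(1) that by blast
        then have "(to_chart A c1 ?x u, 0) \<in> S\<^sub>1 \<times> S\<^sub>2" using subspace_0[OF S2(1)] by blast
        from HH1[OF this] show ?thesis unfolding pd(1) e[symmetric] .
      qed
      show "frechet_derivative H (at z) (0, to_chart A c2 ?y w) = to_chart A ?c (\<Phi> (?x, ?y)) (differential A A (\<lambda>y'. F1 (?x, y')) ?y w)"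
        if "w \<in> D\<^sub>2 ?y" for w
      proof -
        have "to_chart A c2 ?y w \<in> S\<^sub>2" using S2(3)[of ?y] y Nz(2) that by blast
        then have "(0, to_chart A c2 ?y w) \<in> S\<^sub>1 \<times> S\<^sub>2" using subspace_0[OF S1(1)] by blast
        from HH1[OF this] show ?thesis unfolding pd(2) e[symmetric] .
      qed
    qed (use ab in auto)
  qed
  have fc1: "from_chart A c1 (cinv c1 (fst z)) u \<in> D\<^sub>1 (cinv c1 (fst z)) \<and> to_chart A c1 (cinv c1 (fst z)) (from_chart A c1 (cinv c1 (fst z)) u) = u"
    if z: "z \<in> N" "z - z0 \<in> S\<^sub>1 \<times> S\<^sub>2" and u: "u \<in> S\<^sub>1" for z u
  proof -
    have "cinv c1 (fst z) \<in> cdom c1 \<inter> L\<^sub>1"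
      using Nx[OF z(1)] slice[of "fst z"] inS[OF z(2) z0S] by (metis Int_iff imageI mem_Times_iff)
    then obtain v where "v \<in> D\<^sub>1 (cinv c1 (fst z))" "u = to_chart A c1 (cinv c1 (fst z)) v" using S1(3) u by blast
    then show ?thesis using from_to_chart[OF A c1(1) Nx(1)[OF z(1)]] by simp
  qed
  have fc2: "from_chart A c2 (cinv c2 (snd z)) u \<in> D\<^sub>2 (cinv c2 (snd z)) \<and> to_chart A c2 (cinv c2 (snd z)) (from_chart A c2 (cinv c2 (snd z)) u) = u"
    if z: "z \<in> N" "z - z0 \<in> S\<^sub>1 \<times> S\<^sub>2" and u: "u \<in> S\<^sub>2" for z u
  proof -
    have "cinv c2 (snd z) \<in> cdom c2 \<inter> L\<^sub>2"
      using Nx[OF z(1)] slice2[of "snd z"] inS[OF z(2) z0S] by (metis Int_iff imageI mem_Times_iff)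
    then obtain v where "v \<in> D\<^sub>2 (cinv c2 (snd z))" "u = to_chart A c2 (cinv c2 (snd z)) v" using S2(3) u by blast
    then show ?thesis using from_to_chart[OF A c2(1) Nx(2)[OF z(1)]] by simp
  qed
  have Hcq: "H z = cmap ?c (cinv ?c (H z))" "cinv ?c (H z) \<in> cdom ?c" if "z \<in> N" for z
    using HN that cmap_cinv cinv_in by (metis image_subset_iff)+
  show ?thesis
  proof (rule that[OF c N(1) z0N N(2) Hz0 HN S1(1) S2(1)])
    fix z u assume z: "z \<in> N" "z - z0 \<in> S\<^sub>1 \<times> S\<^sub>2" and u: "u \<in> S\<^sub>1"
    show "frechet_derivative H (at z) (u, 0) \<in> to_chart A ?c (cinv ?c (H z)) ` D\<^sub>1 (cinv ?c (H z))"
      using key[OF z] fc1[OF z u] by (metis imageI)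
  next
    fix z w assume z: "z \<in> N" "z - z0 \<in> S\<^sub>1 \<times> S\<^sub>2" and w: "w \<in> S\<^sub>2"
    show "frechet_derivative H (at z) (0, w) \<in> to_chart A ?c (cinv ?c (H z)) ` D\<^sub>2 (cinv ?c (H z))"
      using key[OF z] fc2[OF z w] by (metis imageI)
  next
    fix z u u' assume z: "z \<in> N" "z - z0 \<in> S\<^sub>1 \<times> S\<^sub>2" and u: "u \<in> S\<^sub>1" "u' \<in> S\<^sub>1"
    let ?x = "cinv c1 (fst z)" and ?y = "cinv c2 (snd z)" and ?q = "cinv ?c (H z)"
    obtain a b where b: "linear b" and m: "\<forall>u\<in>D\<^sub>1 ?x. \<forall>u'\<in>D\<^sub>1 ?x. \<forall>v\<in>D\<^sub>2 ?y. \<forall>v'\<in>D\<^sub>2 ?y. g ?q (a u + b v) (a u' + b v') = g ?x u u' + g ?y v v'"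
      and d: "\<forall>u\<in>D\<^sub>1 ?x. frechet_derivative H (at z) (to_chart A c1 ?x u, 0) = to_chart A ?c ?q (a u)"
      using key[OF z] by (elim exE conjE) (rule that; assumption)
    note f = fc1[OF z u(1)] fc1[OF z u(2)]
    have "frechet_derivative H (at z) (u, 0) = to_chart A ?c ?q (a (from_chart A c1 ?x u))"
      "frechet_derivative H (at z) (u', 0) = to_chart A ?c ?q (a (from_chart A c1 ?x u'))"
      using d f by metis+
    then have "metric_rep ?c (H z) (frechet_derivative H (at z) (u, 0)) (frechet_derivative H (at z) (u', 0)) =
        g ?q (a (from_chart A c1 ?x u)) (a (from_chart A c1 ?x u'))"
      using metric_rep_cmap[OF c(1) Hcq(2)[OF z(1)]] Hcq(1)[OF z(1)] by simp
    \<comment> \<open>The product metric is evaluated on pairs whose component in the second factor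
      is 0.\<close>
    also have "\<dots> = g ?x (from_chart A c1 ?x u) (from_chart A c1 ?x u')"
      using m[rule_format, OF conjunct1[OF f(1)] conjunct1[OF f(2)] zero(2) zero(2)] linear_0[OF b] by (simp add: g_simps)
    finally show "metric_rep ?c (H z) (frechet_derivative H (at z) (u, 0)) (frechet_derivative H (at z) (u', 0)) =
       (\<lambda>s u u'. g (cinv c1 s) (from_chart A c1 (cinv c1 s) u) (from_chart A c1 (cinv c1 s) u')) (fst z) u u'" by simp
  next
    fix z u u' assume z: "z \<in> N" "z - z0 \<in> S\<^sub>1 \<times> S\<^sub>2" and u: "u \<in> S\<^sub>2" "u' \<in> S\<^sub>2"
    let ?x = "cinv c1 (fst z)" and ?y = "cinv c2 (snd z)" and ?q = "cinv ?c (H z)"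
    obtain a b where a: "linear a" and m: "\<forall>u\<in>D\<^sub>1 ?x. \<forall>u'\<in>D\<^sub>1 ?x. \<forall>v\<in>D\<^sub>2 ?y. \<forall>v'\<in>D\<^sub>2 ?y. g ?q (a u + b v) (a u' + b v') = g ?x u u' + g ?y v v'"
      and d: "\<forall>u\<in>D\<^sub>2 ?y. frechet_derivative H (at z) (0, to_chart A c2 ?y u) = to_chart A ?c ?q (b u)"
      using key[OF z] by (elim exE conjE) (rule that; assumption)
    note f = fc2[OF z u(1)] fc2[OF z u(2)]
    have "frechet_derivative H (at z) (0, u) = to_chart A ?c ?q (b (from_chart A c2 ?y u))"
      "frechet_derivative H (at z) (0, u') = to_chart A ?c ?q (b (from_chart A c2 ?y u'))"
      using d f by metis+
    then have "metric_rep ?c (H z) (frechet_derivative H (at z) (0, u)) (frechet_derivative H (at z) (0, u')) =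
        g ?q (b (from_chart A c2 ?y u)) (b (from_chart A c2 ?y u'))"
      using metric_rep_cmap[OF c(1) Hcq(2)[OF z(1)]] Hcq(1)[OF z(1)] by simp
    also have "\<dots> = g ?y (from_chart A c2 ?y u) (from_chart A c2 ?y u')"
      using m[rule_format, OF zero(1) zero(1) conjunct1[OF f(1)] conjunct1[OF f(2)]] linear_0[OF a] by (simp add: g_simps)
    finally show "metric_rep ?c (H z) (frechet_derivative H (at z) (0, u)) (frechet_derivative H (at z) (0, u')) =
       (\<lambda>s u u'. g (cinv c2 s) (from_chart A c2 (cinv c2 s) u) (from_chart A c2 (cinv c2 s) u')) (snd z) u u'" by simp
  next
    have z: "z0 - z0 \<in> S\<^sub>1 \<times> S\<^sub>2" using subspace_0[OF sub] by simp
    have i: "cinv c1 (fst z0) = p" "cinv c2 (snd z0) = p" "cinv ?c (H z0) = p"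
      unfolding Hz0 by (simp_all add: z0_def cinv_cmap[OF c1] cinv_cmap[OF c2] cinv_cmap[OF c])
    obtain a b where ab: "a ` D\<^sub>1 p = D\<^sub>1 p" "b ` D\<^sub>2 p = D\<^sub>2 p"
      "\<forall>u\<in>D\<^sub>1 p. frechet_derivative H (at z0) (to_chart A c1 p u, 0) = to_chart A ?c p (a u)"
      "\<forall>u\<in>D\<^sub>2 p. frechet_derivative H (at z0) (0, to_chart A c2 p u) = to_chart A ?c p (b u)"
      using key[OF z0N z] unfolding i by (elim exE conjE) (rule that; assumption)
    have ts: "to_chart A c1 p ` D\<^sub>1 p = S\<^sub>1" "to_chart A c2 p ` D\<^sub>2 p = S\<^sub>2" using S1(3) S2(3) c1 c2 pL by auto
    show "\<exists>u\<in>S\<^sub>1. to_chart A ?c p \<xi> = frechet_derivative H (at z0) (u, 0)" if "\<xi> \<in> D\<^sub>1 p" for \<xi>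
    proof -
      from that have "\<xi> \<in> a ` D\<^sub>1 p" unfolding ab(1) .
      then obtain v where v: "v \<in> D\<^sub>1 p" "\<xi> = a v" by blast
      have "to_chart A c1 p v \<in> S\<^sub>1" unfolding ts(1)[symmetric] by (rule imageI[OF v(1)])
      then show ?thesis unfolding v(2) ab(3)[THEN bspec, OF v(1), symmetric] by blast
    qed
    show "\<exists>u\<in>S\<^sub>2. to_chart A ?c p \<xi> = frechet_derivative H (at z0) (0, u)" if "\<xi> \<in> D\<^sub>2 p" for \<xi>
    proof -
      from that have "\<xi> \<in> b ` D\<^sub>2 p" unfolding ab(2) .
      then obtain v where v: "v \<in> D\<^sub>2 p" "\<xi> = b v" by blast
      have "to_chart A c2 p v \<in> S\<^sub>2" unfolding ts(2)[symmetric] by (rule imageI[OF v(1)])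
      then show ?thesis unfolding v(2) ab(4)[THEN bspec, OF v(1), symmetric] by blast
    qed
  qed
qed

end

section \<open>A local product structure makes both distributions parallel\<close>

context bislant
begin

text \<open>Inner products of images of vectors tangent to one factor are given by the metric of
  that factor, hence do not change in the direction of the other. By the variation formula, the
  mixed component of the covariant derivative is minus half of this vanishing change.\<close>

lemma product_imp_parallel:
  assumes prod: "local_riemannian_product_at A g D\<^sub>1 D\<^sub>2 M p" and W: "open W" "p \<in> W"
    and X: "section_on A D\<^sub>1 W X" and Y: "section_on A D\<^sub>1 W Y" and U: "section_on A D\<^sub>2 W U" and V: "section_on A D\<^sub>2 W V"
  shows "g p (nabla X Y p) (U p) = 0" "g p (nabla U V p) (X p) = 0"
proof -
  have zero: "0 \<in> D\<^sub>1 x" "0 \<in> D\<^sub>2 x" for x using subspace_0[OF D1_subspace] subspace_0[OF D2_subspace] by auto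
  obtain c N0 z0 and H :: "'e \<times> 'e \<Rightarrow> 'e" and S\<^sub>1 S\<^sub>2 \<gamma>\<^sub>1 \<gamma>\<^sub>2 where
    c: "compatible A c" "p \<in> cdom c" and N0: "open N0" "z0 \<in> N0" "smooth_on N0 H" "H z0 = cmap c p" "H ` N0 \<subseteq> cmap c ` cdom c"
    and S: "subspace S\<^sub>1" "subspace S\<^sub>2"
    and T1: "\<And>z u. z \<in> N0 \<Longrightarrow> z - z0 \<in> S\<^sub>1 \<times> S\<^sub>2 \<Longrightarrow> u \<in> S\<^sub>1 \<Longrightarrow>
      frechet_derivative H (at z) (u, 0) \<in> to_chart A c (cinv c (H z)) ` D\<^sub>1 (cinv c (H z))"
    and T2: "\<And>z w. z \<in> N0 \<Longrightarrow> z - z0 \<in> S\<^sub>1 \<times> S\<^sub>2 \<Longrightarrow> w \<in> S\<^sub>2 \<Longrightarrow>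
      frechet_derivative H (at z) (0, w) \<in> to_chart A c (cinv c (H z)) ` D\<^sub>2 (cinv c (H z))"
    and M1: "\<And>z u u'. z \<in> N0 \<Longrightarrow> z - z0 \<in> S\<^sub>1 \<times> S\<^sub>2 \<Longrightarrow> u \<in> S\<^sub>1 \<Longrightarrow> u' \<in> S\<^sub>1 \<Longrightarrow>
      metric_rep c (H z) (frechet_derivative H (at z) (u, 0)) (frechet_derivative H (at z) (u', 0)) = \<gamma>\<^sub>1 (fst z) u u'"
    and M2: "\<And>z w w'. z \<in> N0 \<Longrightarrow> z - z0 \<in> S\<^sub>1 \<times> S\<^sub>2 \<Longrightarrow> w \<in> S\<^sub>2 \<Longrightarrow> w' \<in> S\<^sub>2 \<Longrightarrow>
      metric_rep c (H z) (frechet_derivative H (at z) (0, w)) (frechet_derivative H (at z) (0, w')) = \<gamma>\<^sub>2 (snd z) w w'"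
    and surj: "\<And>\<xi>. \<xi> \<in> D\<^sub>1 p \<Longrightarrow> \<exists>u\<in>S\<^sub>1. to_chart A c p \<xi> = frechet_derivative H (at z0) (u, 0)"
      "\<And>\<xi>. \<xi> \<in> D\<^sub>2 p \<Longrightarrow> \<exists>w\<in>S\<^sub>2. to_chart A c p \<xi> = frechet_derivative H (at z0) (0, w)"
    using product_data[OF prod zero] by blast
  \<comment> \<open>The fields are smooth on \<open>W\<close> only, so \<open>H\<close> is
    restricted to parameters whose points lie in \<open>W\<close>.\<close>
  define N where "N = N0 \<inter> H -` (cmap c ` (cdom c \<inter> W))"
  have "open (cmap c ` (cdom c \<inter> W))"
    by (rule open_cmap_image[OF c(1)]) (use W compatible_open(1)[OF c(1)] in auto)
  then have N: "open N" unfolding N_def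
    by (rule continuous_open_preimage[OF smooth_on_continuous[OF N0(3)] N0(1)])
  have z0: "z0 \<in> N" using N0 c W by (auto simp: N_def)
  have sH: "smooth_on N H" by (rule smooth_on_mono[OF N0(3)]) (auto simp: N_def)
  have q: "cinv c (H z) \<in> cdom c \<inter> W" "H z = cmap c (cinv c (H z))" "z \<in> N0" if "z \<in> N" for z
    using that cinv_cmap[OF c(1)] by (auto simp: N_def)
  have sub: "subspace (S\<^sub>1 \<times> S\<^sub>2)" by (rule subspace_Times[OF S])
  have orth: "metric_rep c (H z) (to_chart A c (cinv c (H z)) u) (to_chart A c (cinv c (H z)) v) = 0"
    "metric_rep c (H z) (to_chart A c (cinv c (H z)) v) (to_chart A c (cinv c (H z)) u) = 0"
    if "z \<in> N" "u \<in> D\<^sub>1 (cinv c (H z))" "v \<in> D\<^sub>2 (cinv c (H z))" for z u v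
    using metric_rep_cmap[OF c(1), of "cinv c (H z)"] q[OF that(1)] D_orth[OF that(2,3)] by (simp_all add: g_sym)
  have fields: "field_rep A c R (H z) = to_chart A c (cinv c (H z)) (R (cinv c (H z)))" for R z
    by (rule field_rep_eq)
  have vfX: "vf W X" "vf W Y" "vf W U" "vf W V" using X Y U V by (auto simp: section_on_def)
  have sec: "X p \<in> D\<^sub>1 p" "Y p \<in> D\<^sub>1 p" "U p \<in> D\<^sub>2 p" "V p \<in> D\<^sub>2 p" using X Y U V W by (auto simp: section_on_def)
  obtain u v w w' where u: "u \<in> S\<^sub>1" "to_chart A c p (X p) = frechet_derivative H (at z0) (u, 0)"
    and v: "v \<in> S\<^sub>1" "to_chart A c p (Y p) = frechet_derivative H (at z0) (v, 0)"
    and w: "w \<in> S\<^sub>2" "to_chart A c p (U p) = frechet_derivative H (at z0) (0, w)"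
    and w': "w' \<in> S\<^sub>2" "to_chart A c p (V p) = frechet_derivative H (at z0) (0, w')"
    using surj sec by metis
  have ST: "(a, 0) \<in> S\<^sub>1 \<times> S\<^sub>2" "(0, b) \<in> S\<^sub>1 \<times> S\<^sub>2" if "a \<in> S\<^sub>1" "b \<in> S\<^sub>2" for a b
    using that subspace_0[OF S(1)] subspace_0[OF S(2)] by auto
  have O: "metric_rep c (H z) (frechet_derivative H (at z) (a, 0)) (frechet_derivative H (at z) (0, b)) = 0"
    "metric_rep c (H z) (frechet_derivative H (at z) (0, b)) (frechet_derivative H (at z) (a, 0)) = 0"
    if z: "z \<in> N" "z - z0 \<in> S\<^sub>1 \<times> S\<^sub>2" and "a \<in> S\<^sub>1" "b \<in> S\<^sub>2" for z a b
    using T1[OF q(3)[OF z(1)] z(2) \<open>a \<in> S\<^sub>1\<close>] T2[OF q(3)[OF z(1)] z(2) \<open>b \<in> S\<^sub>2\<close>] orth[OF z(1)] by auto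
  show "g p (nabla X Y p) (U p) = 0"
  proof -
    have o1: "metric_rep c (H z) (field_rep A c Y (H z)) (frechet_derivative H (at z) (0, w)) = 0"
      if z: "z \<in> N" "z - z0 \<in> S\<^sub>1 \<times> S\<^sub>2" for z
    proof -
      have "Y (cinv c (H z)) \<in> D\<^sub>1 (cinv c (H z))" using q(1)[OF z(1)] Y by (auto simp: section_on_def)
      then show ?thesis using T2[OF q(3)[OF z(1)] z(2) w(1)] orth(1)[OF z(1)] unfolding fields by auto
    qed
    note mv = metric_variation[OF W vfX(1,2,3) c N z0 sH N0(4) sub ST(1)[OF u(1) w(1)] ST(1)[OF v(1) w(1)] u(2) v(2) w(2)
        o1 O(1)[OF _ _ u(1) w(1)] O(1)[OF _ _ v(1) w(1)]]
    have "frechet_derivative (\<lambda>z. metric_rep c (H z) (frechet_derivative H (at z) (u, 0)) (frechet_derivative H (at z) (v, 0))) (at z0) (0, w) = 0"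
    proof (rule slice_derivative_zero[OF mv(1) N z0, where T = "{0} \<times> S\<^sub>2" and k = "\<gamma>\<^sub>1 (fst z0) u v"])
      show "subspace ({0::'e} \<times> S\<^sub>2)" by (rule subspace_Times[OF _ S(2)]) simp
      fix z assume z: "z \<in> N" "z - z0 \<in> {0} \<times> S\<^sub>2"
      then have "z - z0 \<in> S\<^sub>1 \<times> S\<^sub>2" "fst z = fst z0" using subspace_0[OF S(1)] by (auto simp: mem_Times_iff)
      then show "metric_rep c (H z) (frechet_derivative H (at z) (u, 0)) (frechet_derivative H (at z) (v, 0)) = \<gamma>\<^sub>1 (fst z0) u v"
        using M1[OF q(3)[OF z(1)] _ u(1) v(1)] by simp
    qed (use w in auto)
    then show ?thesis using mv(2) by simp
  qed
  show "g p (nabla U V p) (X p) = 0"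
  proof -
    have o1: "metric_rep c (H z) (field_rep A c V (H z)) (frechet_derivative H (at z) (u, 0)) = 0"
      if z: "z \<in> N" "z - z0 \<in> S\<^sub>1 \<times> S\<^sub>2" for z
    proof -
      have "V (cinv c (H z)) \<in> D\<^sub>2 (cinv c (H z))" using q(1)[OF z(1)] V by (auto simp: section_on_def)
      then show ?thesis using T1[OF q(3)[OF z(1)] z(2) u(1)] orth(2)[OF z(1)] unfolding fields by auto
    qed
    note mv = metric_variation[OF W vfX(3,4,1) c N z0 sH N0(4) sub ST(2)[OF u(1) w(1)] ST(2)[OF u(1) w'(1)] w(2) w'(2) u(2)
        o1 O(2)[OF _ _ u(1) w(1)] O(2)[OF _ _ u(1) w'(1)]]
    have "frechet_derivative (\<lambda>z. metric_rep c (H z) (frechet_derivative H (at z) (0, w)) (frechet_derivative H (at z) (0, w'))) (at z0) (u, 0) = 0"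
    proof (rule slice_derivative_zero[OF mv(1) N z0, where T = "S\<^sub>1 \<times> {0}" and k = "\<gamma>\<^sub>2 (snd z0) w w'"])
      show "subspace (S\<^sub>1 \<times> {0::'e})" by (rule subspace_Times[OF S(1)]) simp
      fix z assume z: "z \<in> N" "z - z0 \<in> S\<^sub>1 \<times> {0}"
      then have "z - z0 \<in> S\<^sub>1 \<times> S\<^sub>2" "snd z = snd z0" using subspace_0[OF S(2)] by (auto simp: mem_Times_iff)
      then show "metric_rep c (H z) (frechet_derivative H (at z) (0, w)) (frechet_derivative H (at z) (0, w')) = \<gamma>\<^sub>2 (snd z0) w w'"
        using M2[OF q(3)[OF z(1)] _ w(1) w'(1)] by simp
    qed (use u in auto)
    then show ?thesis using mv(2) by simp
  qed
qed

end

subsection \<open>Adapted charts\<close>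

lemma compatible_reparam:
  fixes c0 :: "('m::topological_space, 'e::euclidean_space) chart"
  assumes A: "smooth_atlas A" and c0: "compatible A c0" and U: "open U" "U \<subseteq> cmap c0 ` cdom c0" and Q: "open Q"
    and hom: "homeomorphism U Q \<Psi> h" and s: "smooth_on U \<Psi>" "smooth_on Q h"
  defines "c \<equiv> (cdom c0 \<inter> cmap c0 -` U, \<lambda>q. \<Psi> (cmap c0 q))"
  shows "compatible A c" "cmap c ` cdom c = Q" "\<And>z. z \<in> Q \<Longrightarrow> cinv c z = cinv c0 (h z)"
proof -
  have hU: "h z \<in> U" "\<Psi> (h z) = z" if "z \<in> Q" for z using hom that by (auto simp: homeomorphism_def)
  have \<Psi>Q: "\<Psi> x \<in> Q" "h (\<Psi> x) = x" if "x \<in> U" for x using hom that by (auto simp: homeomorphism_def)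
  have cd: "cdom c = cdom c0 \<inter> cmap c0 -` U" and cm: "cmap c q = \<Psi> (cmap c0 q)" for q by (simp_all add: c_def)
  have inj: "inj_on (cmap c) (cdom c)"
    using compatible_inj[OF c0] \<Psi>Q(2) by (auto simp: inj_on_def cd cm) metis
  have mem: "cinv c0 (h z) \<in> cdom c" "cmap c (cinv c0 (h z)) = z" if "z \<in> Q" for z
  proof -
    have "h z \<in> cmap c0 ` cdom c0" using hU(1)[OF that] U(2) by blast
    then show "cinv c0 (h z) \<in> cdom c" "cmap c (cinv c0 (h z)) = z"
      using hU[OF that] by (simp_all add: cd cm cmap_cinv cinv_in)
  qed
  show img: "cmap c ` cdom c = Q"
  proof
    show "cmap c ` cdom c \<subseteq> Q" using \<Psi>Q(1) by (auto simp: cd cm)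
    show "Q \<subseteq> cmap c ` cdom c" using mem by (metis imageI subsetI)
  qed
  show ci: "cinv c z = cinv c0 (h z)" if "z \<in> Q" for z by (rule inv_into_f_eq[OF inj mem[OF that]])
  have od: "open (cdom c)" unfolding cd
    by (rule continuous_open_preimage[OF continuous_cmap[OF c0] compatible_open(1)[OF c0] U(1)])
  have homc: "homeomorphism (cdom c) (cmap c ` cdom c) (cmap c) (cinv c)"
  proof (rule homeomorphismI)
    show "continuous_on (cdom c) (cmap c)"
      unfolding cm cd
      by (rule continuous_on_compose2[OF smooth_on_continuous[OF s(1)] continuous_on_subset[OF continuous_cmap[OF c0]]]) auto
    have "continuous_on Q (\<lambda>z. cinv c0 (h z))"
      by (rule continuous_on_compose2[OF continuous_cinv[OF c0] smooth_on_continuous[OF s(2)]]) (use hU U in auto)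
    then show "continuous_on (cmap c ` cdom c) (cinv c)" unfolding img by (rule continuous_on_eq) (simp add: ci)
    show "cinv c ` cmap c ` cdom c \<subseteq> cdom c" using inj by (auto simp: inv_into_f_f)
    show "cinv c (cmap c x) = x" if "x \<in> cdom c" for x using inj that by (simp add: inv_into_f_f)
    show "cmap c (cinv c y) = y" if "y \<in> cmap c ` cdom c" for y using that by (simp add: f_inv_into_f)
  qed auto
  have tr: "smooth_on (cmap c ` (cdom c \<inter> cdom a)) (cmap a \<circ> cinv c)"
    "smooth_on (cmap a ` (cdom a \<inter> cdom c)) (cmap c \<circ> cinv a)" if "a \<in> A" for a
  proof -
    note ca = atlas_compatible[OF A that]
    let ?V = "cdom c \<inter> cdom a"
    have V: "open ?V" "?V \<subseteq> cdom c0" using od compatible_open(1)[OF ca] by (auto simp: cd)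
    have o0: "open (cmap c0 ` ?V)" by (rule open_cmap_image[OF c0 V])
    have oa: "open (cmap a ` ?V)" by (rule open_cmap_image[OF ca V(1)]) blast
    have eq: "cmap c ` ?V = Q \<inter> h -` (cmap c0 ` ?V)"
    proof (rule set_eqI)
      fix z
      show "z \<in> cmap c ` ?V \<longleftrightarrow> z \<in> Q \<inter> h -` (cmap c0 ` ?V)"
      proof
        assume "z \<in> cmap c ` ?V"
        then obtain q where q: "q \<in> ?V" "z = \<Psi> (cmap c0 q)" by (auto simp: cm)
        then show "z \<in> Q \<inter> h -` (cmap c0 ` ?V)" using \<Psi>Q[of "cmap c0 q"] by (auto simp: cd)
      next
        assume "z \<in> Q \<inter> h -` (cmap c0 ` ?V)"
        then obtain q where q: "q \<in> ?V" "h z = cmap c0 q" "z \<in> Q" by auto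
        then have "z = cmap c q" using hU(2) by (simp add: cm) metis
        then show "z \<in> cmap c ` ?V" using q(1) by blast
      qed
    qed
    have oc: "open (cmap c ` ?V)"
      unfolding eq by (rule continuous_open_preimage[OF smooth_on_continuous[OF s(2)] Q o0])
    have t: "smooth_on (cmap c0 ` ?V) (\<lambda>x. cmap a (cinv c0 x))"
      by (rule smooth_on_mono[OF transition_smooth[OF A c0 ca]]) (use V in auto)
    have "smooth_on (cmap c ` ?V) (\<lambda>z. cmap a (cinv c0 (h z)))"
      by (rule smooth_on_compose[OF oc o0 _ t smooth_on_mono[OF s(2)]]) (auto simp: eq)
    then show "smooth_on (cmap c ` ?V) (cmap a \<circ> cinv c)"
      by (rule smooth_on_cong[OF oc, rotated]) (simp add: eq ci)
    have t2: "smooth_on (cmap a ` ?V) (\<lambda>x. cmap c0 (cinv a x))"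
      by (rule smooth_on_mono[OF transition_smooth[OF A ca c0]]) (use V in auto)
    have "smooth_on (cmap a ` ?V) (\<lambda>x. \<Psi> (cmap c0 (cinv a x)))"
      by (rule smooth_on_compose[OF oa U(1) _ s(1) t2]) (auto simp: cinv_cmap[OF ca] cd)
    then show "smooth_on (cmap a ` (cdom a \<inter> cdom c)) (cmap c \<circ> cinv a)"
      by (simp add: o_def cm Int_commute)
  qed
  have trc: "smooth_on (cmap c ` (cdom c \<inter> cdom c)) (cmap c \<circ> cinv c)"
    by (rule smooth_on_cong[OF _ _ smooth_on_ident]) (use Q in \<open>auto simp: img cmap_cinv simp flip: img\<close>)
  have A3: "smooth_on (cmap a ` (cdom a \<inter> cdom b)) (cmap b \<circ> cinv a)" if "a \<in> A" "b \<in> A" for a b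
    using A that unfolding smooth_atlas_def by blast
  show "compatible A c" unfolding compatible_def smooth_atlas_def
  proof (intro conjI ballI)
    fix k assume k: "k \<in> insert c A"
    have "open (cdom k) \<and> open (cmap k ` cdom k) \<and> homeomorphism (cdom k) (cmap k ` cdom k) (cmap k) (cinv k)"
    proof (cases "k = c")
      case True
      then show ?thesis using od Q homc img by simp
    next
      case False
      then have "compatible A k" using k atlas_compatible[OF A] by blast
      then show ?thesis using compatible_open by blast
    qed
    then show "open (cdom k)" "open (cmap k ` cdom k)" "homeomorphism (cdom k) (cmap k ` cdom k) (cmap k) (cinv k)"
      by blast+
    fix l assume l: "l \<in> insert c A"
    show "smooth_on (cmap k ` (cdom k \<inter> cdom l)) (cmap l \<circ> cinv k)"
      using k l tr trc A3 by auto
  next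
    show "(\<Union>k\<in>insert c A. cdom k) = UNIV" using A by (auto simp: smooth_atlas_def)
  qed
qed

lemma constant_along_direction:
  fixes \<psi> :: "'a::euclidean_space \<Rightarrow> real"
  assumes d: "\<And>s. s \<in> {0..1} \<Longrightarrow> (\<psi> has_derivative \<psi>' (z + s *\<^sub>R w)) (at (z + s *\<^sub>R w))"
    and z: "\<And>s. s \<in> {0..1} \<Longrightarrow> \<psi>' (z + s *\<^sub>R w) w = 0"
  shows "\<psi> (z + w) = \<psi> z"
proof -
  have "((\<lambda>s. \<psi> (z + s *\<^sub>R w)) has_derivative (\<lambda>h. 0)) (at s within {0..1})" if s: "s \<in> {0..1}" for s
  proof -
    have "((\<lambda>s. z + s *\<^sub>R w) has_derivative (\<lambda>h. h *\<^sub>R w)) (at s within {0..1})" by (auto intro!: derivative_eq_intros)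
    from has_derivative_compose[OF this d[OF s]]
    have "((\<lambda>s. \<psi> (z + s *\<^sub>R w)) has_derivative (\<lambda>h. \<psi>' (z + s *\<^sub>R w) (h *\<^sub>R w))) (at s within {0..1})" .
    moreover have "\<psi>' (z + s *\<^sub>R w) (h *\<^sub>R w) = 0" for h
      using z[OF s] linear_scale[OF bounded_linear.linear[OF has_derivative_bounded_linear[OF d[OF s]]]] by simp
    ultimately show ?thesis by simp
  qed
  then obtain k where "\<And>s. s \<in> {0..1} \<Longrightarrow> \<psi> (z + s *\<^sub>R w) = k"
    using has_derivative_zero_constant[of "{0..1::real}" "\<lambda>s. \<psi> (z + s *\<^sub>R w)"] by auto
  from this[of 0] this[of 1] show ?thesis by simp
qed

section \<open>Parallel distributions give a local product structure\<close>

context bislant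
begin

text \<open>For \<open>D\<^sub>1\<close> and \<open>D\<^sub>2\<close> this is total geodesy of the
  leaves inside the fibres, phrased before leaves are known to exist. Both distributions are
  arguments, so the locale with exchanged distributions uses the same predicate.\<close>

definition parallel :: "('m \<Rightarrow> 'e set) \<Rightarrow> ('m \<Rightarrow> 'e set) \<Rightarrow> bool" where
  "parallel D D' \<longleftrightarrow> (\<forall>W X Y U p. open W \<longrightarrow> p \<in> W \<longrightarrow> section_on A D W X \<longrightarrow> section_on A D W Y \<longrightarrow>
     section_on A D' W U \<longrightarrow> g p (nabla X Y p) (U p) = 0)"

lemma parallelD:
  "parallel D D' \<Longrightarrow> open W \<Longrightarrow> p \<in> W \<Longrightarrow> section_on A D W X \<Longrightarrow> section_on A D W Y \<Longrightarrow> section_on A D' W U \<Longrightarrow>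
    g p (nabla X Y p) (U p) = 0"
  unfolding parallel_def by blast

lemma section_on_mono: "section_on A D W X \<Longrightarrow> V \<subseteq> W \<Longrightarrow> section_on A D V X"
  by (auto simp: section_on_def intro: vector_field_on_mono)

lemma Ver_orth_D1:
  assumes "w \<in> Ver p" "\<And>v. v \<in> D\<^sub>2 p \<Longrightarrow> g p w v = 0"
  shows "w \<in> D\<^sub>1 p"
proof -
  let ?w2 = "orth_proj (g p) (D\<^sub>2 p) w"
  have "g p ?w2 ?w2 = 0"
    using orth_proj_orth[OF D2 orth_proj_in[OF D2], of p w w] assms(2)[OF orth_proj_in[OF D2]] by (simp add: g_simps)
  then have "orth_proj (g p) (D\<^sub>1 p) w = w" using ver_id[OF assms(1)] by (simp add: ver_eq g_zero)
  then show ?thesis using orth_proj_in[OF D1, of p w] by simp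
qed

text \<open>The bracket is vertical, and its inner product with a section of
  \<open>D\<^sub>2\<close> is the difference of two terms that vanish because the distribution is
  parallel. This is the involutivity required by Frobenius' theorem.\<close>

lemma bracket_D1:
  assumes par: "parallel D\<^sub>1 D\<^sub>2" and W: "open W" "p \<in> W" and X: "section_on A D\<^sub>1 W X" and Y: "section_on A D\<^sub>1 W Y"
  shows "lie_bracket A X Y p \<in> D\<^sub>1 p"
proof (rule Ver_orth_D1)
  have vX: "vf W X" "\<And>q. q \<in> W \<Longrightarrow> X q \<in> Ver q" and vY: "vf W Y" "\<And>q. q \<in> W \<Longrightarrow> Y q \<in> Ver q"
    using X Y D1_Ver by (auto simp: section_on_def)
  show "lie_bracket A X Y p \<in> Ver p" by (rule bracket_vertical[OF W vX vY])
  fix v assume "v \<in> D\<^sub>2 p"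
  then obtain V U where V: "open V" "p \<in> V" and U: "section_on A D\<^sub>2 V U" "U p = v" using section_extension[OF D2] by metis
  have s: "section_on A D\<^sub>1 (V \<inter> W) X" "section_on A D\<^sub>1 (V \<inter> W) Y" "section_on A D\<^sub>2 (V \<inter> W) U"
    using X Y U section_on_mono by (metis inf_le1 inf_le2)+
  have o: "open (V \<inter> W)" "p \<in> V \<inter> W" using V W by auto
  show "g p (lie_bracket A X Y p) v = 0"
    using parallelD[OF par o s(1,2,3)] parallelD[OF par o s(2,1,3)]
    unfolding nabla_torsion[OF W(1) vX(1) vY(1) W(2), symmetric] U(2)[symmetric] by (simp add: g_simps)
qed

text \<open>Frobenius in the chart \<open>c\<close>: a frame of \<open>D\<^sub>1\<close> is read in
  coordinates, and coordinate fields tangent to the distribution are turned into sections so that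
  \<open>bracket_D1\<close> applies. The dimension is recorded because an inclusion of tangent
  spaces will be upgraded to an equality by counting dimensions.\<close>

lemma first_integral:
  assumes par: "parallel D\<^sub>1 D\<^sub>2" and c: "compatible A c" "p \<in> cdom c"
  shows "\<exists>V u. open V \<and> cmap c p \<in> V \<and> V \<subseteq> cmap c ` cdom c \<and> smooth_on V (u :: 'e \<Rightarrow> 'e) \<and>
    (\<forall>q\<in>cdom c. cmap c q \<in> V \<longrightarrow> dim (D\<^sub>1 q) = dim (D\<^sub>1 p) \<and>
      (\<forall>v. frechet_derivative u (at (cmap c q)) (to_chart A c q v) = 0 \<longleftrightarrow> v \<in> D\<^sub>1 q))"
proof -
  obtain W0 S where W0: "open W0" "p \<in> W0" and S: "finite S" "\<And>X. X \<in> S \<Longrightarrow> vf W0 X"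
    "\<And>q. q \<in> W0 \<Longrightarrow> inj_on (\<lambda>X. X q) S \<and> independent ((\<lambda>X. X q) ` S) \<and> span ((\<lambda>X. X q) ` S) = D\<^sub>1 q"
    using dist_frame[OF D1] by metis
  let ?W = "cdom c \<inter> W0"
  have W: "open ?W" using W0 compatible_open(1)[OF c(1)] by blast
  let ?U = "cmap c ` ?W"
  have U: "open ?U" by (rule open_cmap_image[OF c(1) W]) blast
  have pU: "cmap c p \<in> ?U" using c W0 by blast
  define \<Delta> where "\<Delta> x = to_chart A c (cinv c x) ` D\<^sub>1 (cinv c x)" for x
  have q: "cinv c x \<in> cdom c" "cinv c x \<in> W0" "cmap c (cinv c x) = x" if "x \<in> ?U" for x
    using that by (auto simp: cinv_cmap[OF c(1)])
  have \<Delta>mem: "to_chart A c q v \<in> \<Delta> (cmap c q) \<longleftrightarrow> v \<in> D\<^sub>1 q" if "q \<in> cdom c" for q v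
    using bij_is_inj[OF to_chart_bij[OF A c(1) that]] by (auto simp: \<Delta>_def cinv_cmap[OF c(1) that] inj_def)
  let ?R = "field_rep A c"
  \<comment> \<open>The frame in coordinates is indexed by the representing functions; they are
    distinct because the fields differ at \<open>p\<close>.\<close>
  have "inj_on ?R S"
  proof (rule inj_onI)
    fix X Y assume XY: "X \<in> S" "Y \<in> S" "?R X = ?R Y"
    then have "to_chart A c p (X p) = to_chart A c p (Y p)" using field_rep_cmap[OF c] by metis
    then have "X p = Y p" using from_to_chart[OF A c] by metis
    then show "X = Y" using S(3)[OF W0(2)] XY by (auto simp: inj_on_def)
  qed
  have frame: "inj_on (\<lambda>\<xi>. \<xi> x) (?R ` S) \<and> independent ((\<lambda>\<xi>. \<xi> x) ` ?R ` S) \<and> span ((\<lambda>\<xi>. \<xi> x) ` ?R ` S) = \<Delta> x"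
    if x: "x \<in> ?U" for x
  proof -
    let ?q = "cinv c x"
    note l = to_chart_linear[OF A c(1) q(1)[OF x]] and b = bij_is_inj[OF to_chart_bij[OF A c(1) q(1)[OF x]]]
    note Sq = S(3)[OF q(2)[OF x]]
    have im: "(\<lambda>\<xi>. \<xi> x) ` ?R ` S = to_chart A c ?q ` (\<lambda>X. X ?q) ` S" by (auto simp: field_rep_eq image_image)
    have "inj_on (\<lambda>\<xi>. \<xi> x) (?R ` S)"
    proof (rule inj_onI)
      fix \<xi> \<eta> assume "\<xi> \<in> ?R ` S" "\<eta> \<in> ?R ` S" "\<xi> x = \<eta> x"
      then obtain X Y where XY: "X \<in> S" "Y \<in> S" "\<xi> = ?R X" "\<eta> = ?R Y" "?R X x = ?R Y x" by blast
      then have "X ?q = Y ?q" using b by (auto simp: field_rep_eq inj_def)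
      then have "X = Y" using Sq XY(1,2) by (auto simp: inj_on_def)
      then show "\<xi> = \<eta>" using XY by simp
    qed
    moreover have "independent (to_chart A c ?q ` (\<lambda>X. X ?q) ` S)"
      using linear_independent_injective_image[OF l, of "(\<lambda>X. X ?q) ` S"] Sq inj_on_subset[OF b subset_UNIV] by blast
    ultimately show ?thesis unfolding im using linear_span_image[OF l] Sq by (simp add: \<Delta>_def)
  qed
  have sR: "smooth_on ?U \<xi>" if "\<xi> \<in> ?R ` S" for \<xi>
    using that vector_field_on_rep[OF A c(1) W0(1) S(2)] by blast
  have inv: "frechet_derivative \<eta> (at x) (\<xi> x) - frechet_derivative \<xi> (at x) (\<eta> x) \<in> \<Delta> x"
    if O': "open O'" "O' \<subseteq> ?U" and s: "smooth_on O' \<xi>" "smooth_on O' \<eta>"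
      and in\<Delta>: "\<And>x. x \<in> O' \<Longrightarrow> \<xi> x \<in> \<Delta> x \<and> \<eta> x \<in> \<Delta> x" and x: "x \<in> O'" for O' \<xi> \<eta> x
  proof -
    let ?V = "cdom c \<inter> cmap c -` O'"
    have V: "open ?V" by (rule continuous_open_preimage[OF continuous_cmap[OF c(1)] compatible_open(1)[OF c(1)] O'(1)])
    have Vi: "cmap c ` ?V = O'" using O'(2) by auto
    let ?X = "\<lambda>\<xi> q. from_chart A c q (\<xi> (cmap c q))"
    have sec: "section_on A D\<^sub>1 ?V (?X \<zeta>)" if "smooth_on O' \<zeta>" "\<And>x. x \<in> O' \<Longrightarrow> \<zeta> x \<in> \<Delta> x" for \<zeta>
    proof -
      have "vf ?V (?X \<zeta>)" by (rule vector_field_from_chart[OF A c(1) V]) (use that Vi in auto)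
      moreover have "?X \<zeta> q \<in> D\<^sub>1 q" if q: "q \<in> ?V" for q
        using \<open>\<And>x. x \<in> O' \<Longrightarrow> \<zeta> x \<in> \<Delta> x\<close>[of "cmap c q"] \<Delta>mem[of q "?X \<zeta> q"] q A c(1) by simp
      ultimately show ?thesis by (simp add: section_on_def)
    qed
    have rep: "?R (?X \<zeta>) y = \<zeta> y" if "y \<in> O'" for \<zeta> y
      using q[of y] O'(2) that A c(1) by (auto simp: field_rep_eq)
    have dd: "frechet_derivative (?R (?X \<zeta>)) (at x) = frechet_derivative \<zeta> (at x)" for \<zeta>
      by (rule frechet_derivative_cong[OF O'(1) x rep])
    let ?q = "cinv c x"
    have qx: "?q \<in> cdom c" "cmap c ?q = x" "?q \<in> ?V" using q[of x] O'(2) x by auto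
    have 1: "lie_bracket A (?X \<xi>) (?X \<eta>) ?q \<in> D\<^sub>1 ?q"
      by (rule bracket_D1[OF par V qx(3) sec[OF s(1)] sec[OF s(2)]]) (use in\<Delta> in auto)
    have 2: "to_chart A c ?q (lie_bracket A (?X \<xi>) (?X \<eta>) ?q) =
        frechet_derivative \<eta> (at x) (\<xi> x) - frechet_derivative \<xi> (at x) (\<eta> x)"
      using lie_bracket_chart[OF A c(1) qx(1) V qx(3), of "?X \<xi>" "?X \<eta>"] sec[OF s(1)] sec[OF s(2)] in\<Delta>
        to_from_chart[OF A c(1) qx(1)] by (simp add: qx(2) dd section_on_def)
    show ?thesis using \<Delta>mem[OF qx(1), THEN iffD2, OF 1] unfolding qx(2) 2 .
  qed
  obtain V u where V: "open V" "cmap c p \<in> V" "V \<subseteq> ?U" "smooth_on V (u :: 'e \<Rightarrow> 'e)"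
    "\<And>x v. x \<in> V \<Longrightarrow> frechet_derivative u (at x) v = 0 \<longleftrightarrow> v \<in> \<Delta> x"
    by (rule frobenius[OF U pU finite_imageI[OF S(1)] sR frame inv]) (assumption+, rule that)
  have dimD: "dim (D\<^sub>1 q) = card S" if "q \<in> W0" for q
    using S(3)[OF that] dim_span_eq_card_independent[of "(\<lambda>X. X q) ` S"] card_image[of "\<lambda>X. X q" S] by metis
  have "q \<in> W0" if "q \<in> cdom c" "cmap c q \<in> V" for q
    using q(2)[OF subsetD[OF V(3) that(2)]] by (simp add: cinv_cmap[OF c(1) that(1)])
  moreover have "V \<subseteq> cmap c ` cdom c" using V(3) by blast
  ultimately show ?thesis using V(1,2,4,5) \<Delta>mem dimD W0(2) by (intro exI[of _ V] exI[of _ u]) auto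
qed

text \<open>The coordinate along \<open>D\<^sub>1\<close> is the first integral of
  \<open>D\<^sub>2\<close>, the one along \<open>D\<^sub>2\<close> is the first integral of
  \<open>D\<^sub>1\<close>, and \<open>\<pi>\<close> gives the transverse coordinate. The
  projections \<open>p1\<close>, \<open>p2\<close>, \<open>p3\<close> express the splitting inside
  the model space, so that the chart keeps the type of the atlas. The image is a box for these
  projections because components of different points will be recombined.\<close>

lemma adapted_chart:
  assumes par1: "parallel D\<^sub>1 D\<^sub>2" and par2: "parallel D\<^sub>2 D\<^sub>1"
  obtains c and p1 p2 p3 :: "'e \<Rightarrow> 'e" and \<epsilon> :: real where
    "compatible A c" "p \<in> cdom c" "cmap c p = 0" "linear p1" "linear p2" "linear p3"
    "\<And>z. p1 z + p2 z + p3 z = z"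
    "\<And>z. p1 (p1 z) = p1 z" "\<And>z. p2 (p1 z) = 0" "\<And>z. p1 (p2 z) = 0" "\<And>z. p2 (p2 z) = p2 z"
    "\<And>z. p3 (p1 z) = 0" "\<And>z. p3 (p2 z) = 0"
    "0 < \<epsilon>" "cmap c ` cdom c = {z. norm (p1 z) < \<epsilon> \<and> norm (p2 z) < \<epsilon> \<and> norm (p3 z) < \<epsilon>}"
    "\<And>q. q \<in> cdom c \<Longrightarrow> to_chart A c q ` D\<^sub>1 q = range p1"
    "\<And>q. q \<in> cdom c \<Longrightarrow> to_chart A c q ` D\<^sub>2 q = range p2"
    "\<And>q. q \<in> cdom c \<Longrightarrow> \<pi> q = \<pi> p \<longleftrightarrow> p3 (cmap c q) = 0"
proof -
  let ?c0 = "chart_at A p"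
  have c0: "compatible A ?c0" "p \<in> cdom ?c0" using chart_at_compatible[OF A] chart_at[OF A] by auto
  obtain d where d: "d \<in> B" "\<pi> p \<in> cdom d" using atlas_cover[OF B] by blast
  note dd = atlas_compatible[OF B d(1)]
  define x0 where "x0 = cmap ?c0 p"
  obtain V1 u1 where V1: "open V1" "x0 \<in> V1" "V1 \<subseteq> cmap ?c0 ` cdom ?c0" and su1: "smooth_on V1 (u1 :: 'e \<Rightarrow> 'e)"
    and k1: "\<And>q. q \<in> cdom ?c0 \<Longrightarrow> cmap ?c0 q \<in> V1 \<Longrightarrow> dim (D\<^sub>1 q) = dim (D\<^sub>1 p) \<and>
      (\<forall>v. frechet_derivative u1 (at (cmap ?c0 q)) (to_chart A ?c0 q v) = 0 \<longleftrightarrow> v \<in> D\<^sub>1 q)"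
    using first_integral[OF par1 c0] unfolding x0_def by metis
  obtain V2 u2 where V2: "open V2" "x0 \<in> V2" "V2 \<subseteq> cmap ?c0 ` cdom ?c0" and su2: "smooth_on V2 (u2 :: 'e \<Rightarrow> 'e)"
    and k2: "\<And>q. q \<in> cdom ?c0 \<Longrightarrow> cmap ?c0 q \<in> V2 \<Longrightarrow> dim (D\<^sub>2 q) = dim (D\<^sub>2 p) \<and>
      (\<forall>v. frechet_derivative u2 (at (cmap ?c0 q)) (to_chart A ?c0 q v) = 0 \<longleftrightarrow> v \<in> D\<^sub>2 q)"
    using bislant.first_integral[OF swap par2 c0] unfolding x0_def by metis
  define L where "L = (\<lambda>x. cmap d (\<pi> (cinv ?c0 x)))"
  define VL where "VL = cmap ?c0 ` (cdom ?c0 \<inter> UNIV \<inter> \<pi> -` cdom d)"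
  have cpi: "continuous_on UNIV \<pi>" using pi by (simp add: smooth_map_on_def)
  have VL: "open VL" unfolding VL_def by (rule smooth_map_on_open_rep(2)[OF c0(1) dd open_UNIV cpi])
  have sL: "smooth_on VL L" unfolding L_def VL_def by (rule smooth_map_on_rep[OF A B c0(1) dd open_UNIV pi])
  define U where "U = V1 \<inter> V2 \<inter> VL"
  have U: "open U" unfolding U_def by (intro open_Int V1 V2 VL)
  have x0: "x0 \<in> U" using V1 V2 c0 d unfolding U_def VL_def x0_def by blast
  have s: "smooth_on U u1" "smooth_on U u2" "smooth_on U L"
    using smooth_on_mono[OF su1, of U] smooth_on_mono[OF su2, of U] smooth_on_mono[OF sL, of U] by (auto simp: U_def)
  have sub: "U \<subseteq> cmap ?c0 ` cdom ?c0" using V1(3) by (auto simp: U_def)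
  have piU: "\<pi> q \<in> cdom d" if "q \<in> cdom ?c0" "cmap ?c0 q \<in> U" for q
    using that compatible_inj[OF c0(1)] by (auto simp: U_def VL_def inj_on_def)
  have kL: "frechet_derivative L (at (cmap ?c0 q)) (to_chart A ?c0 q v) = 0 \<longleftrightarrow> v \<in> Ver q"
    if "q \<in> cdom ?c0" "cmap ?c0 q \<in> U" for q v
    using Ver_chart[OF c0(1) that(1) dd piU[OF that]] by (simp add: L_def)
  let ?t = "to_chart A ?c0 p"
  have lt: "linear ?t" by (rule to_chart_linear[OF A c0])
  define K1 where "K1 = ?t ` D\<^sub>1 p"
  define K2 where "K2 = ?t ` D\<^sub>2 p"
  have sK: "subspace K1" "subspace K2"
    unfolding K1_def K2_def by (rule linear_subspace_image[OF lt D1_subspace] linear_subspace_image[OF lt D2_subspace])+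
  let ?du1 = "frechet_derivative u1 (at x0)" and ?du2 = "frechet_derivative u2 (at x0)" and ?dL = "frechet_derivative L (at x0)"
  have lin: "linear ?du1" "linear ?du2" "linear ?dL" using s x0 smooth_on_linear_derivative by blast+
  have z1: "?du1 (?t v) = 0 \<longleftrightarrow> v \<in> D\<^sub>1 p" and z2: "?du2 (?t v) = 0 \<longleftrightarrow> v \<in> D\<^sub>2 p" and zL: "?dL (?t v) = 0 \<longleftrightarrow> v \<in> Ver p" for v
    using k1[OF c0(2)] k2[OF c0(2)] kL[OF c0(2)] V1(2) V2(2) x0 by (auto simp: x0_def)
  have D12: "v = 0" if "v \<in> D\<^sub>1 p" "v \<in> D\<^sub>2 p" for v using D_orth[OF that] by (simp add: g_zero)
  \<comment> \<open>The kernel of \<open>?du1\<close> is \<open>K1\<close>, which meets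
    \<open>K2\<close> only in 0 because the distributions are orthogonal.\<close>
  have "inj_on ?du1 K2"
  proof (rule inj_onI)
    fix a b assume ab: "a \<in> K2" "b \<in> K2" and e: "?du1 a = ?du1 b"
    have "a - b \<in> K2" using ab sK(2) by (simp add: subspace_diff)
    then obtain v where v: "v \<in> D\<^sub>2 p" "a - b = ?t v" unfolding K2_def by blast
    have "?du1 (?t v) = 0" using e unfolding v(2)[symmetric] linear_diff[OF lin(1)] by simp
    then have "v = 0" using z1 D12 v(1) by blast
    then show "a = b" using v(2) linear_0[OF lt] by simp
  qed
  then obtain \<alpha> where \<alpha>: "range \<alpha> \<subseteq> K2" "linear \<alpha>" "\<And>v. v \<in> K2 \<Longrightarrow> \<alpha> (?du1 v) = v"
    using linear_exists_left_inverse_on[OF lin(1) sK(2)] by blast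
  have "inj_on ?du2 K1"
  proof (rule inj_onI)
    fix a b assume ab: "a \<in> K1" "b \<in> K1" and e: "?du2 a = ?du2 b"
    have "a - b \<in> K1" using ab sK(1) by (simp add: subspace_diff)
    then obtain v where v: "v \<in> D\<^sub>1 p" "a - b = ?t v" unfolding K1_def by blast
    have "?du2 (?t v) = 0" using e unfolding v(2)[symmetric] linear_diff[OF lin(2)] by simp
    then have "v = 0" using z2 D12 v(1) by blast
    then show "a = b" using v(2) linear_0[OF lt] by simp
  qed
  then obtain \<beta> where \<beta>: "range \<beta> \<subseteq> K1" "linear \<beta>" "\<And>v. v \<in> K1 \<Longrightarrow> \<beta> (?du2 v) = v"
    using linear_exists_left_inverse_on[OF lin(2) sK(1)] by blast
  have "surj ?dL"
  proof (rule surjI)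
    fix y
    let ?v = "inv (differential A B \<pi> p) (from_chart B d (\<pi> p) y)"
    have "differential A B \<pi> p ?v = from_chart B d (\<pi> p) y" using pi_surj by (simp add: surj_f_inv_f)
    then show "?dL (?t ?v) = y"
      using differential_chart[where f = \<pi>, OF A B c0 dd d(2) open_UNIV UNIV_I pi, of ?v] to_from_chart[OF B dd d(2)]
      by (simp add: L_def x0_def)
  qed
  then obtain \<gamma> where \<gamma>: "linear \<gamma>" "\<And>w. ?dL (\<gamma> w) = w"
    using linear_surjective_right_inverse[OF lin(3)] by (metis comp_apply id_apply)
  \<comment> \<open>\<open>\<gamma>\<close> is a right inverse of the derivative of
    \<open>L\<close>, so \<open>p3\<close> projects along the vertical space; on the vertical
    remainder \<open>\<beta>\<close> and \<open>\<alpha>\<close> recover the components in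
    \<open>K1\<close> and \<open>K2\<close>.\<close>
  define p3 where "p3 v = \<gamma> (?dL v)" for v
  define p1 where "p1 v = \<beta> (?du2 (v - p3 v))" for v
  define p2 where "p2 v = \<alpha> (?du1 (v - p3 v))" for v
  note z = linear_0[OF \<alpha>(2)] linear_0[OF \<beta>(2)] linear_0[OF \<gamma>(1)] linear_0[OF lin(1)] linear_0[OF lin(2)] linear_0[OF lin(3)]
  have lp3: "linear p3" unfolding p3_def[abs_def] using linear_compose[OF lin(3) \<gamma>(1)] by (simp add: o_def)
  have l3': "linear (\<lambda>v. v - p3 v)" by (rule linear_compose_sub[OF linear_ident lp3])
  have lp1: "linear p1" unfolding p1_def[abs_def]
    using linear_compose[OF linear_compose[OF l3' lin(2)] \<beta>(2)] by (simp add: o_def)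
  have lp2: "linear p2" unfolding p2_def[abs_def]
    using linear_compose[OF linear_compose[OF l3' lin(1)] \<alpha>(2)] by (simp add: o_def)
  have K1p: "p1 k = k" "p2 k = 0" "p3 k = 0" if "k \<in> K1" for k
  proof -
    obtain v where v: "v \<in> D\<^sub>1 p" "k = ?t v" using \<open>k \<in> K1\<close> unfolding K1_def by blast
    have 0: "?dL k = 0" "?du1 k = 0" unfolding v(2) zL z1 using v(1) D1_Ver by auto
    then show "p3 k = 0" by (simp add: p3_def z)
    then show "p1 k = k" "p2 k = 0" using \<beta>(3)[OF that] 0 by (simp_all add: p1_def p2_def z)
  qed
  have K2p: "p1 k = 0" "p2 k = k" "p3 k = 0" if "k \<in> K2" for k
  proof -
    obtain v where v: "v \<in> D\<^sub>2 p" "k = ?t v" using \<open>k \<in> K2\<close> unfolding K2_def by blast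
    have 0: "?dL k = 0" "?du2 k = 0" unfolding v(2) zL z2 using v(1) D2_Ver by auto
    then show "p3 k = 0" by (simp add: p3_def z)
    then show "p2 k = k" "p1 k = 0" using \<alpha>(3)[OF that] 0 by (simp_all add: p1_def p2_def z)
  qed
  have \<gamma>p: "p1 (\<gamma> w) = 0" "p2 (\<gamma> w) = 0" "p3 (\<gamma> w) = \<gamma> w" for w
    by (simp_all add: p1_def p2_def p3_def \<gamma>(2) z)
  have rp1: "p1 v \<in> K1" and rp2: "p2 v \<in> K2" for v using \<alpha>(1) \<beta>(1) by (auto simp: p1_def p2_def)
  have r1: "range p1 = K1" using rp1 K1p(1) by (metis image_subset_iff rangeI subsetI subset_antisym)
  have r2: "range p2 = K2" using rp2 K2p(2) by (metis image_subset_iff rangeI subsetI subset_antisym)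
  have sum: "p1 v + p2 v + p3 v = v" for v
  proof -
    have "?dL (v - p3 v) = 0" by (simp add: linear_diff[OF lin(3)] p3_def \<gamma>(2))
    then obtain a b where ab: "v - p3 v = ?t a + ?t b" "a \<in> D\<^sub>1 p" "b \<in> D\<^sub>2 p"
      using zL[of "from_chart A ?c0 p (v - p3 v)"] to_from_chart[OF A c0] linear_add[OF lt] unfolding Ver_sum
      by (auto, metis)
    have k: "?t a \<in> K1" "?t b \<in> K2" using ab by (auto simp: K1_def K2_def)
    have "v = ?t a + ?t b + p3 v" using ab(1) by (simp add: algebra_simps)
    then have "p1 v = p1 (?t a + ?t b + p3 v)" "p2 v = p2 (?t a + ?t b + p3 v)" by simp_all
    then have "p1 v = ?t a" "p2 v = ?t b"
      using K1p[OF k(1)] K2p[OF k(2)] \<gamma>p by (simp_all add: linear_add[OF lp1] linear_add[OF lp2] p3_def[of v])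
    then show ?thesis using ab(1) by (simp add: algebra_simps)
  qed
  \<comment> \<open>The first integrals have values in the whole model space; \<open>\<beta>\<close>
    and \<open>\<alpha>\<close> cut them down to \<open>K1\<close> and \<open>K2\<close>, which
    leaves the right number of coordinates for a local diffeomorphism.\<close>
  define \<Psi> where "\<Psi> x = \<beta> (u2 x - u2 x0) + \<alpha> (u1 x - u1 x0) + \<gamma> (L x - L x0)" for x
  note bl = \<alpha>(2)[unfolded linear_conv_bounded_linear] \<beta>(2)[unfolded linear_conv_bounded_linear] \<gamma>(1)[unfolded linear_conv_bounded_linear]
  have s\<Psi>: "smooth_on U \<Psi>" unfolding \<Psi>_def[abs_def]
    by (intro smooth_on_add[OF U] smooth_on_linear[OF U bl(1)] smooth_on_linear[OF U bl(2)] smooth_on_linear[OF U bl(3)]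
        smooth_on_diff[OF U] smooth_on_const s)
  have D\<Psi>: "frechet_derivative \<Psi> (at x) v = \<beta> (frechet_derivative u2 (at x) v) + \<alpha> (frechet_derivative u1 (at x) v) + \<gamma> (frechet_derivative L (at x) v)"
    if "x \<in> U" for x v
  proof -
    note dr = smooth_on_has_derivative[OF s(1) that] smooth_on_has_derivative[OF s(2) that] smooth_on_has_derivative[OF s(3) that]
    have "(\<Psi> has_derivative (\<lambda>v. \<beta> (frechet_derivative u2 (at x) v - 0) + \<alpha> (frechet_derivative u1 (at x) v - 0) + \<gamma> (frechet_derivative L (at x) v - 0))) (at x)"
      unfolding \<Psi>_def[abs_def]
      by (intro has_derivative_add bounded_linear.has_derivative[OF bl(1)] bounded_linear.has_derivative[OF bl(2)]
          bounded_linear.has_derivative[OF bl(3)] has_derivative_diff dr has_derivative_const)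
    then show ?thesis by (simp add: frechet_derivative_eq)
  qed
  have parts: "p1 (\<beta> a + \<alpha> b + \<gamma> w) = \<beta> a" "p2 (\<beta> a + \<alpha> b + \<gamma> w) = \<alpha> b" "p3 (\<beta> a + \<alpha> b + \<gamma> w) = \<gamma> w" for a b w
  proof -
    have k: "\<beta> a \<in> K1" "\<alpha> b \<in> K2" using \<alpha>(1) \<beta>(1) by auto
    show "p1 (\<beta> a + \<alpha> b + \<gamma> w) = \<beta> a" "p2 (\<beta> a + \<alpha> b + \<gamma> w) = \<alpha> b" "p3 (\<beta> a + \<alpha> b + \<gamma> w) = \<gamma> w"
      by (simp_all add: linear_add[OF lp1] linear_add[OF lp2] linear_add[OF lp3] K1p[OF k(1)] K2p[OF k(2)] \<gamma>p)
  qed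
  have inj: "v = 0" if v: "frechet_derivative \<Psi> (at x0) v = 0" for v
  proof -
    have "\<beta> (?du2 v) = 0" "\<alpha> (?du1 v) = 0" "\<gamma> (?dL v) = 0"
      using parts[of "?du2 v" "?du1 v" "?dL v"] v linear_0[OF lp1] linear_0[OF lp2] linear_0[OF lp3] unfolding D\<Psi>[OF x0] by auto
    then have "p3 v = 0" "p1 v = 0" "p2 v = 0" by (simp_all add: p1_def p2_def p3_def)
    then show ?thesis using sum[of v] by simp
  qed
  obtain U' V' h where UV: "open U'" "U' \<subseteq> U" "x0 \<in> U'" "open V'" "homeomorphism U' V' \<Psi> h" "smooth_on V' h"
    using smooth_inverse_function[OF s\<Psi> U x0 inj] by metis
  have \<Psi>0: "\<Psi> x0 = 0" by (simp add: \<Psi>_def z)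
  have "0 \<in> V'" using homeomorphism_image1[OF UV(5)] imageI[OF UV(3), of \<Psi>] \<Psi>0 by simp
  then obtain r where r: "r > 0" "ball 0 r \<subseteq> V'" using UV(4) open_contains_ball by metis
  \<comment> \<open>A vector is the sum of its three components, so a box of this size lies in the
    ball of radius \<open>r\<close>.\<close>
  define \<epsilon> where "\<epsilon> = r / 3"
  have eps: "\<epsilon> > 0" using r by (simp add: \<epsilon>_def)
  define Q where "Q = {z. norm (p1 z) < \<epsilon> \<and> norm (p2 z) < \<epsilon> \<and> norm (p3 z) < \<epsilon>}"
  have QV: "Q \<subseteq> V'"
  proof
    fix y assume y: "y \<in> Q"
    have "norm y \<le> norm (p1 y) + norm (p2 y) + norm (p3 y)"
      using norm_triangle_ineq[of "p1 y + p2 y" "p3 y"] norm_triangle_ineq[of "p1 y" "p2 y"] sum[of y] by simp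
    also have "\<dots> < r" using y by (simp add: Q_def \<epsilon>_def)
    finally show "y \<in> V'" using r(2) by auto
  qed
  have cont: "continuous_on UNIV p1" "continuous_on UNIV p2" "continuous_on UNIV p3"
    using lp1 lp2 lp3 by (simp_all add: linear_continuous_on linear_conv_bounded_linear)
  have Q: "open Q" unfolding Q_def
    by (intro open_Collect_conj open_Collect_less continuous_on_norm cont continuous_on_const)
  define U'' where "U'' = U' \<inter> \<Psi> -` Q"
  have U'': "open U''" unfolding U''_def
    by (rule continuous_open_preimage[OF homeomorphism_cont1[OF UV(5)] UV(1) Q])
  have hom: "homeomorphism U'' Q \<Psi> h"
  proof (rule homeomorphismI)
    show "continuous_on U'' \<Psi>" by (rule continuous_on_subset[OF homeomorphism_cont1[OF UV(5)]]) (auto simp: U''_def)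
    show "continuous_on Q h" by (rule continuous_on_subset[OF homeomorphism_cont2[OF UV(5)] QV])
    show "h ` Q \<subseteq> U''"
      using QV homeomorphism_image2[OF UV(5)] homeomorphism_apply2[OF UV(5)] by (auto simp: U''_def subset_eq)
    show "h (\<Psi> x) = x" if "x \<in> U''" for x using that homeomorphism_apply1[OF UV(5)] by (auto simp: U''_def)
    show "\<Psi> (h y) = y" if "y \<in> Q" for y using that QV homeomorphism_apply2[OF UV(5)] by blast
  qed (auto simp: U''_def)
  have U''U: "U'' \<subseteq> U" using UV(2) by (auto simp: U''_def)
  define c where "c = (cdom ?c0 \<inter> cmap ?c0 -` U'', \<lambda>q. \<Psi> (cmap ?c0 q))"
  note rep = compatible_reparam[OF A c0(1) U'' subset_trans[OF U''U sub] Q hom smooth_on_mono[OF s\<Psi> U''U] smooth_on_mono[OF UV(6) QV], folded c_def]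
  have cd: "cdom c = cdom ?c0 \<inter> cmap ?c0 -` U''" and cm: "cmap c q = \<Psi> (cmap ?c0 q)" for q by (simp_all add: c_def)
  have x0'': "x0 \<in> U''" using UV(3) eps by (simp add: U''_def \<Psi>0 Q_def linear_0[OF lp1] linear_0[OF lp2] linear_0[OF lp3])
  have pc: "p \<in> cdom c" "cmap c p = 0" using c0(2) x0'' \<Psi>0 by (simp_all add: cd cm x0_def)
  have qU: "q \<in> cdom ?c0" "cmap ?c0 q \<in> U''" "cmap ?c0 q \<in> U" if "q \<in> cdom c" for q using that U''U by (auto simp: cd)
  have tc: "to_chart A c q v = frechet_derivative \<Psi> (at (cmap ?c0 q)) (to_chart A ?c0 q v)" if q: "q \<in> cdom c" for q v
  proof -
    have "frechet_derivative (\<lambda>x. cmap c (cinv ?c0 x)) (at (cmap ?c0 q)) = frechet_derivative \<Psi> (at (cmap ?c0 q))"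
      by (rule frechet_derivative_cong[OF U'' qU(2)[OF q]]) (use U''U sub in \<open>auto simp: cm cmap_cinv subset_eq\<close>)
    then show ?thesis using to_chart_change[OF A c0(1) qU(1)[OF q] rep(1) q, of v] by simp
  qed
  have linq: "linear (to_chart A c q)" "inj (to_chart A c q)" if "q \<in> cdom c" for q
    using to_chart_linear[OF A rep(1) that] to_chart_bij[OF A rep(1) that] by (auto simp: bij_is_inj)
  have dimq: "dim (to_chart A c q ` S) = dim S" if "q \<in> cdom c" for q S
    by (rule dim_image_eq[OF linq(1)[OF that] inj_on_subset[OF linq(2)[OF that] subset_UNIV]])
  have dimp: "dim (?t ` S) = dim S" for S
    by (rule dim_image_eq[OF lt inj_on_subset[OF bij_is_inj[OF to_chart_bij[OF A c0]] subset_UNIV]])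
  have T1: "to_chart A c q ` D\<^sub>1 q = range p1" if q: "q \<in> cdom c" for q
    unfolding r1
  proof (rule subspace_dim_equal)
    have k: "\<And>v. v \<in> D\<^sub>1 q \<Longrightarrow> frechet_derivative u1 (at (cmap ?c0 q)) (to_chart A ?c0 q v) = 0" "dim (D\<^sub>1 q) = dim (D\<^sub>1 p)"
      using k1[OF qU(1)[OF q]] qU(3)[OF q] by (auto simp: U_def)
    show "subspace (to_chart A c q ` D\<^sub>1 q)" by (rule linear_subspace_image[OF linq(1)[OF q] D1_subspace])
    show "to_chart A c q ` D\<^sub>1 q \<subseteq> K1"
    proof
      fix w assume "w \<in> to_chart A c q ` D\<^sub>1 q"
      then obtain v where v: "v \<in> D\<^sub>1 q" "w = to_chart A c q v" by blast
      have "frechet_derivative L (at (cmap ?c0 q)) (to_chart A ?c0 q v) = 0"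
        using kL[OF qU(1,3)[OF q]] D1_Ver[OF v(1)] by blast
      \<comment> \<open>On vectors of \<open>D\<^sub>1\<close> the derivatives of \<open>u1\<close>
        and \<open>L\<close> vanish at every point of the chart and not only at \<open>p\<close>, so
        only the \<open>K1\<close> component survives.\<close>
      then have "w = \<beta> (frechet_derivative u2 (at (cmap ?c0 q)) (to_chart A ?c0 q v))"
        unfolding v(2) tc[OF q] D\<Psi>[OF qU(3)[OF q]] k(1)[OF v(1)] by (simp add: z)
      then show "w \<in> K1" using \<beta>(1) by auto
    qed
    show "dim K1 \<le> dim (to_chart A c q ` D\<^sub>1 q)" unfolding dimq[OF q] K1_def dimp using k(2) by simp
  qed (rule sK)
  have T2: "to_chart A c q ` D\<^sub>2 q = range p2" if q: "q \<in> cdom c" for q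
    unfolding r2
  proof (rule subspace_dim_equal)
    have k: "\<And>v. v \<in> D\<^sub>2 q \<Longrightarrow> frechet_derivative u2 (at (cmap ?c0 q)) (to_chart A ?c0 q v) = 0" "dim (D\<^sub>2 q) = dim (D\<^sub>2 p)"
      using k2[OF qU(1)[OF q]] qU(3)[OF q] by (auto simp: U_def)
    show "subspace (to_chart A c q ` D\<^sub>2 q)" by (rule linear_subspace_image[OF linq(1)[OF q] D2_subspace])
    show "to_chart A c q ` D\<^sub>2 q \<subseteq> K2"
    proof
      fix w assume "w \<in> to_chart A c q ` D\<^sub>2 q"
      then obtain v where v: "v \<in> D\<^sub>2 q" "w = to_chart A c q v" by blast
      have "frechet_derivative L (at (cmap ?c0 q)) (to_chart A ?c0 q v) = 0"
        using kL[OF qU(1,3)[OF q]] D2_Ver[OF v(1)] by blast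
      then have "w = \<alpha> (frechet_derivative u1 (at (cmap ?c0 q)) (to_chart A ?c0 q v))"
        unfolding v(2) tc[OF q] D\<Psi>[OF qU(3)[OF q]] k(1)[OF v(1)] by (simp add: z)
      then show "w \<in> K2" using \<alpha>(1) by auto
    qed
    show "dim K2 \<le> dim (to_chart A c q ` D\<^sub>2 q)" unfolding dimq[OF q] K2_def dimp using k(2) by simp
  qed (rule sK)
  have fibre: "\<pi> q = \<pi> p \<longleftrightarrow> p3 (cmap c q) = 0" if q: "q \<in> cdom c" for q
  proof -
    let ?x = "cmap ?c0 q"
    have "p3 (cmap c q) = \<gamma> (L ?x - L x0)" unfolding cm \<Psi>_def by (rule parts(3))
    \<comment> \<open>A right inverse is injective, so the third coordinate determines the base
      point.\<close>
    moreover have "\<gamma> w = 0 \<longleftrightarrow> w = 0" for w using \<gamma>(2)[of w] z by metis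
    ultimately have "p3 (cmap c q) = 0 \<longleftrightarrow> cmap d (\<pi> q) = cmap d (\<pi> p)"
      by (simp add: L_def x0_def cinv_cmap[OF c0] cinv_cmap[OF c0(1) qU(1)[OF q]])
    then show ?thesis using compatible_inj[OF dd] piU[OF qU(1,3)[OF q]] d(2) by (auto simp: inj_on_def)
  qed
  show ?thesis
    by (rule that[OF rep(1) pc lp1 lp2 lp3 sum K1p(1)[OF rp1] K1p(2)[OF rp1] K2p(1)[OF rp2] K2p(2)[OF rp2]
        K1p(3)[OF rp1] K2p(3)[OF rp2] eps rep(2)[unfolded Q_def] T1 T2 fibre])
qed

text \<open>In an adapted chart the fibre through \<open>p\<close> is a product of two coordinate
  slices, and \<open>F\<close> adds their components. The variation formula shows that the metric
  components along one slice do not change along the other, so at any point of the fibre they equal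
  those on the slices through \<open>p\<close>.\<close>

lemma parallel_imp_product:
  assumes par1: "parallel D\<^sub>1 D\<^sub>2" and par2: "parallel D\<^sub>2 D\<^sub>1"
  shows "local_riemannian_product_at A g D\<^sub>1 D\<^sub>2 (\<pi> -` {\<pi> p}) p"
proof (rule adapted_chart[OF par1 par2, of p])
  fix c and p1 p2 p3 :: "'e \<Rightarrow> 'e" and \<epsilon> :: real
  assume c: "compatible A c" "p \<in> cdom c" and p0: "cmap c p = 0" and lp: "linear p1" "linear p2" "linear p3"
    and sum: "\<And>z. p1 z + p2 z + p3 z = z"
    and pp: "\<And>z. p1 (p1 z) = p1 z" "\<And>z. p2 (p1 z) = 0" "\<And>z. p1 (p2 z) = 0" "\<And>z. p2 (p2 z) = p2 z"
    "\<And>z. p3 (p1 z) = 0" "\<And>z. p3 (p2 z) = 0"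
    and eps: "0 < \<epsilon>" and img: "cmap c ` cdom c = {z. norm (p1 z) < \<epsilon> \<and> norm (p2 z) < \<epsilon> \<and> norm (p3 z) < \<epsilon>}"
    and T1: "\<And>q. q \<in> cdom c \<Longrightarrow> to_chart A c q ` D\<^sub>1 q = range p1"
    and T2: "\<And>q. q \<in> cdom c \<Longrightarrow> to_chart A c q ` D\<^sub>2 q = range p2"
    and fibre: "\<And>q. q \<in> cdom c \<Longrightarrow> \<pi> q = \<pi> p \<longleftrightarrow> p3 (cmap c q) = 0"
  let ?Q = "cmap c ` cdom c"
  note Q = compatible_open(2)[OF c(1)] and od = compatible_open(1)[OF c(1)]
  note ci = cinv_cmap[OF c(1)]
  have bl: "bounded_linear p1" "bounded_linear p2" using lp by (simp_all add: linear_conv_bounded_linear)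
  have pz: "p1 0 = 0" "p2 0 = 0" "p3 0 = 0" using lp linear_0 by blast+
  \<comment> \<open>This is what the box shape is for: the components are bounded separately and can
    be recombined.\<close>
  have mix: "p1 z + p2 z' \<in> ?Q" if "z \<in> ?Q" "z' \<in> ?Q" for z z'
    using that eps unfolding img by (simp add: linear_add[OF lp(1)] linear_add[OF lp(2)] linear_add[OF lp(3)] pp)
  have p1Q: "p1 z \<in> ?Q" and p2Q: "p2 z \<in> ?Q" if "z \<in> ?Q" for z
    using that eps unfolding img by (simp_all add: pp)
  have mem1: "v \<in> D\<^sub>1 q \<longleftrightarrow> p1 (to_chart A c q v) = to_chart A c q v" if "q \<in> cdom c" for q v
  proof -
    have "v \<in> D\<^sub>1 q \<longleftrightarrow> to_chart A c q v \<in> range p1"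
      unfolding T1[OF that, symmetric] using bij_is_inj[OF to_chart_bij[OF A c(1) that]] by (auto simp: inj_def)
    also have "\<dots> \<longleftrightarrow> p1 (to_chart A c q v) = to_chart A c q v" using pp(1) by (auto intro: range_eqI[OF sym])
    finally show ?thesis .
  qed
  have mem2: "v \<in> D\<^sub>2 q \<longleftrightarrow> p2 (to_chart A c q v) = to_chart A c q v" if "q \<in> cdom c" for q v
  proof -
    have "v \<in> D\<^sub>2 q \<longleftrightarrow> to_chart A c q v \<in> range p2"
      unfolding T2[OF that, symmetric] using bij_is_inj[OF to_chart_bij[OF A c(1) that]] by (auto simp: inj_def)
    also have "\<dots> \<longleftrightarrow> p2 (to_chart A c q v) = to_chart A c q v" using pp(4) by (auto intro: range_eqI[OF sym])
    finally show ?thesis .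
  qed
  let ?G = "metric_rep c"
  have Gq: "?G (cmap c q) (to_chart A c q u) (to_chart A c q v) = g q u v" if "q \<in> cdom c" for q u v
    by (rule metric_rep_cmap[OF c(1) that])
  have orth: "?G z (p1 a) (p2 b) = 0" "?G z (p2 b) (p1 a) = 0" if z: "z \<in> ?Q" for z a b
  proof -
    obtain q where q: "q \<in> cdom c" "z = cmap c q" using z by blast
    have "p1 a \<in> to_chart A c q ` D\<^sub>1 q" "p2 b \<in> to_chart A c q ` D\<^sub>2 q" unfolding T1[OF q(1)] T2[OF q(1)] by blast+
    then show "?G z (p1 a) (p2 b) = 0" "?G z (p2 b) (p1 a) = 0"
      using Gq[OF q(1)] D_orth[of _ q] unfolding q(2) by (auto simp: g_sym)
  qed
  have vf_const: "vf (cdom c) (\<lambda>q. from_chart A c q v)" for v by (rule vf_from_chart_const[OF c(1)])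
  have sec1: "section_on A D\<^sub>1 (cdom c) (\<lambda>q. from_chart A c q (p1 v))"
    and sec2: "section_on A D\<^sub>2 (cdom c) (\<lambda>q. from_chart A c q (p2 v))" for v
    using vf_const mem1 mem2 to_from_chart[OF A c(1)] by (auto simp: section_on_def pp)
  have dG: "((\<lambda>z. ?G z a b) has_derivative frechet_derivative (\<lambda>z. ?G z a b) (at z)) (at z)" if "z \<in> ?Q" for z a b
    by (rule smooth_on_has_derivative[OF _ that])
      (intro smooth_on_linear[OF Q blinfun.bounded_linear_left] smooth_metric_rep[OF c(1)])
  have idD: "frechet_derivative (\<lambda>z::'e. z) (at z) v = v" for z v by (simp add: frechet_derivative_eq[OF has_derivative_ident])
  \<comment> \<open>\<open>metric_variation\<close> with the identity for \<open>H\<close> and the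
    whole space for \<open>T\<close>; the orthogonality relations hold throughout the box, since
    there the coordinate planes are the values of the distributions.\<close>
  have var1: "frechet_derivative (\<lambda>z. ?G z (p1 u) (p1 v)) (at z) (p2 w) = 0" if z: "z \<in> ?Q" for z u v w
  proof -
    let ?q = "cinv c z"
    have q: "?q \<in> cdom c" "cmap c ?q = z" using z ci by auto
    note mv = metric_variation[OF od q(1) vf_const[of "p1 u"] vf_const[of "p1 v"] vf_const[of "p2 w"] c(1) q(1) Q z
        smooth_on_ident[OF Q] q(2)[symmetric] subspace_UNIV UNIV_I UNIV_I, of "p1 u" "p1 v" "p2 w", unfolded idD]
    have "frechet_derivative (\<lambda>z. ?G z (p1 u) (p1 v)) (at z) (p2 w) =
        - 2 * g ?q (nabla (\<lambda>q. from_chart A c q (p1 u)) (\<lambda>q. from_chart A c q (p1 v)) ?q) (from_chart A c ?q (p2 w))"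
      using q orth by (intro mv(2)) (auto simp: to_from_chart[OF A c(1)] field_rep_eq ci)
    then show ?thesis using parallelD[OF par1 od q(1) sec1 sec1 sec2] by simp
  qed
  have var2: "frechet_derivative (\<lambda>z. ?G z (p2 u) (p2 v)) (at z) (p1 w) = 0" if z: "z \<in> ?Q" for z u v w
  proof -
    let ?q = "cinv c z"
    have q: "?q \<in> cdom c" "cmap c ?q = z" using z ci by auto
    note mv = metric_variation[OF od q(1) vf_const[of "p2 u"] vf_const[of "p2 v"] vf_const[of "p1 w"] c(1) q(1) Q z
        smooth_on_ident[OF Q] q(2)[symmetric] subspace_UNIV UNIV_I UNIV_I, of "p2 u" "p2 v" "p1 w", unfolded idD]
    have "frechet_derivative (\<lambda>z. ?G z (p2 u) (p2 v)) (at z) (p1 w) =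
        - 2 * g ?q (nabla (\<lambda>q. from_chart A c q (p2 u)) (\<lambda>q. from_chart A c q (p2 v)) ?q) (from_chart A c ?q (p1 w))"
      using q orth by (intro mv(2)) (auto simp: to_from_chart[OF A c(1)] field_rep_eq ci)
    then show ?thesis using parallelD[OF par2 od q(1) sec2 sec2 sec1] by simp
  qed
  have shrink: "norm (s *\<^sub>R v) < \<epsilon>" if "s \<in> {0..1}" "norm v < \<epsilon>" for s and v :: 'e
    using that mult_left_le_one_le[of "norm v" s] by auto
  \<comment> \<open>The vanishing derivative is integrated along a segment in the direction of the
    second factor, which stays in the box.\<close>
  have const1: "?G (p1 z + p2 z') (p1 u) (p1 v) = ?G (p1 z) (p1 u) (p1 v)" if z: "z \<in> ?Q" "z' \<in> ?Q" for z z' u v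
  proof (rule constant_along_direction)
    fix s :: real assume s: "s \<in> {0..1}"
    have m: "p1 z + s *\<^sub>R p2 z' \<in> ?Q" using z eps shrink[OF s] unfolding img
      by (simp add: linear_add[OF lp(1)] linear_add[OF lp(2)] linear_add[OF lp(3)]
          linear_scale[OF lp(1)] linear_scale[OF lp(2)] linear_scale[OF lp(3)] pp)
    show "((\<lambda>z. ?G z (p1 u) (p1 v)) has_derivative frechet_derivative (\<lambda>z. ?G z (p1 u) (p1 v)) (at (p1 z + s *\<^sub>R p2 z'))) (at (p1 z + s *\<^sub>R p2 z'))"
      by (rule dG[OF m])
    show "frechet_derivative (\<lambda>z. ?G z (p1 u) (p1 v)) (at (p1 z + s *\<^sub>R p2 z')) (p2 z') = 0" by (rule var1[OF m])
  qed
  have const2: "?G (p1 z + p2 z') (p2 u) (p2 v) = ?G (p2 z') (p2 u) (p2 v)" if z: "z \<in> ?Q" "z' \<in> ?Q" for z z' u v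
    unfolding add.commute[of "p1 z"]
  proof (rule constant_along_direction)
    fix s :: real assume s: "s \<in> {0..1}"
    have m: "p2 z' + s *\<^sub>R p1 z \<in> ?Q" using z eps shrink[OF s] unfolding img
      by (simp add: linear_add[OF lp(1)] linear_add[OF lp(2)] linear_add[OF lp(3)]
          linear_scale[OF lp(1)] linear_scale[OF lp(2)] linear_scale[OF lp(3)] pp)
    show "((\<lambda>z. ?G z (p2 u) (p2 v)) has_derivative frechet_derivative (\<lambda>z. ?G z (p2 u) (p2 v)) (at (p2 z' + s *\<^sub>R p1 z))) (at (p2 z' + s *\<^sub>R p1 z))"
      by (rule dG[OF m])
    show "frechet_derivative (\<lambda>z. ?G z (p2 u) (p2 v)) (at (p2 z' + s *\<^sub>R p1 z)) (p1 z) = 0" by (rule var2[OF m])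
  qed
  define L1 where "L1 = {q \<in> cdom c. p1 (cmap c q) = cmap c q}"
  define L2 where "L2 = {q \<in> cdom c. p2 (cmap c q) = cmap c q}"
  define W where "W = cdom c \<inter> \<pi> -` {\<pi> p}"
  define F where "F = (\<lambda>(x, y). cinv c (p1 (cmap c x) + p2 (cmap c y)))"
  \<comment> \<open>The two coordinate projections. On the fibre they invert \<open>F\<close>, and
    being smooth on the whole chart domain they provide the required extension of the
    inverse.\<close>
  define \<Gamma> where "\<Gamma> q = (cinv c (p1 (cmap c q)), cinv c (p2 (cmap c q)))" for q
  have cF: "F (x, y) \<in> cdom c" "cmap c (F (x, y)) = p1 (cmap c x) + p2 (cmap c y)" if "x \<in> cdom c" "y \<in> cdom c" for x y
    using mix[OF imageI[OF that(1), of "cmap c"] imageI[OF that(2), of "cmap c"]] by (simp_all add: F_def cmap_cinv cinv_in)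
  have c\<Gamma>: "cinv c (p1 (cmap c q)) \<in> cdom c" "cinv c (p2 (cmap c q)) \<in> cdom c"
    "cmap c (cinv c (p1 (cmap c q))) = p1 (cmap c q)" "cmap c (cinv c (p2 (cmap c q))) = p2 (cmap c q)" if "q \<in> cdom c" for q
    using p1Q[OF imageI[OF that]] p2Q[OF imageI[OF that]] by (simp_all add: cmap_cinv cinv_in)
  have L1c: "x \<in> cdom c" "p1 (cmap c x) = cmap c x" "p2 (cmap c x) = 0" "p3 (cmap c x) = 0" if "x \<in> L1" for x
    using that pp(2)[of "cmap c x"] pp(5)[of "cmap c x"] by (auto simp: L1_def)
  have L2c: "x \<in> cdom c" "p2 (cmap c x) = cmap c x" "p1 (cmap c x) = 0" "p3 (cmap c x) = 0" if "x \<in> L2" for x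
    using that pp(3)[of "cmap c x"] pp(6)[of "cmap c x"] by (auto simp: L2_def)
  have pL: "p \<in> L1" "p \<in> L2" using c(2) pz by (simp_all add: L1_def L2_def p0)
  have inv1: "\<Gamma> (F z) = z" if zL: "z \<in> L1 \<times> L2" for z
  proof -
    obtain x y where z: "z = (x, y)" "x \<in> L1" "y \<in> L2" using zL by (cases z) auto
    note x = L1c[OF z(2)] and y = L2c[OF z(3)]
    have e: "cmap c (F (x, y)) = cmap c x + cmap c y" using cF(2)[OF x(1) y(1)] x(2) y(2) by simp
    have "p1 (cmap c x + cmap c y) = cmap c x" "p2 (cmap c x + cmap c y) = cmap c y"
      by (simp_all add: linear_add[OF lp(1)] linear_add[OF lp(2)] x y)
    then show ?thesis unfolding z(1) \<Gamma>_def e by (simp add: ci x(1) y(1))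
  qed
  have inv2: "F (\<Gamma> q) = q" if "q \<in> W" for q
  proof -
    have q: "q \<in> cdom c" "p3 (cmap c q) = 0" using that fibre by (auto simp: W_def)
    then show ?thesis using sum[of "cmap c q"] by (simp add: F_def \<Gamma>_def c\<Gamma>[OF q(1)] pp ci)
  qed
  have F_W: "F ` (L1 \<times> L2) \<subseteq> W"
  proof
    fix q assume "q \<in> F ` (L1 \<times> L2)"
    then obtain x y where z: "q = F (x, y)" "x \<in> L1" "y \<in> L2" by blast
    note x = L1c[OF z(2)] and y = L2c[OF z(3)]
    have "p3 (cmap c (F (x, y))) = 0" unfolding cF(2)[OF x(1) y(1)] by (simp add: linear_add[OF lp(3)] pp)
    then show "q \<in> W" using cF(1)[OF x(1) y(1)] fibre by (simp add: W_def z)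
  qed
  have \<Gamma>_L: "\<Gamma> ` W \<subseteq> L1 \<times> L2"
    using c\<Gamma> by (auto simp: \<Gamma>_def W_def L1_def L2_def pp)
  have bij: "bij_betw F (L1 \<times> L2) W"
    by (rule bij_betw_byWitness[of _ \<Gamma>]) (use inv1 inv2 F_W \<Gamma>_L in auto)
  have r1: "w \<in> range p1 \<longleftrightarrow> p1 w = w" and r2: "w \<in> range p2 \<longleftrightarrow> p2 w = w" for w
    using pp(1,4) by (auto intro: range_eqI[OF sym])
  have im1: "integral_manifold A D\<^sub>1 L1"
    unfolding integral_manifold_def
  proof
    fix q assume q: "q \<in> L1"
    show "\<exists>c S. q \<in> cdom c \<and> smooth_atlas (insert c A) \<and> subspace S \<and> cmap c ` (cdom c \<inter> L1) = cmap c ` cdom c \<inter> S \<and>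
        (\<forall>q\<in>cdom c \<inter> L1. to_chart A c q ` D\<^sub>1 q = S)"
    proof (intro exI[of _ c] exI[of _ "range p1"] conjI)
      show "q \<in> cdom c" using q by (simp add: L1_def)
      show "smooth_atlas (insert c A)" using c(1) by (simp add: compatible_def)
      show "subspace (range p1)" using linear_subspace_image[OF lp(1) subspace_UNIV] .
      show "cmap c ` (cdom c \<inter> L1) = cmap c ` cdom c \<inter> range p1"
        unfolding set_eq_iff Int_iff r1 by (auto simp: L1_def)
    qed (use T1 in blast)
  qed
  have im2: "integral_manifold A D\<^sub>2 L2"
    unfolding integral_manifold_def
  proof
    fix q assume q: "q \<in> L2"
    show "\<exists>c S. q \<in> cdom c \<and> smooth_atlas (insert c A) \<and> subspace S \<and> cmap c ` (cdom c \<inter> L2) = cmap c ` cdom c \<inter> S \<and>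
        (\<forall>q\<in>cdom c \<inter> L2. to_chart A c q ` D\<^sub>2 q = S)"
    proof (intro exI[of _ c] exI[of _ "range p2"] conjI)
      show "q \<in> cdom c" using q by (simp add: L2_def)
      show "smooth_atlas (insert c A)" using c(1) by (simp add: compatible_def)
      show "subspace (range p2)" using linear_subspace_image[OF lp(2) subspace_UNIV] .
      show "cmap c ` (cdom c \<inter> L2) = cmap c ` cdom c \<inter> range p2"
        unfolding set_eq_iff Int_iff r2 by (auto simp: L2_def)
    qed (use T2 in blast)
  qed
  note AA = smooth_atlas_prod[OF A A] and cc = compatible_prod[OF A A c(1) c(1)]
  have ocd: "open (cdom c \<times> cdom c)" by (rule open_Times[OF od od])
  have oQQ: "open (?Q \<times> ?Q)" by (rule open_Times[OF Q Q])
  have cip: "cinv (prod_chart c c) (cmap c x, cmap c y) = (x, y)" if "x \<in> cdom c" "y \<in> cdom c" for x y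
    unfolding cinv_prod_chart[OF c(1) c(1) imageI[of _ _ "cmap c", OF that(1)] imageI[of _ _ "cmap c", OF that(2)]]
    using ci that by simp
  have sF: "smooth_map_on (prod_atlas A A) A (cdom c \<times> cdom c) F"
  proof (rule smooth_map_onI[OF AA A])
    fix w assume w: "w \<in> cdom c \<times> cdom c"
    have "smooth_on (?Q \<times> ?Q) (\<lambda>z. p1 (fst z) + p2 (snd z))"
      by (intro smooth_on_add[OF oQQ] smooth_on_linear[OF oQQ bl(1)] smooth_on_linear[OF oQQ bl(2)]
          smooth_on_linear[OF oQQ bounded_linear_fst] smooth_on_linear[OF oQQ bounded_linear_snd] smooth_on_ident[OF oQQ])
    then have "smooth_on (?Q \<times> ?Q) (\<lambda>z. cmap c (F (cinv (prod_chart c c) z)))"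
    proof (rule smooth_on_cong[OF oQQ, rotated])
      fix z assume "z \<in> ?Q \<times> ?Q"
      then obtain x y where z: "x \<in> cdom c" "y \<in> cdom c" "z = (cmap c x, cmap c y)" by auto
      show "p1 (fst z) + p2 (snd z) = cmap c (F (cinv (prod_chart c c) z))"
        unfolding z(3) cip[OF z(1,2)] cF(2)[OF z(1,2)] by simp
    qed
    then show "\<exists>k d V. compatible (prod_atlas A A) k \<and> compatible A d \<and> open V \<and> w \<in> V \<and> V \<subseteq> cdom c \<times> cdom c \<inter> cdom k \<and>
        F ` V \<subseteq> cdom d \<and> smooth_on (cmap k ` V) (\<lambda>x. cmap d (F (cinv k x)))"
      using cc c(1) ocd w cF(1)
      by (intro exI[of _ "prod_chart c c"] exI[of _ c] exI[of _ "cdom c \<times> cdom c"]) (auto simp: prod_chart_image)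
  qed
  have s\<Gamma>: "smooth_map_on A (prod_atlas A A) (cdom c) \<Gamma>"
  proof (rule smooth_map_onI[OF A AA])
    fix w assume w: "w \<in> cdom c"
    have "smooth_on ?Q (\<lambda>z. (p1 z, p2 z))"
      by (intro smooth_on_Pair[OF Q] smooth_on_linear[OF Q bl(1)] smooth_on_linear[OF Q bl(2)] smooth_on_ident[OF Q])
    then have "smooth_on ?Q (\<lambda>z. cmap (prod_chart c c) (\<Gamma> (cinv c z)))"
      by (rule smooth_on_cong[OF Q, rotated]) (auto simp: \<Gamma>_def c\<Gamma> ci)
    then show "\<exists>k d V. compatible A k \<and> compatible (prod_atlas A A) d \<and> open V \<and> w \<in> V \<and> V \<subseteq> cdom c \<inter> cdom k \<and>
        \<Gamma> ` V \<subseteq> cdom d \<and> smooth_on (cmap k ` V) (\<lambda>x. cmap d (\<Gamma> (cinv k x)))"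
      using cc c(1) od w c\<Gamma>
      by (intro exI[of _ c] exI[of _ "prod_chart c c"] exI[of _ "cdom c"]) (auto simp: \<Gamma>_def)
  qed
  show ?thesis
    unfolding local_riemannian_product_at_def
  proof (rule exI[of _ W], rule exI[of _ L1], rule exI[of _ L2], rule exI[of _ F], intro conjI ballI)
    show "openin (top_of_set (\<pi> -` {\<pi> p})) W" unfolding W_def Int_commute[of "cdom c"] by (rule openin_open_Int[OF od])
    show "integral_manifold A D\<^sub>1 L1" "integral_manifold A D\<^sub>2 L2" "p \<in> L1" "p \<in> L2" "bij_betw F (L1 \<times> L2) W"
      by (fact im1 im2 pL bij)+
    show "F (x, p) = x" if "x \<in> L1" for x using L1c[OF that] by (simp add: F_def p0 pz ci)
    show "F (p, y) = y" if "y \<in> L2" for y using L2c[OF that] by (simp add: F_def p0 pz ci)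
    show "\<exists>G. smooth_extension_at A (prod_atlas A A) W (inv_into (L1 \<times> L2) F) w G" if "w \<in> W" for w
      unfolding smooth_extension_at_def
    proof (intro exI[of _ \<Gamma>] exI[of _ "cdom c"] conjI ballI od s\<Gamma>)
      show "w \<in> cdom c" using that by (simp add: W_def)
      show "\<Gamma> z = inv_into (L1 \<times> L2) F z" if "z \<in> cdom c \<inter> W" for z
      proof -
        have "\<Gamma> z \<in> L1 \<times> L2" "F (\<Gamma> z) = z" using that \<Gamma>_L inv2 by auto
        then show ?thesis using inv_into_f_eq[OF bij_betw_imp_inj_on[OF bij]] by metis
      qed
    qed
    fix x y assume x: "x \<in> L1" and y: "y \<in> L2"
    note xc = L1c[OF x] and yc = L2c[OF y]
    let ?q = "F (x, y)" and ?a = "differential A A (\<lambda>x'. F (x', y)) x" and ?b = "differential A A (\<lambda>y'. F (x, y')) y"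
    have q: "?q \<in> cdom c" "cmap c ?q = p1 (cmap c x) + p2 (cmap c y)" using cF[OF xc(1) yc(1)] by auto
    let ?H = "\<lambda>z. cmap c (F (cinv c (fst z), cinv c (snd z)))" and ?z = "(cmap c x, cmap c y)"
    \<comment> \<open>In the chart \<open>F\<close> is linear with components \<open>p1\<close> and
      \<open>p2\<close>. As these fix the components of vectors of \<open>D\<^sub>1\<close> and
      \<open>D\<^sub>2\<close>, both partial differentials act there as the identity on chart
      components.\<close>
    have dH: "frechet_derivative ?H (at ?z) (r, s) = p1 r + p2 s" for r s
    proof -
      have "((\<lambda>z. p1 (fst z) + p2 (snd z)) has_derivative (\<lambda>r. p1 (fst r) + p2 (snd r))) (at ?z)"
        by (intro has_derivative_add bounded_linear.has_derivative[OF bl(1)] bounded_linear.has_derivative[OF bl(2)]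
            bounded_linear_imp_has_derivative bounded_linear_fst bounded_linear_snd)
      then have "(?H has_derivative (\<lambda>r. p1 (fst r) + p2 (snd r))) (at ?z)"
        by (rule has_derivative_transform_within_open[OF _ oQQ]) (use xc yc in \<open>auto simp: cF ci\<close>)
      then show ?thesis by (simp add: frechet_derivative_eq)
    qed
    have xy: "(x, y) \<in> cdom c \<times> cdom c" using xc yc by blast
    note pd = partial_differential[OF A A A c(1) xc(1) c(1) yc(1) c(1) q(1) ocd xy sF, unfolded dH]
    have ta: "to_chart A c ?q (?a u) = to_chart A c x u" if "u \<in> D\<^sub>1 x" for u
      using pd(1)[of u] mem1[OF xc(1)] that pz by simp
    have tb: "to_chart A c ?q (?b v) = to_chart A c y v" if "v \<in> D\<^sub>2 y" for v
      using pd(2)[of v] mem2[OF yc(1)] that pz by simp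
    have a_im: "?a ` D\<^sub>1 x = D\<^sub>1 ?q"
    proof -
      have "to_chart A c ?q ` ?a ` D\<^sub>1 x = to_chart A c ?q ` D\<^sub>1 ?q"
        using image_cong[OF refl, of "D\<^sub>1 x" "\<lambda>u. to_chart A c ?q (?a u)" "to_chart A c x", OF ta] T1[OF q(1)] T1[OF xc(1)]
        by (simp add: image_image)
      then show ?thesis by (simp only: inj_image_eq_iff[OF bij_is_inj[OF to_chart_bij[OF A c(1) q(1)]]])
    qed
    have b_im: "?b ` D\<^sub>2 y = D\<^sub>2 ?q"
    proof -
      have "to_chart A c ?q ` ?b ` D\<^sub>2 y = to_chart A c ?q ` D\<^sub>2 ?q"
        using image_cong[OF refl, of "D\<^sub>2 y" "\<lambda>u. to_chart A c ?q (?b u)" "to_chart A c y", OF tb] T2[OF q(1)] T2[OF yc(1)]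
        by (simp add: image_image)
      then show ?thesis by (simp only: inj_image_eq_iff[OF bij_is_inj[OF to_chart_bij[OF A c(1) q(1)]]])
    qed
    have xQ: "cmap c x \<in> ?Q" "cmap c y \<in> ?Q" using xc(1) yc(1) by auto
    have met: "g ?q (?a u + ?b v) (?a u' + ?b v') = g x u u' + g y v v'"
      if u: "u \<in> D\<^sub>1 x" "u' \<in> D\<^sub>1 x" and v: "v \<in> D\<^sub>2 y" "v' \<in> D\<^sub>2 y" for u u' v v'
    proof -
      have o: "g ?q (?a u) (?b v') = 0" "g ?q (?b v) (?a u') = 0"
        using D_orth[of "?a u" ?q "?b v'"] D_orth[of "?a u'" ?q "?b v"] a_im b_im u v by (auto simp: g_sym[of _ "?b v"])
      have fu: "p1 (to_chart A c x u) = to_chart A c x u" "p1 (to_chart A c x u') = to_chart A c x u'"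
        "p2 (to_chart A c y v) = to_chart A c y v" "p2 (to_chart A c y v') = to_chart A c y v'"
        using mem1[OF xc(1)] mem2[OF yc(1)] u v by blast+
      have "g ?q (?a u) (?a u') = ?G (p1 (cmap c x) + p2 (cmap c y)) (to_chart A c x u) (to_chart A c x u')"
        unfolding Gq[OF q(1), symmetric] ta[OF u(1)] ta[OF u(2)] q(2) ..
      also have "\<dots> = g x u u'"
        using const1[OF xQ, of "to_chart A c x u" "to_chart A c x u'"] unfolding fu xc(2) Gq[OF xc(1)] .
      finally have 1: "g ?q (?a u) (?a u') = g x u u'" .
      have "g ?q (?b v) (?b v') = ?G (p1 (cmap c x) + p2 (cmap c y)) (to_chart A c y v) (to_chart A c y v')"
        unfolding Gq[OF q(1), symmetric] tb[OF v(1)] tb[OF v(2)] q(2) ..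
      also have "\<dots> = g y v v'"
        using const2[OF xQ, of "to_chart A c y v" "to_chart A c y v'"] unfolding fu yc(2) Gq[OF yc(1)] .
      finally have 2: "g ?q (?b v) (?b v') = g y v v'" .
      show ?thesis by (simp add: g_simps o 1 2)
    qed
    show "\<exists>F'. smooth_extension_at (prod_atlas A A) A (L1 \<times> L2) F (x, y) F' \<and>
         (let a = differential A A (\<lambda>x'. F' (x', y)) x; b = differential A A (\<lambda>y'. F' (x, y')) y; q = F (x, y)
          in a ` D\<^sub>1 x = D\<^sub>1 q \<and> b ` D\<^sub>2 y = D\<^sub>2 q \<and>
             (\<forall>u\<in>D\<^sub>1 x. \<forall>u'\<in>D\<^sub>1 x. \<forall>v\<in>D\<^sub>2 y. \<forall>v'\<in>D\<^sub>2 y. g q (a u + b v) (a u' + b v') = g x u u' + g y v v'))"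
    proof (intro exI[of _ F] conjI)
      show "smooth_extension_at (prod_atlas A A) A (L1 \<times> L2) F (x, y) F"
        unfolding smooth_extension_at_def using ocd xy sF by (intro exI[of _ "cdom c \<times> cdom c"]) auto
    qed (simp add: Let_def a_im b_im met)
  qed
qed

end

theorem corollary3p11:
  fixes A :: "('m::{t2_space,second_countable_topology}, 'e::euclidean_space) chart set"
    and B :: "('n::{t2_space,second_countable_topology}, 'f::euclidean_space) chart set"
    and g :: "'m \<Rightarrow> 'e \<Rightarrow> 'e \<Rightarrow> real" and g\<^sub>N :: "'n \<Rightarrow> 'f \<Rightarrow> 'f \<Rightarrow> real"
    and nabla :: "('m \<Rightarrow> 'e) \<Rightarrow> ('m \<Rightarrow> 'e) \<Rightarrow> 'm \<Rightarrow> 'e"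
    and J :: "'m \<Rightarrow> 'e \<Rightarrow> 'e" and \<pi> :: "'m \<Rightarrow> 'n"
    and D\<^sub>1 D\<^sub>2 :: "'m \<Rightarrow> 'e set" and \<theta>\<^sub>1 \<theta>\<^sub>2 :: real
  assumes "smooth_atlas A" and "riemannian_metric A g"
    and "smooth_atlas B" and "riemannian_metric B g\<^sub>N"
    and "levi_civita A g nabla" and "kaehler A g nabla J"
    and "proper_bi_slant_submersion A g J B g\<^sub>N \<pi> D\<^sub>1 \<theta>\<^sub>1 D\<^sub>2 \<theta>\<^sub>2"
    and "locally_spanned_by_basic A g B \<pi> (\<lambda>p. J_hor A g B \<pi> J p ` D\<^sub>1 p)"
    and "locally_spanned_by_basic A g B \<pi> (\<lambda>p. J_hor A g B \<pi> J p ` D\<^sub>2 p)"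
  shows "fibres_locally_riemannian_product A g \<pi> D\<^sub>1 D\<^sub>2 \<longleftrightarrow>
    (let P = (\<lambda>X q. J_ver A g B \<pi> J q (X q));
         F = (\<lambda>X q. J_hor A g B \<pi> J q (X q));
         \<T> = oneill_T A g B \<pi> nabla;
         \<A> = oneill_A A g B \<pi> nabla
     in \<forall>W X Y U V. open W \<and> section_on A D\<^sub>1 W X \<and> section_on A D\<^sub>1 W Y \<and>
          section_on A D\<^sub>2 W U \<and> section_on A D\<^sub>2 W V \<longrightarrow>
        (\<forall>p\<in>W.
          g p (\<T> (P U) (F Y) p - \<T> U (F (P Y)) p + \<A> (F U) (F Y) p) (X p) = 0 \<and>
          g p (\<T> (P X) (F V) p - \<T> X (F (P V)) p + \<A> (F X) (F V) p) (U p) = 0))"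
proof -
  interpret bs: bislant A g nabla B g\<^sub>N J \<pi> D\<^sub>1 D\<^sub>2 \<theta>\<^sub>1 \<theta>\<^sub>2
    by unfold_locales (use assms in auto)
  interpret sw: bislant A g nabla B g\<^sub>N J \<pi> D\<^sub>2 D\<^sub>1 \<theta>\<^sub>2 \<theta>\<^sub>1
    by (rule bs.swap)
  have pos: "(sin \<theta>\<^sub>1)\<^sup>2 \<noteq> 0" "(sin \<theta>\<^sub>2)\<^sup>2 \<noteq> 0"
    using bs.angles sw.angles sin_gt_zero[of \<theta>\<^sub>1] sin_gt_zero[of \<theta>\<^sub>2] by auto
  have e1: "g p (oneill_T A g B \<pi> nabla (\<lambda>q. J_ver A g B \<pi> J q (U q)) (\<lambda>q. J_hor A g B \<pi> J q (Y q)) p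
      - oneill_T A g B \<pi> nabla U (\<lambda>q. J_hor A g B \<pi> J q (J_ver A g B \<pi> J q (Y q))) p
      + oneill_A A g B \<pi> nabla (\<lambda>q. J_hor A g B \<pi> J q (U q)) (\<lambda>q. J_hor A g B \<pi> J q (Y q)) p) (X p) = 0
      \<longleftrightarrow> g p (nabla X Y p) (U p) = 0"
    if "open W" "p \<in> W" "section_on A D\<^sub>1 W X" "section_on A D\<^sub>1 W Y" "section_on A D\<^sub>2 W U" for W p X Y U
    unfolding bs.tensor_identity[OF that] using pos by simp
  have e2: "g p (oneill_T A g B \<pi> nabla (\<lambda>q. J_ver A g B \<pi> J q (X q)) (\<lambda>q. J_hor A g B \<pi> J q (V q)) p
      - oneill_T A g B \<pi> nabla X (\<lambda>q. J_hor A g B \<pi> J q (J_ver A g B \<pi> J q (V q))) p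
      + oneill_A A g B \<pi> nabla (\<lambda>q. J_hor A g B \<pi> J q (X q)) (\<lambda>q. J_hor A g B \<pi> J q (V q)) p) (U p) = 0
      \<longleftrightarrow> g p (nabla U V p) (X p) = 0"
    if "open W" "p \<in> W" "section_on A D\<^sub>2 W U" "section_on A D\<^sub>2 W V" "section_on A D\<^sub>1 W X" for W p X U V
    unfolding sw.tensor_identity[OF that] using pos by simp
  show ?thesis unfolding Let_def
  proof (intro iffI allI impI ballI, elim conjE)
    fix W X Y U V p
    assume prod: "fibres_locally_riemannian_product A g \<pi> D\<^sub>1 D\<^sub>2" and p: "p \<in> W"
      and W: "open W" and X: "section_on A D\<^sub>1 W X" and Y: "section_on A D\<^sub>1 W Y"
      and U: "section_on A D\<^sub>2 W U" and V: "section_on A D\<^sub>2 W V"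
    have "local_riemannian_product_at A g D\<^sub>1 D\<^sub>2 (\<pi> -` {\<pi> p}) p"
      using prod unfolding fibres_locally_riemannian_product_def by blast
    from bs.product_imp_parallel[OF this W p X Y U V]
    show "g p (oneill_T A g B \<pi> nabla (\<lambda>q. J_ver A g B \<pi> J q (U q)) (\<lambda>q. J_hor A g B \<pi> J q (Y q)) p
      - oneill_T A g B \<pi> nabla U (\<lambda>q. J_hor A g B \<pi> J q (J_ver A g B \<pi> J q (Y q))) p
      + oneill_A A g B \<pi> nabla (\<lambda>q. J_hor A g B \<pi> J q (U q)) (\<lambda>q. J_hor A g B \<pi> J q (Y q)) p) (X p) = 0 \<and>
      g p (oneill_T A g B \<pi> nabla (\<lambda>q. J_ver A g B \<pi> J q (X q)) (\<lambda>q. J_hor A g B \<pi> J q (V q)) p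
      - oneill_T A g B \<pi> nabla X (\<lambda>q. J_hor A g B \<pi> J q (J_ver A g B \<pi> J q (V q))) p
      + oneill_A A g B \<pi> nabla (\<lambda>q. J_hor A g B \<pi> J q (X q)) (\<lambda>q. J_hor A g B \<pi> J q (V q)) p) (U p) = 0"
      unfolding e1[OF W p X Y U] e2[OF W p U V X] by blast
  next
    assume *: "\<forall>W X Y U V. open W \<and> section_on A D\<^sub>1 W X \<and> section_on A D\<^sub>1 W Y \<and>
          section_on A D\<^sub>2 W U \<and> section_on A D\<^sub>2 W V \<longrightarrow>
        (\<forall>p\<in>W.
      g p (oneill_T A g B \<pi> nabla (\<lambda>q. J_ver A g B \<pi> J q (U q)) (\<lambda>q. J_hor A g B \<pi> J q (Y q)) p
      - oneill_T A g B \<pi> nabla U (\<lambda>q. J_hor A g B \<pi> J q (J_ver A g B \<pi> J q (Y q))) p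
      + oneill_A A g B \<pi> nabla (\<lambda>q. J_hor A g B \<pi> J q (U q)) (\<lambda>q. J_hor A g B \<pi> J q (Y q)) p) (X p) = 0 \<and>
      g p (oneill_T A g B \<pi> nabla (\<lambda>q. J_ver A g B \<pi> J q (X q)) (\<lambda>q. J_hor A g B \<pi> J q (V q)) p
      - oneill_T A g B \<pi> nabla X (\<lambda>q. J_hor A g B \<pi> J q (J_ver A g B \<pi> J q (V q))) p
      + oneill_A A g B \<pi> nabla (\<lambda>q. J_hor A g B \<pi> J q (X q)) (\<lambda>q. J_hor A g B \<pi> J q (V q)) p) (U p) = 0)"
    have "bs.parallel D\<^sub>1 D\<^sub>2" unfolding bs.parallel_def
    proof (intro allI impI)
      fix W X Y U p
      assume h: "open W" "p \<in> W" "section_on A D\<^sub>1 W X" "section_on A D\<^sub>1 W Y" "section_on A D\<^sub>2 W U"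
      \<comment> \<open>Only the first equation is wanted here, so \<open>U\<close> serves as the
        fourth section as well.\<close>
      then show "g p (nabla X Y p) (U p) = 0"
        using *[THEN spec, of W, THEN spec, of X, THEN spec, of Y, THEN spec, of U, THEN spec, of U] e1[OF h] by blast
    qed
    moreover have "bs.parallel D\<^sub>2 D\<^sub>1" unfolding bs.parallel_def
    proof (intro allI impI)
      fix W U V X p
      assume h: "open W" "p \<in> W" "section_on A D\<^sub>2 W U" "section_on A D\<^sub>2 W V" "section_on A D\<^sub>1 W X"
      then show "g p (nabla U V p) (X p) = 0"
        using *[THEN spec, of W, THEN spec, of X, THEN spec, of X, THEN spec, of U, THEN spec, of V] e2[OF h] by blast
    qed
    ultimately show "fibres_locally_riemannian_product A g \<pi> D\<^sub>1 D\<^sub>2"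
      unfolding fibres_locally_riemannian_product_def using bs.parallel_imp_product by auto
  qed
qed

end
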